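(* Assume that the particle distribution $\mathcal P$ satisfies the moment condition (M) of the context. Let $F$, $\mathbf G$, $\Psi$, $\alpha^N$ be such that $\mu^{-1/2}F\in\mathcal L^2(D)$, $\mathbf G\in\mathcal L^2(D)^d$, $\mu^{-1/2}\Psi\in\mathcal L^2(\Sigma_0)$ and $\mu^{-1/2}\alpha^N\in\mathcal L^2(\Sigma_H)$. Then there exists a unique $\widetilde U\in\mathcal W_0(D)$ such that for all $V\in\mathcal W_0(D)$ $$\mathbb E\Big[\int_{\square_1}\int_0^{+\infty}\mathbb 1_D\,\nabla\widetilde U\cdot\nabla\overline V\,dy\Big]=\mathbb E\Big[\int_{\square_1}\int_0^{+\infty}\mathbb 1_D\,(F\overline V+\mathbf G\cdot\nabla\overline V)\,dy+\int_{\square_1}\big(\Psi\,\overline V|_{\Sigma_0}+\alpha^N\,\overline V|_{\Sigma_H}\big)dy_\parallel\Big].$$ Moreover there is a constant $C>0$, independent of $F,\mathbf G,\Psi,\alpha^N$, such that $$\|\widetilde U\|_{\mathcal W_0(D)}\le C\big(\|\mu^{-1/2}\Psi\|_{\mathcal L^2(\Sigma_0)}+\|\mu^{-1/2}\alpha^N\|_{\mathcal L^2(\Sigma_H)}+\|\mu^{-1/2}F\|_{\mathcal L^2(D)}+\|\mathbf G\|_{\mathcal L^2(D)}\big).$$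
   Context: Let $d\in\{2,3\}$; points of $\mathbb R^d$ are written $y=(y_\parallel,y_d)$ with $y_\parallel\in\mathbb R^{d-1}$; $\square_R=(-R/2,R/2)^{d-1}$; $\Sigma_t=\{y_d=t\}$, identified with $\mathbb R^{d-1}$. Fix $h>0$, $\delta>0$, $H>h$. Random setting: $\Omega$ is the set of point sets $\{x_n^\omega\}_{n\in\mathbb N}$ (particle centres) such that the unit balls $B(x_n^\omega)$ are contained in $\mathbb R^{d-1}\times(0,h)$ and lie at distance at least $\delta$ from one another and from $\Sigma_0$. $\Omega$ carries its cylindrical $\sigma$-algebra and a probability $\mathbb P$ that is invariant under the translations $\tau_{y_\parallel}$, $y_\parallel\in\mathbb R^{d-1}$, where $x_n^{\tau_{y_\parallel}\omega}=x_n^\omega-(y_\parallel,0)$; this action is ergodic (every event invariant under all $\tau_{y_\parallel}$ has probability $0$ or $1$). A random field $f$ on $\mathbb R^{d-1}$ is stationary if $f^\omega(x_\parallel+y_\parallel)=f^{\tau_{y_\parallel}\omega}(x_\parallel)$. Set $\mathcal P^\omega=\bigcup_nB(x_n^\omega)$, $D^\omega=(\mathbb R^{d-1}\times(0,+\infty))\setminus\overline{\mathcal P^\omega}$, $\mathbb 1_D$ the indicator of $D^\omega$ (products with $\mathbb 1_D$ vanish outside $D^\omega$), $R^\omega(y)=\min_n|y-x_n^\omega|$. Condition (M): there is $m>2d$ (fixed) such that $\sup_{y_d\in[0,h]}\mathbb E[R(\cdot,y_d)^m]<+\infty$. Weight: $\mu^\omega(y)=R^\omega(y)^{-m}$ if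 $y_d\in[0,h]$, and $\mu^\omega(y)=(y_d^2+R^\omega(y_\parallel,h)^{2m})^{-1}$ if $y_d>h$. $\mathcal W_0(D)$ is the space of (complex-valued) random fields $v$ with, a.s., $v^\omega\in H^1_{loc}(D^\omega)$, $v^\omega=0$ on $\partial\mathcal P^\omega$, $\mathbb 1_Dv(\cdot,y_d)$ stationary for every $y_d>0$, and finite norm $\|v\|_{\mathcal W_0(D)}^2=\mathbb E\big[\int_{\square_1}\int_0^{+\infty}\mathbb 1_D(\mu|v|^2+|\nabla v|^2)\,dy\big]$. $\mathcal L^2(D)$ is the space of random fields $v$ with a.s. $v^\omega\in L^2_{loc}(D^\omega)$, $\mathbb 1_Dv(\cdot,y_d)$ stationary for every $y_d>0$, and $\|v\|^2_{\mathcal L^2(D)}=\mathbb E[\int_{\square_1}\int_0^{+\infty}\mathbb 1_D|v|^2dy]<+\infty$. For $t\ge0$, $\mathcal L^2(\Sigma_t)$ is the space of stationary $\varphi\in L^2_{loc}(\Sigma_t,L^2(\Omega))$ with $\|\varphi\|^2_{\mathcal L^2(\Sigma_t)}=\mathbb E[|\varphi|^2]<+\infty$. *)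

theory Defs
  imports "HOL-Probability.Probability"
begin

text \<open>
  The ambient dimension is \<open>d = CARD('n) + 1\<close>; a point is the pair of its horizontal part and of
  its last coordinate. Gradients of complex-valued functions take values in \<open>'n cvec\<close>, whose norm
  is the Hermitian norm.
\<close>

type_synonym 'n pt = "(real ^ 'n) \<times> real"
type_synonym 'n cvec = "(complex ^ 'n) \<times> complex"

definition hdot :: "'n::finite cvec \<Rightarrow> 'n cvec \<Rightarrow> complex" where
  "hdot a b = (\<Sum>i\<in>UNIV. fst a $ i * cnj (fst b $ i)) + snd a * cnj (snd b)"

definition square :: "real \<Rightarrow> (real ^ 'n::finite) set" where
  "square r = box (\<chi> i. - r / 2) (\<chi> i. r / 2)"

definition plane :: "real \<Rightarrow> 'n::finite pt set" where
  "plane t = {y. snd y = t}"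

primrec Ck :: "nat \<Rightarrow> ('a::euclidean_space \<Rightarrow> 'b::real_normed_vector) \<Rightarrow> bool" where
  "Ck 0 f \<longleftrightarrow> continuous_on UNIV f"
| "Ck (Suc k) f \<longleftrightarrow>
     (\<exists>f'. (\<forall>x. (f has_derivative f' x) (at x)) \<and> (\<forall>b\<in>Basis. Ck k (\<lambda>x. f' x b)))"

definition smooth :: "('a::euclidean_space \<Rightarrow> 'b::real_normed_vector) \<Rightarrow> bool" where
  "smooth f \<longleftrightarrow> (\<forall>k. Ck k f)"

definition test_function :: "'a::euclidean_space set \<Rightarrow> ('a \<Rightarrow> real) \<Rightarrow> bool" where
  "test_function D \<phi> \<longleftrightarrow>
     smooth \<phi> \<and> compact (closure {x. \<phi> x \<noteq> 0}) \<and> closure {x. \<phi> x \<noteq> 0} \<subseteq> D"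

definition weak_deriv ::
  "'a::euclidean_space set \<Rightarrow> 'a \<Rightarrow> ('a \<Rightarrow> complex) \<Rightarrow> ('a \<Rightarrow> complex) \<Rightarrow> bool" where
  "weak_deriv D b v w \<longleftrightarrow>
     (\<forall>\<phi>. test_function D \<phi> \<longrightarrow>
        (LINT y:D|lborel. frechet_derivative \<phi> (at y) b *\<^sub>R v y) = - (LINT y:D|lborel. \<phi> y *\<^sub>R w y))"

definition weak_gradient ::
  "'n::finite pt set \<Rightarrow> ('n pt \<Rightarrow> complex) \<Rightarrow> ('n pt \<Rightarrow> 'n cvec) \<Rightarrow> bool" where
  "weak_gradient D v G \<longleftrightarrow>
     (\<forall>i. weak_deriv D (axis i 1, 0) v (\<lambda>y. fst (G y) $ i)) \<and>
     weak_deriv D (0, 1) v (\<lambda>y. snd (G y))"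

definition classical_gradient :: "('n::finite pt \<Rightarrow> complex) \<Rightarrow> 'n pt \<Rightarrow> 'n cvec" where
  "classical_gradient \<phi> y =
     ((\<chi> i. frechet_derivative \<phi> (at y) (axis i 1, 0)), frechet_derivative \<phi> (at y) (0, 1))"

text \<open>
  Here ``local'' means on bounded subsets of \<open>D\<close>, up to the boundary of \<open>D\<close>: this is what gives a
  meaning to traces on the boundary.
\<close>

definition L2loc :: "'a::euclidean_space set \<Rightarrow> ('a \<Rightarrow> 'b::euclidean_space) \<Rightarrow> bool" where
  "L2loc D v \<longleftrightarrow> set_borel_measurable lborel D v \<and>
     (\<forall>r. (\<integral>\<^sup>+y\<in>D \<inter> ball 0 r. ennreal ((norm (v y))\<^sup>2) \<partial>lborel) < \<infinity>)"

definition H1loc :: "'n::finite pt set \<Rightarrow> ('n pt \<Rightarrow> complex) \<Rightarrow> ('n pt \<Rightarrow> 'n cvec) \<Rightarrow> bool" where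
  "H1loc D v G \<longleftrightarrow> L2loc D v \<and> L2loc D G \<and> weak_gradient D v G"

text \<open>
  The trace on a surface carrying the surface measure \<open>S\<close> is defined by density: it is the
  \<open>L\<^sup>2\<^sub>l\<^sub>o\<^sub>c\<close> limit of the restrictions of smooth functions that converge to \<open>v\<close> in
  \<open>H\<^sup>1\<^sub>l\<^sub>o\<^sub>c\<close>.
\<close>

definition has_trace ::
  "'n::finite pt set \<Rightarrow> 'n pt measure \<Rightarrow> ('n pt \<Rightarrow> complex) \<Rightarrow> ('n pt \<Rightarrow> complex) \<Rightarrow> bool" where
  "has_trace D S v g \<longleftrightarrow>
     g \<in> borel_measurable S \<and>
     (\<exists>G \<phi>. H1loc D v G \<and> (\<forall>k::nat. smooth (\<phi> k)) \<and>
       (\<forall>r. (\<lambda>k. \<integral>\<^sup>+y\<in>D \<inter> ball 0 r. ennreal ((norm (\<phi> k y - v y))\<^sup>2) \<partial>lborel) \<longlonglongrightarrow> 0) \<and>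
       (\<forall>r. (\<lambda>k. \<integral>\<^sup>+y\<in>D \<inter> ball 0 r. ennreal ((norm (classical_gradient (\<phi> k) y - G y))\<^sup>2) \<partial>lborel)
          \<longlonglongrightarrow> 0) \<and>
       (\<forall>r. (\<lambda>k. \<integral>\<^sup>+y\<in>ball 0 r. ennreal ((norm (\<phi> k y - g y))\<^sup>2) \<partial>S) \<longlonglongrightarrow> 0))"

definition plane_measure :: "real \<Rightarrow> 'n::finite pt measure" where
  "plane_measure t = distr lborel borel (\<lambda>x. (x, t))"

text \<open>
  Surface measure of the unit sphere centred at \<open>c\<close>: the measure of a piece \<open>A\<close> of the sphere is
  \<open>d\<close> times the volume of the cone with base \<open>A\<close> and apex \<open>c\<close>.
\<close>

definition sphere_measure :: "'a::euclidean_space \<Rightarrow> 'a measure" where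
  "sphere_measure c =
     distr (density lborel (\<lambda>y. of_nat DIM('a) * indicator (ball c 1) y)) borel (\<lambda>y. c + sgn (y - c))"

definition configs :: "real \<Rightarrow> real \<Rightarrow> 'n::finite pt set set" where
  "configs h \<delta> = {range x | x :: nat \<Rightarrow> 'n pt.
     (\<forall>n. ball (x n) 1 \<subseteq> UNIV \<times> {0<..<h}) \<and>
     (\<forall>n. setdist (ball (x n) 1) (plane 0) \<ge> \<delta>) \<and>
     (\<forall>k n. k \<noteq> n \<longrightarrow> setdist (ball (x k) 1) (ball (x n) 1) \<ge> \<delta>)}"

text \<open>The cylindrical sigma-algebra is generated by the numbers of points in bounded Borel sets.\<close>

definition config_space :: "real \<Rightarrow> real \<Rightarrow> 'n::finite pt set measure" where
  "config_space h \<delta> = sigma (configs h \<delta>)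
     {{\<omega> \<in> configs h \<delta>. card (\<omega> \<inter> B) = k} | B k. B \<in> sets borel \<and> bounded B}"

definition shift :: "real ^ 'n::finite \<Rightarrow> 'n pt set \<Rightarrow> 'n pt set" where
  "shift z \<omega> = (\<lambda>x. x - (z, 0)) ` \<omega>"

definition shift_invariant :: "'n::finite pt set measure \<Rightarrow> bool" where
  "shift_invariant P \<longleftrightarrow> (\<forall>z. distr P P (shift z) = P)"

definition shift_ergodic :: "'n::finite pt set measure \<Rightarrow> bool" where
  "shift_ergodic P \<longleftrightarrow>
     (\<forall>A\<in>sets P. (\<forall>z. {\<omega> \<in> space P. shift z \<omega> \<in> A} = A) \<longrightarrow> measure P A = 0 \<or> measure P A = 1)"

definition particles :: "'n::finite pt set \<Rightarrow> 'n pt set" where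
  "particles \<omega> = (\<Union>x\<in>\<omega>. ball x 1)"

definition fluid_dom :: "'n::finite pt set \<Rightarrow> 'n pt set" where
  "fluid_dom \<omega> = UNIV \<times> {0<..} - closure (particles \<omega>)"

text \<open>
  Distance to the nearest centre; the infimum is a minimum since configurations are nonempty and
  locally finite.
\<close>

definition nearest_dist :: "'n::finite pt set \<Rightarrow> 'n pt \<Rightarrow> real" where
  "nearest_dist \<omega> y = infdist y \<omega>"

text \<open>
  Under a shift-invariant law the expectation below is the same at \<open>(x, t)\<close> for all \<open>x\<close>.
\<close>

definition moment_condition :: "'n::finite pt set measure \<Rightarrow> real \<Rightarrow> real \<Rightarrow> bool" where
  "moment_condition P h m \<longleftrightarrow>
     (SUP t\<in>{0..h}. \<integral>\<^sup>+\<omega>. ennreal (nearest_dist \<omega> (0, t) powr m) \<partial>P) < \<infinity>"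

definition weight :: "real \<Rightarrow> real \<Rightarrow> 'n::finite pt set \<Rightarrow> 'n pt \<Rightarrow> real" where
  "weight h m \<omega> y =
     (if snd y \<le> h then nearest_dist \<omega> y powr (- m)
      else inverse ((snd y)\<^sup>2 + nearest_dist \<omega> (fst y, h) powr (2 * m)))"

text \<open>
  A random field is a jointly measurable function of the configuration and of the point.
  Fields are genuine functions, stationary for every configuration; the elements of the function
  spaces of the theory are their classes modulo \<open>field_eq\<close>, and every class of almost everywhere
  stationary fields has such a representative.
\<close>

definition stationary ::
  "'n::finite pt set measure \<Rightarrow> ('n pt set \<Rightarrow> real ^ 'n \<Rightarrow> 'b) \<Rightarrow> bool" where
  "stationary P f \<longleftrightarrow> (\<forall>\<omega>\<in>space P. \<forall>x z. f \<omega> (x + z) = f (shift z \<omega>) x)"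

definition on_dom :: "('n::finite pt set \<Rightarrow> 'n pt \<Rightarrow> 'b::real_vector) \<Rightarrow> 'n pt set \<Rightarrow> 'n pt \<Rightarrow> 'b" where
  "on_dom v \<omega> y = indicator (fluid_dom \<omega>) y *\<^sub>R v \<omega> y"

definition random_field ::
  "'n::finite pt set measure \<Rightarrow> ('n pt set \<Rightarrow> 'n pt \<Rightarrow> 'b::euclidean_space) \<Rightarrow> bool" where
  "random_field P v \<longleftrightarrow> (\<lambda>(\<omega>, y). on_dom v \<omega> y) \<in> borel_measurable (P \<Otimes>\<^sub>M lborel)"

text \<open>
  Gradient and traces are weak gradient and traces of the realisations, chosen jointly measurable.
  They are determined up to null sets.
\<close>

definition random_gradient ::
  "'n::finite pt set measure \<Rightarrow> ('n pt set \<Rightarrow> 'n pt \<Rightarrow> complex) \<Rightarrow> ('n pt set \<Rightarrow> 'n pt \<Rightarrow> 'n cvec) \<Rightarrow> bool"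
  where
  "random_gradient P v G \<longleftrightarrow> random_field P G \<and> (AE \<omega> in P. H1loc (fluid_dom \<omega>) (v \<omega>) (G \<omega>))"

definition grad ::
  "'n::finite pt set measure \<Rightarrow> ('n pt set \<Rightarrow> 'n pt \<Rightarrow> complex) \<Rightarrow> 'n pt set \<Rightarrow> 'n pt \<Rightarrow> 'n cvec" where
  "grad P v = (SOME G. random_gradient P v G)"

definition trace_on ::
  "'n::finite pt set measure \<Rightarrow> real \<Rightarrow> ('n pt set \<Rightarrow> 'n pt \<Rightarrow> complex) \<Rightarrow> 'n pt set \<Rightarrow> real ^ 'n \<Rightarrow> complex"
  where
  "trace_on P t v = (SOME g. (\<lambda>(\<omega>, x). g \<omega> x) \<in> borel_measurable (P \<Otimes>\<^sub>M lborel) \<and>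
     (AE \<omega> in P. has_trace (fluid_dom \<omega>) (plane_measure t) (v \<omega>) (\<lambda>y. g \<omega> (fst y))))"

definition W0_sqnorm ::
  "'n::finite pt set measure \<Rightarrow> real \<Rightarrow> real \<Rightarrow> ('n pt set \<Rightarrow> 'n pt \<Rightarrow> complex) \<Rightarrow> ennreal" where
  "W0_sqnorm P h m v =
     (\<integral>\<^sup>+\<omega>. (\<integral>\<^sup>+y\<in>square 1 \<times> {0<..}.
        indicator (fluid_dom \<omega>) y *
          ennreal (weight h m \<omega> y * (norm (v \<omega> y))\<^sup>2 + (norm (grad P v \<omega> y))\<^sup>2) \<partial>lborel) \<partial>P)"

definition W0_norm ::
  "'n::finite pt set measure \<Rightarrow> real \<Rightarrow> real \<Rightarrow> ('n pt set \<Rightarrow> 'n pt \<Rightarrow> complex) \<Rightarrow> real" where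
  "W0_norm P h m v = sqrt (enn2real (W0_sqnorm P h m v))"

text \<open>
  The boundary of the set of particles is the disjoint union of the unit spheres centred at the
  points of the configuration.
\<close>

definition W0 ::
  "'n::finite pt set measure \<Rightarrow> real \<Rightarrow> real \<Rightarrow> ('n pt set \<Rightarrow> 'n pt \<Rightarrow> complex) set" where
  "W0 P h m = {v. random_field P v \<and> (\<exists>G. random_gradient P v G) \<and>
     (AE \<omega> in P. \<forall>c\<in>\<omega>. has_trace (fluid_dom \<omega>) (sphere_measure c) (v \<omega>) (\<lambda>y. 0)) \<and>
     (\<forall>t>0. stationary P (\<lambda>\<omega> x. on_dom v \<omega> (x, t))) \<and>
     W0_sqnorm P h m v < \<infinity>}"

definition L2D_sqnorm ::
  "'n::finite pt set measure \<Rightarrow> ('n pt set \<Rightarrow> 'n pt \<Rightarrow> 'b::euclidean_space) \<Rightarrow> ennreal" where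
  "L2D_sqnorm P v =
     (\<integral>\<^sup>+\<omega>. (\<integral>\<^sup>+y\<in>square 1 \<times> {0<..}.
        indicator (fluid_dom \<omega>) y * ennreal ((norm (v \<omega> y))\<^sup>2) \<partial>lborel) \<partial>P)"

definition L2D_norm ::
  "'n::finite pt set measure \<Rightarrow> ('n pt set \<Rightarrow> 'n pt \<Rightarrow> 'b::euclidean_space) \<Rightarrow> real" where
  "L2D_norm P v = sqrt (enn2real (L2D_sqnorm P v))"

definition L2D ::
  "'n::finite pt set measure \<Rightarrow> ('n pt set \<Rightarrow> 'n pt \<Rightarrow> 'b::euclidean_space) set" where
  "L2D P = {v. random_field P v \<and> (AE \<omega> in P. L2loc (fluid_dom \<omega>) (v \<omega>)) \<and>
     (\<forall>t>0. stationary P (\<lambda>\<omega> x. on_dom v \<omega> (x, t))) \<and>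
     L2D_sqnorm P v < \<infinity>}"

text \<open>
  Fields on a horizontal plane, identified with the space of horizontal vectors. The second moment
  of a stationary field does not depend on the point, and is taken at the origin.
\<close>

definition L2S_sqnorm ::
  "'n::finite pt set measure \<Rightarrow> ('n pt set \<Rightarrow> real ^ 'n \<Rightarrow> complex) \<Rightarrow> ennreal" where
  "L2S_sqnorm P \<phi> = (\<integral>\<^sup>+\<omega>. ennreal ((norm (\<phi> \<omega> 0))\<^sup>2) \<partial>P)"

definition L2S_norm ::
  "'n::finite pt set measure \<Rightarrow> ('n pt set \<Rightarrow> real ^ 'n \<Rightarrow> complex) \<Rightarrow> real" where
  "L2S_norm P \<phi> = sqrt (enn2real (L2S_sqnorm P \<phi>))"

definition L2S ::
  "'n::finite pt set measure \<Rightarrow> ('n pt set \<Rightarrow> real ^ 'n \<Rightarrow> complex) set" where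
  "L2S P = {\<phi>. (\<lambda>(\<omega>, x). \<phi> \<omega> x) \<in> borel_measurable (P \<Otimes>\<^sub>M lborel) \<and>
     (\<forall>r. (\<integral>\<^sup>+x\<in>ball 0 r. (\<integral>\<^sup>+\<omega>. ennreal ((norm (\<phi> \<omega> x))\<^sup>2) \<partial>P) \<partial>lborel) < \<infinity>) \<and>
     stationary P \<phi> \<and> L2S_sqnorm P \<phi> < \<infinity>}"

definition field_eq ::
  "'n::finite pt set measure \<Rightarrow> ('n pt set \<Rightarrow> 'n pt \<Rightarrow> complex) \<Rightarrow> ('n pt set \<Rightarrow> 'n pt \<Rightarrow> complex) \<Rightarrow> bool"
  where
  "field_eq P u v \<longleftrightarrow> (AE \<omega> in P. AE y in lborel. y \<in> fluid_dom \<omega> \<longrightarrow> u \<omega> y = v \<omega> y)"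

definition weak_solution ::
  "'n::finite pt set measure \<Rightarrow> real \<Rightarrow> real \<Rightarrow> real \<Rightarrow>
   ('n pt set \<Rightarrow> 'n pt \<Rightarrow> complex) \<Rightarrow> ('n pt set \<Rightarrow> 'n pt \<Rightarrow> 'n cvec) \<Rightarrow>
   ('n pt set \<Rightarrow> real ^ 'n \<Rightarrow> complex) \<Rightarrow> ('n pt set \<Rightarrow> real ^ 'n \<Rightarrow> complex) \<Rightarrow>
   ('n pt set \<Rightarrow> 'n pt \<Rightarrow> complex) \<Rightarrow> bool" where
  "weak_solution P h H m F G \<Psi> \<alpha> U \<longleftrightarrow> U \<in> W0 P h m \<and>
     (\<forall>V\<in>W0 P h m.
        (\<integral>\<omega>. (LINT y:square 1 \<times> {0<..}|lborel.
           indicator (fluid_dom \<omega>) y *\<^sub>R hdot (grad P U \<omega> y) (grad P V \<omega> y)) \<partial>P) =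
        (\<integral>\<omega>. (LINT y:square 1 \<times> {0<..}|lborel.
             indicator (fluid_dom \<omega>) y *\<^sub>R (F \<omega> y * cnj (V \<omega> y) + hdot (G \<omega> y) (grad P V \<omega> y))) +
           (LINT x:square 1|lborel.
             \<Psi> \<omega> x * cnj (trace_on P 0 V \<omega> x) + \<alpha> \<omega> x * cnj (trace_on P H V \<omega> x)) \<partial>P))"

end

theory Submission
  imports Defs
begin

text \<open>
  The gradient seminorm controls the weighted \<open>L\<^sup>2\<close> part of the norm of \<open>\<W>\<^sub>0\<close>, so that Riesz's theorem
  applies. The underlying Hardy inequality is proved realisation by realisation. Below the height
  \<open>h + 1\<close> the fluid domain is split into the Voronoi cells of the centres: a cell is star-shaped with
  respect to its centre \<open>c\<close> and the field vanishes on the unit sphere around \<open>c\<close>, so the field is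
  recovered by integrating its gradient along the rays from \<open>c\<close>. Above \<open>h\<close> a one-dimensional Hardy
  inequality is started from a height in \<open>(h, h + 1)\<close> and averaged over that height. Localising to
  a square would produce lateral boundary terms; instead one integrates against the weight
  \<open>\<Prod>\<^sub>i (1 + |x\<^sub>i|)\<^sup>-\<^sup>q\<close>, which is integrable for \<open>q > 1\<close> and varies slowly enough along the rays because
  \<open>m > 2d\<close>. By stationarity the expectation of a weighted integral is comparable to the expectation
  over the unit square.

  Completeness and measurable traces are obtained by explicit limits: of a subsequence converging
  fast enough to converge almost everywhere for almost every realisation, and of vertical averages over
  shrinking strips.
\<close>

text \<open>The threshold \<open>m > 2 d\<close> comes from the rays. Cauchy-Schwarz along a ray of
  length \<open>r\<close> costs \<open>r^2\<close>, the change of the polynomial weight costs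
  \<open>r^(q (d - 1))\<close>, and the substitution by the dilation \<open>c + s (y - c)\<close>
  costs \<open>s^(-d)\<close>; what remains is the integral over \<open>0 < s < 1\<close> of
  \<open>s^(m - 2 - q (d - 1) - d)\<close>, which converges for some \<open>q > 1\<close> exactly
  when \<open>m > 2 d\<close>. A trace is a limit of smooth functions that converge to the field on
  all bounded parts of the fluid domain. A field with a trace on one particle therefore brings its
  own approximating sequence, and this sequence also yields its values on the planes and the
  estimate above the layer. Finally, \<open>grad\<close> and \<open>trace_on\<close> are choices, so
  every identity about them passes through uniqueness: of weak gradients by the fundamental lemma,
  of traces on a plane because every approximating sequence has the limit of the vertical averages
  there. Stationarity of gradients and linearity of gradients and traces are obtained in this
  way.\<close>

abbreviation nsq :: "'a::real_normed_vector \<Rightarrow> ennreal" where "nsq z \<equiv> ennreal ((norm z)\<^sup>2)"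

abbreviation nn_lborel (binder "LI " 10) where "nn_lborel f \<equiv> nn_integral (lborel :: 'a::euclidean_space measure) f"

abbreviation LIS :: "'a::euclidean_space set \<Rightarrow> ('a \<Rightarrow> ennreal) \<Rightarrow> ennreal" where
  "LIS A f \<equiv> \<integral>\<^sup>+y\<in>A. f y \<partial>lborel"

abbreviation lsq :: "'a::euclidean_space set \<Rightarrow> real \<Rightarrow> ('a \<Rightarrow> 'b::real_normed_vector) \<Rightarrow> ennreal" where
  "lsq D r f \<equiv> \<integral>\<^sup>+y\<in>D \<inter> ball 0 r. nsq (f y) \<partial>lborel"

abbreviation l2conv :: "'a::euclidean_space set \<Rightarrow> real \<Rightarrow> (nat \<Rightarrow> 'a \<Rightarrow> 'b::real_normed_vector) \<Rightarrow> ('a \<Rightarrow> 'b) \<Rightarrow> bool" where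
  "l2conv D r p v \<equiv> (\<lambda>k. lsq D r (\<lambda>y. p k y - v y)) \<longlonglongrightarrow> 0"

lemma pt_measurable[measurable]:
  "(fst :: 'n::finite pt \<Rightarrow> _) \<in> borel_measurable borel" "(snd :: 'n pt \<Rightarrow> _) \<in> borel_measurable borel"
  by (intro borel_measurable_continuous_onI continuous_intros)+

subsection \<open>Smooth functions and the fundamental lemma\<close>

lemma Ck_Suc_imp: "Ck (Suc k) f \<Longrightarrow> Ck k f"
proof (induction k arbitrary: f)
  case 0
  then show ?case
    by (auto intro!: continuous_at_imp_continuous_on intro: has_derivative_continuous)
next
  case (Suc k)
  then obtain f' where f': "\<forall>x. (f has_derivative f' x) (at x)" "\<forall>b\<in>Basis. Ck (Suc k) (\<lambda>x. f' x b)"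
    by (metis Ck.simps(2))
  then show ?case using Suc.IH by (metis Ck.simps(2))
qed

lemma Ck_const: "Ck k (\<lambda>x. c)"
  by (induction k arbitrary: c) (auto intro!: exI[of _ "\<lambda>x h. 0"])

lemma Ck_add: "Ck k f \<Longrightarrow> Ck k g \<Longrightarrow> Ck k (\<lambda>x. f x + g x)"
proof (induction k arbitrary: f g)
  case 0 then show ?case by (auto intro: continuous_intros)
next
  case (Suc k)
  from Suc.prems obtain f' g' where
    "\<forall>x. (f has_derivative f' x) (at x)" "\<forall>b\<in>Basis. Ck k (\<lambda>x. f' x b)"
    "\<forall>x. (g has_derivative g' x) (at x)" "\<forall>b\<in>Basis. Ck k (\<lambda>x. g' x b)" by auto
  then show ?case using Suc.IH
    by (auto intro!: exI[of _ "\<lambda>x h. f' x h + g' x h"] has_derivative_add)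
qed

lemma Ck_bounded_linear: "bounded_linear L \<Longrightarrow> Ck k f \<Longrightarrow> Ck k (\<lambda>x. L (f x))"
proof (induction k arbitrary: f)
  case 0 then show ?case
    by (auto intro!: continuous_on_compose2[OF linear_continuous_on[OF 0(1)]])
next
  case (Suc k)
  from Suc.prems obtain f' where
    "\<forall>x. (f has_derivative f' x) (at x)" "\<forall>b\<in>Basis. Ck k (\<lambda>x. f' x b)" by auto
  moreover then have "\<forall>x. ((\<lambda>x. L (f x)) has_derivative (\<lambda>h. L (f' x h))) (at x)"
    using bounded_linear.has_derivative[OF Suc.prems(1)] by blast
  ultimately show ?case using Suc.IH[OF Suc.prems(1)]
    by (auto intro!: exI[of _ "\<lambda>x h. L (f' x h)"])
qed

lemma Ck_mult:
  fixes f g :: "'a::euclidean_space \<Rightarrow> real"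
  shows "Ck k f \<Longrightarrow> Ck k g \<Longrightarrow> Ck k (\<lambda>x. f x * g x)"
proof (induction k arbitrary: f g)
  case 0 then show ?case by (auto intro: continuous_intros)
next
  case (Suc k)
  from Suc.prems obtain f' g' where *:
    "\<forall>x. (f has_derivative f' x) (at x)" "\<forall>b\<in>Basis. Ck k (\<lambda>x. f' x b)"
    "\<forall>x. (g has_derivative g' x) (at x)" "\<forall>b\<in>Basis. Ck k (\<lambda>x. g' x b)" by auto
  have "Ck k f" "Ck k g" using Suc.prems Ck_Suc_imp by blast+
  then show ?case using * Suc.IH
    by (auto intro!: exI[of _ "\<lambda>x h. f x * g' x h + f' x h * g x"] has_derivative_mult Ck_add)
qed

lemma Ck_power:
  fixes f :: "'a::euclidean_space \<Rightarrow> real"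
  shows "Ck k f \<Longrightarrow> Ck k (\<lambda>x. f x ^ n)"
  by (induction n) (auto intro: Ck_mult Ck_const)

lemma Ck_prod:
  fixes f :: "'i \<Rightarrow> 'a::euclidean_space \<Rightarrow> real"
  assumes "finite I" "\<And>i. i \<in> I \<Longrightarrow> Ck k (f i)"
  shows "Ck k (\<lambda>x. \<Prod>i\<in>I. f i x)"
  using assms by (induction I rule: finite_induct) (auto intro: Ck_mult Ck_const)

text \<open>The chain rule in the one case that occurs, a function of one variable applied to an
  affine function of one coordinate. The derivative in direction \<open>b\<close> is a constant
  times a function of the same form, so the induction over \<open>k\<close> closes.\<close>

lemma Ck_inner:
  fixes g :: "real \<Rightarrow> real" and e :: "'a::euclidean_space"
  shows "Ck k g \<Longrightarrow> Ck k (\<lambda>x. g (s * (x \<bullet> e) + a))"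
proof (induction k arbitrary: g)
  case 0
  then show ?case by (auto intro!: continuous_on_compose2[of UNIV g] continuous_intros)
next
  case (Suc k)
  from Suc.prems obtain g' where
    g': "\<And>x. (g has_derivative g' x) (at x)" "Ck k (\<lambda>x. g' x 1)" by auto
  have "((\<lambda>x. g (s * (x \<bullet> e) + a)) has_derivative (\<lambda>h. (s * (h \<bullet> e)) *\<^sub>R g' (s * (x \<bullet> e) + a) 1)) (at x)" for x
  proof -
    have "linear (g' (s * (x \<bullet> e) + a))" using g'(1) has_derivative_linear by blast
    then have "g' (s * (x \<bullet> e) + a) (s * (h \<bullet> e)) = (s * (h \<bullet> e)) *\<^sub>R g' (s * (x \<bullet> e) + a) 1" for h
      using linear_scale[of "g' (s * (x \<bullet> e) + a)" "s * (h \<bullet> e)" 1] by simp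
    moreover have "((\<lambda>x. g (s * (x \<bullet> e) + a)) has_derivative (\<lambda>h. g' (s * (x \<bullet> e) + a) (s * (h \<bullet> e)))) (at x)"
      by (rule has_derivative_compose[OF _ g'(1)]) (auto intro!: derivative_eq_intros)
    ultimately show ?thesis by simp
  qed
  moreover have "Ck k (\<lambda>x. (s * (b \<bullet> e)) *\<^sub>R g' (s * (x \<bullet> e) + a) 1)" for b
    by (rule Ck_bounded_linear[OF bounded_linear_scaleR_right Suc.IH[OF g'(2)]])
  ultimately show ?case unfolding Ck.simps(2)
    by (intro exI[of _ "\<lambda>x h. (s * (h \<bullet> e)) *\<^sub>R g' (s * (x \<bullet> e) + a) 1"]) blast
qed

lemma Ck_translate: "Ck k f \<Longrightarrow> Ck k (\<lambda>x. f (x + a))"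
proof (induction k arbitrary: f)
  case 0
  then show ?case by (auto intro!: continuous_on_compose2[of UNIV f] continuous_intros)
next
  case (Suc k)
  from Suc.prems obtain f' where
    f': "\<And>x. (f has_derivative f' x) (at x)" "\<forall>b\<in>Basis. Ck k (\<lambda>x. f' x b)" by auto
  have "((\<lambda>x. f (x + a)) has_derivative f' (x + a)) (at x)" for x
    by (rule has_derivative_compose[OF _ f'(1), where f = "\<lambda>x. x + a", simplified])
       (auto intro!: derivative_eq_intros)
  then show ?case using f' Suc.IH by (auto intro!: exI[of _ "\<lambda>x. f' (x + a)"])
qed

lemma smooth_has_derivative:
  assumes "smooth f"
  shows "(f has_derivative frechet_derivative f (at x)) (at x)"
proof -
  from assms have "Ck (Suc 0) f" unfolding smooth_def by blast
  then have "f differentiable (at x)" by (auto simp: differentiable_def)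
  then show ?thesis by (simp add: frechet_derivative_works)
qed

lemma smooth_continuous: "smooth f \<Longrightarrow> continuous_on UNIV f"
  unfolding smooth_def by (metis Ck.simps(1))

text \<open>\<open>Ck\<close> speaks of the derivative in basis directions only; by linearity the
  derivative in direction \<open>b\<close> is a combination of those with constant
  coefficients.\<close>

lemma smooth_continuous_derivative:
  assumes "smooth f"
  shows "continuous_on UNIV (\<lambda>x. frechet_derivative f (at x) b)"
proof -
  from assms have "Ck (Suc 0) f" unfolding smooth_def by blast
  then obtain f' where f': "\<And>x. (f has_derivative f' x) (at x)"
    "\<And>b. b \<in> Basis \<Longrightarrow> continuous_on UNIV (\<lambda>x. f' x b)" by auto
  have eq: "frechet_derivative f (at x) = f' x" for x
    using f'(1) by (metis frechet_derivative_at)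
  have "f' x b = (\<Sum>i\<in>Basis. (b \<bullet> i) *\<^sub>R f' x i)" for x
  proof -
    interpret linear "f' x" using f'(1) has_derivative_linear by blast
    show ?thesis by (subst euclidean_representation[of b, symmetric]) (simp only: sum scale)
  qed
  then show ?thesis unfolding eq using f'(2) by (auto intro!: continuous_intros)
qed

lemma smooth_add: "smooth f \<Longrightarrow> smooth g \<Longrightarrow> smooth (\<lambda>x. f x + g x)"
  and smooth_bounded_linear: "bounded_linear L \<Longrightarrow> smooth f \<Longrightarrow> smooth (\<lambda>x. L (f x))"
  and smooth_const: "smooth (\<lambda>x. c)"
  and smooth_translate: "smooth f \<Longrightarrow> smooth (\<lambda>x. f (x + a))"
  by (auto simp: smooth_def intro: Ck_add Ck_bounded_linear Ck_const Ck_translate)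

section \<open>Smooth bump functions on boxes\<close>

lemma poly_exp_tendsto_0:
  "((\<lambda>t. poly p (1/t) * exp (-1/t) / t) \<longlongrightarrow> (0::real)) (at_right 0)"
proof -
  \<comment> \<open>The substitution \<open>u = 1/t\<close> turns the limit at \<open>0\<close> from
    the right into the decay of a polynomial times \<open>exp (- u)\<close> at infinity.\<close>
  have "((\<lambda>u. poly p u * u * exp (- u)) \<longlongrightarrow> (0::real)) at_top"
  proof -
    have "((\<lambda>u. (\<Sum>i\<le>degree p. coeff p i * (u ^ Suc i / exp u))) \<longlongrightarrow> (\<Sum>i\<le>degree p. coeff p i * 0)) at_top"
      by (intro tendsto_intros tendsto_power_div_exp_0)
    moreover have "(\<Sum>i\<le>degree p. coeff p i * (u ^ Suc i / exp u)) = poly p u * u * exp (- u)" for u :: real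
      by (simp add: poly_altdef sum_distrib_left sum_distrib_right exp_minus divide_inverse mult_ac)
    ultimately show ?thesis by simp
  qed
  then have "((\<lambda>t. poly p (inverse t) * inverse t * exp (- inverse t)) \<longlongrightarrow> (0::real)) (at_right 0)"
    by (rule filterlim_compose[OF _ filterlim_inverse_at_top_right])
  then show ?thesis by (simp add: divide_inverse mult_ac)
qed

text \<open>These functions are closed under differentiation: the derivative replaces
  \<open>p\<close> by \<open>X^2 (p - p')\<close>, the \<open>?q p\<close> of the proof, and at
  \<open>0\<close> it vanishes by the limit just proved. Quantifying over all polynomials makes the
  induction over \<open>k\<close> work.\<close>

lemma Ck_poly_exp:
  "Ck k (\<lambda>t::real. if 0 < t then poly p (1/t) * exp (-1/t) else 0)"
proof (induction k arbitrary: p)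
  let ?F = "\<lambda>p t::real. if 0 < t then poly p (1/t) * exp (-1/t) else (0::real)"
  let ?q = "\<lambda>p. [:0,0,1:] * (p - pderiv p)"
  have der: "(?F p has_real_derivative ?F (?q p) t) (at t)" for p t
  proof -
    consider "t > 0" | "t = 0" | "t < 0" by linarith
    then show ?thesis
    proof cases
      case 1
      have "((\<lambda>t. poly p (1/t) * exp (-1/t)) has_real_derivative ?F (?q p) t) (at t)"
        using 1 by (auto intro!: derivative_eq_intros DERIV_chain2[OF poly_DERIV] simp: algebra_simps power2_eq_square)
      moreover have "\<forall>\<^sub>F s in nhds t. poly p (1/s) * exp (-1/s) = ?F p s"
        using eventually_nhds_in_open[of "{0<..}" t] 1 by (auto elim: eventually_mono)
      ultimately show ?thesis by (subst DERIV_cong_ev[OF refl _ refl, symmetric]) auto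
    next
      case 3
      have "\<forall>\<^sub>F s in nhds t. 0 = ?F p s"
        using eventually_nhds_in_open[of "{..<0}" t] 3 by (auto elim!: eventually_mono)
      moreover have "((\<lambda>t. 0) has_real_derivative ?F (?q p) t) (at t)" using 3 by simp
      ultimately show ?thesis by (subst DERIV_cong_ev[OF refl _ refl, symmetric]) auto
    next
      case 2
      have "((\<lambda>s. ?F p s / s) \<longlongrightarrow> 0) (at 0)"
      proof (rule filterlim_split_at)
        show "((\<lambda>s. ?F p s / s) \<longlongrightarrow> 0) (at_left 0)"
          by (rule tendsto_eventually) (auto simp: eventually_at_left_field intro: exI[of _ "-1"])
        show "((\<lambda>s. ?F p s / s) \<longlongrightarrow> 0) (at_right 0)"
          using poly_exp_tendsto_0[of p]
          by (rule tendsto_cong[THEN iffD1, rotated]) (auto simp: eventually_at_right_field intro: exI[of _ 1])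
      qed
      then show ?thesis using 2 by (simp add: has_field_derivative_iff)
    qed
  qed
  {
    case 0
    show ?case using der by (auto intro!: continuous_at_imp_continuous_on DERIV_isCont)
  next
    case (Suc k)
    have *: "\<forall>t. (?F p has_derivative (\<lambda>h. ?F (?q p) t * h)) (at t)"
      using der unfolding has_field_derivative_def by blast
    have "\<forall>b\<in>Basis. Ck k (\<lambda>t. ?F (?q p) t * b)"
      using Ck_mult[OF Suc.IH[of "?q p"] Ck_const] by blast
    with * show ?case unfolding Ck.simps(2)
      by (intro exI[of _ "\<lambda>t h. ?F (?q p) t * h"]) blast
  }
qed

definition bump1 :: "real \<Rightarrow> real" where
  "bump1 t = (if 0 < t then exp (-1/t) else 0)"

lemma Ck_bump1: "Ck k bump1"
  using Ck_poly_exp[of k "[:1:]"] unfolding bump1_def[abs_def] by (simp cong: if_cong)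

lemma bump1_bounds: "0 \<le> bump1 t" "bump1 t < 1" "0 < bump1 t \<longleftrightarrow> 0 < t"
  by (auto simp: bump1_def)

text \<open>Positive exactly on the open box and below \<open>1\<close> everywhere, so that
  \<open>1 - (1 - box_bump a b x) ^ j\<close> increases to the indicator of the box as
  \<open>j\<close> grows.\<close>

definition box_bump :: "'a::euclidean_space \<Rightarrow> 'a \<Rightarrow> 'a \<Rightarrow> real" where
  "box_bump a b x = (\<Prod>e\<in>Basis. bump1 (x \<bullet> e - a \<bullet> e) * bump1 (b \<bullet> e - x \<bullet> e))"

lemma smooth_box_bump: "smooth (\<lambda>x. 1 - (1 - box_bump a b x) ^ j)"
proof -
  have "Ck k (\<lambda>x. bump1 (1 * (x \<bullet> e) + - (a \<bullet> e)) * bump1 ((-1) * (x \<bullet> e) + b \<bullet> e))" for k e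
    by (intro Ck_mult Ck_inner Ck_bump1)
  then have *: "Ck k (box_bump a b)" for k
    unfolding box_bump_def[abs_def] by (intro Ck_prod) auto
  have "Ck k (\<lambda>x. 1 + (- ((1 + (- box_bump a b x)) ^ j)))" for k
    by (intro Ck_add Ck_const Ck_bounded_linear[OF bounded_linear_minus[OF bounded_linear_ident]] Ck_power *)
  then show ?thesis by (simp add: smooth_def)
qed

lemma box_bump_bounds:
  "0 \<le> box_bump a b x" "box_bump a b x < 1" "x \<in> box a b \<longleftrightarrow> 0 < box_bump a b x"
proof -
  have 1: "0 \<le> bump1 (x \<bullet> e - a \<bullet> e) * bump1 (b \<bullet> e - x \<bullet> e)" for e
    using bump1_bounds by simp
  then show "0 \<le> box_bump a b x" by (simp add: box_bump_def prod_nonneg)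
  have 2: "bump1 (x \<bullet> e - a \<bullet> e) * bump1 (b \<bullet> e - x \<bullet> e) < 1" for e
    using mult_strict_mono[of "bump1 (x \<bullet> e - a \<bullet> e)" 1 "bump1 (b \<bullet> e - x \<bullet> e)" 1] bump1_bounds by simp
  obtain e0 :: 'a where e0: "e0 \<in> Basis" using nonempty_Basis by blast
  have "box_bump a b x = (bump1 (x \<bullet> e0 - a \<bullet> e0) * bump1 (b \<bullet> e0 - x \<bullet> e0)) *
     (\<Prod>e\<in>Basis - {e0}. bump1 (x \<bullet> e - a \<bullet> e) * bump1 (b \<bullet> e - x \<bullet> e))"
    unfolding box_bump_def using e0 by (subst prod.remove[of _ e0]) auto
  also have "\<dots> \<le> (bump1 (x \<bullet> e0 - a \<bullet> e0) * bump1 (b \<bullet> e0 - x \<bullet> e0)) * 1"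
    using 1 2 by (intro mult_left_mono prod_le_1) (auto intro: less_imp_le)
  also have "\<dots> < 1" using 2 by simp
  finally show "box_bump a b x < 1" .
  show "x \<in> box a b \<longleftrightarrow> 0 < box_bump a b x"
  proof
    assume "x \<in> box a b"
    then show "0 < box_bump a b x" unfolding box_bump_def
      by (intro prod_pos) (auto simp: mem_box bump1_bounds(3))
  next
    assume *: "0 < box_bump a b x"
    have **: "0 < bump1 (x \<bullet> e - a \<bullet> e) * bump1 (b \<bullet> e - x \<bullet> e)" if "e \<in> Basis" for e
    proof -
      have "bump1 (x \<bullet> e - a \<bullet> e) * bump1 (b \<bullet> e - x \<bullet> e) \<noteq> 0"
        using * that unfolding box_bump_def by (metis (no_types, lifting) finite_Basis less_irrefl prod_zero_iff)
      then show ?thesis using 1[of e] by linarith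
    qed
    have "0 < bump1 (x \<bullet> e - a \<bullet> e)" "0 < bump1 (b \<bullet> e - x \<bullet> e)" if "e \<in> Basis" for e
      using **[OF that] bump1_bounds(1)[of "x \<bullet> e - a \<bullet> e"] bump1_bounds(1)[of "b \<bullet> e - x \<bullet> e"]
      by (auto simp: zero_less_mult_iff)
    then show "x \<in> box a b" by (simp add: mem_box bump1_bounds(3))
  qed
qed

lemma test_function_box_bump:
  assumes "cbox a b \<subseteq> D"
  shows "test_function D (\<lambda>x. 1 - (1 - box_bump a b x) ^ j)"
proof -
  have "{x. 1 - (1 - box_bump a b x) ^ j \<noteq> 0} \<subseteq> box a b"
  proof clarify
    fix x assume "1 - (1 - box_bump a b x) ^ j \<noteq> 0"
    then have "box_bump a b x \<noteq> 0" by auto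
    then show "x \<in> box a b" using box_bump_bounds(1)[of a b x] box_bump_bounds(3)[of x a b] by linarith
  qed
  then have "closure {x. 1 - (1 - box_bump a b x) ^ j \<noteq> 0} \<subseteq> cbox a b"
    by (meson box_subset_cbox closed_cbox closure_minimal order_trans)
  then show ?thesis using assms smooth_box_bump[of a b j] bounded_subset[OF bounded_cbox]
    unfolding test_function_def compact_eq_bounded_closed by blast
qed

text \<open>Open boxes form an intersection-stable generator of the Borel sets, and the sets over
  which \<open>w\<close> integrates to \<open>0\<close> are closed under complements and countable
  disjoint unions.\<close>

lemma AE_zero_of_box_integrals:
  fixes w :: "'a::euclidean_space \<Rightarrow> complex"
  assumes w: "integrable lborel w" and z: "\<And>a b. (LINT y:box a b|lborel. w y) = 0"
  shows "AE y in lborel. w y = 0"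
proof (rule sigma_finite_measure.density_zero[OF sigma_finite_lborel w])
  fix A :: "'a set" assume "A \<in> sets lborel"
  then have A: "A \<in> sigma_sets UNIV (range (\<lambda>(a, b). box a b))"
    by (simp add: borel_eq_box)
  have st: "Int_stable (range (\<lambda>(a, b). box a b :: 'a set))"
    by (auto simp: Int_stable_def box_Int_box)
  have sub: "range (\<lambda>(a, b). box a b :: 'a set) \<subseteq> Pow UNIV" by auto
  have int: "set_integrable lborel B w" if "B \<in> sigma_sets UNIV (range (\<lambda>(a, b). box a b))" for B
    using that w unfolding set_integrable_def
    by (intro integrable_mult_indicator) (simp_all add: borel_eq_box)
  \<comment> \<open>The step to complements needs a vanishing integral over the whole space, which
    is exhausted by centred cubes.\<close>
  have all0: "(LINT y|lborel. w y) = 0"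
  proof -
    have "(\<lambda>n::nat. LINT y:box (- (real n *\<^sub>R One)) (real n *\<^sub>R One)|lborel. w y) \<longlonglongrightarrow>
        (LINT y:(\<Union>n::nat. box (- (real n *\<^sub>R One)) (real n *\<^sub>R One))|lborel. w y)"
    proof (rule set_integral_cont_up)
      show "incseq (\<lambda>n::nat. box (- (real n *\<^sub>R One)) (real n *\<^sub>R One :: 'a))"
        by (auto simp: incseq_def mem_box inner_simps) (smt (verit) of_nat_mono)+
      show "set_integrable lborel (\<Union>n::nat. box (- (real n *\<^sub>R One)) (real n *\<^sub>R One)) w"
        unfolding set_integrable_def using w by (intro integrable_mult_indicator) auto
    qed auto
    then show ?thesis unfolding z UN_box_eq_UNIV by (simp add: LIMSEQ_const_iff set_lebesgue_integral_def)
  qed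
  show "set_lebesgue_integral lborel A w = 0"
    using st sub A
  proof (induction rule: sigma_sets_induct_disjoint)
    case (basic A) then show ?case using z by auto
  next
    case empty show ?case by (simp add: set_lebesgue_integral_def)
  next
    case (compl A)
    have "(LINT y:UNIV - A|lborel. w y) = (LINT y|lborel. w y) - (LINT y:A|lborel. w y)"
    proof -
      have "(LINT y|lborel. w y) - (LINT y:A|lborel. w y) = (LINT y|lborel. w y - indicator A y *\<^sub>R w y)"
        unfolding set_lebesgue_integral_def using int[OF compl(1)] w
        by (subst Bochner_Integration.integral_diff) (auto simp: set_integrable_def)
      also have "\<dots> = (LINT y:UNIV - A|lborel. w y)"
        unfolding set_lebesgue_integral_def
        by (intro Bochner_Integration.integral_cong) (auto simp: indicator_def)
      finally show ?thesis by simp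
    qed
    then show ?case using compl all0 by simp
  next
    case (union A)
    have U: "(\<Union>i. A i) \<in> sigma_sets UNIV (range (\<lambda>(a, b). box a b))"
      using union(2) by (intro sigma_sets.Union) auto
    have "(LINT y:(\<Union>i. A i)|lborel. w y) = (\<Sum>i. (LINT y:(A i)|lborel. w y))"
      using union int[OF U] by (intro lebesgue_integral_countable_add)
        (auto simp: borel_eq_box disjoint_family_on_def)
    then show ?case using union by simp
  qed
qed

text \<open>The functions \<open>1 - (1 - box_bump a b x) ^ j\<close> are admissible tests whenever
  \<open>cbox a b\<close> lies in \<open>D\<close>. Dominated convergence replaces them by the
  indicator of the box, and countably many closed boxes cover \<open>D\<close>.\<close>

lemma fundamental_lemma:
  fixes w :: "'a::euclidean_space \<Rightarrow> complex"
  assumes D: "open D" and int: "\<And>a b. cbox a b \<subseteq> D \<Longrightarrow> set_integrable lborel (cbox a b) w"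
    and z: "\<And>\<phi>. test_function D \<phi> \<Longrightarrow> (LINT y:D|lborel. \<phi> y *\<^sub>R w y) = 0"
  shows "AE y in lborel. y \<in> D \<longrightarrow> w y = 0"
proof -
  have box0: "(LINT y:box a b|lborel. w y) = 0" if "cbox a b \<subseteq> D" for a b
  proof -
    let ?h = "\<lambda>(j::nat) y. 1 - (1 - box_bump a b y) ^ j"
    have out: "?h j y = 0" if "y \<notin> box a b" for j y
      using that box_bump_bounds(1)[of a b y] box_bump_bounds(3)[of y a b] by (cases j) auto
    have "(\<lambda>j. LINT y|lborel. ?h j y *\<^sub>R (indicator (cbox a b) y *\<^sub>R w y)) \<longlonglongrightarrow>
        (LINT y|lborel. indicator (box a b) y *\<^sub>R w y)"
    proof (rule integral_dominated_convergence)
      show "integrable lborel (\<lambda>y. norm (indicator (cbox a b) y *\<^sub>R w y))"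
        using int[OF that] unfolding set_integrable_def by (rule integrable_norm)
      have wm: "(\<lambda>y. indicator (cbox a b) y *\<^sub>R w y) \<in> borel_measurable lborel"
        using int[OF that] unfolding set_integrable_def by (rule borel_measurable_integrable)
      have "(\<lambda>y. indicator (box a b) y *\<^sub>R (indicator (cbox a b) y *\<^sub>R w y)) \<in> borel_measurable lborel"
        by (intro borel_measurable_scaleR[OF _ wm] borel_measurable_indicator) auto
      moreover have "(\<lambda>y. indicator (box a b) y *\<^sub>R (indicator (cbox a b) y *\<^sub>R w y)) = (\<lambda>y. indicator (box a b) y *\<^sub>R w y)"
        using box_subset_cbox[of a b] by (auto simp: indicator_def fun_eq_iff)
      ultimately show "(\<lambda>y. indicator (box a b) y *\<^sub>R w y) \<in> borel_measurable lborel" by simp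
      have hm: "?h j \<in> borel_measurable lborel" for j
        using smooth_continuous[OF smooth_box_bump] borel_measurable_continuous_onI by auto
      show "(\<lambda>y. ?h j y *\<^sub>R (indicator (cbox a b) y *\<^sub>R w y)) \<in> borel_measurable lborel" for j
        by (rule borel_measurable_scaleR[OF hm wm])
      have "(\<lambda>j. ?h j y *\<^sub>R (indicator (cbox a b) y *\<^sub>R w y)) \<longlonglongrightarrow> indicator (box a b) y *\<^sub>R w y" for y
      proof (cases "y \<in> box a b")
        case True
        have "(\<lambda>j. (1 - box_bump a b y) ^ j) \<longlonglongrightarrow> 0"
        proof (rule LIMSEQ_power_zero)
          have "0 < box_bump a b y" "box_bump a b y < 1"
            using True box_bump_bounds(2)[of a b y] box_bump_bounds(3)[of y a b] by blast+
          then show "norm (1 - box_bump a b y) < 1" unfolding real_norm_def by linarith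
        qed
        then have "(\<lambda>j. ?h j y *\<^sub>R (indicator (cbox a b) y *\<^sub>R w y)) \<longlonglongrightarrow> (1 - 0) *\<^sub>R (indicator (cbox a b) y *\<^sub>R w y)"
          by (intro tendsto_scaleR tendsto_diff tendsto_const)
        then show ?thesis using True box_subset_cbox[of a b] by (auto simp: indicator_def)
      next
        case False
        then show ?thesis using out by simp
      qed
      then show "AE y in lborel. (\<lambda>j. ?h j y *\<^sub>R (indicator (cbox a b) y *\<^sub>R w y)) \<longlonglongrightarrow> indicator (box a b) y *\<^sub>R w y"
        by simp
      have "norm (?h j y) \<le> 1" for j y
        using box_bump_bounds(1,2)[of a b y] by (simp add: power_le_one)
      then show "AE y in lborel. norm (?h j y *\<^sub>R (indicator (cbox a b) y *\<^sub>R w y)) \<le> norm (indicator (cbox a b) y *\<^sub>R w y)" for j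
        by (intro AE_I2) (metis mult_left_le_one_le norm_ge_zero norm_scaleR real_norm_def abs_ge_zero)
    qed
    moreover have "(LINT y|lborel. ?h j y *\<^sub>R (indicator (cbox a b) y *\<^sub>R w y)) = 0" for j
    proof -
      have "?h j y *\<^sub>R (indicator (cbox a b) y *\<^sub>R w y) = indicator D y *\<^sub>R (?h j y *\<^sub>R w y)" for y
        using out[of y j] box_subset_cbox[of a b] that by (cases "y \<in> box a b") (auto simp: indicator_def)
      then show ?thesis using z[OF test_function_box_bump[OF that, of j]]
        unfolding set_lebesgue_integral_def by (simp only:)
    qed
    ultimately show ?thesis by (simp add: LIMSEQ_const_iff set_lebesgue_integral_def)
  qed
  have ae: "AE y in lborel. y \<in> cbox a b \<longrightarrow> w y = 0" if "cbox a b \<subseteq> D" for a b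
  proof -
    have "AE y in lborel. indicator (cbox a b) y *\<^sub>R w y = 0"
    proof (rule AE_zero_of_box_integrals)
      show "integrable lborel (\<lambda>y. indicator (cbox a b) y *\<^sub>R w y)"
        using int[OF that] by (simp add: set_integrable_def)
      fix c d :: 'a
      \<comment> \<open>\<open>AE_zero_of_box_integrals\<close> asks for all boxes of the space,
        while only boxes with closure in \<open>D\<close> are at hand. Multiplied by the indicator
        of \<open>cbox a b\<close>, the function is integrated over the smaller box
        \<open>box p q\<close>, up to the null boundary of \<open>box a b\<close>.\<close>
      obtain p q where pq: "box a b \<inter> box c d = box p q" "cbox a b \<inter> cbox c d = cbox p q"
        using box_Int_box[of a b c d] Int_interval[of a b c d] by blast
      have "(LINT y:box c d|lborel. indicator (cbox a b) y *\<^sub>R w y) = (LINT y:box p q|lborel. w y)"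
        unfolding set_lebesgue_integral_def
      proof (rule integral_cong_AE)
        have *: "(\<lambda>y. indicator (cbox a b) y *\<^sub>R w y) \<in> borel_measurable lborel"
          using int[OF that] unfolding set_integrable_def by (rule borel_measurable_integrable)
        show "(\<lambda>y. indicator (box c d) y *\<^sub>R indicator (cbox a b) y *\<^sub>R w y) \<in> borel_measurable lborel"
          by (intro borel_measurable_scaleR[OF _ *] borel_measurable_indicator) auto
        have "(\<lambda>y. indicator (box p q) y *\<^sub>R indicator (cbox a b) y *\<^sub>R w y) \<in> borel_measurable lborel"
          by (intro borel_measurable_scaleR[OF _ *] borel_measurable_indicator) auto
        moreover have "(\<lambda>y. indicator (box p q) y *\<^sub>R indicator (cbox a b) y *\<^sub>R w y) = (\<lambda>y. indicator (box p q) y *\<^sub>R w y)"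
          using pq box_subset_cbox[of a b] by (auto simp: indicator_def fun_eq_iff)
        ultimately show "(\<lambda>y. indicator (box p q) y *\<^sub>R w y) \<in> borel_measurable lborel" by simp
        have "AE y in lborel. y \<notin> cbox a b - box a b"
          using null_sets_cbox_Diff_box by (rule AE_not_in)
        then show "AE y in lborel. indicator (box c d) y *\<^sub>R indicator (cbox a b) y *\<^sub>R w y = indicator (box p q) y *\<^sub>R w y"
          by eventually_elim (use pq box_subset_cbox[of a b] in \<open>auto simp: indicator_def\<close>)
      qed
      also have "\<dots> = 0"
      proof (cases "cbox p q \<subseteq> D")
        case True then show ?thesis by (rule box0)
      next
        case False then show ?thesis using pq(2) that by blast
      qed
      finally show "(LINT y:box c d|lborel. indicator (cbox a b) y *\<^sub>R w y) = 0" .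
    qed
    then show ?thesis by eventually_elim (auto simp: indicator_def)
  qed
  obtain \<D> where \<D>: "countable \<D>" "\<D> \<subseteq> Pow D" "\<And>X. X \<in> \<D> \<Longrightarrow> \<exists>a b. X = cbox a b" "\<Union>\<D> = D"
    using open_countable_Union_open_cbox[OF D] by metis
  have "AE y in lborel. \<forall>X\<in>\<D>. y \<in> X \<longrightarrow> w y = 0"
    unfolding AE_ball_countable[OF \<D>(1)]
  proof
    fix X assume X: "X \<in> \<D>"
    then obtain a b where "X = cbox a b" using \<D>(3) by blast
    then show "AE y in lborel. y \<in> X \<longrightarrow> w y = 0" using ae[of a b] X \<D>(2) by blast
  qed
  then show ?thesis by eventually_elim (use \<D>(4) in blast)
qed

subsection \<open>Weak gradients and traces\<close>

lemma L2loc_measurable: "L2loc D v \<Longrightarrow> (\<lambda>y. indicator D y *\<^sub>R v y) \<in> borel_measurable borel"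
  by (simp add: L2loc_def set_borel_measurable_def)

lemma L2loc_cong: "(\<And>y. y \<in> D \<Longrightarrow> v y = v' y) \<Longrightarrow> L2loc D v \<longleftrightarrow> L2loc D v'"
proof -
  assume *: "\<And>y. y \<in> D \<Longrightarrow> v y = v' y"
  have 1: "(\<lambda>y. indicator D y *\<^sub>R v y) = (\<lambda>y. indicator D y *\<^sub>R v' y)"
    using * by (auto simp: indicator_def fun_eq_iff)
  have 2: "(\<lambda>y. nsq (v y) * indicator (D \<inter> ball 0 r) y) =
     (\<lambda>y. nsq (v' y) * indicator (D \<inter> ball 0 r) y)" for r
    using * by (auto simp: indicator_def fun_eq_iff)
  show ?thesis unfolding L2loc_def set_borel_measurable_def 1 2 ..
qed

lemma weak_deriv_cong:
  "(\<And>y. y \<in> D \<Longrightarrow> v y = v' y) \<Longrightarrow> (\<And>y. y \<in> D \<Longrightarrow> w y = w' y) \<Longrightarrow> weak_deriv D b v w \<longleftrightarrow> weak_deriv D b v' w'"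
proof -
  assume *: "\<And>y. y \<in> D \<Longrightarrow> v y = v' y" "\<And>y. y \<in> D \<Longrightarrow> w y = w' y"
  have "(LINT y:D|lborel. (\<psi> y::real) *\<^sub>R v y) = (LINT y:D|lborel. \<psi> y *\<^sub>R v' y)"
    "(LINT y:D|lborel. (\<psi> y::real) *\<^sub>R w y) = (LINT y:D|lborel. \<psi> y *\<^sub>R w' y)" for \<psi>
    unfolding set_lebesgue_integral_def using * by (auto intro!: Bochner_Integration.integral_cong simp: indicator_def)
  then show ?thesis by (simp add: weak_deriv_def)
qed

lemma H1loc_cong:
  "(\<And>y. y \<in> D \<Longrightarrow> v y = v' y) \<Longrightarrow> (\<And>y. y \<in> D \<Longrightarrow> G y = G' y) \<Longrightarrow> H1loc D v G \<longleftrightarrow> H1loc D v' G'"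
  unfolding H1loc_def weak_gradient_def
  using L2loc_cong[of D v v'] L2loc_cong[of D G G']
    weak_deriv_cong[of D v v' "\<lambda>y. fst (G y) $ _" "\<lambda>y. fst (G' y) $ _"]
    weak_deriv_cong[of D v v' "\<lambda>y. snd (G y)" "\<lambda>y. snd (G' y)"]
  by (smt (verit))

lemma ennreal_sq: "0 \<le> a \<Longrightarrow> ennreal a ^ 2 = ennreal (a\<^sup>2)"
  by (simp add: ennreal_power)

text \<open>Cauchy-Schwarz with a bounded multiplier that vanishes off a ball. The first part makes
  test integrals meaningful, the second makes them continuous for convergence in
  \<open>L2loc\<close>.\<close>

lemma test_integral:
  fixes v :: "'a::euclidean_space \<Rightarrow> 'b::euclidean_space"
  assumes v: "L2loc D v" and D: "D \<in> sets borel" and [measurable]: "\<psi> \<in> borel_measurable borel"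
    and B: "\<And>y. \<bar>\<psi> y\<bar> \<le> B * indicator (ball 0 r) y" "0 \<le> B"
  shows "integrable lborel (\<lambda>y. indicator D y *\<^sub>R (\<psi> y *\<^sub>R v y))"
    and "(ennreal (norm (LINT y:D|lborel. \<psi> y *\<^sub>R v y)))\<^sup>2 \<le>
      ennreal (B\<^sup>2) * emeasure lborel (ball (0::'a) r) * lsq D r v"
proof -
  note [measurable] = L2loc_measurable[OF v]
  have [measurable]: "ball (0::'a) r \<in> sets borel" by simp
  let ?f = "\<lambda>y. indicator D y *\<^sub>R (\<psi> y *\<^sub>R v y)"
  have eq: "?f = (\<lambda>y. \<psi> y *\<^sub>R (indicator D y *\<^sub>R v y))" by (auto simp: fun_eq_iff)
  have meas[measurable]: "?f \<in> borel_measurable lborel" unfolding eq by measurable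
  let ?R = "ennreal (B\<^sup>2) * emeasure lborel (ball (0::'a) r) * lsq D r v"
  let ?a = "\<lambda>y::'a. ennreal (B * indicator (ball 0 r) y)"
  let ?b = "\<lambda>y. ennreal (norm (indicator D y *\<^sub>R v y)) * indicator (ball 0 r) y"
  have "(LI y. ennreal (norm (?f y))) \<le> (LI y. ?a y * ?b y)"
  proof (intro nn_integral_mono)
    fix y
    show "ennreal (norm (?f y)) \<le> ?a y * ?b y"
      using B(1)[of y] B(2)
      by (cases "y \<in> ball 0 r"; cases "y \<in> D") (auto simp: ennreal_mult[symmetric] intro!: ennreal_leI mult_right_mono)
  qed
  then have "(LI y. ennreal (norm (?f y)))\<^sup>2 \<le> (LI y. ?a y * ?b y)\<^sup>2"
    by (rule power_mono) simp
  also have "\<dots> \<le> (LI y. (?a y)^2) * (LI y. (?b y)^2)"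
    by (rule Cauchy_Schwarz_nn_integral[where f = ?a and g = ?b]) measurable
  also have "(LI y. (?a y)^2) = (LI y. ennreal (B\<^sup>2) * indicator (ball (0::'a) r) y)"
    using B(2) by (intro nn_integral_cong) (auto simp: indicator_def ennreal_sq)
  also have "\<dots> = ennreal (B\<^sup>2) * emeasure lborel (ball (0::'a) r)"
    by (subst nn_integral_cmult_indicator) auto
  also have "(LI y. (?b y)^2) = lsq D r v"
    by (intro nn_integral_cong) (auto simp: indicator_def ennreal_sq)
  finally have *: "(LI y. ennreal (norm (?f y)))\<^sup>2 \<le> ?R" .
  have "?R < \<infinity>"
    using v emeasure_lborel_ball_finite[of "0::'a" r] unfolding L2loc_def by (auto simp: ennreal_mult_less_top)
  then have "(LI y. ennreal (norm (?f y)))\<^sup>2 < \<infinity>" using * by (rule le_less_trans[rotated])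
  then have "(LI y. ennreal (norm (?f y))) < \<infinity>"
    by (auto simp: power2_eq_square ennreal_mult_eq_top_iff less_top[symmetric])
  then show int: "integrable lborel ?f" by (intro integrableI_bounded meas)
  have "ennreal (norm (LINT y:D|lborel. \<psi> y *\<^sub>R v y)) \<le> (LI y. ennreal (norm (?f y)))"
    unfolding set_lebesgue_integral_def using int by (rule integral_norm_bound_ennreal)
  then have "(ennreal (norm (LINT y:D|lborel. \<psi> y *\<^sub>R v y)))\<^sup>2 \<le> (LI y. ennreal (norm (?f y)))\<^sup>2"
    by (rule power_mono) simp
  then show "(ennreal (norm (LINT y:D|lborel. \<psi> y *\<^sub>R v y)))\<^sup>2 \<le> ?R" using * by (rule order_trans)
qed

lemma bounded_continuous_bound:
  fixes f :: "'a::euclidean_space \<Rightarrow> real"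
  assumes "continuous_on UNIV f" and "\<And>y. y \<notin> ball 0 r \<Longrightarrow> f y = 0"
  obtains B where "0 \<le> B" "\<And>y. \<bar>f y\<bar> \<le> B * indicator (ball 0 r) y"
proof -
  have "compact (f ` cball 0 r)"
    using assms(1) by (intro compact_continuous_image) (auto intro: continuous_on_subset)
  then obtain B where B: "\<And>y. y \<in> cball 0 r \<Longrightarrow> norm (f y) \<le> B"
    using compact_imp_bounded bounded_iff by (metis imageI)
  show ?thesis
  proof (rule that[of "max B 0"])
    fix y show "\<bar>f y\<bar> \<le> max B 0 * indicator (ball 0 r) y"
      using assms(2)[of y] B[of y] by (cases "y \<in> ball 0 r") auto
  qed simp
qed

text \<open>One radius and one bound serve both the function and its derivative, in the form in
  which \<open>test_integral\<close> takes them.\<close>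

lemma test_function_bounds:
  fixes \<phi> :: "'a::euclidean_space \<Rightarrow> real"
  assumes "test_function D \<phi>"
  obtains r B where "0 \<le> B" "\<phi> \<in> borel_measurable borel"
    "(\<lambda>y. frechet_derivative \<phi> (at y) b) \<in> borel_measurable borel"
    "\<And>y. \<bar>\<phi> y\<bar> \<le> B * indicator (ball 0 r) y"
    "\<And>y. \<bar>frechet_derivative \<phi> (at y) b\<bar> \<le> B * indicator (ball 0 r) y"
proof -
  let ?K = "closure {x. \<phi> x \<noteq> 0}"
  have sm: "smooth \<phi>" and K: "compact ?K" using assms by (auto simp: test_function_def)
  obtain r where r: "?K \<subseteq> ball 0 r"
    using bounded_subset_ballD[OF compact_imp_bounded[OF K]] by blast
  have 0: "\<phi> y = 0" if "y \<notin> ball 0 r" for y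
    using that r closure_subset[of "{x. \<phi> x \<noteq> 0}"] by blast
  have 1: "frechet_derivative \<phi> (at y) b = 0" if "y \<notin> ball 0 r" for y
  proof -
    have "open (- ?K)" "y \<in> - ?K" using that r by auto
    \<comment> \<open>The complement of the closed support is open and the function vanishes on it,
      hence so does the derivative.\<close>
    have "(\<phi> has_derivative (\<lambda>h. 0)) (at y)"
    proof (rule has_derivative_transform_within_open[OF has_derivative_const[of 0]])
      show "open (- ?K)" "y \<in> - ?K" by fact+
      show "0 = \<phi> x" if "x \<in> - ?K" for x
        using that closure_subset[of "{x. \<phi> x \<noteq> 0}"] by fastforce
    qed
    then show ?thesis using frechet_derivative_at by metis
  qed
  obtain B1 where B1: "0 \<le> B1" "\<And>y. \<bar>\<phi> y\<bar> \<le> B1 * indicator (ball 0 r) y"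
    using bounded_continuous_bound[OF smooth_continuous[OF sm] 0] by metis
  obtain B2 where B2: "0 \<le> B2" "\<And>y. \<bar>frechet_derivative \<phi> (at y) b\<bar> \<le> B2 * indicator (ball 0 r) y"
    using bounded_continuous_bound[OF smooth_continuous_derivative[OF sm, of b] 1] by metis
  show ?thesis
  proof (rule that[of "max B1 B2" r])
    show "\<phi> \<in> borel_measurable borel" "(\<lambda>y. frechet_derivative \<phi> (at y) b) \<in> borel_measurable borel"
      using smooth_continuous[OF sm] smooth_continuous_derivative[OF sm] by (auto intro: borel_measurable_continuous_onI)
    show "\<bar>\<phi> y\<bar> \<le> max B1 B2 * indicator (ball 0 r) y"
      "\<bar>frechet_derivative \<phi> (at y) b\<bar> \<le> max B1 B2 * indicator (ball 0 r) y" for y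
      using B1(2)[of y] B2(2)[of y] by (auto simp: indicator_def split: if_splits)
  qed (use B1 B2 in auto)
qed

lemma norm_add_sq_le:
  fixes a b :: "'a::real_normed_vector"
  shows "(norm (a + b))\<^sup>2 \<le> 2 * (norm a)\<^sup>2 + 2 * (norm b)\<^sup>2"
proof -
  have "(norm (a + b))\<^sup>2 \<le> (norm a + norm b)\<^sup>2" by (intro power_mono norm_triangle_ineq) simp
  also have "\<dots> \<le> 2 * (norm a)\<^sup>2 + 2 * (norm b)\<^sup>2"
    using zero_le_power2[of "norm a - norm b"] by (simp add: power2_eq_square algebra_simps)
  finally show ?thesis .
qed

lemma ennreal_norm_add_sq_le:
  fixes a b :: "'a::real_normed_vector"
  shows "nsq (a + b) \<le> 2 * nsq a + 2 * nsq b"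
proof -
  have "nsq (a + b) \<le> ennreal (2 * (norm a)\<^sup>2 + 2 * (norm b)\<^sup>2)"
    by (intro ennreal_leI norm_add_sq_le)
  then show ?thesis by (simp add: ennreal_plus ennreal_mult)
qed

lemma L2loc_norm_measurable:
  assumes "L2loc D v" "A \<subseteq> D" "A \<in> sets borel"
  shows "(\<lambda>y. nsq (v y) * indicator A y) \<in> borel_measurable borel"
proof -
  note [measurable] = L2loc_measurable[OF assms(1)] assms(3)
  have "(\<lambda>y. nsq (indicator D y *\<^sub>R v y) * indicator A y) \<in> borel_measurable borel"
    by measurable
  also have "(\<lambda>y. nsq (indicator D y *\<^sub>R v y) * indicator A y) = (\<lambda>y. nsq (v y) * indicator A y)"
    using assms(2) by (auto simp: indicator_def fun_eq_iff)
  finally show ?thesis .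
qed

lemma L2loc_add:
  assumes D: "D \<in> sets borel" and L: "L2loc D v" "L2loc D w"
  shows "L2loc D (\<lambda>y. v y + w y)"
  unfolding L2loc_def
proof (intro conjI allI)
  have "(\<lambda>y. indicator D y *\<^sub>R v y + indicator D y *\<^sub>R w y) \<in> borel_measurable borel"
    using L2loc_measurable[OF L(1)] L2loc_measurable[OF L(2)] by measurable
  then show "set_borel_measurable lborel D (\<lambda>y. v y + w y)"
    by (simp add: set_borel_measurable_def scaleR_add_right)
  fix r
  let ?A = "D \<inter> ball 0 r"
  have A: "?A \<in> sets borel" using D by simp
  have "(LIS ?A (\<lambda>y. nsq (v y + w y))) \<le>
    (LI y. 2 * (nsq (v y) * indicator ?A y) + 2 * (nsq (w y) * indicator ?A y))"
    by (intro nn_integral_mono) (use ennreal_norm_add_sq_le in \<open>auto simp: indicator_def\<close>)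
  also have "\<dots> = 2 * (LIS ?A (\<lambda>y. nsq (v y))) + 2 * (LIS ?A (\<lambda>y. nsq (w y)))"
    using L2loc_norm_measurable[OF L(1) _ A] L2loc_norm_measurable[OF L(2) _ A]
    by (subst nn_integral_add) (auto simp: nn_integral_cmult)
  also have "\<dots> < \<infinity>" using L by (auto simp: L2loc_def ennreal_mult_less_top)
  finally show "(LIS ?A (\<lambda>y. nsq (v y + w y))) < \<infinity>" .
qed

lemma L2loc_bounded_linear:
  assumes D: "D \<in> sets borel" and L: "bounded_linear L" and v: "L2loc D v"
  shows "L2loc D (\<lambda>y. L (v y))"
  unfolding L2loc_def set_borel_measurable_def
proof (intro conjI allI)
  have "(\<lambda>y. L (indicator D y *\<^sub>R v y)) \<in> borel_measurable borel"
    using L2loc_measurable[OF v] borel_measurable_continuous_onI[OF linear_continuous_on[OF L(1)]]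
    by (rule measurable_compose)
  then show "(\<lambda>y. indicator D y *\<^sub>R L (v y)) \<in> borel_measurable lborel"
    by (simp add: linear_scale[OF bounded_linear.linear[OF L(1)]])
  fix r
  obtain K where K: "\<And>x. norm (L x) \<le> K * norm x"
    using bounded_linear.bounded[OF L] by (metis mult.commute)
  have "lsq D r (\<lambda>y. L (v y)) \<le> (LI y. ennreal (K\<^sup>2) * (nsq (v y) * indicator (D \<inter> ball 0 r) y))"
  proof (intro nn_integral_mono)
    fix y
    have "(norm (L (v y)))\<^sup>2 \<le> (K * norm (v y))\<^sup>2" using K by (intro power_mono) auto
    then show "nsq (L (v y)) * indicator (D \<inter> ball 0 r) y \<le> ennreal (K\<^sup>2) * (nsq (v y) * indicator (D \<inter> ball 0 r) y)"
      by (auto simp: indicator_def ennreal_mult[symmetric] power_mult_distrib intro!: ennreal_leI)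
  qed
  also have "\<dots> = ennreal (K\<^sup>2) * lsq D r v"
    using L2loc_norm_measurable[OF v, of "D \<inter> ball 0 r"] D by (subst nn_integral_cmult) auto
  also have "\<dots> < \<infinity>" using v by (auto simp: L2loc_def ennreal_mult_less_top)
  finally show "lsq D r (\<lambda>y. L (v y)) < \<infinity>" .
qed

lemma L2loc_diff:
  assumes D: "D \<in> sets borel" and L: "L2loc D v" "L2loc D w"
  shows "L2loc D (\<lambda>y. v y - w y)"
  using L2loc_add[OF D L(1) L2loc_bounded_linear[OF D bounded_linear_minus[OF bounded_linear_ident] L(2)]] by simp

lemma weak_deriv_lin:
  assumes D: "D \<in> sets borel" and L: "L2loc D v1" "L2loc D v2" "L2loc D w1" "L2loc D w2"
    and w: "weak_deriv D b v1 w1" "weak_deriv D b v2 w2"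
  shows "weak_deriv D b (\<lambda>y. c * v1 y + d * v2 y) (\<lambda>y. c * w1 y + d * w2 y)"
  unfolding weak_deriv_def
proof (intro allI impI)
  fix \<phi> assume t: "test_function D \<phi>"
  obtain r B where B: "0 \<le> B" "\<phi> \<in> borel_measurable borel"
    "(\<lambda>y. frechet_derivative \<phi> (at y) b) \<in> borel_measurable borel"
    "\<And>y. \<bar>\<phi> y\<bar> \<le> B * indicator (ball 0 r) y"
    "\<And>y. \<bar>frechet_derivative \<phi> (at y) b\<bar> \<le> B * indicator (ball 0 r) y"
    using test_function_bounds[OF t] by metis
  have *: "(LINT y:D|lborel. \<psi> y *\<^sub>R (c * u1 y + d * u2 y)) =
    c * (LINT y:D|lborel. \<psi> y *\<^sub>R u1 y) + d * (LINT y:D|lborel. \<psi> y *\<^sub>R u2 y)"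
    if "\<psi> \<in> borel_measurable borel" "\<And>y. \<bar>\<psi> y\<bar> \<le> B * indicator (ball 0 r) y" "L2loc D u1" "L2loc D u2" for \<psi> u1 u2
  proof -
    note i1 = test_integral(1)[OF that(3) D that(1,2) B(1)] and i2 = test_integral(1)[OF that(4) D that(1,2) B(1)]
    have "(LINT y:D|lborel. \<psi> y *\<^sub>R (c * u1 y + d * u2 y)) =
      (LINT y|lborel. c * (indicator D y *\<^sub>R (\<psi> y *\<^sub>R u1 y)) + d * (indicator D y *\<^sub>R (\<psi> y *\<^sub>R u2 y)))"
      unfolding set_lebesgue_integral_def by (intro Bochner_Integration.integral_cong) (auto simp: algebra_simps)
    also have "\<dots> = c * (LINT y:D|lborel. \<psi> y *\<^sub>R u1 y) + d * (LINT y:D|lborel. \<psi> y *\<^sub>R u2 y)"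
      unfolding set_lebesgue_integral_def
      by (subst Bochner_Integration.integral_add[OF integrable_mult_right[OF i1] integrable_mult_right[OF i2]])
        (simp only: integral_mult_right_zero)
    finally show ?thesis .
  qed
  show "(LINT y:D|lborel. frechet_derivative \<phi> (at y) b *\<^sub>R (c * v1 y + d * v2 y)) =
    - (LINT y:D|lborel. \<phi> y *\<^sub>R (c * w1 y + d * w2 y))"
    using *[OF B(3,5) L(1,2)] *[OF B(2,4) L(3,4)] w t by (simp add: weak_deriv_def)
qed

lemma L2loc_set_integrable:
  fixes w :: "'a::euclidean_space \<Rightarrow> 'b::euclidean_space"
  assumes "L2loc D w" "D \<in> sets borel" "bounded A" "A \<in> sets borel" "A \<subseteq> D"
  shows "set_integrable lborel A w"
proof -
  obtain r where r: "A \<subseteq> ball 0 r" using bounded_subset_ballD[OF assms(3)] by blast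
  have "integrable lborel (\<lambda>y. indicator D y *\<^sub>R (indicator A y *\<^sub>R w y))"
    using r assms(4) by (intro test_integral(1)[OF assms(1,2), of _ 1 r]) (auto simp: indicator_def)
  moreover have "(\<lambda>y. indicator D y *\<^sub>R (indicator A y *\<^sub>R w y)) = (\<lambda>y. indicator A y *\<^sub>R w y)"
    using assms(5) by (auto simp: indicator_def fun_eq_iff)
  ultimately show ?thesis by (simp add: set_integrable_def)
qed

lemma weak_deriv_unique:
  assumes D: "open D" and L: "L2loc D w1" "L2loc D w2" and w: "weak_deriv D b v w1" "weak_deriv D b v w2"
  shows "AE y in lborel. y \<in> D \<longrightarrow> w1 y = w2 y"
proof -
  have Db: "D \<in> sets borel" using D by auto
  have "AE y in lborel. y \<in> D \<longrightarrow> w1 y - w2 y = 0"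
  proof (rule fundamental_lemma[OF D])
    fix p q assume "cbox p q \<subseteq> D"
    then show "set_integrable lborel (cbox p q) (\<lambda>y. w1 y - w2 y)"
      using L2loc_set_integrable[OF L(1) Db, of "cbox p q"] L2loc_set_integrable[OF L(2) Db, of "cbox p q"]
      by (auto intro: set_integral_diff)
  next
    fix \<phi> assume t: "test_function D \<phi>"
    obtain r B where B: "0 \<le> B" "\<phi> \<in> borel_measurable borel" "\<And>y. \<bar>\<phi> y\<bar> \<le> B * indicator (ball 0 r) y"
      using test_function_bounds[OF t] by metis
    note i1 = test_integral(1)[OF L(1) Db B(2,3,1)] and i2 = test_integral(1)[OF L(2) Db B(2,3,1)]
    have "(LINT y:D|lborel. \<phi> y *\<^sub>R (w1 y - w2 y)) = (LINT y:D|lborel. \<phi> y *\<^sub>R w1 y) - (LINT y:D|lborel. \<phi> y *\<^sub>R w2 y)"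
      using i1 i2 unfolding set_lebesgue_integral_def
      by (subst Bochner_Integration.integral_diff[symmetric]) (auto simp: algebra_simps)
    moreover have "- (LINT y:D|lborel. \<phi> y *\<^sub>R w1 y) = - (LINT y:D|lborel. \<phi> y *\<^sub>R w2 y)"
      using w t unfolding weak_deriv_def by metis
    ultimately show "(LINT y:D|lborel. \<phi> y *\<^sub>R (w1 y - w2 y)) = 0" by simp
  qed
  then show ?thesis by simp
qed

lemma weak_gradient_unique:
  assumes D: "open D" and H: "H1loc D v G1" "H1loc D v G2"
  shows "AE y in lborel. y \<in> D \<longrightarrow> G1 y = G2 y"
proof -
  have Db: "D \<in> sets borel" using D by simp
  have b1: "bounded_linear (\<lambda>g :: 'a cvec. fst g $ i)" for i
    by (rule bounded_linear_compose[OF bounded_linear_vec_nth bounded_linear_fst])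
  have "AE y in lborel. y \<in> D \<longrightarrow> fst (G1 y) $ i = fst (G2 y) $ i" for i
    using H by (intro weak_deriv_unique[OF D L2loc_bounded_linear[OF Db b1] L2loc_bounded_linear[OF Db b1]]) (auto simp: H1loc_def weak_gradient_def)
  then have "AE y in lborel. \<forall>i\<in>UNIV. y \<in> D \<longrightarrow> fst (G1 y) $ i = fst (G2 y) $ i"
    by (intro AE_ball_countable[THEN iffD2]) auto
  moreover have "AE y in lborel. y \<in> D \<longrightarrow> snd (G1 y) = snd (G2 y)"
    using H by (intro weak_deriv_unique[OF D L2loc_bounded_linear[OF Db bounded_linear_snd] L2loc_bounded_linear[OF Db bounded_linear_snd]])
      (auto simp: H1loc_def weak_gradient_def)
  ultimately show ?thesis
    by eventually_elim (auto simp: prod_eq_iff vec_eq_iff)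
qed

lemma test_integral_limit:
  fixes v :: "'a::euclidean_space \<Rightarrow> 'b::euclidean_space"
  assumes D: "D \<in> sets borel" and L: "L2loc D v" "\<And>k. L2loc D (vs k)"
    and lim: "\<And>r. l2conv D r vs v"
    and \<psi>: "\<psi> \<in> borel_measurable borel" "\<And>y. \<bar>\<psi> y\<bar> \<le> B * indicator (ball 0 r) y" "0 \<le> B"
  shows "(\<lambda>k. LINT y:D|lborel. \<psi> y *\<^sub>R vs k y) \<longlonglongrightarrow> (LINT y:D|lborel. \<psi> y *\<^sub>R v y)"
proof -
  let ?I = "\<lambda>k. lsq D r (\<lambda>y. vs k y - v y)"
  let ?C = "ennreal (B\<^sup>2) * emeasure lborel (ball (0::'a) r)"
  let ?d = "\<lambda>k. (LINT y:D|lborel. \<psi> y *\<^sub>R vs k y) - (LINT y:D|lborel. \<psi> y *\<^sub>R v y)"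
  have d: "?d k = (LINT y:D|lborel. \<psi> y *\<^sub>R (vs k y - v y))" for k
    using test_integral(1)[OF L(2) D \<psi>] test_integral(1)[OF L(1) D \<psi>] unfolding set_lebesgue_integral_def
    by (subst Bochner_Integration.integral_diff[symmetric]) (auto simp: algebra_simps)
  have le: "(ennreal (norm (?d k)))\<^sup>2 \<le> ?C * ?I k" for k
    unfolding d using test_integral(2)[OF L2loc_diff[OF D L(2) L(1)] D \<psi>] by simp
  have "?C < \<infinity>" using emeasure_lborel_ball_finite[of "0::'a" r] by (auto simp: ennreal_mult_less_top)
  then have CI: "(\<lambda>k. ?C * ?I k) \<longlonglongrightarrow> 0" using ennreal_tendsto_cmult[OF _ lim, of ?C r] by simp
  have "(\<lambda>k. (ennreal (norm (?d k)))\<^sup>2) \<longlonglongrightarrow> 0"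
    by (rule tendsto_sandwich[OF always_eventually always_eventually tendsto_const CI]) (intro allI zero_le, intro allI le)
  then have "(\<lambda>k. nsq (?d k)) \<longlonglongrightarrow> ennreal 0" by (simp add: ennreal_sq)
  then have "(\<lambda>k. (norm (?d k))\<^sup>2) \<longlonglongrightarrow> 0"
    using tendsto_ennreal_iff[where f = "\<lambda>k. (norm (?d k))\<^sup>2" and F = sequentially and x = 0] by (simp only: always_eventually zero_le_power2 simp_thms order_refl)
  then have "(\<lambda>k. sqrt ((norm (?d k))\<^sup>2)) \<longlonglongrightarrow> sqrt 0" by (rule tendsto_real_sqrt)
  then have "(\<lambda>k. norm (?d k)) \<longlonglongrightarrow> 0" by simp
  then show ?thesis by (rule LIM_zero_cancel[OF tendsto_norm_zero_cancel])
qed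

text \<open>Both sides of the defining identity are test integrals, hence continuous in the field
  and in its derivative: weak differentiation is a closed relation.\<close>

lemma weak_deriv_limit:
  assumes D: "D \<in> sets borel" and L: "L2loc D v" "\<And>k. L2loc D (vs k)" "L2loc D w" "\<And>k. L2loc D (ws k)"
    and lim: "\<And>r. l2conv D r vs v"
    "\<And>r. l2conv D r ws w"
    and wd: "\<And>k. weak_deriv D b (vs k) (ws k)"
  shows "weak_deriv D b v w"
  unfolding weak_deriv_def
proof (intro allI impI)
  fix \<phi> assume t: "test_function D \<phi>"
  obtain r B where B: "0 \<le> B" "\<phi> \<in> borel_measurable borel"
    "(\<lambda>y. frechet_derivative \<phi> (at y) b) \<in> borel_measurable borel"
    "\<And>y. \<bar>\<phi> y\<bar> \<le> B * indicator (ball 0 r) y"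
    "\<And>y. \<bar>frechet_derivative \<phi> (at y) b\<bar> \<le> B * indicator (ball 0 r) y"
    using test_function_bounds[OF t] by metis
  note l1 = test_integral_limit[OF D L(1,2) lim(1) B(3,5,1)]
  note l2 = test_integral_limit[OF D L(3,4) lim(2) B(2,4,1)]
  have "(\<lambda>k. - (LINT y:D|lborel. \<phi> y *\<^sub>R ws k y)) \<longlonglongrightarrow> (LINT y:D|lborel. frechet_derivative \<phi> (at y) b *\<^sub>R v y)"
    using l1 wd t unfolding weak_deriv_def by simp
  then show "(LINT y:D|lborel. frechet_derivative \<phi> (at y) b *\<^sub>R v y) = - (LINT y:D|lborel. \<phi> y *\<^sub>R w y)"
    using LIMSEQ_unique tendsto_minus[OF l2] by blast
qed

section \<open>Translations of weak derivatives\<close>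

lemma nn_integral_lborel_shift:
  fixes f :: "'a::euclidean_space \<Rightarrow> ennreal"
  assumes [measurable]: "f \<in> borel_measurable borel"
  shows "(LI y. f (y + a)) = (LI y. f y)"
proof -
  have "(LI y. f y) = (\<integral>\<^sup>+y. f y \<partial>distr lborel borel ((+) a))" by (simp add: lborel_distr_plus)
  also have "\<dots> = (LI y. f (a + y))" by (rule nn_integral_distr) auto
  finally show ?thesis by (simp add: add.commute)
qed

lemma integral_lborel_shift:
  fixes f :: "'a::euclidean_space \<Rightarrow> 'b::{banach, second_countable_topology}"
  assumes [measurable]: "f \<in> borel_measurable borel"
  shows "(LINT y|lborel. f (y + a)) = (LINT y|lborel. f y)"
proof -
  have "(LINT y|lborel. f y) = (LINT y|distr lborel borel ((+) a). f y)" by (simp add: lborel_distr_plus)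
  also have "\<dots> = (LINT y|lborel. f (a + y))" by (rule integral_distr) auto
  finally show ?thesis by (simp add: add.commute)
qed

lemma L2loc_translate:
  assumes D: "D \<in> sets borel" and v: "L2loc D v"
  shows "L2loc {y. y + a \<in> D} (\<lambda>y. v (y + a))"
  unfolding L2loc_def set_borel_measurable_def
proof (intro conjI allI)
  have "(\<lambda>y. indicator D (y + a) *\<^sub>R v (y + a)) \<in> borel_measurable borel"
    by (rule measurable_compose[OF _ L2loc_measurable[OF v]]) simp
  then show "(\<lambda>y. indicator {y. y + a \<in> D} y *\<^sub>R v (y + a)) \<in> borel_measurable lborel"
    by (simp add: indicator_def)
  fix r
  have "ball a r \<subseteq> ball 0 (r + norm a)"
    by (auto simp: dist_norm) (smt (verit) norm_minus_commute norm_triangle_ineq2)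
  then have "(LI y. nsq (v y) * indicator (D \<inter> ball a r) y) \<le>
      (LI y. nsq (v y) * indicator (D \<inter> ball 0 (r + norm a)) y)"
    by (intro nn_integral_mono) (auto simp: indicator_def)
  also have "\<dots> < \<infinity>" using v by (simp add: L2loc_def)
  also have "(LI y. nsq (v y) * indicator (D \<inter> ball a r) y) =
     (LI y. nsq (v (y + a)) * indicator (D \<inter> ball a r) (y + a))"
    using L2loc_norm_measurable[OF v, of "D \<inter> ball a r"] D
    by (subst nn_integral_lborel_shift[symmetric, where a = a]) auto
  also have "\<dots> = (LIS ({y. y + a \<in> D} \<inter> ball 0 r) (\<lambda>y. nsq (v (y + a))))"
    by (intro nn_integral_cong) (auto simp: indicator_def dist_norm)
  finally show "(LIS ({y. y + a \<in> D} \<inter> ball 0 r) (\<lambda>y. nsq (v (y + a)))) < \<infinity>" .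
qed

lemma frechet_derivative_translate:
  fixes f :: "'a::euclidean_space \<Rightarrow> 'b::real_normed_vector"
  assumes "smooth f"
  shows "frechet_derivative (\<lambda>x. f (x + a)) (at x) = frechet_derivative f (at (x + a))"
proof -
  have "((\<lambda>x. f (x + a)) has_derivative frechet_derivative f (at (x + a))) (at x)"
    by (rule has_derivative_compose[OF _ smooth_has_derivative[OF assms], where f = "\<lambda>x. x + a", simplified])
       (auto intro!: derivative_eq_intros)
  then show ?thesis using frechet_derivative_at by metis
qed

lemma test_function_translate:
  assumes "test_function {y. y + a \<in> D} \<phi>"
  shows "test_function D (\<lambda>x. \<phi> (x + (- a)))"
proof -
  have "{x. \<phi> (x + - a) \<noteq> 0} = (+) a ` {x. \<phi> x \<noteq> 0}"
    by (auto simp: image_iff) (metis add_diff_cancel_left' diff_add_cancel add.commute)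
  then have "closure {x. \<phi> (x + - a) \<noteq> 0} = (+) a ` closure {x. \<phi> x \<noteq> 0}"
    by (simp add: closure_translation)
  moreover have "(+) a ` closure {x. \<phi> x \<noteq> 0} \<subseteq> D" "compact ((+) a ` closure {x. \<phi> x \<noteq> 0})"
    using assms compact_translation[of "closure {x. \<phi> x \<noteq> 0}" a]
    unfolding test_function_def by (auto simp: add.commute)
  ultimately show ?thesis using assms smooth_translate[of \<phi> "- a"] unfolding test_function_def by simp
qed

text \<open>Test functions of the translated domain are translates of test functions of
  \<open>D\<close>, and a change of variables moves the translation from the test function to the
  field.\<close>

lemma weak_deriv_translate:
  assumes D: "D \<in> sets borel" and L: "L2loc D v" "L2loc D w" and wd: "weak_deriv D b v w"
  shows "weak_deriv {y. y + a \<in> D} b (\<lambda>y. v (y + a)) (\<lambda>y. w (y + a))"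
  unfolding weak_deriv_def
proof (intro allI impI)
  fix \<phi> assume t: "test_function {y. y + a \<in> D} \<phi>"
  let ?\<phi> = "\<lambda>x. \<phi> (x + (- a))"
  have t': "test_function D ?\<phi>" by (rule test_function_translate[OF t])
  have sm: "smooth \<phi>" using t by (simp add: test_function_def)
  obtain r B where B: "?\<phi> \<in> borel_measurable borel"
    "(\<lambda>y. frechet_derivative ?\<phi> (at y) b) \<in> borel_measurable borel"
    using test_function_bounds[OF t'] by metis
  have *: "(LINT y:{y. y + a \<in> D}|lborel. \<psi> (y + a) *\<^sub>R u (y + a)) = (LINT y:D|lborel. \<psi> y *\<^sub>R u y)"
    if "L2loc D u" "\<psi> \<in> borel_measurable borel" for \<psi> and u :: "'a \<Rightarrow> complex"
  proof -
    have "(\<lambda>y. \<psi> y *\<^sub>R (indicator D y *\<^sub>R u y)) \<in> borel_measurable borel"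
      using L2loc_measurable[OF that(1)] that(2) by measurable
    then have "(\<lambda>y. indicator D y *\<^sub>R (\<psi> y *\<^sub>R u y)) \<in> borel_measurable borel"
      by (simp add: mult.commute)
    from integral_lborel_shift[OF this, of a] show ?thesis
      unfolding set_lebesgue_integral_def by (simp add: indicator_def)
  qed
  have f: "frechet_derivative \<phi> (at y) = frechet_derivative ?\<phi> (at (y + a))" for y
    using frechet_derivative_translate[OF sm, of "- a" "y + a"] by simp
  show "(LINT y:{y. y + a \<in> D}|lborel. frechet_derivative \<phi> (at y) b *\<^sub>R v (y + a)) =
      - (LINT y:{y. y + a \<in> D}|lborel. \<phi> y *\<^sub>R w (y + a))"
    unfolding f using *[OF L(1) B(2)] *[OF L(2) B(1)] wd t' unfolding weak_deriv_def by simp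
qed

lemma
  shows L2loc_fst: "D \<in> sets borel \<Longrightarrow> L2loc D G \<Longrightarrow> L2loc D (\<lambda>y. fst (G y :: 'n::finite cvec) $ i)"
    and L2loc_snd: "D \<in> sets borel \<Longrightarrow> L2loc D G \<Longrightarrow> L2loc D (\<lambda>y. snd (G y))"
  by (rule L2loc_bounded_linear[of D "\<lambda>g. fst g $ i"], simp, rule bounded_linear_compose[OF bounded_linear_vec_nth bounded_linear_fst], simp)
     (rule L2loc_bounded_linear[OF _ bounded_linear_snd])

lemma H1loc_translate:
  assumes "D \<in> sets borel" "H1loc D v G"
  shows "H1loc {y. y + a \<in> D} (\<lambda>y. v (y + a)) (\<lambda>y. G (y + a))"
proof -
  have L: "L2loc D v" "L2loc D G"
    and w: "\<And>i. weak_deriv D (axis i 1, 0) v (\<lambda>y. fst (G y) $ i)" "weak_deriv D (0, 1) v (\<lambda>y. snd (G y))"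
    using assms(2) by (auto simp: H1loc_def weak_gradient_def)
  show ?thesis unfolding H1loc_def weak_gradient_def
    by (intro conjI allI L2loc_translate[OF assms(1)] L
      weak_deriv_translate[OF assms(1) L(1) L2loc_fst[OF assms(1) L(2)] w(1)]
      weak_deriv_translate[OF assms(1) L(1) L2loc_snd[OF assms(1) L(2)] w(2)])
qed

text \<open>Complex scalars acting on gradients: the type of gradients is only a real vector space,
  whereas the space of fields is complex.\<close>

definition cscale :: "complex \<Rightarrow> 'n::finite cvec \<Rightarrow> 'n cvec" where
  "cscale c g = ((\<chi> i. c * fst g $ i), c * snd g)"

lemma cvec_norm_sq: "(norm (g :: 'n::finite cvec))\<^sup>2 = (\<Sum>i\<in>UNIV. (norm (fst g $ i))\<^sup>2) + (norm (snd g))\<^sup>2"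
  by (simp add: norm_prod_def norm_vec_def L2_set_def sum_nonneg)

lemma norm_cscale: "norm (cscale c g) = norm c * norm g"
proof (rule power2_eq_imp_eq)
  show "(norm (cscale c g))\<^sup>2 = (norm c * norm g)\<^sup>2"
    unfolding power_mult_distrib cvec_norm_sq
    by (simp add: cscale_def norm_mult power_mult_distrib sum_distrib_left algebra_simps)
qed auto

lemma bounded_linear_cscale: "bounded_linear (cscale c)"
proof (rule bounded_linear_intro[where K = "norm c"])
  show "norm (cscale c g) \<le> norm g * norm c" for g :: "'a cvec" by (simp add: norm_cscale)
qed (simp_all add: cscale_def prod_eq_iff vec_eq_iff algebra_simps)

lemma cscale_minus1: "cscale (-1) g = - g"
  by (simp add: cscale_def prod_eq_iff vec_eq_iff)

lemma cscale_1: "cscale 1 g = g"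
  by (simp add: cscale_def prod_eq_iff vec_eq_iff)

lemma L2loc_lin:
  assumes D: "D \<in> sets borel" and L: "L2loc D v" "L2loc D w"
  shows "L2loc D (\<lambda>y. c * v y + d * w y :: complex)"
  by (intro L2loc_add[OF D] L2loc_bounded_linear[OF D bounded_linear_mult_right] L)

lemma L2loc_lin_cvec:
  assumes D: "D \<in> sets borel" and L: "L2loc D v" "L2loc D w"
  shows "L2loc D (\<lambda>y. cscale c (v y) + cscale d (w y))"
  by (intro L2loc_add[OF D] L2loc_bounded_linear[OF D bounded_linear_cscale] L)

lemma H1loc_lin:
  assumes D: "D \<in> sets borel" and H: "H1loc D v1 G1" "H1loc D v2 G2"
  shows "H1loc D (\<lambda>y. c * v1 y + d * v2 y) (\<lambda>y. cscale c (G1 y) + cscale d (G2 y))"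
proof -
  have L: "L2loc D v1" "L2loc D v2" "L2loc D G1" "L2loc D G2" using H by (auto simp: H1loc_def)
  have "weak_deriv D (axis i 1, 0) (\<lambda>y. c * v1 y + d * v2 y) (\<lambda>y. c * fst (G1 y) $ i + d * fst (G2 y) $ i)" for i
    using H by (intro weak_deriv_lin[OF D L(1,2) L2loc_fst[OF D L(3)] L2loc_fst[OF D L(4)]])
      (auto simp: H1loc_def weak_gradient_def)
  moreover have "weak_deriv D (0, 1) (\<lambda>y. c * v1 y + d * v2 y) (\<lambda>y. c * snd (G1 y) + d * snd (G2 y))"
    using H by (intro weak_deriv_lin[OF D L(1,2) L2loc_snd[OF D L(3)] L2loc_snd[OF D L(4)]])
      (auto simp: H1loc_def weak_gradient_def)
  ultimately show ?thesis
    using L2loc_lin[OF D L(1,2)] L2loc_lin_cvec[OF D L(3,4)]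
    by (simp add: H1loc_def weak_gradient_def cscale_def)
qed

text \<open>The triangle inequality in \<open>L^2\<close>, phrased with integrals of squares: if the
  norm is dominated by a combination of two null sequences, the square costs a factor
  \<open>2\<close> for each of them. Sums, differences and intermediate approximants all pass
  through it.\<close>

lemma sq_dom_tendsto:
  fixes c :: "nat \<Rightarrow> 'x \<Rightarrow> 'a::real_normed_vector" and a :: "nat \<Rightarrow> 'x \<Rightarrow> 'b::real_normed_vector"
    and b :: "nat \<Rightarrow> 'x \<Rightarrow> 'c::real_normed_vector"
  assumes A: "\<And>k. (\<lambda>y. nsq (a k y) * indicator A y) \<in> borel_measurable M"
      "\<And>k. (\<lambda>y. nsq (b k y) * indicator A y) \<in> borel_measurable M"
    and lim: "(\<lambda>k. \<integral>\<^sup>+y\<in>A. nsq (a k y) \<partial>M) \<longlonglongrightarrow> 0"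
      "(\<lambda>k. \<integral>\<^sup>+y\<in>A. nsq (b k y) \<partial>M) \<longlonglongrightarrow> 0"
    and le: "\<And>k y. y \<in> A \<Longrightarrow> norm (c k y) \<le> K * norm (a k y) + L * norm (b k y)"
  shows "(\<lambda>k. \<integral>\<^sup>+y\<in>A. nsq (c k y) \<partial>M) \<longlonglongrightarrow> 0"
proof (rule tendsto_sandwich[OF always_eventually always_eventually tendsto_const])
  let ?a = "\<lambda>k. \<integral>\<^sup>+y\<in>A. nsq (a k y) \<partial>M" and ?b = "\<lambda>k. \<integral>\<^sup>+y\<in>A. nsq (b k y) \<partial>M"
  have "(\<lambda>k. ennreal (2 * K\<^sup>2) * ?a k + ennreal (2 * L\<^sup>2) * ?b k) \<longlonglongrightarrow> ennreal (2 * K\<^sup>2) * 0 + ennreal (2 * L\<^sup>2) * 0"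
    by (intro tendsto_add ennreal_tendsto_cmult lim) auto
  then show "(\<lambda>k. ennreal (2 * K\<^sup>2) * ?a k + ennreal (2 * L\<^sup>2) * ?b k) \<longlonglongrightarrow> 0" by simp
  show "\<forall>k. (\<integral>\<^sup>+y\<in>A. nsq (c k y) \<partial>M) \<le> ennreal (2 * K\<^sup>2) * ?a k + ennreal (2 * L\<^sup>2) * ?b k"
  proof
    fix k
    have "(\<integral>\<^sup>+y\<in>A. nsq (c k y) \<partial>M) \<le>
      (\<integral>\<^sup>+y. ennreal (2 * K\<^sup>2) * (nsq (a k y) * indicator A y) + ennreal (2 * L\<^sup>2) * (nsq (b k y) * indicator A y) \<partial>M)"
    proof (intro nn_integral_mono)
      fix y
      have "nsq (c k y) \<le> ennreal (2 * K\<^sup>2) * nsq (a k y) + ennreal (2 * L\<^sup>2) * nsq (b k y)"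
        if "y \<in> A"
      proof -
        have "(norm (c k y))\<^sup>2 \<le> (K * norm (a k y) + L * norm (b k y))\<^sup>2" using le[OF that] by (intro power_mono) auto
        also have "\<dots> \<le> 2 * (K * norm (a k y))\<^sup>2 + 2 * (L * norm (b k y))\<^sup>2"
          using norm_add_sq_le[of "K * norm (a k y)" "L * norm (b k y)"] by simp
        finally have "nsq (c k y) \<le> ennreal (2 * K\<^sup>2 * (norm (a k y))\<^sup>2 + 2 * L\<^sup>2 * (norm (b k y))\<^sup>2)"
          by (intro ennreal_leI) (simp add: power_mult_distrib)
        then show ?thesis by (simp add: ennreal_plus ennreal_mult'')
      qed
      then show "nsq (c k y) * indicator A y \<le> ennreal (2 * K\<^sup>2) * (nsq (a k y) * indicator A y)
         + ennreal (2 * L\<^sup>2) * (nsq (b k y) * indicator A y)"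
        by (auto simp: indicator_def)
    qed
    also have "\<dots> = ennreal (2 * K\<^sup>2) * ?a k + ennreal (2 * L\<^sup>2) * ?b k"
      using A by (subst nn_integral_add) (auto simp: nn_integral_cmult)
    finally show "(\<integral>\<^sup>+y\<in>A. nsq (c k y) \<partial>M) \<le> ennreal (2 * K\<^sup>2) * ?a k + ennreal (2 * L\<^sup>2) * ?b k" .
  qed
qed simp

lemma H1loc_limit:
  assumes D: "D \<in> sets borel" and L: "L2loc D v" "L2loc D G" and H: "\<And>k. H1loc D (vs k) (Gs k)"
    and lim: "\<And>r. l2conv D r vs v"
    "\<And>r. l2conv D r Gs G"
  shows "H1loc D v G"
proof -
  have Hk: "L2loc D (vs k)" "L2loc D (Gs k)" "\<And>i. weak_deriv D (axis i 1, 0) (vs k) (\<lambda>y. fst (Gs k y) $ i)"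
    "weak_deriv D (0, 1) (vs k) (\<lambda>y. snd (Gs k y))" for k
    using H[of k] by (auto simp: H1loc_def weak_gradient_def)
  have *: "l2conv D r (\<lambda>k. (\<lambda>y. l (Gs k y))) (\<lambda>y. l (G y))"
    if l: "linear l" "\<And>g. norm (l g) \<le> norm g" for l :: "'a cvec \<Rightarrow> complex" and r
  proof (rule tendsto_sandwich[OF always_eventually always_eventually tendsto_const lim(2)[of r]])
    show "\<forall>k. lsq D r (\<lambda>y. l (Gs k y) - l (G y)) \<le>
      lsq D r (\<lambda>y. Gs k y - G y)"
      using l(2) by (intro allI nn_integral_mono mult_right_mono ennreal_leI power_mono)
        (auto simp: linear_diff[OF l(1), symmetric])
  qed simp
  have n1: "norm (fst g $ i) \<le> norm g" for g :: "'a cvec" and i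
    by (rule order_trans[OF Finite_Cartesian_Product.norm_nth_le]) (metis norm_fst_le prod.collapse)
  have n2: "norm (snd g) \<le> norm g" for g :: "'a cvec" by (metis norm_snd_le prod.collapse)
  have b1: "linear (\<lambda>g :: 'a cvec. fst g $ i)" for i
    by (rule bounded_linear.linear[OF bounded_linear_compose[OF bounded_linear_vec_nth bounded_linear_fst]])
  have b2: "linear (\<lambda>g :: 'a cvec. snd g)" by (rule bounded_linear.linear[OF bounded_linear_snd])
  have "weak_deriv D (axis i 1, 0) v (\<lambda>y. fst (G y) $ i)" for i
    by (rule weak_deriv_limit[OF D L(1) Hk(1) L2loc_fst[OF D L(2)] L2loc_fst[OF D Hk(2)] lim(1) *[OF b1 n1] Hk(3)])
  moreover have "weak_deriv D (0, 1) v (\<lambda>y. snd (G y))"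
    by (rule weak_deriv_limit[OF D L(1) Hk(1) L2loc_snd[OF D L(2)] L2loc_snd[OF D Hk(2)] lim(1) *[OF b2 n2] Hk(4)])
  ultimately show ?thesis using L by (auto simp: H1loc_def weak_gradient_def)
qed

lemma smooth_lin:
  fixes f g :: "'a::euclidean_space \<Rightarrow> complex"
  shows "smooth f \<Longrightarrow> smooth g \<Longrightarrow> smooth (\<lambda>x. c * f x + d * g x)"
  by (intro smooth_add smooth_bounded_linear[OF bounded_linear_mult_right])

lemma classical_gradient_lin:
  assumes "smooth f" "smooth g"
  shows "classical_gradient (\<lambda>x. c * f x + d * g x) y = cscale c (classical_gradient f y) + cscale d (classical_gradient g y)"
proof -
  have "((\<lambda>x. c * f x + d * g x) has_derivative (\<lambda>h. c * frechet_derivative f (at y) h + d * frechet_derivative g (at y) h)) (at y)"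
    by (intro has_derivative_add has_derivative_mult_right smooth_has_derivative assms)
  note frechet_derivative_at[OF this, symmetric, simp]
  show ?thesis by (simp add: classical_gradient_def cscale_def prod_eq_iff vec_eq_iff)
qed

lemma smooth_measurable[measurable_dest]:
  fixes f :: "'a::euclidean_space \<Rightarrow> complex"
  shows "smooth f \<Longrightarrow> f \<in> borel_measurable borel"
  by (intro borel_measurable_continuous_onI smooth_continuous)

lemma classical_gradient_continuous:
  assumes "smooth f" shows "continuous_on UNIV (classical_gradient f)"
  unfolding classical_gradient_def[abs_def]
  by (intro continuous_intros smooth_continuous_derivative[OF assms])

lemma classical_gradient_measurable:
  "smooth f \<Longrightarrow> classical_gradient f \<in> borel_measurable borel"
  by (intro borel_measurable_continuous_onI classical_gradient_continuous)

lemma sq_diff_measurable: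
  fixes f v :: "'a::euclidean_space \<Rightarrow> 'b::euclidean_space"
  assumes [measurable]: "f \<in> borel_measurable borel" and v: "L2loc D v" and A: "A \<subseteq> D" "A \<in> sets borel"
  shows "(\<lambda>y. nsq (f y - v y) * indicator A y) \<in> borel_measurable borel"
proof -
  note [measurable] = L2loc_measurable[OF v] A(2)
  have "(\<lambda>y. nsq (f y - indicator D y *\<^sub>R v y) * indicator A y) \<in> borel_measurable borel" by measurable
  also have "(\<lambda>y. nsq (f y - indicator D y *\<^sub>R v y) * indicator A y) = (\<lambda>y. nsq (f y - v y) * indicator A y)"
    using A(1) by (auto simp: indicator_def fun_eq_iff)
  finally show ?thesis .
qed

section \<open>Linear combinations and limits of traces\<close>

lemma has_trace_lin:
  assumes D: "D \<in> sets borel" and S: "sets S = sets borel"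
    and t: "has_trace D S v1 g1" "has_trace D S v2 g2"
  shows "has_trace D S (\<lambda>y. c * v1 y + d * v2 y) (\<lambda>y. c * g1 y + d * g2 y)"
proof -
  obtain G1 p1 where 1: "H1loc D v1 G1" "\<And>k::nat. smooth (p1 k)"
    "\<And>r. l2conv D r p1 v1"
    "\<And>r. l2conv D r (\<lambda>k. classical_gradient (p1 k)) G1"
    "\<And>r. (\<lambda>k. \<integral>\<^sup>+y\<in>ball 0 r. nsq (p1 k y - g1 y) \<partial>S) \<longlonglongrightarrow> 0"
    using t(1) unfolding has_trace_def by blast
  obtain G2 p2 where 2: "H1loc D v2 G2" "\<And>k::nat. smooth (p2 k)"
    "\<And>r. l2conv D r p2 v2"
    "\<And>r. l2conv D r (\<lambda>k. classical_gradient (p2 k)) G2"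
    "\<And>r. (\<lambda>k. \<integral>\<^sup>+y\<in>ball 0 r. nsq (p2 k y - g2 y) \<partial>S) \<longlonglongrightarrow> 0"
    using t(2) unfolding has_trace_def by blast
  have g: "g1 \<in> borel_measurable borel" "g2 \<in> borel_measurable borel"
    using t unfolding has_trace_def by (simp_all add: measurable_cong_sets[OF S refl])
  note [measurable] = g smooth_measurable[OF 1(2)] smooth_measurable[OF 2(2)]
    classical_gradient_measurable[OF 1(2)] classical_gradient_measurable[OF 2(2)]
  have L: "L2loc D v1" "L2loc D v2" "L2loc D G1" "L2loc D G2" using 1(1) 2(1) by (auto simp: H1loc_def)
  have m: "(\<lambda>y. nsq (f y - v y) * indicator (D \<inter> ball 0 r) y) \<in> borel_measurable lborel"
    if "f \<in> borel_measurable borel" "L2loc D v" for f v :: "'a pt \<Rightarrow> 'b::euclidean_space" and r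
    using sq_diff_measurable[OF that, of "D \<inter> ball 0 r"] D by simp
  have n: "norm (c * a + d * b - (c * a' + d * b')) \<le> norm c * norm (a - a') + norm d * norm (b - b')" for a b a' b' :: complex
  proof -
    have "c * a + d * b - (c * a' + d * b') = c * (a - a') + d * (b - b')" by (simp add: algebra_simps)
    then show ?thesis using norm_triangle_ineq[of "c * (a - a')" "d * (b - b')"] by (simp add: norm_mult)
  qed
  have n': "norm (cscale c a + cscale d b - (cscale c a' + cscale d b')) \<le> norm c * norm (a - a') + norm d * norm (b - b')" for a b a' b' :: "'a cvec"
  proof -
    interpret C: bounded_linear "cscale c" by (rule bounded_linear_cscale)
    interpret Dd: bounded_linear "cscale d" by (rule bounded_linear_cscale)
    have "cscale c a + cscale d b - (cscale c a' + cscale d b') = cscale c (a - a') + cscale d (b - b')"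
      by (simp add: C.diff Dd.diff)
    then show ?thesis using norm_triangle_ineq[of "cscale c (a - a')" "cscale d (b - b')"] by (simp add: norm_cscale)
  qed
  have Sm: "(\<lambda>y. nsq (p y - q y) * indicator (ball 0 r) y) \<in> borel_measurable S"
    if [measurable]: "p \<in> borel_measurable borel" "q \<in> borel_measurable borel" for p q :: "'a pt \<Rightarrow> complex" and r
  proof -
    have [measurable]: "ball (0::'a pt) r \<in> sets borel" by simp
    show ?thesis unfolding measurable_cong_sets[OF S refl] by measurable
  qed
  show ?thesis
    unfolding has_trace_def
  proof (intro conjI exI allI)
    show "(\<lambda>y. c * g1 y + d * g2 y) \<in> borel_measurable S"
      unfolding measurable_cong_sets[OF S refl] by measurable
    show "H1loc D (\<lambda>y. c * v1 y + d * v2 y) (\<lambda>y. cscale c (G1 y) + cscale d (G2 y))"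
      by (rule H1loc_lin[OF D 1(1) 2(1)])
    show "smooth (\<lambda>y. c * p1 k y + d * p2 k y)" for k by (rule smooth_lin[OF 1(2) 2(2)])
    fix r
    show "l2conv D r (\<lambda>k. (\<lambda>y. c * p1 k y + d * p2 k y)) (\<lambda>y. c * v1 y + d * v2 y)"
      by (rule sq_dom_tendsto[OF m[OF smooth_measurable[OF 1(2)] L(1)] m[OF smooth_measurable[OF 2(2)] L(2)] 1(3) 2(3) n])
    show "l2conv D r (\<lambda>k. (\<lambda>y. classical_gradient (\<lambda>y. c * p1 k y + d * p2 k y) y)) (\<lambda>y. cscale c (G1 y) + cscale d (G2 y))"
      unfolding classical_gradient_lin[OF 1(2) 2(2)]
      by (rule sq_dom_tendsto[OF m[OF classical_gradient_measurable[OF 1(2)] L(3)] m[OF classical_gradient_measurable[OF 2(2)] L(4)] 1(4) 2(4) n'])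
    show "(\<lambda>k. \<integral>\<^sup>+y\<in>ball 0 r. nsq (c * p1 k y + d * p2 k y - (c * g1 y + d * g2 y)) \<partial>S) \<longlonglongrightarrow> 0"
      by (rule sq_dom_tendsto[OF Sm[OF smooth_measurable[OF 1(2)] g(1)] Sm[OF smooth_measurable[OF 2(2)] g(2)] 1(5) 2(5) n])
  qed
qed

text \<open>A diagonal sequence: for each \<open>j\<close> a smooth function is chosen within
  \<open>1/(j + 1)\<close> of \<open>vs j\<close> on the ball of radius \<open>j\<close>, in value,
  in gradient and on the surface. The balls grow, so every fixed ball is eventually covered.\<close>

lemma has_trace_limit:
  assumes D: "open D" and S: "sets S = sets borel"
    and t: "\<And>j. has_trace D S (vs j) (\<lambda>y. 0)" and H: "\<And>j. H1loc D (vs j) (Gs j)" "H1loc D v G"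
    and lim: "\<And>r. l2conv D r vs v"
    "\<And>r. l2conv D r Gs G"
  shows "has_trace D S v (\<lambda>y. 0)"
proof -
  have Db: "D \<in> sets borel" using D by simp
  let ?a = "\<lambda>p (j::nat). \<integral>\<^sup>+y\<in>D \<inter> ball 0 (real j). nsq (p y - vs j y) \<partial>lborel"
  let ?b = "\<lambda>p (j::nat). \<integral>\<^sup>+y\<in>D \<inter> ball 0 (real j). nsq (classical_gradient p y - Gs j y) \<partial>lborel"
  let ?c = "\<lambda>p (j::nat). \<integral>\<^sup>+y\<in>ball 0 (real j). nsq (p y) \<partial>S"
  let ?e = "\<lambda>j::nat. ennreal (1 / (real j + 1))"
  have "\<exists>p. smooth p \<and> ?a p j < ?e j \<and> ?b p j < ?e j \<and> ?c p j < ?e j" for j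
  proof -
    obtain G' p where p: "H1loc D (vs j) G'" "\<And>k::nat. smooth (p k)"
      "\<And>r. l2conv D r p (vs j)"
      "\<And>r. l2conv D r (\<lambda>k. classical_gradient (p k)) G'"
      "\<And>r. (\<lambda>k. \<integral>\<^sup>+y\<in>ball 0 r. nsq (p k y - 0) \<partial>S) \<longlonglongrightarrow> 0"
      using t[of j] unfolding has_trace_def by blast
    \<comment> \<open>The trace of \<open>vs j\<close> comes with a weak gradient of its own, which
      uniqueness replaces by \<open>Gs j\<close>.\<close>
    have b: "(LIS (D \<inter> ball 0 (real j)) (\<lambda>y. nsq (classical_gradient (p k) y - G' y))) = ?b (p k) j" for k
      using weak_gradient_unique[OF D p(1) H(1)[of j]]
      by (intro nn_integral_cong_AE, elim eventually_mono) (auto simp: indicator_def)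
    have e: "0 < ?e j" by simp
    have "\<forall>\<^sub>F k in sequentially. ?a (p k) j < ?e j \<and> ?b (p k) j < ?e j \<and> ?c (p k) j < ?e j"
      using order_tendstoD(2)[OF p(3)[of "real j"] e] order_tendstoD(2)[OF p(4)[of "real j", unfolded b] e]
        order_tendstoD(2)[OF p(5)[of "real j"] e] by eventually_elim simp
    then show ?thesis using p(2) eventually_happens'[OF sequentially_bot] by blast
  qed
  then have "\<exists>p. \<forall>j. smooth (p j) \<and> ?a (p j) j < ?e j \<and> ?b (p j) j < ?e j \<and> ?c (p j) j < ?e j"
    by (intro choice allI)
  then obtain p where p: "\<And>j. smooth (p j)" "\<And>j. ?a (p j) j < ?e j" "\<And>j. ?b (p j) j < ?e j" "\<And>j. ?c (p j) j < ?e j"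
    by blast
  have e0: "?e \<longlonglongrightarrow> 0"
  proof -
    have "(\<lambda>j. 1 / (real j + 1)) \<longlonglongrightarrow> 0" using LIMSEQ_inverse_real_of_nat by (simp add: inverse_eq_divide add.commute)
    from tendsto_ennrealI[OF this] show ?thesis by simp
  qed
  have small: "(\<lambda>j. \<integral>\<^sup>+y\<in>A \<inter> ball 0 r. f j y \<partial>M) \<longlonglongrightarrow> 0"
    if "\<And>j. (\<integral>\<^sup>+y\<in>A \<inter> ball 0 (real j). f j y \<partial>M) < ?e j" for A r and f :: "nat \<Rightarrow> 'a pt \<Rightarrow> ennreal" and M
  proof (rule tendsto_sandwich[OF _ _ tendsto_const e0])
    obtain N :: nat where N: "r \<le> real N" using real_arch_simple by blast
    show "\<forall>\<^sub>F j in sequentially. (\<integral>\<^sup>+y\<in>A \<inter> ball 0 r. f j y \<partial>M) \<le> ?e j"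
      using eventually_ge_at_top[of N]
    proof eventually_elim
      fix j assume "N \<le> j"
      then have "(\<integral>\<^sup>+y\<in>A \<inter> ball 0 r. f j y \<partial>M) \<le> (\<integral>\<^sup>+y\<in>A \<inter> ball 0 (real j). f j y \<partial>M)"
        using N by (intro nn_integral_mono) (auto simp: indicator_def)
      then show "(\<integral>\<^sup>+y\<in>A \<inter> ball 0 r. f j y \<partial>M) \<le> ?e j" using that[of j] by simp
    qed
  qed simp
  have L: "L2loc D (vs j)" "L2loc D (Gs j)" "L2loc D v" "L2loc D G" for j
    using H(1)[of j] H(2) by (auto simp: H1loc_def)
  have m: "(\<lambda>y. nsq (f y - v y) * indicator (D \<inter> ball 0 r) y) \<in> borel_measurable lborel"
    if "f \<in> borel_measurable borel" "L2loc D v" for f v :: "'a pt \<Rightarrow> 'b::euclidean_space" and r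
    using sq_diff_measurable[OF that, of "D \<inter> ball 0 r"] Db by simp
  have m2: "(\<lambda>y. nsq (w y - v y) * indicator (D \<inter> ball 0 r) y) \<in> borel_measurable lborel"
    if "L2loc D w" "L2loc D v" for w v :: "'a pt \<Rightarrow> 'b::euclidean_space" and r
    using L2loc_norm_measurable[OF L2loc_diff[OF Db that], of "D \<inter> ball 0 r"] Db by simp
  have n: "norm (a - c) \<le> 1 * norm (a - b) + 1 * norm (b - c)" for a b c :: "'b::real_normed_vector"
    using norm_triangle_ineq[of "a - b" "b - c"] by simp
  show ?thesis unfolding has_trace_def
  proof (intro conjI exI allI)
    show "H1loc D v G" by fact
    show "smooth (p j)" for j by (rule p)
    fix r
    show "l2conv D r p v"
      by (rule sq_dom_tendsto[OF m[OF smooth_measurable[OF p(1)] L(1)] m2[OF L(1,3)] small[OF p(2)] lim(1) n])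
    show "l2conv D r (\<lambda>k. classical_gradient (p k)) G"
      by (rule sq_dom_tendsto[OF m[OF classical_gradient_measurable[OF p(1)] L(2)] m2[OF L(2,4)] small[OF p(3)] lim(2) n])
    show "(\<lambda>k. \<integral>\<^sup>+y\<in>ball 0 r. nsq (p k y - 0) \<partial>S) \<longlonglongrightarrow> 0"
    proof -
      have "(\<lambda>k. \<integral>\<^sup>+y\<in>UNIV \<inter> ball 0 r. nsq (p k y) \<partial>S) \<longlonglongrightarrow> 0"
        by (rule small) (use p(4) in simp)
      then show ?thesis by simp
    qed
  qed simp
qed

subsection \<open>Particle configurations\<close>

text \<open>Set distances become inequalities between centres. Passing to closures leaves
  \<open>setdist\<close> unchanged, so two centres at distance at most \<open>2\<close> would have
  their midpoint in both closed balls, against \<open>\<delta> > 0\<close>.\<close>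

lemma configs_enum:
  assumes "\<omega> \<in> configs h \<delta>" "0 < \<delta>"
  obtains x :: "nat \<Rightarrow> 'n::finite pt" where "\<omega> = range x" "\<And>k n. k \<noteq> n \<Longrightarrow> 2 < dist (x k) (x n)"
    "\<And>n. 1 + \<delta> \<le> snd (x n)" "\<And>n. snd (x n) \<le> h - 1"
proof -
  obtain x :: "nat \<Rightarrow> 'n pt" where x: "\<omega> = range x" "\<And>n. ball (x n) 1 \<subseteq> UNIV \<times> {0<..<h}"
    "\<And>n. \<delta> \<le> setdist (ball (x n) 1) (plane 0)"
    "\<And>k n. k \<noteq> n \<Longrightarrow> \<delta> \<le> setdist (ball (x k) 1) (ball (x n) 1)"
    using assms(1) unfolding configs_def by blast
  have 1: "2 < dist (x k) (x n)" if "k \<noteq> n" for k n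
  proof (rule ccontr)
    assume *: "\<not> 2 < dist (x k) (x n)"
    let ?m = "midpoint (x k) (x n)"
    have "setdist (cball (x k) 1) (cball (x n) 1) \<le> dist ?m ?m"
      using * by (intro setdist_le_dist) (auto simp: dist_midpoint dist_commute)
    moreover have "setdist (cball (x k) 1) (cball (x n) 1) = setdist (ball (x k) 1) (ball (x n) 1)"
      by (metis closure_ball setdist_closure_1 setdist_closure_2 zero_less_one)
    ultimately show False using x(4)[OF that] assms(2) by simp
  qed
  have 2: "snd y \<le> h \<and> 0 \<le> snd y" if "y \<in> cball (x n) 1" for y n
  proof -
    have "ball (x n) 1 \<subseteq> {y. 0 \<le> snd y} \<inter> {y. snd y \<le> h}" using x(2)[of n] by auto
    moreover have "closed ({y :: 'n pt. 0 \<le> snd y} \<inter> {y. snd y \<le> h})"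
      by (intro closed_Int closed_Collect_le continuous_intros)
    ultimately have "closure (ball (x n) 1) \<subseteq> {y. 0 \<le> snd y} \<inter> {y. snd y \<le> h}" by (rule closure_minimal)
    then show ?thesis using that by auto
  qed
  have d: "dist (x n) (x n + (0, t)) = \<bar>t\<bar>" for t n
    by (simp add: dist_norm norm_Pair)
  have 3: "snd (x n) \<le> h - 1" for n
    using 2[of "x n + (0, 1)" n] d[of n 1] by simp
  have 4: "1 + \<delta> \<le> snd (x n)" for n
  proof -
    \<comment> \<open>The lowest point of the closed ball and its foot on the plane at height
      \<open>0\<close>: their distance is the height of that point.\<close>
    let ?y = "x n + (0, -1)"
    have y: "?y \<in> cball (x n) 1" using d[of n "-1"] by simp
    have p: "(fst (x n), 0) \<in> plane 0" by (simp add: plane_def)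
    have "\<delta> \<le> setdist (cball (x n) 1) (plane 0)"
      using x(3)[of n] by (metis closure_ball setdist_closure_1 zero_less_one)
    also have "\<dots> \<le> dist ?y (fst (x n), 0)" by (rule setdist_le_dist[OF y p])
    also have "\<dots> = \<bar>snd (x n) - 1\<bar>" by (simp add: dist_norm norm_prod_def fst_diff)
    finally show ?thesis using 2[OF y] by simp
  qed
  show ?thesis by (rule that[OF x(1) 1 4 3])
qed

context
  fixes \<omega> :: "'n::finite pt set" and h \<delta> :: real
  assumes \<omega>: "\<omega> \<in> configs h \<delta>" and \<delta>: "0 < \<delta>"
begin

lemma config_nonempty: "\<omega> \<noteq> {}" and config_countable: "countable \<omega>"
  using configs_enum[OF \<omega> \<delta>] by (metis empty_not_UNIV image_is_empty, metis countable_image countableI_type)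

lemma config_dist: "c \<in> \<omega> \<Longrightarrow> c' \<in> \<omega> \<Longrightarrow> c \<noteq> c' \<Longrightarrow> 2 < dist c c'"
  using configs_enum[OF \<omega> \<delta>] by (metis rangeE)

lemma config_height: "c \<in> \<omega> \<Longrightarrow> 1 + \<delta> \<le> snd c" "c \<in> \<omega> \<Longrightarrow> snd c \<le> h - 1"
  using configs_enum[OF \<omega> \<delta>] by (metis rangeE)+

lemma config_closed: "closed \<omega>"
  by (rule discrete_imp_closed[of 2]) (use config_dist in force)+

text \<open>Two centres close to an accumulation point would be at distance less than
  \<open>2\<close> from each other.\<close>

lemma config_locally_finite:
  assumes "bounded B" shows "finite (\<omega> \<inter> B)"
proof (rule ccontr)
  assume inf: "infinite (\<omega> \<inter> B)"
  have "compact (closure B)" using assms by (simp add: compact_closure)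
  then obtain l where l: "l islimpt (\<omega> \<inter> B)"
    using inf closure_subset[of B] Heine_Borel_imp_Bolzano_Weierstrass[of "closure B" "\<omega> \<inter> B"] by blast
  obtain c where c: "c \<in> \<omega>" "c \<noteq> l" "dist c l < 1" using l unfolding islimpt_approachable by (meson IntD1 zero_less_one)
  obtain c' where c': "c' \<in> \<omega>" "c' \<noteq> l" "dist c' l < dist c l" using l c unfolding islimpt_approachable by (metis IntD1 zero_less_dist_iff)
  have "dist c c' < 2" using c(3) c'(3) dist_triangle2[of c c' l] by simp
  then show False using config_dist[OF c(1) c'(1)] c'(3) by force
qed

lemma infdist_less_iff: "infdist y \<omega> < r \<longleftrightarrow> \<omega> \<inter> ball y r \<noteq> {}"
proof
  assume "infdist y \<omega> < r"
  obtain c where "c \<in> \<omega>" "infdist y \<omega> = dist y c" using infdist_attains_inf[OF config_closed config_nonempty] by metis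
  then show "\<omega> \<inter> ball y r \<noteq> {}" using \<open>infdist y \<omega> < r\<close> by auto
next
  assume "\<omega> \<inter> ball y r \<noteq> {}"
  then obtain c where "c \<in> \<omega>" "dist y c < r" by auto
  then show "infdist y \<omega> < r" using infdist_le[of c \<omega> y] by simp
qed

lemma infdist_less_card: "infdist y \<omega> < r \<longleftrightarrow> card (\<omega> \<inter> ball y r) \<noteq> 0"
  using infdist_less_iff config_locally_finite[of "ball y r"] by simp

text \<open>The nearest centre is attained, so the closure of the union of the open balls is the set
  at distance at most \<open>1\<close> from the configuration. The domain is thereby described
  through the single function \<open>infdist\<close>, which gives both its openness and its
  measurability.\<close>

lemma fluid_dom_eq: "fluid_dom \<omega> = {y. 0 < snd y \<and> 1 < infdist y \<omega>}"
proof -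
  have "closure (particles \<omega>) = {y. infdist y \<omega> \<le> 1}"
  proof
    have "closed {y. infdist y \<omega> \<le> 1}" by (intro closed_Collect_le continuous_intros)
    moreover have "particles \<omega> \<subseteq> {y. infdist y \<omega> \<le> 1}"
    proof
      fix y assume "y \<in> particles \<omega>"
      then obtain c where "c \<in> \<omega>" "dist y c < 1" by (auto simp: particles_def dist_commute)
      then show "y \<in> {y. infdist y \<omega> \<le> 1}" using infdist_le[of c \<omega> y] by simp
    qed
    ultimately show "closure (particles \<omega>) \<subseteq> {y. infdist y \<omega> \<le> 1}" by (intro closure_minimal)
    show "{y. infdist y \<omega> \<le> 1} \<subseteq> closure (particles \<omega>)"
    proof clarify
      fix y assume y: "infdist y \<omega> \<le> 1"
      obtain c where c: "c \<in> \<omega>" "infdist y \<omega> = dist y c" using infdist_attains_inf[OF config_closed config_nonempty] by metis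
      then have "y \<in> closure (ball c 1)" using y by (simp add: dist_commute)
      moreover have "ball c 1 \<subseteq> particles \<omega>" using c by (auto simp: particles_def)
      ultimately show "y \<in> closure (particles \<omega>)" using closure_mono by blast
    qed
  qed
  then show ?thesis unfolding fluid_dom_def by (simp add: set_eq_iff mem_Times_iff not_le)
qed

lemma fluid_dom_open: "open (fluid_dom \<omega>)"
  unfolding fluid_dom_eq by (intro open_Collect_conj open_Collect_less continuous_intros)

lemma fluid_dom_borel: "fluid_dom \<omega> \<in> sets borel"
  using fluid_dom_open by simp

lemma snd_dist_le: "\<bar>snd y - snd c\<bar> \<le> dist y (c :: 'n pt)"
  by (metis dist_norm norm_snd_le prod.collapse real_norm_def snd_diff)

text \<open>Centres lie between the heights \<open>1 + \<delta>\<close> and \<open>h - 1\<close>, so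
  the vertical distance alone exceeds \<open>1\<close> below \<open>\<delta>\<close> and above
  \<open>h\<close>. The strips used for traces lie in these two regions.\<close>

lemma infdist_gt:
  assumes "snd y < \<delta> \<or> h < snd y" shows "1 < infdist y \<omega>"
proof -
  obtain c where c: "c \<in> \<omega>" "infdist y \<omega> = dist y c" using infdist_attains_inf[OF config_closed config_nonempty] by metis
  then show ?thesis using snd_dist_le[of y c] config_height[OF c(1)] assms by auto
qed

lemma infdist_ge1: "h \<le> snd y \<Longrightarrow> 1 \<le> infdist y \<omega>"
proof -
  assume y: "h \<le> snd y"
  obtain c where c: "c \<in> \<omega>" "infdist y \<omega> = dist y c" using infdist_attains_inf[OF config_closed config_nonempty] by metis
  then show ?thesis using snd_dist_le[of y c] config_height[OF c(1)] y by auto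
qed

lemma height_pos: "1 + \<delta> \<le> h - 1"
  using config_nonempty config_height by (meson ex_in_conv order_trans)

lemma strip_in_fluid_dom: "0 < snd y \<Longrightarrow> snd y < \<delta> \<or> h < snd y \<Longrightarrow> y \<in> fluid_dom \<omega>"
  using infdist_gt[of y] by (simp add: fluid_dom_eq)

lemma nearest_centre: obtains c where "c \<in> \<omega>" "infdist y \<omega> = dist y c"
  using infdist_attains_inf[OF config_closed config_nonempty] by metis

lemma infdist_lip: "infdist y \<omega> \<le> infdist y' \<omega> + dist y y'"
  using infdist_triangle by blast

end

section \<open>Shifts of configurations\<close>

lemma infdist_shift: "infdist y (shift z \<omega>) = infdist (y + (z, 0)) \<omega>"
proof -
  have "dist y (x - (z, 0)) = dist (y + (z, 0)) x" for x :: "'a pt"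
    by (simp add: dist_norm algebra_simps)
  then show ?thesis unfolding infdist_def shift_def by (auto simp: image_image)
qed

lemma nearest_dist_shift: "nearest_dist (shift z \<omega>) y = nearest_dist \<omega> (y + (z, 0))"
  by (simp add: nearest_dist_def infdist_shift)

lemma weight_shift: "weight h m (shift z \<omega>) y = weight h m \<omega> (y + (z, 0))"
  by (simp add: weight_def nearest_dist_shift)

lemma shift_inter: "card (shift z \<omega> \<inter> B) = card (\<omega> \<inter> {y. y - (z, 0) \<in> B})"
proof -
  have "shift z \<omega> \<inter> B = (\<lambda>x. x - (z, 0)) ` (\<omega> \<inter> {y. y - (z, 0) \<in> B})" by (auto simp: shift_def)
  then show ?thesis by (simp add: card_image)
qed

lemma shift_configs: "\<omega> \<in> configs h \<delta> \<Longrightarrow> shift z \<omega> \<in> configs h \<delta>"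
proof -
  assume "\<omega> \<in> configs h \<delta>"
  then obtain x where x: "\<omega> = range x" "\<And>n::nat. ball (x n) 1 \<subseteq> UNIV \<times> {0<..<h}"
    "\<And>n. \<delta> \<le> setdist (ball (x n) 1) (plane 0)"
    "\<And>k n. k \<noteq> n \<Longrightarrow> \<delta> \<le> setdist (ball (x k) 1) (ball (x n) 1)"
    unfolding configs_def by blast
  have b: "ball (a - (z, 0)) 1 = (+) (- (z, 0)) ` ball a 1" for a :: "'a pt"
    by (metis ball_translation uminus_add_conv_diff)
  have p: "plane 0 = (+) (- (z, 0)) ` (plane 0 :: 'a pt set)"
    by (auto simp: plane_def image_iff intro!: exI[of _ "_ + z"])
  have st: "setdist ((+) a ` S) ((+) a ` T) = setdist S T" for a :: "'a pt" and S T
  proof -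
    have "{dist x y |x y. x \<in> (+) a ` S \<and> y \<in> (+) a ` T} = {dist (a + x) (a + y) |x y. x \<in> S \<and> y \<in> T}" by blast
    also have "\<dots> = {dist x y |x y. x \<in> S \<and> y \<in> T}" by (simp only: dist_add_cancel)
    finally show ?thesis unfolding setdist_def by (simp only: image_is_empty)
  qed
  show ?thesis unfolding configs_def
  proof (intro CollectI exI[of _ "\<lambda>n. x n - (z, 0)"] conjI allI impI)
    show "shift z \<omega> = range (\<lambda>n. x n - (z, 0))" by (auto simp: shift_def x(1))
    show "ball (x n - (z, 0)) 1 \<subseteq> UNIV \<times> {0<..<h}" for n
    proof
      fix y assume "y \<in> ball (x n - (z, 0)) 1"
      then have "y + (z, 0) \<in> ball (x n) 1" by (simp add: dist_norm algebra_simps)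
      then have "y + (z, 0) \<in> UNIV \<times> {0<..<h}" using x(2) by blast
      then show "y \<in> UNIV \<times> {0<..<h}" by (cases y) auto
    qed
    show "\<delta> \<le> setdist (ball (x n - (z, 0)) 1) (plane 0)" for n
      using x(3)[of n] by (subst p, simp only: b st)
    show "\<delta> \<le> setdist (ball (x k - (z, 0)) 1) (ball (x n - (z, 0)) 1)" if "k \<noteq> n" for k n
      using x(4)[OF that] by (simp only: b st)
  qed
qed

lemma shift_fluid_dom:
  assumes "\<omega> \<in> configs h \<delta>" "0 < \<delta>"
  shows "fluid_dom (shift z \<omega>) = {y. y + (z, 0) \<in> fluid_dom \<omega>}"
  unfolding fluid_dom_eq[OF assms] fluid_dom_eq[OF shift_configs[OF assms(1)] assms(2)] by (simp add: infdist_shift)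

section \<open>Measurability in the configuration\<close>

context
  fixes P :: "'n::finite pt set measure" and h \<delta> :: real
  assumes sets_P: "sets P = sets (config_space h \<delta>)" and \<delta>: "0 < \<delta>"
begin

lemma space_P: "space P = configs h \<delta>"
  using sets_eq_imp_space_eq[OF sets_P] unfolding config_space_def by (simp add: space_measure_of_conv)

lemma config_event: "B \<in> sets borel \<Longrightarrow> bounded B \<Longrightarrow> {\<omega> \<in> space P. card (\<omega> \<inter> B) = k} \<in> sets P"
  unfolding sets_P space_P config_space_def
  by (subst sets_measure_of) (auto intro!: sigma_sets.Basic)

text \<open>The preimage of a counting event under \<open>shift z\<close> is the counting event of
  the translated set, so generators pull back to generators.\<close>

lemma measurable_shift: "shift z \<in> measurable P P"
proof -
  have "shift z \<in> measurable P (config_space h \<delta>)"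
    unfolding config_space_def
  proof (rule measurable_measure_of)
    show "shift z \<in> space P \<rightarrow> configs h \<delta>" using shift_configs by (auto simp: space_P)
    fix A :: "'n pt set set"
    assume "A \<in> {{\<omega> \<in> configs h \<delta>. card (\<omega> \<inter> B) = k} | B k. B \<in> sets borel \<and> bounded B}"
    then obtain B k where A: "A = {\<omega> \<in> configs h \<delta>. card (\<omega> \<inter> B) = k}" and B: "B \<in> sets borel" "bounded B" by blast
    let ?B = "{y. y - (z, 0) \<in> B}"
    have "?B = (+) (z, 0) ` B" by (force simp: image_iff intro: bexI[of _ "_ - (z, 0)"])
    then have "bounded ?B" using B(2) bounded_translation by metis
    moreover have "?B \<in> sets borel"
      using measurable_sets[of "\<lambda>y. y - (z, 0)" borel borel B] B(1) by (simp add: vimage_def)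
    ultimately have "{\<omega> \<in> space P. card (\<omega> \<inter> ?B) = k} \<in> sets P" by (intro config_event)
    moreover have "shift z -` A \<inter> space P = {\<omega> \<in> space P. card (\<omega> \<inter> ?B) = k}"
      using shift_configs unfolding A by (auto simp: shift_inter space_P)
    ultimately show "shift z -` A \<inter> space P \<in> sets P" by simp
  qed auto
  then show ?thesis by (simp add: measurable_cong_sets[OF refl sets_P])
qed

text \<open>A centre lies closer to \<open>y\<close> than \<open>r\<close> if and only if the count
  in the ball of radius \<open>r\<close> is nonzero, which is an event of the cylindrical
  sigma-algebra.\<close>

lemma measurable_infdist_point: "(\<lambda>\<omega>. infdist y \<omega>) \<in> borel_measurable P"
proof (rule borel_measurableI_less)
  fix r
  have "{\<omega> \<in> space P. infdist y \<omega> < r} = space P - {\<omega> \<in> space P. card (\<omega> \<inter> ball y r) = 0}"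
    using infdist_less_card[OF _ \<delta>, of _ h y r] by (auto simp: space_P)
  then show "{\<omega> \<in> space P. infdist y \<omega> < r} \<in> sets P"
    using config_event[of "ball y r" 0] by auto
qed

text \<open>\<open>infdist\<close> is \<open>1\<close>-Lipschitz in the point, so it equals the
  infimum of \<open>infdist q \<omega> + dist q y\<close> over a countable dense set of
  \<open>q\<close>, and each of these terms is jointly measurable.\<close>

lemma measurable_infdist[measurable]: "(\<lambda>(\<omega>, y). infdist y \<omega>) \<in> borel_measurable (P \<Otimes>\<^sub>M borel)"
proof -
  obtain Q :: "'n pt set" where Q: "countable Q" "\<And>X. open X \<Longrightarrow> X \<noteq> {} \<Longrightarrow> \<exists>d\<in>Q. d \<in> X"
    using countable_dense_setE by blast
  have Q0: "Q \<noteq> {}" using Q(2)[of UNIV] by auto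
  have bd: "bdd_below ((\<lambda>q. infdist q \<omega> + dist q y) ` Q)" for \<omega> y
    by (intro bdd_belowI2[of _ 0]) (simp add: infdist_nonneg)
  have eq: "infdist y \<omega> = (INF q\<in>Q. infdist q \<omega> + dist q y)" for \<omega> and y :: "'n pt"
  proof (rule antisym)
    show "infdist y \<omega> \<le> (INF q\<in>Q. infdist q \<omega> + dist q y)"
      by (rule cINF_greatest[OF Q0]) (metis dist_commute infdist_triangle)
    show "(INF q\<in>Q. infdist q \<omega> + dist q y) \<le> infdist y \<omega>"
    proof (rule field_le_epsilon)
      fix e :: real assume e: "0 < e"
      then obtain q where q: "q \<in> Q" "q \<in> ball y (e/2)" using Q(2)[of "ball y (e/2)"] by auto
      have "(INF q\<in>Q. infdist q \<omega> + dist q y) \<le> infdist q \<omega> + dist q y" by (rule cINF_lower[OF bd q(1)])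
      also have "\<dots> \<le> infdist y \<omega> + e"
        using infdist_triangle[of q \<omega> y] q(2) by (simp add: dist_commute)
      finally show "(INF q\<in>Q. infdist q \<omega> + dist q y) \<le> infdist y \<omega> + e" .
    qed
  qed
  have "(\<lambda>(\<omega>, y). infdist y \<omega>) = (\<lambda>p. INF q\<in>Q. infdist q (fst p) + dist q (snd p))"
    by (intro ext, subst case_prod_unfold, rule eq)
  also have "\<dots> \<in> borel_measurable (P \<Otimes>\<^sub>M borel)"
  proof (rule borel_measurable_cINF[OF Q(1)])
    fix q
    have [measurable]: "(\<lambda>p. infdist q (fst p)) \<in> borel_measurable (P \<Otimes>\<^sub>M (borel :: 'n pt measure))"
      using measurable_compose[OF measurable_fst measurable_infdist_point] .
    have [measurable]: "(\<lambda>p. dist q (snd p)) \<in> borel_measurable (P \<Otimes>\<^sub>M (borel :: 'n pt measure))"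
      by (rule measurable_compose[OF measurable_snd]) measurable
    show "(\<lambda>p. infdist q (fst p) + dist q (snd p)) \<in> borel_measurable (P \<Otimes>\<^sub>M (borel :: 'n pt measure))" by measurable
  qed (rule bd)
  finally show ?thesis .
qed

lemma measurable_fluid_dom: "{p \<in> space (P \<Otimes>\<^sub>M borel). snd p \<in> fluid_dom (fst p)} \<in> sets (P \<Otimes>\<^sub>M borel)"
proof -
  have [measurable]: "(\<lambda>p. infdist (snd p) (fst p)) \<in> borel_measurable (P \<Otimes>\<^sub>M (borel :: 'n pt measure))"
    using measurable_infdist by (simp add: case_prod_unfold)
  have [measurable]: "(\<lambda>p. snd (snd p)) \<in> borel_measurable (P \<Otimes>\<^sub>M (borel :: 'n pt measure))"
    by (rule measurable_compose[OF measurable_snd]) (intro borel_measurable_continuous_onI continuous_intros)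
  have "{p \<in> space (P \<Otimes>\<^sub>M borel). 0 < snd (snd p) \<and> 1 < infdist (snd p) (fst p)} \<in> sets (P \<Otimes>\<^sub>M (borel :: 'n pt measure))"
    by measurable
  also have "{p \<in> space (P \<Otimes>\<^sub>M borel). 0 < snd (snd p) \<and> 1 < infdist (snd p) (fst p)} =
      {p \<in> space (P \<Otimes>\<^sub>M borel). snd p \<in> fluid_dom (fst p)}"
    by (auto simp: space_pair_measure space_P fluid_dom_eq[OF _ \<delta>, of _ h])
  finally show ?thesis .
qed

lemma measurable_weight: "(\<lambda>(\<omega>, y). weight h' m \<omega> y) \<in> borel_measurable (P \<Otimes>\<^sub>M borel)"
proof -
  have [measurable]: "(\<lambda>p. infdist (snd p) (fst p)) \<in> borel_measurable (P \<Otimes>\<^sub>M (borel :: 'n pt measure))"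
    using measurable_infdist by (simp add: case_prod_unfold)
  have [measurable]: "(\<lambda>p. snd (snd p)) \<in> borel_measurable (P \<Otimes>\<^sub>M (borel :: 'n pt measure))"
    by (rule measurable_compose[OF measurable_snd]) (intro borel_measurable_continuous_onI continuous_intros)
  have "(\<lambda>p. (fst p, (fst (snd p), h'))) \<in> (P \<Otimes>\<^sub>M borel) \<rightarrow>\<^sub>M P \<Otimes>\<^sub>M (borel :: 'n pt measure)"
    by (intro measurable_Pair measurable_fst measurable_compose[OF measurable_snd] borel_measurable_continuous_onI continuous_intros)
  from measurable_compose[OF this measurable_infdist]
  have [measurable]: "(\<lambda>p. infdist (fst (snd p), h') (fst p)) \<in> borel_measurable (P \<Otimes>\<^sub>M (borel :: 'n pt measure))" by simp
  show ?thesis unfolding weight_def nearest_dist_def case_prod_unfold by measurable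
qed

end

section \<open>Smooth functions along lines, and dilations\<close>

lemma norm_diff_le_line_integral:
  fixes g g' :: "real \<Rightarrow> complex"
  assumes "a \<le> b" and g: "\<And>s. (g has_vector_derivative g' s) (at s)" and c: "continuous_on UNIV g'"
  shows "ennreal (norm (g b - g a)) \<le> (LI s. ennreal (norm (g' s)) * indicator {a<..<b} s)"
proof -
  have hb: "has_bochner_integral lborel (\<lambda>x. indicator {a..b} x *\<^sub>R g' x) (g b - g a)"
    using assms by (intro has_bochner_integral_FTC_Icc) (auto intro: has_vector_derivative_at_within continuous_on_subset)
  have "ennreal (norm (g b - g a)) \<le> (LI s. ennreal (norm (indicator {a..b} s *\<^sub>R g' s)))"
    using hb by (metis has_bochner_integral_iff integral_norm_bound_ennreal)
  also have "\<dots> = (LI s. ennreal (norm (g' s)) * indicator {a<..<b} s)"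
  proof (rule nn_integral_cong_AE)
    have "AE s in lborel. s \<noteq> a \<and> s \<noteq> b" using AE_lborel_singleton[of a] AE_lborel_singleton[of b] by eventually_elim simp
    then show "AE s in lborel. ennreal (norm (indicator {a..b} s *\<^sub>R g' s)) = ennreal (norm (g' s)) * indicator {a<..<b} s"
      by eventually_elim (auto simp: indicator_def)
  qed
  finally show ?thesis .
qed

lemma smooth_line:
  fixes \<phi> :: "'a::euclidean_space \<Rightarrow> complex"
  assumes "smooth \<phi>"
  shows "((\<lambda>s. \<phi> (p + s *\<^sub>R u)) has_vector_derivative frechet_derivative \<phi> (at (p + s *\<^sub>R u)) u) (at s)"
    and "continuous_on UNIV (\<lambda>s. frechet_derivative \<phi> (at (p + s *\<^sub>R u)) u)"
proof -
  have "((\<lambda>s. p + s *\<^sub>R u) has_vector_derivative u) (at s)" by (auto intro!: derivative_eq_intros)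
  then show "((\<lambda>s. \<phi> (p + s *\<^sub>R u)) has_vector_derivative frechet_derivative \<phi> (at (p + s *\<^sub>R u)) u) (at s)"
    using vector_derivative_diff_chain_within[of "\<lambda>s. p + s *\<^sub>R u" u s UNIV \<phi> "frechet_derivative \<phi> (at (p + s *\<^sub>R u))"]
      has_derivative_at_withinI[OF smooth_has_derivative[OF assms]] by (simp add: o_def)
  show "continuous_on UNIV (\<lambda>s. frechet_derivative \<phi> (at (p + s *\<^sub>R u)) u)"
    by (rule continuous_on_compose2[OF smooth_continuous_derivative[OF assms]]) (auto intro!: continuous_intros)
qed

text \<open>Cauchy-Schwarz over the coordinates: the derivative in the real direction
  \<open>u\<close> is a real combination of complex partial derivatives, and the norm of these is
  that of \<open>classical_gradient\<close>.\<close>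

lemma norm_derivative_le:
  fixes \<phi> :: "'n::finite pt \<Rightarrow> complex"
  assumes "smooth \<phi>"
  shows "norm (frechet_derivative \<phi> (at z) u) \<le> norm (classical_gradient \<phi> z) * norm u"
proof -
  let ?f = "frechet_derivative \<phi> (at z)"
  interpret linear ?f using smooth_has_derivative[OF assms] has_derivative_linear by blast
  have "u = (\<Sum>i\<in>UNIV. (fst u $ i) *\<^sub>R (axis i 1, 0)) + snd u *\<^sub>R (0, 1)"
  proof (rule prod_eqI)
    show "fst u = fst ((\<Sum>i\<in>UNIV. (fst u $ i) *\<^sub>R (axis i 1, 0)) + snd u *\<^sub>R (0, 1))"
      by (simp add: fst_sum vec_eq_iff axis_def sum.delta if_distrib cong: if_cong)
    show "snd u = snd ((\<Sum>i\<in>UNIV. (fst u $ i) *\<^sub>R (axis i 1, 0)) + snd u *\<^sub>R (0, 1))"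
      by (simp add: snd_sum)
  qed
  then have "?f u = (\<Sum>i\<in>UNIV. (fst u $ i) *\<^sub>R ?f (axis i 1, 0)) + snd u *\<^sub>R ?f (0, 1)"
    by (metis (no_types, lifting) add sum scale sum.cong)
  then have "norm (?f u) \<le> (\<Sum>i\<in>UNIV. \<bar>fst u $ i\<bar> * norm (?f (axis i 1, 0))) + \<bar>snd u\<bar> * norm (?f (0, 1))"
    by (simp only:) (rule norm_triangle_le, rule add_mono, rule sum_norm_le, simp_all)
  also have "\<dots> = (\<chi> i. norm (?f (axis i 1, 0)), norm (?f (0, 1))) \<bullet> (\<chi> i. \<bar>fst u $ i\<bar>, \<bar>snd u\<bar>)"
    by (simp add: inner_prod_def inner_vec_def mult.commute)
  also have "\<dots> \<le> norm (\<chi> i. norm (?f (axis i 1, 0)), norm (?f (0, 1))) * norm (\<chi> i. \<bar>fst u $ i\<bar>, \<bar>snd u\<bar>)"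
    by (rule norm_cauchy_schwarz)
  also have "norm (\<chi> i. norm (?f (axis i 1, 0)), norm (?f (0, 1))) = norm (classical_gradient \<phi> z)"
    by (simp add: classical_gradient_def norm_prod_def norm_vec_def L2_set_def)
  also have "norm (\<chi> i. \<bar>fst u $ i\<bar>, \<bar>snd u\<bar>) = norm u"
    by (simp add: norm_prod_def norm_vec_def L2_set_def)
  finally show ?thesis .
qed

lemma powr_nn_integral:
  assumes "-1 < (e::real)"
  shows "(LI s. ennreal (s powr e) * indicator {0<..<1} s) \<le> ennreal (1 / (e + 1))"
proof -
  have "(LI s. ennreal (s powr e) * indicator {0<..<1} s) \<le> (LI s. ennreal (indicator {0..1} s * s powr e))"
    by (intro nn_integral_mono) (auto simp: indicator_def)
  also have "\<dots> = ennreal (1 / (e + 1))"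
    using nn_integral_has_integral_lebesgue[OF _ has_integral_powr_from_0[OF assms, of 1]] by simp
  finally show ?thesis .
qed

lemma nn_integral_affine:
  fixes f :: "'a::euclidean_space \<Rightarrow> ennreal"
  assumes [measurable]: "f \<in> borel_measurable borel" and s: "0 < s"
  shows "(LI y. f (p + s *\<^sub>R y)) = ennreal (s powr (- real DIM('a))) * (LI y. f y)"
proof -
  have "(LI y. f y) = (\<integral>\<^sup>+y. f y \<partial>density (distr lborel borel (\<lambda>x. p + s *\<^sub>R x)) (\<lambda>_. \<bar>s\<bar>^DIM('a)))"
    using lborel_affine[of s p] s by simp
  also have "\<dots> = ennreal (s ^ DIM('a)) * (LI y. f (p + s *\<^sub>R y))"
    using s by (subst nn_integral_density) (auto simp: nn_integral_distr nn_integral_cmult)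
  finally have "ennreal (s powr (- real DIM('a))) * (LI y. f y) =
      ennreal (s powr (- real DIM('a)) * s ^ DIM('a)) * (LI y. f (p + s *\<^sub>R y))"
    using s by (simp add: ennreal_mult mult.assoc)
  also have "s powr (- real DIM('a)) * s ^ DIM('a) = 1"
    using s by (simp add: powr_minus powr_realpow)
  finally show ?thesis by simp
qed

lemma nn_integral_dilation:
  fixes f :: "'a::euclidean_space \<Rightarrow> ennreal"
  assumes "f \<in> borel_measurable borel" and s: "0 < s"
  shows "(LI y. f (c + s *\<^sub>R (y - c))) = ennreal (s powr (- real DIM('a))) * (LI y. f y)"
  using nn_integral_affine[OF assms, of "c - s *\<^sub>R c"] by (simp add: algebra_simps)

subsection \<open>Hardy inequality for one realisation\<close>

text \<open>A product of one-dimensional weights: its integral factorises over the coordinates, and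
  its values at two points are compared coordinate by coordinate.\<close>

definition pw :: "real \<Rightarrow> real ^ 'n::finite \<Rightarrow> real" where
  "pw q x = (\<Prod>i\<in>UNIV. (1 + \<bar>x $ i\<bar>) powr (- q))"

lemma pw_pos: "0 < pw q x"
  unfolding pw_def by (intro prod_pos) auto

lemma pw_le_1: "0 \<le> q \<Longrightarrow> pw q x \<le> 1"
  unfolding pw_def by (intro prod_le_1) (auto simp: powr_minus inverse_le_1_iff intro!: ge_one_powr_ge_zero)

lemma pw_measurable[measurable]: "pw q \<in> borel_measurable borel"
  unfolding pw_def by measurable

lemma pw_meas[measurable]: "(\<lambda>y :: 'n::finite pt. pw q (fst y)) \<in> borel_measurable borel"
  by (rule measurable_compose[OF pt_measurable(1) pw_measurable])

text \<open>A displacement of at most \<open>r - 1\<close> in a coordinate changes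
  \<open>1 + \<bar>x $ i\<bar>\<close> by at most the factor \<open>r\<close>, because
  \<open>r + a \<le> r * (1 + a)\<close>; each coordinate thus costs
  \<open>r powr q\<close>.\<close>

lemma pw_compare:
  assumes q: "0 \<le> q" and r: "1 \<le> r" and d: "\<And>i. \<bar>x $ i - x' $ i\<bar> \<le> r - 1"
  shows "pw q x \<le> r powr (q * real CARD('n)) * pw q (x' :: real ^ 'n::finite)"
proof -
  have "pw q x \<le> (\<Prod>i\<in>UNIV. r powr q * (1 + \<bar>x' $ i\<bar>) powr (- q))"
    unfolding pw_def
  proof (intro prod_mono conjI)
    fix i
    have "1 + \<bar>x' $ i\<bar> \<le> r + \<bar>x $ i\<bar>" using d[of i] by linarith
    also have "\<dots> \<le> r * (1 + \<bar>x $ i\<bar>)" using r mult_right_mono[of 1 r "\<bar>x $ i\<bar>"] by (simp add: algebra_simps)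
    finally have "(1 + \<bar>x' $ i\<bar>) powr q \<le> (r * (1 + \<bar>x $ i\<bar>)) powr q" using q by (intro powr_mono2) auto
    also have "\<dots> = r powr q * (1 + \<bar>x $ i\<bar>) powr q" using r by (simp add: powr_mult)
    finally show "(1 + \<bar>x $ i\<bar>) powr (- q) \<le> r powr q * (1 + \<bar>x' $ i\<bar>) powr (- q)"
      by (simp add: powr_minus field_simps)
  qed auto
  also have "\<dots> = r powr (q * real CARD('n)) * pw q x'"
    using r by (simp add: pw_def prod.distrib powr_powr[symmetric] powr_realpow)
  finally show ?thesis .
qed

text \<open>Carries a weighted inequality from smooth approximants to their limit. The weights are
  at most \<open>1\<close> on \<open>A\<close>, so convergence of the unweighted squares is enough.
  The factor \<open>4\<close> arises because a square is split into twice two squares once on each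
  side. The error \<open>e\<close> takes up boundary terms.\<close>

lemma sq_limit_le:
  fixes v :: "'x \<Rightarrow> 'a::euclidean_space" and G :: "'x \<Rightarrow> 'b::euclidean_space"
    and p :: "nat \<Rightarrow> 'x \<Rightarrow> 'a" and r :: "nat \<Rightarrow> 'x \<Rightarrow> 'b" and a b b' :: "'x \<Rightarrow> ennreal"
  assumes [measurable]: "v \<in> borel_measurable M" "G \<in> borel_measurable M" "\<And>k. p k \<in> borel_measurable M" "\<And>k. r k \<in> borel_measurable M"
    "a \<in> borel_measurable M" "b \<in> borel_measurable M" "b' \<in> borel_measurable M"
    and A[measurable]: "A \<in> sets M"
    and le1: "\<And>y. y \<in> A \<Longrightarrow> a y \<le> 1" "\<And>y. y \<in> A \<Longrightarrow> b y \<le> 1" "\<And>y. y \<in> A \<Longrightarrow> b' y \<le> 1"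
    and lim: "(\<lambda>k. \<integral>\<^sup>+y\<in>A. nsq (p k y - v y) \<partial>M) \<longlonglongrightarrow> 0" "(\<lambda>k. \<integral>\<^sup>+y\<in>A. nsq (r k y - G y) \<partial>M) \<longlonglongrightarrow> 0"
    and e: "e \<longlonglongrightarrow> 0" and C: "C1 < \<infinity>" "C2 < \<infinity>"
    and le: "\<And>k. (\<integral>\<^sup>+y\<in>A. a y * nsq (p k y) \<partial>M) \<le> e k + C1 * (\<integral>\<^sup>+y\<in>A. b y * nsq (r k y) \<partial>M) + C2 * (\<integral>\<^sup>+y\<in>A. b' y * nsq (p k y) \<partial>M)"
  shows "(\<integral>\<^sup>+y\<in>A. a y * nsq (v y) \<partial>M) \<le> 4 * C1 * (\<integral>\<^sup>+y\<in>A. b y * nsq (G y) \<partial>M) + 4 * C2 * (\<integral>\<^sup>+y\<in>A. b' y * nsq (v y) \<partial>M)"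
proof -
  have gen: "(\<integral>\<^sup>+y\<in>A. w y * nsq (f y) \<partial>M) \<le> 2 * (\<integral>\<^sup>+y\<in>A. nsq (f y - g y) \<partial>M) + 2 * (\<integral>\<^sup>+y\<in>A. w y * nsq (g y) \<partial>M)"
    if [measurable]: "f \<in> borel_measurable M" "g \<in> borel_measurable M" "w \<in> borel_measurable M" and w: "\<And>y. y \<in> A \<Longrightarrow> w y \<le> 1"
    for f g :: "'x \<Rightarrow> 'c::euclidean_space" and w
  proof -
    have "(\<integral>\<^sup>+y\<in>A. w y * nsq (f y) \<partial>M) \<le> (\<integral>\<^sup>+y. 2 * (nsq (f y - g y) * indicator A y) + 2 * (w y * nsq (g y) * indicator A y) \<partial>M)"
    proof (intro nn_integral_mono)
      fix y
      have "w y * nsq (f y) \<le> w y * (2 * nsq (f y - g y) + 2 * nsq (g y))"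
        using ennreal_norm_add_sq_le[of "f y - g y" "g y"] by (intro mult_left_mono) auto
      also have "\<dots> = 2 * (w y * nsq (f y - g y)) + 2 * (w y * nsq (g y))" by (simp add: algebra_simps)
      finally have *: "w y * nsq (f y) \<le> 2 * (w y * nsq (f y - g y)) + 2 * (w y * nsq (g y))" .
      have "w y * nsq (f y) \<le> 2 * nsq (f y - g y) + 2 * (w y * nsq (g y))" if "y \<in> A"
      proof -
        have "w y * nsq (f y - g y) \<le> 1 * nsq (f y - g y)" using w[OF that] by (rule mult_right_mono) simp
        then have "2 * (w y * nsq (f y - g y)) \<le> 2 * nsq (f y - g y)" by (intro mult_left_mono) auto
        then show ?thesis using * by (meson add_right_mono order_trans)
      qed
      then show "w y * nsq (f y) * indicator A y \<le> 2 * (nsq (f y - g y) * indicator A y) + 2 * (w y * nsq (g y) * indicator A y)"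
        by (cases "y \<in> A") auto
    qed
    then show ?thesis by (simp add: nn_integral_add nn_integral_cmult)
  qed
  let ?P = "\<lambda>k. \<integral>\<^sup>+y\<in>A. nsq (p k y - v y) \<partial>M" and ?R = "\<lambda>k. \<integral>\<^sup>+y\<in>A. nsq (r k y - G y) \<partial>M"
  let ?G = "\<integral>\<^sup>+y\<in>A. b y * nsq (G y) \<partial>M" and ?V = "\<integral>\<^sup>+y\<in>A. b' y * nsq (v y) \<partial>M"
  let ?U = "\<lambda>k. 2 * ?P k + 2 * (e k + C1 * (2 * ?R k + 2 * ?G) + C2 * (2 * ?P k + 2 * ?V))"
  have 1: "(\<integral>\<^sup>+y\<in>A. a y * nsq (v y) \<partial>M) \<le> ?U k" for k
  proof -
    have "(\<integral>\<^sup>+y\<in>A. a y * nsq (v y) \<partial>M) \<le> 2 * ?P k + 2 * (\<integral>\<^sup>+y\<in>A. a y * nsq (p k y) \<partial>M)"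
      using gen[of v "p k" a] le1(1) by (simp add: norm_minus_commute)
    also have "\<dots> \<le> 2 * ?P k + 2 * (e k + C1 * (\<integral>\<^sup>+y\<in>A. b y * nsq (r k y) \<partial>M) + C2 * (\<integral>\<^sup>+y\<in>A. b' y * nsq (p k y) \<partial>M))"
      by (intro add_left_mono mult_left_mono le) auto
    also have "\<dots> \<le> ?U k"
      by (intro add_left_mono mult_left_mono add_mono order_refl gen le1) auto
    finally show ?thesis .
  qed
  have "?U \<longlonglongrightarrow> 2 * 0 + 2 * (0 + C1 * (2 * 0 + 2 * ?G) + C2 * (2 * 0 + 2 * ?V))"
    using C by (intro tendsto_add ennreal_tendsto_cmult lim e tendsto_const) auto
  then have "(\<integral>\<^sup>+y\<in>A. a y * nsq (v y) \<partial>M) \<le> 2 * 0 + 2 * (0 + C1 * (2 * 0 + 2 * ?G) + C2 * (2 * 0 + 2 * ?V))"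
    by (rule LIMSEQ_le_const) (use 1 in auto)
  also have "\<dots> = 4 * C1 * ?G + 4 * C2 * ?V"
  proof -
    have "2 * (2 * z) = 4 * z" for z :: ennreal
      by (simp add: mult.assoc[symmetric])
    then show ?thesis by (simp add: distrib_left mult.left_commute mult.assoc)
  qed
  finally show ?thesis .
qed

text \<open>Approximants converge on bounded sets only; an estimate with a constant independent of
  the radius passes to the whole set by monotone convergence.\<close>

lemma nn_integral_exhaust_ball:
  fixes f :: "'a::euclidean_space \<Rightarrow> ennreal"
  assumes [measurable]: "f \<in> borel_measurable borel" "A \<in> sets borel"
    and le: "\<And>N::nat. (LIS (A \<inter> ball c (real N)) f) \<le> K"
  shows "(LIS A f) \<le> K"
proof -
  have inc: "incseq (\<lambda>N::nat. \<lambda>y. f y * indicator (A \<inter> ball c (real N)) y)"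
    by (auto simp: incseq_def le_fun_def indicator_def)
  have [measurable]: "ball c r \<in> sets borel" for r by simp
  have "f y * indicator A y = (SUP N::nat. f y * indicator (A \<inter> ball c (real N)) y)" for y
  proof (rule antisym)
    obtain N :: nat where "dist c y < real N" using reals_Archimedean2 by blast
    then have "f y * indicator A y \<le> f y * indicator (A \<inter> ball c (real N)) y" by (auto simp: indicator_def)
    then show "f y * indicator A y \<le> (SUP N::nat. f y * indicator (A \<inter> ball c (real N)) y)" by (rule SUP_upper2[OF UNIV_I])
    show "(SUP N::nat. f y * indicator (A \<inter> ball c (real N)) y) \<le> f y * indicator A y"
      by (rule SUP_least) (auto simp: indicator_def)
  qed
  then have "(LIS A f) = (SUP N::nat. \<integral>\<^sup>+y\<in>A \<inter> ball c (real N). f y \<partial>lborel)"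
    by (simp only:) (intro nn_integral_monotone_convergence_SUP inc, measurable)
  then show ?thesis using le by (auto intro: SUP_least)
qed

text \<open>The segment from the point \<open>c + sgn (y - c)\<close> of the sphere to
  \<open>y\<close> is traversed by \<open>s\<close> between \<open>1 / dist y c\<close> and
  \<open>1\<close> with speed \<open>dist y c\<close>. The parameter interval is shorter than
  \<open>1\<close>, so Cauchy-Schwarz leaves the squared speed as the only factor.\<close>

lemma radial_bound:
  fixes \<phi> :: "'n::finite pt \<Rightarrow> complex"
  assumes sm: "smooth \<phi>" and y: "1 < dist y c"
  shows "nsq (\<phi> y) \<le> 2 * nsq (\<phi> (c + sgn (y - c))) +
    2 * ennreal ((dist y c)\<^sup>2) * (LI s. nsq (classical_gradient \<phi> (c + s *\<^sub>R (y - c))) * indicator {1 / dist y c<..<1} s)"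
proof -
  let ?u = "y - c" let ?r = "dist y c"
  have r: "0 < ?r" "norm ?u = ?r" using y by (auto simp: dist_norm)
  let ?S = "{1 / ?r<..<1}"
  let ?g = "\<lambda>s. ennreal (norm (frechet_derivative \<phi> (at (c + s *\<^sub>R ?u)) ?u))"
  have [measurable]: "(\<lambda>s. frechet_derivative \<phi> (at (c + s *\<^sub>R ?u)) ?u) \<in> borel_measurable borel"
    by (intro borel_measurable_continuous_onI smooth_line sm)
  have [measurable]: "(\<lambda>s. classical_gradient \<phi> (c + s *\<^sub>R ?u)) \<in> borel_measurable borel"
    by (rule measurable_compose[OF _ classical_gradient_measurable[OF sm]]) measurable
  have a: "c + (1 / ?r) *\<^sub>R ?u = c + sgn ?u" by (simp add: sgn_div_norm dist_norm divide_inverse)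
  have "ennreal (norm (\<phi> (c + 1 *\<^sub>R ?u) - \<phi> (c + (1 / ?r) *\<^sub>R ?u))) \<le> (LI s. ?g s * indicator ?S s)"
    by (intro norm_diff_le_line_integral smooth_line sm) (use y r in \<open>simp add: divide_le_eq_1\<close>)
  then have "(ennreal (norm (\<phi> y - \<phi> (c + sgn ?u))))\<^sup>2 \<le> (LI s. indicator ?S s * (?g s * indicator ?S s))\<^sup>2"
  proof (unfold a, intro power_mono)
    assume "ennreal (norm (\<phi> (c + 1 *\<^sub>R ?u) - \<phi> (c + sgn ?u))) \<le> (LI s. ?g s * indicator ?S s)"
    moreover have "(LI s. ?g s * indicator ?S s) = (LI s. indicator ?S s * (?g s * indicator ?S s))"
      by (intro nn_integral_cong) (simp add: indicator_def)
    ultimately show "ennreal (norm (\<phi> y - \<phi> (c + sgn ?u))) \<le> (LI s. indicator ?S s * (?g s * indicator ?S s))" by simp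
  qed simp
  also have "\<dots> \<le> (LI s. (indicator ?S s)^2) * (LI s. (?g s * indicator ?S s)^2)"
    by (rule Cauchy_Schwarz_nn_integral[where f = "\<lambda>s. indicator ?S s" and g = "\<lambda>s. ?g s * indicator ?S s"]) measurable
  also have "\<dots> \<le> 1 * (LI s. ennreal (?r\<^sup>2) * (nsq (classical_gradient \<phi> (c + s *\<^sub>R ?u)) * indicator ?S s))"
  proof (intro mult_mono)
    have "(LI s. (indicator ?S s)^2) = (LI s. indicator ?S s)"
      by (intro nn_integral_cong) (auto simp: indicator_def)
    also have "\<dots> = ennreal (1 - 1 / ?r)" using y r by (subst nn_integral_indicator) (auto simp: divide_le_eq_1)
    also have "\<dots> \<le> 1" using r by (subst ennreal_1[symmetric], intro ennreal_leI) auto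
    finally show "(LI s. (indicator ?S s)^2) \<le> 1" .
    show "(LI s. (?g s * indicator ?S s)^2) \<le> (LI s. ennreal (?r\<^sup>2) * (nsq (classical_gradient \<phi> (c + s *\<^sub>R ?u)) * indicator ?S s))"
    proof (intro nn_integral_mono)
      fix s
      have "(norm (frechet_derivative \<phi> (at (c + s *\<^sub>R ?u)) ?u))\<^sup>2 \<le> (norm (classical_gradient \<phi> (c + s *\<^sub>R ?u)) * ?r)\<^sup>2"
        using norm_derivative_le[OF sm, of "c + s *\<^sub>R ?u" ?u] r(2) by (intro power_mono) auto
      then show "(?g s * indicator ?S s)^2 \<le> ennreal (?r\<^sup>2) * (nsq (classical_gradient \<phi> (c + s *\<^sub>R ?u)) * indicator ?S s)"
        by (auto simp: indicator_def ennreal_sq ennreal_mult[symmetric] power_mult_distrib mult.commute intro!: ennreal_leI)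
    qed
  qed auto
  also have "\<dots> = ennreal (?r\<^sup>2) * (LI s. nsq (classical_gradient \<phi> (c + s *\<^sub>R ?u)) * indicator ?S s)"
    by (simp add: nn_integral_cmult)
  finally have 1: "nsq (\<phi> y - \<phi> (c + sgn ?u)) \<le> ennreal (?r\<^sup>2) * (LI s. nsq (classical_gradient \<phi> (c + s *\<^sub>R ?u)) * indicator ?S s)"
    by (simp add: ennreal_sq)
  have "nsq (\<phi> y) \<le> 2 * nsq (\<phi> (c + sgn ?u)) + 2 * nsq (\<phi> y - \<phi> (c + sgn ?u))"
    using ennreal_norm_add_sq_le[of "\<phi> (c + sgn ?u)" "\<phi> y - \<phi> (c + sgn ?u)"] by simp
  also have "\<dots> \<le> 2 * nsq (\<phi> (c + sgn ?u)) + 2 * (ennreal (?r\<^sup>2) * (LI s. nsq (classical_gradient \<phi> (c + s *\<^sub>R ?u)) * indicator ?S s))"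
    by (intro add_left_mono mult_left_mono 1) auto
  finally show ?thesis by (simp add: mult.assoc)
qed

text \<open>The exponent \<open>m - 2 - q (d - 1)\<close> is what remains of \<open>r\<^sup>-\<^sup>m\<close> once the derivative along the ray
  and the comparison of the polynomial weight at the two ends of the ray are paid for.\<close>

lemma star_shaped_hardy_smooth:
  fixes \<phi> :: "'n::finite pt \<Rightarrow> complex"
  defines "d \<equiv> real CARD('n) + 1"
  assumes sm: "smooth \<phi>" and V[measurable]: "V \<in> sets borel"
    and star: "\<And>y s. y \<in> V \<Longrightarrow> 0 < s \<Longrightarrow> s \<le> 1 \<Longrightarrow> 1 < dist (c + s *\<^sub>R (y - c)) c \<Longrightarrow> c + s *\<^sub>R (y - c) \<in> V"
    and V1: "\<And>y. y \<in> V \<Longrightarrow> 1 < dist y c"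
    and q: "0 \<le> q" and \<kappa>: "\<kappa> = m - 2 - q * real CARD('n)" "0 < \<kappa>" "-1 < \<kappa> - d"
  shows "(LIS V (\<lambda>y. ennreal (pw q (fst y) * dist y c powr (- m)) * nsq (\<phi> y))) \<le>
    2 * (LIS V (\<lambda>y. nsq (\<phi> (c + sgn (y - c))))) +
    ennreal (2 / (\<kappa> - d + 1)) * (LIS V (\<lambda>y. ennreal (pw q (fst y)) * nsq (classical_gradient \<phi> y)))"
proof -
  note [measurable] = smooth_measurable[OF sm] classical_gradient_measurable[OF sm]
  let ?w = "\<lambda>y. ennreal (pw q (fst y) * dist y c powr (- m))"
  let ?F = "\<lambda>z. ennreal (pw q (fst z)) * nsq (classical_gradient \<phi> z) * indicator V z"
  have DIM: "real DIM('n pt) = d" by (simp add: d_def)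
  have Fm[measurable]: "?F \<in> borel_measurable borel" by measurable
  have sgnm[measurable]: "(\<lambda>y :: 'n pt. c + sgn (y - c)) \<in> borel_measurable borel"
    unfolding sgn_div_norm by measurable
  have key: "?w y * nsq (\<phi> y) * indicator V y \<le> 2 * (nsq (\<phi> (c + sgn (y - c))) * indicator V y) +
     2 * (LI s. ennreal (s powr \<kappa>) * indicator {0<..<1} s * ?F (c + s *\<^sub>R (y - c)))" for y
  proof (cases "y \<in> V")
    case True
    let ?r = "dist y c"
    have r: "1 < ?r" using V1[OF True] .
    have cgm[measurable]: "(\<lambda>s. classical_gradient \<phi> (c + s *\<^sub>R (y - c))) \<in> borel_measurable borel"
      by (rule measurable_compose[OF _ classical_gradient_measurable[OF sm]]) measurable
    have w1: "?w y \<le> 1"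
    proof -
      have "0 \<le> q * real CARD('n)" using q by simp
      then have "1 \<le> ?r powr m" using r \<kappa> by (intro ge_one_powr_ge_zero) auto
      then have "?r powr (- m) \<le> 1" by (simp add: powr_minus inverse_le_1_iff)
      then have "pw q (fst y) * ?r powr (- m) \<le> 1 * 1"
        using pw_le_1[OF q, of "fst y"] by (intro mult_mono) auto
      then show ?thesis using ennreal_leI by fastforce
    qed
    have "?w y * nsq (\<phi> y) \<le> ?w y * (2 * nsq (\<phi> (c + sgn (y - c))) +
      2 * ennreal (?r\<^sup>2) * (LI s. nsq (classical_gradient \<phi> (c + s *\<^sub>R (y - c))) * indicator {1 / ?r<..<1} s))"
      by (intro mult_left_mono radial_bound sm r) auto
    also have "\<dots> = ?w y * (2 * nsq (\<phi> (c + sgn (y - c)))) +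
      2 * ((?w y * ennreal (?r\<^sup>2)) * (LI s. nsq (classical_gradient \<phi> (c + s *\<^sub>R (y - c))) * indicator {1 / ?r<..<1} s))"
      by (simp add: distrib_left mult_ac)
    also have "\<dots> \<le> 1 * (2 * nsq (\<phi> (c + sgn (y - c)))) +
      2 * (LI s. ennreal (s powr \<kappa>) * indicator {0<..<1} s * ?F (c + s *\<^sub>R (y - c)))"
    proof (intro add_mono mult_right_mono mult_left_mono w1)
      have "(?w y * ennreal (?r\<^sup>2)) * (LI s. nsq (classical_gradient \<phi> (c + s *\<^sub>R (y - c))) * indicator {1 / ?r<..<1} s)
        = (LI s. (?w y * ennreal (?r\<^sup>2)) * (nsq (classical_gradient \<phi> (c + s *\<^sub>R (y - c))) * indicator {1 / ?r<..<1} s))"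
        by (rule nn_integral_cmult[symmetric]) measurable
      also have "\<dots> \<le> (LI s. ennreal (s powr \<kappa>) * indicator {0<..<1} s * ?F (c + s *\<^sub>R (y - c)))"
      proof (intro nn_integral_mono)
        fix s
        let ?z = "c + s *\<^sub>R (y - c)"
        show "(?w y * ennreal (?r\<^sup>2)) * (nsq (classical_gradient \<phi> ?z) * indicator {1 / ?r<..<1} s) \<le>
          ennreal (s powr \<kappa>) * indicator {0<..<1} s * ?F ?z"
        proof (cases "s \<in> {1 / ?r<..<1}")
          case s: True
          have r0: "0 < ?r" using r by linarith
          then have "0 < 1 / ?r" by simp
          moreover have "1 / ?r < s" "s < 1" using s by auto
          ultimately have s0: "0 < s" "s < 1" "1 < s * ?r" using pos_divide_less_eq[OF r0, of 1 s] by linarith+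
          have dz: "dist ?z c = s * ?r" using s0 by (simp add: dist_norm)
          have z: "?z \<in> V" using star[OF True, of s] s0 dz by simp
          \<comment> \<open>Since \<open>s * ?r > 1\<close>, the displacement
            \<open>(1 - s) * ?r\<close> is below \<open>?r - 1\<close>; this is the radius with
            which \<open>pw_compare\<close> is applied.\<close>
          have "\<bar>fst y $ i - fst ?z $ i\<bar> \<le> ?r - 1" for i
          proof -
            have "fst y $ i - fst ?z $ i = (1 - s) * (fst (y - c) $ i)" by (simp add: algebra_simps)
            then have "\<bar>fst y $ i - fst ?z $ i\<bar> = (1 - s) * \<bar>fst (y - c) $ i\<bar>" using s0 by (simp add: abs_mult)
            also have "\<dots> \<le> (1 - s) * ?r"
            proof (rule mult_left_mono)
              have "\<bar>fst (y - c) $ i\<bar> \<le> norm (fst (y - c))" using component_le_norm_cart by blast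
              also have "\<dots> \<le> ?r" unfolding dist_norm by (metis norm_fst_le prod.collapse)
              finally show "\<bar>fst (y - c) $ i\<bar> \<le> ?r" .
            qed (use s0 in auto)
            also have "\<dots> \<le> ?r - 1" using s0 by (simp add: algebra_simps)
            finally show ?thesis .
          qed
          then have pw: "pw q (fst y) \<le> ?r powr (q * real CARD('n)) * pw q (fst ?z)"
            using r by (intro pw_compare q) auto
          have "pw q (fst y) * ?r powr (- m) * ?r\<^sup>2 \<le> ?r powr (q * real CARD('n)) * pw q (fst ?z) * ?r powr (- m) * ?r\<^sup>2"
            using pw by (intro mult_right_mono) auto
          also have "\<dots> = ?r powr (- \<kappa>) * pw q (fst ?z)"
          proof -
            have r2: "?r\<^sup>2 = ?r powr 2" using r by simp
            have "- \<kappa> = q * real CARD('n) + (- m) + 2" by (simp add: \<kappa>)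
            then have "?r powr (q * real CARD('n)) * ?r powr (- m) * ?r\<^sup>2 = ?r powr (- \<kappa>)"
              unfolding r2 by (simp only: powr_add)
            then show ?thesis by (simp add: mult_ac)
          qed
          \<comment> \<open>The distance \<open>?r\<close> depends on \<open>y\<close>. It exceeds
            \<open>1/s\<close>, so its negative power can be replaced by a factor in
            \<open>s\<close> alone before the integrals are exchanged.\<close>
          also have "\<dots> \<le> s powr \<kappa> * pw q (fst ?z)"
          proof (rule mult_right_mono)
            have "?r powr (- \<kappa>) = (1 / ?r) powr \<kappa>" using r by (simp add: powr_minus powr_divide inverse_eq_divide)
            also have "\<dots> \<le> s powr \<kappa>" using s r \<kappa>(2) by (intro powr_mono2) auto
            finally show "?r powr (- \<kappa>) \<le> s powr \<kappa>" .
          qed (use pw_pos in \<open>auto intro: less_imp_le\<close>)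
          finally have "ennreal (pw q (fst y) * ?r powr (- m) * ?r\<^sup>2) \<le> ennreal (s powr \<kappa> * pw q (fst ?z))" by (rule ennreal_leI)
          then have "ennreal (pw q (fst y) * ?r powr (- m)) * ennreal (?r\<^sup>2) \<le> ennreal (s powr \<kappa>) * ennreal (pw q (fst ?z))"
            using pw_pos[of q "fst y"] pw_pos[of q "fst ?z"] by (simp add: ennreal_mult)
          then have "(?w y * ennreal (?r\<^sup>2)) * nsq (classical_gradient \<phi> ?z) \<le> ennreal (s powr \<kappa>) * ennreal (pw q (fst ?z)) * nsq (classical_gradient \<phi> ?z)"
            by (rule mult_right_mono) simp
          then show ?thesis using s s0 z by (simp add: mult.assoc)
        qed simp
      qed
      finally show "(?w y * ennreal (?r\<^sup>2)) * (LI s. nsq (classical_gradient \<phi> (c + s *\<^sub>R (y - c))) * indicator {1 / ?r<..<1} s) \<le>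
        (LI s. ennreal (s powr \<kappa>) * indicator {0<..<1} s * ?F (c + s *\<^sub>R (y - c)))" .
    qed auto
    finally show ?thesis using True by simp
  qed simp
  have [measurable]: "(\<lambda>(y, s). ?F (c + s *\<^sub>R (y - c))) \<in> borel_measurable (lborel \<Otimes>\<^sub>M lborel)"
    unfolding case_prod_unfold by (rule measurable_compose[OF _ Fm]) measurable
  have [measurable]: "(\<lambda>(s, y). ?F (c + s *\<^sub>R (y - c))) \<in> borel_measurable (lborel \<Otimes>\<^sub>M lborel)"
    unfolding case_prod_unfold by (rule measurable_compose[OF _ Fm]) measurable
  have Fs: "(\<lambda>y. ?F (c + s *\<^sub>R (y - c))) \<in> borel_measurable borel" for s
    by (rule measurable_compose[OF _ Fm]) measurable
  have "(LIS V (\<lambda>y. ?w y * nsq (\<phi> y))) \<le> (LI y. 2 * (nsq (\<phi> (c + sgn (y - c))) * indicator V y) +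
     2 * (LI s. ennreal (s powr \<kappa>) * indicator {0<..<1} s * ?F (c + s *\<^sub>R (y - c))))"
    using key by (intro nn_integral_mono) auto
  also have "\<dots> = 2 * (LIS V (\<lambda>y. nsq (\<phi> (c + sgn (y - c))))) +
     2 * (\<integral>\<^sup>+y. \<integral>\<^sup>+s. ennreal (s powr \<kappa>) * indicator {0<..<1} s * ?F (c + s *\<^sub>R (y - c)) \<partial>lborel \<partial>lborel)"
    by (subst nn_integral_add) (measurable, simp add: nn_integral_cmult)
  also have "(\<integral>\<^sup>+y. \<integral>\<^sup>+s. ennreal (s powr \<kappa>) * indicator {0<..<1} s * ?F (c + s *\<^sub>R (y - c)) \<partial>lborel \<partial>lborel)
     = (\<integral>\<^sup>+s. \<integral>\<^sup>+y. ennreal (s powr \<kappa>) * indicator {0<..<1} s * ?F (c + s *\<^sub>R (y - c)) \<partial>lborel \<partial>lborel)"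
    by (rule lborel_pair.Fubini') measurable
  \<comment> \<open>For fixed \<open>s\<close> the map is a dilation about \<open>c\<close>, and
    \<open>?F\<close> carries the indicator of \<open>V\<close>; the inner integral is therefore
    \<open>s powr (- d)\<close> times the integral over \<open>V\<close>. The condition
    \<open>-1 < \<kappa> - d\<close> makes the remaining power integrable at
    \<open>0\<close>.\<close>
  also have "\<dots> = (LI s. (ennreal (s powr (\<kappa> - d)) * indicator {0<..<1} s) * (LI y. ?F y))"
  proof (intro nn_integral_cong)
    fix s :: real
    show "(LI y. ennreal (s powr \<kappa>) * indicator {0<..<1} s * ?F (c + s *\<^sub>R (y - c))) =
      (ennreal (s powr (\<kappa> - d)) * indicator {0<..<1} s) * (LI y. ?F y)"
    proof (cases "s \<in> {0<..<1}")
      case True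
      then have s: "0 < s" by simp
      have "(LI y. ennreal (s powr \<kappa>) * indicator {0<..<1} s * ?F (c + s *\<^sub>R (y - c))) =
         ennreal (s powr \<kappa>) * (LI y. ?F (c + s *\<^sub>R (y - c)))"
        using True Fs by (simp add: nn_integral_cmult)
      also have "(LI y. ?F (c + s *\<^sub>R (y - c))) = ennreal (s powr (- d)) * (LI y. ?F y)"
        using nn_integral_dilation[OF Fm s, of c] unfolding DIM by simp
      also have "ennreal (s powr \<kappa>) * (ennreal (s powr (- d)) * (LI y. ?F y)) = ennreal (s powr (\<kappa> - d)) * (LI y. ?F y)"
        by (simp add: mult.assoc[symmetric] ennreal_mult[symmetric] powr_add[symmetric])
      finally show ?thesis using True by simp
    qed simp
  qed
  also have "\<dots> = (LI s. ennreal (s powr (\<kappa> - d)) * indicator {0<..<1} s) * (LI y. ?F y)"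
    by (rule nn_integral_multc) measurable
  also have "\<dots> \<le> ennreal (1 / (\<kappa> - d + 1)) * (LI y. ?F y)"
    by (intro mult_right_mono powr_nn_integral \<kappa>) auto
  finally have "(LIS V (\<lambda>y. ?w y * nsq (\<phi> y))) \<le> 2 * (LIS V (\<lambda>y. nsq (\<phi> (c + sgn (y - c))))) +
     2 * (ennreal (1 / (\<kappa> - d + 1)) * (LI y. ?F y))"
    by (meson add_left_mono mult_left_mono order_trans zero_le)
  also have "2 * (ennreal (1 / (\<kappa> - d + 1)) * (LI y. ?F y)) = ennreal (2 / (\<kappa> - d + 1)) * (LI y. ?F y)"
  proof -
    have "2 * ennreal (1 / (\<kappa> - d + 1)) = ennreal (2 / (\<kappa> - d + 1))"
      using \<kappa> ennreal_mult[of 2 "1 / (\<kappa> - d + 1)"] by simp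
    then show ?thesis by (simp add: mult.assoc[symmetric])
  qed
  finally show ?thesis .
qed

text \<open>\<open>sphere_measure c\<close> is \<open>d\<close> times Lebesgue measure on the unit
  ball, pushed to the sphere along rays. The integrand is constant along rays, so a dilation reduces
  the ball of radius \<open>M\<close> to the unit ball at the price of the \<open>d\<close>-th power
  of \<open>M\<close>, and the density \<open>d\<close> is at least \<open>1\<close>. The condition
  on \<open>R\<close> keeps the whole sphere inside the ball about \<open>0\<close>.\<close>

lemma sgn_integral_le:
  fixes \<phi> :: "'n::finite pt \<Rightarrow> complex"
  assumes sm: "smooth \<phi>" and M: "0 < M" and R: "norm c + 1 < R"
  shows "(LIS (ball c M) (\<lambda>y. nsq (\<phi> (c + sgn (y - c))))) \<le>
    ennreal (M powr real DIM('n pt)) * (\<integral>\<^sup>+y\<in>ball 0 R. nsq (\<phi> y) \<partial>sphere_measure c)"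
proof -
  note [measurable] = smooth_measurable[OF sm]
  have sgnm[measurable]: "(\<lambda>y :: 'n pt. c + sgn (y - c)) \<in> borel_measurable borel"
    unfolding sgn_div_norm by measurable
  have bm[measurable]: "ball a r \<in> sets borel" for a :: "'n pt" and r by simp
  let ?f = "\<lambda>y. nsq (\<phi> (c + sgn (y - c))) * indicator (ball c 1) y"
  have "(LIS (ball c M) (\<lambda>y. nsq (\<phi> (c + sgn (y - c))))) = (LI y. ?f (c + (1 / M) *\<^sub>R (y - c)))"
  proof (intro nn_integral_cong)
    fix y
    have "sgn ((1 / M) *\<^sub>R (y - c)) = sgn (y - c)" using M by (simp add: sgn_scaleR)
    moreover have "c + (1 / M) *\<^sub>R (y - c) \<in> ball c 1 \<longleftrightarrow> y \<in> ball c M"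
    proof -
      have "dist c (c + (1 / M) *\<^sub>R (y - c)) = dist c y / M" using M by (simp add: dist_norm norm_minus_commute)
      then show ?thesis using M by (simp add: divide_less_eq)
    qed
    ultimately show "nsq (\<phi> (c + sgn (y - c))) * indicator (ball c M) y = ?f (c + (1 / M) *\<^sub>R (y - c))"
      by (simp add: indicator_def)
  qed
  also have "\<dots> = ennreal ((1 / M) powr (- real DIM('n pt))) * (LI y. ?f y)"
    using M by (intro nn_integral_dilation) auto
  also have "(1 / M) powr (- real DIM('n pt)) = M powr real DIM('n pt)"
  proof -
    have "(1 / M) powr (- r) = M powr r" for r using M by (simp add: powr_minus powr_divide)
    then show ?thesis by blast
  qed
  also have "(LI y. ?f y) \<le> (\<integral>\<^sup>+y\<in>ball 0 R. nsq (\<phi> y) \<partial>sphere_measure c)"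
  proof -
    have "(\<integral>\<^sup>+y\<in>ball 0 R. nsq (\<phi> y) \<partial>sphere_measure c) =
      (LI y. (of_nat DIM('n pt) * indicator (ball c 1) y) * (nsq (\<phi> (c + sgn (y - c))) * indicator (ball 0 R) (c + sgn (y - c))))"
    proof -
      have [measurable]: "(\<lambda>y. c + sgn (y - c)) \<in> density lborel (\<lambda>y. of_nat DIM('n pt) * indicator (ball c 1) y) \<rightarrow>\<^sub>M borel"
        using sgnm by simp
      have "(\<integral>\<^sup>+y\<in>ball 0 R. nsq (\<phi> y) \<partial>sphere_measure c) =
        (\<integral>\<^sup>+y. nsq (\<phi> (c + sgn (y - c))) * indicator (ball 0 R) (c + sgn (y - c)) \<partial>density lborel (\<lambda>y. of_nat DIM('n pt) * indicator (ball c 1) y))"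
        unfolding sphere_measure_def by (rule nn_integral_distr) measurable
      also have "\<dots> = (LI y. (of_nat DIM('n pt) * indicator (ball c 1) y) * (nsq (\<phi> (c + sgn (y - c))) * indicator (ball 0 R) (c + sgn (y - c))))"
        by (rule nn_integral_density) measurable
      finally show ?thesis .
    qed
    also have "\<dots> \<ge> (LI y. ?f y)"
    proof (intro nn_integral_mono)
      fix y
      have "norm (c + sgn (y - c)) \<le> norm c + 1"
        by (rule norm_triangle_le) (simp add: norm_sgn)
      then have "c + sgn (y - c) \<in> ball 0 R" using R by simp
      moreover have "1 * nsq (\<phi> (c + sgn (y - c))) \<le> of_nat DIM('n pt) * nsq (\<phi> (c + sgn (y - c)))"
      proof (rule mult_right_mono)
        have "(of_nat 1 :: ennreal) \<le> of_nat DIM('n pt)" by (rule of_nat_mono) (rule DIM_positive[unfolded Suc_le_eq[symmetric] One_nat_def[symmetric]])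
        then show "(1 :: ennreal) \<le> of_nat DIM('n pt)" by simp
      qed simp
      ultimately show "?f y \<le> (of_nat DIM('n pt) * indicator (ball c 1) y) * (nsq (\<phi> (c + sgn (y - c))) * indicator (ball 0 R) (c + sgn (y - c)))"
        by (auto simp: indicator_def)
    qed
    finally show ?thesis .
  qed
  finally show ?thesis by (meson mult_left_mono order_trans zero_le)
qed

text \<open>\<open>has_trace\<close> quantifies over a weak gradient; by uniqueness the
  approximating gradients converge to the prescribed \<open>G\<close> as well.\<close>

lemma has_trace_approx:
  assumes D: "open D" and t: "has_trace D S v g" and H: "H1loc D v G"
  obtains p where "\<And>k::nat. smooth (p k)"
    "\<And>r. l2conv D r p v"
    "\<And>r. l2conv D r (\<lambda>k. classical_gradient (p k)) G"
    "\<And>r. (\<lambda>k. \<integral>\<^sup>+y\<in>ball 0 r. nsq (p k y - g y) \<partial>S) \<longlonglongrightarrow> 0"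
proof -
  obtain G' p where p: "H1loc D v G'" "\<And>k::nat. smooth (p k)"
    "\<And>r. l2conv D r p v"
    "\<And>r. l2conv D r (\<lambda>k. classical_gradient (p k)) G'"
    "\<And>r. (\<lambda>k. \<integral>\<^sup>+y\<in>ball 0 r. nsq (p k y - g y) \<partial>S) \<longlonglongrightarrow> 0"
    using t unfolding has_trace_def by blast
  have "lsq D r (\<lambda>y. classical_gradient (p k) y - G' y) =
     lsq D r (\<lambda>y. classical_gradient (p k) y - G y)" for k r
    using weak_gradient_unique[OF D p(1) H]
    by (intro nn_integral_cong_AE, elim eventually_mono) (auto simp: indicator_def)
  then show ?thesis using that[OF p(2,3) _ p(5)] p(4) by simp
qed

lemma sq_tendsto_subset:
  assumes "(\<lambda>k. \<integral>\<^sup>+y\<in>B. f k y \<partial>M) \<longlonglongrightarrow> 0" "A \<subseteq> B"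
  shows "(\<lambda>k. \<integral>\<^sup>+y\<in>A. f k y \<partial>M) \<longlonglongrightarrow> (0::ennreal)"
proof (rule tendsto_sandwich[OF always_eventually always_eventually tendsto_const assms(1)])
  show "\<forall>k. (\<integral>\<^sup>+y\<in>A. f k y \<partial>M) \<le> (\<integral>\<^sup>+y\<in>B. f k y \<partial>M)"
    using assms(2) by (intro allI nn_integral_mono) (auto simp: indicator_def)
qed simp

text \<open>The smooth inequality along approximants: their sphere term tends to \<open>0\<close>
  because the trace vanishes, and \<open>sq_limit_le\<close> contributes the factor
  \<open>4\<close>.\<close>

lemma star_shaped_hardy:
  fixes v :: "'n::finite pt \<Rightarrow> complex" and D :: "'n pt set"
  defines "d \<equiv> real CARD('n) + 1"
  assumes D: "open D" and V[measurable]: "V \<in> sets borel" and VD: "V \<subseteq> D"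
    and star: "\<And>y s. y \<in> V \<Longrightarrow> 0 < s \<Longrightarrow> s \<le> 1 \<Longrightarrow> 1 < dist (c + s *\<^sub>R (y - c)) c \<Longrightarrow> c + s *\<^sub>R (y - c) \<in> V"
    and V1: "\<And>y. y \<in> V \<Longrightarrow> 1 < dist y c"
    and q: "0 \<le> q" and \<kappa>: "\<kappa> = m - 2 - q * real CARD('n)" "0 < \<kappa>" "-1 < \<kappa> - d"
    and v[measurable]: "v \<in> borel_measurable borel" "G \<in> borel_measurable borel"
    and t: "has_trace D (sphere_measure c) v (\<lambda>y. 0)" and H: "H1loc D v G"
  shows "(LIS V (\<lambda>y. ennreal (pw q (fst y) * dist y c powr (- m)) * nsq (v y))) \<le>
    4 * ennreal (2 / (\<kappa> - d + 1)) * (LIS V (\<lambda>y. ennreal (pw q (fst y)) * nsq (G y)))"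
proof -
  obtain p where p: "\<And>k::nat. smooth (p k)"
    "\<And>r. l2conv D r p v"
    "\<And>r. l2conv D r (\<lambda>k. classical_gradient (p k)) G"
    "\<And>r. (\<lambda>k. \<integral>\<^sup>+y\<in>ball 0 r. nsq (p k y - 0) \<partial>sphere_measure c) \<longlonglongrightarrow> 0"
    by (rule has_trace_approx[OF D t H], rule that)
  have "0 \<le> q * real CARD('n)" using q by simp
  then have m: "0 \<le> m" using \<kappa> by linarith
  have w1: "ennreal (pw q (fst y) * dist y c powr (- m)) \<le> 1" if "y \<in> V" for y
  proof -
    have "1 \<le> dist y c powr m" using V1[OF that] m by (intro ge_one_powr_ge_zero) auto
    then have "dist y c powr (- m) \<le> 1" by (simp add: powr_minus inverse_le_1_iff)
    then have "pw q (fst y) * dist y c powr (- m) \<le> 1 * 1"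
      using pw_le_1[OF q, of "fst y"] by (intro mult_mono) auto
    then show ?thesis using ennreal_leI by fastforce
  qed
  show ?thesis
  proof (rule nn_integral_exhaust_ball[where c = c])
    fix N :: nat
    \<comment> \<open>The balls are centred at \<open>c\<close>, so the truncated set is still
      star-shaped about \<open>c\<close>.\<close>
    let ?V = "V \<inter> ball c (real N)" let ?R = "norm c + real N + 2"
    have Vm[measurable]: "?V \<in> sets borel" by simp
    have sub: "?V \<subseteq> D \<inter> ball 0 ?R"
    proof -
      have "y \<in> ball 0 ?R" if "y \<in> ball c (real N)" for y
        using that norm_triangle_ineq2[of y c] by (simp add: dist_norm norm_minus_commute)
      then show ?thesis using VD by blast
    qed
    have star': "c + s *\<^sub>R (y - c) \<in> ?V" if "y \<in> ?V" "0 < s" "s \<le> 1" "1 < dist (c + s *\<^sub>R (y - c)) c" for y s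
    proof -
      have "dist c (c + s *\<^sub>R (y - c)) = s * dist c y" using that by (simp add: dist_norm norm_minus_commute)
      also have "\<dots> \<le> 1 * dist c y" using that by (intro mult_right_mono) auto
      finally show ?thesis using that star[of y s] by auto
    qed
    \<comment> \<open>The sphere term of the smooth inequality, bounded through
      \<open>sgn_integral_le\<close> with \<open>M = N + 1\<close>, which is positive even for
      \<open>N = 0\<close>.\<close>
    let ?e = "\<lambda>k. 2 * (ennreal ((real N + 1) powr real DIM('n pt)) * (\<integral>\<^sup>+y\<in>ball 0 ?R. nsq (p k y - 0) \<partial>sphere_measure c))"
    have e: "?e \<longlonglongrightarrow> 0"
    proof -
      have "?e \<longlonglongrightarrow> 2 * (ennreal ((real N + 1) powr real DIM('n pt)) * 0)"
        by (intro ennreal_tendsto_cmult p(4)) auto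
      then show ?thesis by simp
    qed
    have "(LIS ?V (\<lambda>y. ennreal (pw q (fst y) * dist y c powr (- m)) * nsq (v y))) \<le>
       4 * ennreal (2 / (\<kappa> - d + 1)) * (LIS ?V (\<lambda>y. ennreal (pw q (fst y)) * nsq (G y)))
       + 4 * 0 * (LIS ?V (\<lambda>y. 0 * nsq (v y)))"
    proof (rule sq_limit_le[where p = p and r = "\<lambda>k. classical_gradient (p k)" and e = ?e])
      show "p k \<in> borel_measurable lborel" "classical_gradient (p k) \<in> borel_measurable lborel" for k
        using smooth_measurable[OF p(1)] classical_gradient_measurable[OF p(1)] by auto
      show "(\<lambda>k. \<integral>\<^sup>+y\<in>?V. nsq (p k y - v y) \<partial>lborel) \<longlonglongrightarrow> 0" by (rule sq_tendsto_subset[OF p(2) sub])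
      show "(\<lambda>k. \<integral>\<^sup>+y\<in>?V. nsq (classical_gradient (p k) y - G y) \<partial>lborel) \<longlonglongrightarrow> 0" by (rule sq_tendsto_subset[OF p(3) sub])
      show "?e \<longlonglongrightarrow> 0" by (rule e)
      show "ennreal (pw q (fst y)) \<le> 1" for y :: "'n pt" using pw_le_1[OF q, of "fst y"] ennreal_leI by fastforce
      fix k
      note [measurable] = smooth_measurable[OF p(1), of k]
      have "(LIS ?V (\<lambda>y. ennreal (pw q (fst y) * dist y c powr (- m)) * nsq (p k y))) \<le>
        2 * (LIS ?V (\<lambda>y. nsq (p k (c + sgn (y - c))))) +
        ennreal (2 / (\<kappa> - (real CARD('n) + 1) + 1)) * (LIS ?V (\<lambda>y. ennreal (pw q (fst y)) * nsq (classical_gradient (p k) y)))"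
        using \<kappa> V1 unfolding d_def by (intro star_shaped_hardy_smooth p Vm star' q) auto
      also have "(LIS ?V (\<lambda>y. nsq (p k (c + sgn (y - c))))) \<le> (LIS (ball c (real N + 1)) (\<lambda>y. nsq (p k (c + sgn (y - c)))))"
        by (intro nn_integral_mono) (auto simp: indicator_def)
      also have "\<dots> \<le> ennreal ((real N + 1) powr real DIM('n pt)) * (\<integral>\<^sup>+y\<in>ball 0 ?R. nsq (p k y) \<partial>sphere_measure c)"
        by (intro sgn_integral_le p) auto
      finally show "(LIS ?V (\<lambda>y. ennreal (pw q (fst y) * dist y c powr (- m)) * nsq (p k y))) \<le>
        ?e k + ennreal (2 / (\<kappa> - d + 1)) * (LIS ?V (\<lambda>y. ennreal (pw q (fst y)) * nsq (classical_gradient (p k) y)))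
        + 0 * (LIS ?V (\<lambda>y. 0 * nsq (p k y)))"
        by (simp add: d_def mult_left_mono add_right_mono)
    qed (use w1 in auto)
    also have "\<dots> \<le> 4 * ennreal (2 / (\<kappa> - d + 1)) * (LIS V (\<lambda>y. ennreal (pw q (fst y)) * nsq (G y)))"
      by (simp, intro mult_left_mono nn_integral_mono) (auto simp: indicator_def)
    finally show "(LIS ?V (\<lambda>y. ennreal (pw q (fst y) * dist y c powr (- m)) * nsq (v y))) \<le>
       4 * ennreal (2 / (\<kappa> - d + 1)) * (LIS V (\<lambda>y. ennreal (pw q (fst y)) * nsq (G y)))" .
  qed measurable
qed

lemma hyperplane_null: "a \<noteq> b \<Longrightarrow> {y :: 'a::euclidean_space. dist y a = dist y b} \<in> null_sets lborel"
proof -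
  assume "a \<noteq> b"
  have "{y. dist y a = dist y b} = {y. (2 *\<^sub>R (b - a)) \<bullet> y = b \<bullet> b - a \<bullet> a}"
  proof (intro Collect_cong)
    fix y
    have "dist y a = dist y b \<longleftrightarrow> (dist y a)\<^sup>2 = (dist y b)\<^sup>2" by (simp add: power2_eq_iff_nonneg)
    also have "\<dots> \<longleftrightarrow> (2 *\<^sub>R (b - a)) \<bullet> y = b \<bullet> b - a \<bullet> a"
      by (simp add: dist_norm power2_norm_eq_inner inner_simps inner_commute algebra_simps) 
    finally show "dist y a = dist y b \<longleftrightarrow> (2 *\<^sub>R (b - a)) \<bullet> y = b \<bullet> b - a \<bullet> a" .
  qed
  moreover have "negligible {y. (2 *\<^sub>R (b - a)) \<bullet> y = b \<bullet> b - a \<bullet> a}"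
    using \<open>a \<noteq> b\<close> by (intro negligible_hyperplane) auto
  moreover have "closed {y. dist y a = dist y b}" by (intro closed_Collect_eq continuous_intros)
  ultimately show ?thesis by (auto simp: negligible_iff_null_sets null_sets_completion_iff)
qed

text \<open>All cells share one constant, so their inequalities add up. The slab reaches up to
  \<open>h + 1\<close> rather than \<open>h\<close> because the estimate above the layer starts from
  the strip in between.\<close>

lemma slab_hardy:
  fixes v :: "'n::finite pt \<Rightarrow> complex" and \<omega> :: "'n pt set"
  defines "d \<equiv> real CARD('n) + 1" and "D \<equiv> fluid_dom \<omega>"
  assumes \<omega>: "\<omega> \<in> configs h \<delta>" and \<delta>: "0 < \<delta>"
    and q: "0 \<le> q" and \<kappa>: "\<kappa> = m - 2 - q * real CARD('n)" "0 < \<kappa>" "-1 < \<kappa> - d"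
    and v[measurable]: "v \<in> borel_measurable borel" "G \<in> borel_measurable borel"
    and t: "\<And>c. c \<in> \<omega> \<Longrightarrow> has_trace D (sphere_measure c) v (\<lambda>y. 0)" and H: "H1loc D v G"
  shows "(LIS (D \<inter> UNIV \<times> {..<h + 1}) (\<lambda>y. ennreal (pw q (fst y) * infdist y \<omega> powr (- m)) * nsq (v y))) \<le>
    4 * ennreal (2 / (\<kappa> - d + 1)) * (LIS D (\<lambda>y. ennreal (pw q (fst y)) * nsq (G y)))"
proof -
  let ?K = "4 * ennreal (2 / (\<kappa> - d + 1))"
  obtain x :: "nat \<Rightarrow> 'n pt" where x: "\<omega> = range x" "\<And>k n. k \<noteq> n \<Longrightarrow> 2 < dist (x k) (x n)"
    "\<And>n. 1 + \<delta> \<le> snd (x n)" "\<And>n. snd (x n) \<le> h - 1"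
    using configs_enum[OF \<omega> \<delta>] by metis
  have inm[measurable]: "(\<lambda>y. infdist y \<omega>) \<in> borel_measurable borel"
    by (intro borel_measurable_continuous_onI continuous_intros)
  have Do: "open D" unfolding D_def by (rule fluid_dom_open[OF \<omega> \<delta>])
  have Dm[measurable]: "D \<in> sets borel" using Do by simp
  have D_eq: "D = {y. 0 < snd y \<and> 1 < infdist y \<omega>}" unfolding D_def by (rule fluid_dom_eq[OF \<omega> \<delta>])
  \<comment> \<open>Strict inequalities make the cells disjoint, at the expense of the bisectors,
    which are null. The cuts at the heights \<open>0\<close> and \<open>h + 1\<close> preserve
    star-shapedness since every centre lies strictly between them.\<close>
  define V where "V n = {y. 0 < snd y \<and> snd y < h + 1 \<and> 1 < dist y (x n) \<and> (\<forall>k. k \<noteq> n \<longrightarrow> dist y (x n) < dist y (x k))}" for n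
  have Vm[measurable]: "V n \<in> sets borel" for n
    unfolding V_def by measurable
  have inf: "infdist y \<omega> = dist y (x n)" if "y \<in> V n" for y n
  proof (rule antisym)
    show "infdist y \<omega> \<le> dist y (x n)" by (rule infdist_le) (simp add: x)
    obtain c where "c \<in> \<omega>" "infdist y \<omega> = dist y c" by (rule nearest_centre[OF \<omega> \<delta>])
    then obtain k where "infdist y \<omega> = dist y (x k)" using x(1) by auto
    then show "dist y (x n) \<le> infdist y \<omega>" using that unfolding V_def by (cases "k = n") (auto intro: less_imp_le)
  qed
  have VD: "V n \<subseteq> D" for n
    using inf by (auto simp: D_eq V_def)
  have disj: "disjoint_family V"
    unfolding disjoint_family_on_def
  proof (intro ballI impI)
    fix k n :: nat assume "k \<noteq> n"
    show "V k \<inter> V n = {}"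
    proof (rule equals0I)
      fix y assume "y \<in> V k \<inter> V n"
      then have 1: "\<forall>j. j \<noteq> k \<longrightarrow> dist y (x k) < dist y (x j)" and 2: "\<forall>j. j \<noteq> n \<longrightarrow> dist y (x n) < dist y (x j)"
        by (simp_all add: V_def)
      have "dist y (x k) < dist y (x n)" by (rule 1[rule_format]) (use \<open>k \<noteq> n\<close> in simp)
      moreover have "dist y (x n) < dist y (x k)" by (rule 2[rule_format]) (use \<open>k \<noteq> n\<close> in simp)
      ultimately show False by linarith
    qed
  qed
  have cell: "(LIS (V n) (\<lambda>y. ennreal (pw q (fst y) * infdist y \<omega> powr (- m)) * nsq (v y))) \<le>
    ?K * (LIS (V n) (\<lambda>y. ennreal (pw q (fst y)) * nsq (G y)))" for n
  proof -
    have "(LIS (V n) (\<lambda>y. ennreal (pw q (fst y) * infdist y \<omega> powr (- m)) * nsq (v y))) =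
      (LIS (V n) (\<lambda>y. ennreal (pw q (fst y) * dist y (x n) powr (- m)) * nsq (v y)))"
      by (intro nn_integral_cong) (auto simp: indicator_def inf)
    also have "\<dots> \<le> ?K * (LIS (V n) (\<lambda>y. ennreal (pw q (fst y)) * nsq (G y)))"
      unfolding d_def
    proof (rule star_shaped_hardy[OF Do Vm VD _ _ q])
      fix y s assume y: "y \<in> V n" and s: "0 < s" "s \<le> 1" and z: "1 < dist (x n + s *\<^sub>R (y - x n)) (x n)"
      let ?z = "x n + s *\<^sub>R (y - x n)"
      have dz: "dist ?z (x n) = s * dist y (x n)" using s by (simp add: dist_norm)
      have "?z - y = (1 - s) *\<^sub>R (x n - y)" by (simp add: algebra_simps)
      then have dy: "dist y ?z = (1 - s) * dist y (x n)"
        using s by (metis abs_of_nonneg diff_ge_0_iff_ge dist_commute dist_norm norm_scaleR)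
      have sz: "snd ?z = (1 - s) * snd (x n) + s * snd y" by (simp add: algebra_simps)
      have sy: "0 < snd y" "snd y < h + 1" using y by (auto simp: V_def)
      have "0 < snd ?z"
        unfolding sz using s sy x(3)[of n] \<delta> by (intro add_nonneg_pos mult_nonneg_nonneg mult_pos_pos) auto
      moreover have "snd ?z < h + 1"
      proof -
        have "(1 - s) * snd (x n) \<le> (1 - s) * (h + 1)" using x(4)[of n] s by (intro mult_left_mono) auto
        moreover have "s * snd y < s * (h + 1)" using s sy by (intro mult_strict_left_mono) auto
        ultimately show ?thesis unfolding sz by (simp add: algebra_simps)
      qed
      \<comment> \<open>Moving from \<open>y\<close> straight towards \<open>x n\<close> shortens
        the distance to \<open>x n\<close> by the full length of the move, and the distance to any
        other centre by at most that length.\<close>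
      moreover have "dist ?z (x n) < dist ?z (x k)" if "k \<noteq> n" for k
      proof -
        have "dist y (x n) < dist y (x k)" using y that by (auto simp: V_def)
        also have "\<dots> \<le> dist y ?z + dist ?z (x k)" by (rule dist_triangle)
        finally show ?thesis unfolding dy dz by (simp add: algebra_simps)
      qed
      ultimately show "?z \<in> V n" using z by (auto simp: V_def)
    next
      fix y assume "y \<in> V n" then show "1 < dist y (x n)" by (simp add: V_def)
    next
      show "has_trace D (sphere_measure (x n)) v (\<lambda>y. 0)" by (rule t) (simp add: x)
    qed (use \<kappa> H in \<open>auto simp: d_def\<close>)
    finally show ?thesis .
  qed
  have ae: "AE y in lborel. \<forall>k n. k \<noteq> n \<longrightarrow> dist y (x k) \<noteq> dist y (x n)"
  proof (intro AE_all_countable[THEN iffD2] allI)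
    fix k n
    show "AE y in lborel. k \<noteq> n \<longrightarrow> dist y (x k) \<noteq> dist y (x n)"
    proof (cases "k = n")
      case False
      then have "x k \<noteq> x n" using x(2)[OF False] by auto
      from AE_not_in[OF hyperplane_null[OF this]] show ?thesis by simp
    qed simp
  qed
  have "(LIS (D \<inter> UNIV \<times> {..<h + 1}) (\<lambda>y. ennreal (pw q (fst y) * infdist y \<omega> powr (- m)) * nsq (v y))) =
    (LIS (\<Union>n. V n) (\<lambda>y. ennreal (pw q (fst y) * infdist y \<omega> powr (- m)) * nsq (v y)))"
  proof (rule nn_integral_cong_AE)
    from ae show "AE y in lborel. ennreal (pw q (fst y) * infdist y \<omega> powr (- m)) * nsq (v y) * indicator (D \<inter> UNIV \<times> {..<h + 1}) y =
      ennreal (pw q (fst y) * infdist y \<omega> powr (- m)) * nsq (v y) * indicator (\<Union>n. V n) y"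
    proof eventually_elim
      fix y assume *: "\<forall>k n. k \<noteq> n \<longrightarrow> dist y (x k) \<noteq> dist y (x n)"
      have "y \<in> D \<inter> UNIV \<times> {..<h + 1} \<longleftrightarrow> y \<in> (\<Union>n. V n)"
      proof
        assume y: "y \<in> D \<inter> UNIV \<times> {..<h + 1}"
        obtain c where "c \<in> \<omega>" "infdist y \<omega> = dist y c" by (rule nearest_centre[OF \<omega> \<delta>])
        then obtain n where n: "infdist y \<omega> = dist y (x n)" using x(1) by auto
        have "dist y (x n) < dist y (x k)" if "k \<noteq> n" for k
          using infdist_le[of "x k" \<omega> y] n * that x(1) by (metis order_le_less rangeI)
        then have "y \<in> V n" using y n by (auto simp: D_eq V_def)
        then show "y \<in> (\<Union>n. V n)" by blast
      next
        assume "y \<in> (\<Union>n. V n)"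
        then obtain n where n: "y \<in> V n" by blast
        then have "y \<in> D" "snd y < h + 1" using VD by (blast, simp add: V_def)
        then show "y \<in> D \<inter> UNIV \<times> {..<h + 1}" by (simp add: mem_Times_iff)
      qed
      then show "ennreal (pw q (fst y) * infdist y \<omega> powr (- m)) * nsq (v y) * indicator (D \<inter> UNIV \<times> {..<h + 1}) y =
        ennreal (pw q (fst y) * infdist y \<omega> powr (- m)) * nsq (v y) * indicator (\<Union>n. V n) y"
        by (simp add: indicator_def)
    qed
  qed
  also have "\<dots> = (\<Sum>n. \<integral>\<^sup>+y\<in>V n. ennreal (pw q (fst y) * infdist y \<omega> powr (- m)) * nsq (v y) \<partial>lborel)"
    by (rule nn_integral_disjoint_family[OF _ _ disj]) measurable
  also have "\<dots> \<le> (\<Sum>n. ?K * (LIS (V n) (\<lambda>y. ennreal (pw q (fst y)) * nsq (G y))))"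
    by (intro suminf_le cell) auto
  also have "\<dots> = ?K * (\<Sum>n. \<integral>\<^sup>+y\<in>V n. ennreal (pw q (fst y)) * nsq (G y) \<partial>lborel)"
    by (rule ennreal_suminf_cmult)
  also have "(\<Sum>n. \<integral>\<^sup>+y\<in>V n. ennreal (pw q (fst y)) * nsq (G y) \<partial>lborel) = (LIS (\<Union>n. V n) (\<lambda>y. ennreal (pw q (fst y)) * nsq (G y)))"
    by (rule nn_integral_disjoint_family[OF _ _ disj, symmetric]) measurable
  also have "\<dots> \<le> (LIS D (\<lambda>y. ennreal (pw q (fst y)) * nsq (G y)))"
    using VD by (intro nn_integral_mono) (auto simp: indicator_def)
  finally show ?thesis by (meson mult_left_mono order_trans zero_le)
qed

text \<open>Hardy's inequality by dilations about \<open>\<tau>\<close>: Cauchy-Schwarz in the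
  dilation parameter \<open>s\<close>, then a change of variables for fixed \<open>s\<close>. Both
  steps lead to the integral of \<open>s powr (-1/2)\<close> over \<open>(0, 1)\<close>, which is at
  most \<open>2\<close>; hence the constant \<open>4\<close>. Since \<open>\<tau>\<close> lies in
  the interval, so do the dilated points.\<close>

lemma weighted_line_hardy:
  fixes f f' :: "real \<Rightarrow> complex"
  assumes f: "\<And>s. (f has_vector_derivative f' s) (at s)" and c: "continuous_on UNIV f'"
    and h: "1 \<le> h" and \<tau>: "h < \<tau>" "\<tau> < h + 1" and T: "h + 1 \<le> T"
  shows "(LIS {h<..<T} (\<lambda>t. ennreal (inverse (t\<^sup>2)) * nsq (f t - f \<tau>))) \<le> 4 * (LIS {h<..<T} (\<lambda>t. nsq (f' t)))"
proof -
  have [measurable]: "f' \<in> borel_measurable borel" using c by (rule borel_measurable_continuous_onI)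
  let ?F = "\<lambda>\<sigma>. nsq (f' \<sigma>) * indicator {h<..<T} \<sigma>"
  have Fm[measurable]: "?F \<in> borel_measurable borel" by measurable
  have key: "ennreal (inverse (t\<^sup>2)) * nsq (f t - f \<tau>) * indicator {h<..<T} t \<le>
     2 * (LI s. ennreal (s powr (1/2)) * indicator {0<..<1} s * ?F (\<tau> + s *\<^sub>R (t - \<tau>)))" for t
  proof (cases "t \<in> {h<..<T}")
    case True
    let ?u = "t - \<tau>"
    have tpos: "0 < t" using True h by auto
    have g: "((\<lambda>s. f (\<tau> + s *\<^sub>R ?u)) has_vector_derivative ?u *\<^sub>R f' (\<tau> + s *\<^sub>R ?u)) (at s)" for s
    proof -
      have "((\<lambda>s. \<tau> + s *\<^sub>R ?u) has_vector_derivative ?u) (at s)" by (auto intro!: derivative_eq_intros)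
      then show ?thesis using vector_diff_chain_at[of "\<lambda>s. \<tau> + s *\<^sub>R ?u" ?u s f] f by (simp add: o_def)
    qed
    have gc: "continuous_on UNIV (\<lambda>s. ?u *\<^sub>R f' (\<tau> + s *\<^sub>R ?u))"
      by (intro continuous_intros continuous_on_compose2[OF c]) auto
    \<comment> \<open>The factor \<open>1\<close> is split into these two powers: the square of the
      first is integrable at \<open>0\<close>, and the square of the second stays integrable after
      the Jacobian \<open>1/s\<close>.\<close>
    let ?a = "\<lambda>s. ennreal (s powr (-1/4)) * indicator {0<..<1} s"
    let ?b = "\<lambda>s. ennreal (s powr (1/4) * norm (?u *\<^sub>R f' (\<tau> + s *\<^sub>R ?u))) * indicator {0<..<1} s"
    have "ennreal (norm (f (\<tau> + 1 *\<^sub>R ?u) - f (\<tau> + 0 *\<^sub>R ?u))) \<le> (LI s. ennreal (norm (?u *\<^sub>R f' (\<tau> + s *\<^sub>R ?u))) * indicator {0<..<1} s)"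
      by (rule norm_diff_le_line_integral[OF _ g gc]) simp
    also have "\<dots> = (LI s. ?a s * ?b s)"
    proof (intro nn_integral_cong)
      fix s :: real
      have "s powr (-1/4) * (s powr (1/4) * X) = X" if "0 < s" for X
        using that by (simp add: mult.assoc[symmetric] powr_add[symmetric])
      then show "ennreal (norm (?u *\<^sub>R f' (\<tau> + s *\<^sub>R ?u))) * indicator {0<..<1} s = ?a s * ?b s"
        by (auto simp: indicator_def ennreal_mult[symmetric])
    qed
    finally have "(ennreal (norm (f t - f \<tau>)))\<^sup>2 \<le> (LI s. ?a s * ?b s)\<^sup>2"
      by (intro power_mono) auto
    also have "\<dots> \<le> (LI s. (?a s)^2) * (LI s. (?b s)^2)"
      by (rule Cauchy_Schwarz_nn_integral[where f = ?a and g = ?b]) measurable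
    also have "(LI s. (?a s)^2) = (LI s. ennreal (s powr (-1/2)) * indicator {0<..<1} s)"
    proof (intro nn_integral_cong)
      fix s :: real
      have "(s powr (-1/4))\<^sup>2 = s powr (-1/2)" by (simp add: power2_eq_square powr_add[symmetric])
      then show "(?a s)^2 = ennreal (s powr (-1/2)) * indicator {0<..<1} s"
        by (auto simp: indicator_def ennreal_sq)
    qed
    also have "\<dots> \<le> ennreal 2" using powr_nn_integral[of "-1/2"] by simp
    also have "(LI s. (?b s)^2) = (LI s. ennreal (?u\<^sup>2) * (ennreal (s powr (1/2)) * indicator {0<..<1} s * ?F (\<tau> + s *\<^sub>R ?u)))"
    proof (intro nn_integral_cong)
      fix s :: real
      have 1: "(s powr (1/4))\<^sup>2 = s powr (1/2)" by (simp add: power2_eq_square powr_add[symmetric])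
      have 2: "\<tau> + s *\<^sub>R ?u \<in> {h<..<T}" if s: "0 < s" "s < 1"
      proof -
        have eq: "\<tau> + s *\<^sub>R ?u = (1 - s) * \<tau> + s * t" by (simp add: algebra_simps)
        have "(1 - s) * h < (1 - s) * \<tau>" "s * h < s * t" "(1 - s) * \<tau> < (1 - s) * T" "s * t < s * T"
          using s True \<tau> T by (auto intro!: mult_strict_left_mono)
        then show ?thesis unfolding eq by (simp add: algebra_simps)
      qed
      have "(s powr (1/4) * norm (?u *\<^sub>R f' (\<tau> + s *\<^sub>R ?u)))\<^sup>2 = ?u\<^sup>2 * (s powr (1/2) * (norm (f' (\<tau> + s *\<^sub>R ?u)))\<^sup>2)"
        by (simp add: power_mult_distrib 1)
      note 3 = this
      show "(?b s)^2 = ennreal (?u\<^sup>2) * (ennreal (s powr (1/2)) * indicator {0<..<1} s * ?F (\<tau> + s *\<^sub>R ?u))"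
      proof (cases "s \<in> {0<..<1}")
        case s: True
        then have "(?b s)^2 = ennreal ((s powr (1/4) * norm (?u *\<^sub>R f' (\<tau> + s *\<^sub>R ?u)))\<^sup>2)"
          using ennreal_sq[of "s powr (1/4) * norm (?u *\<^sub>R f' (\<tau> + s *\<^sub>R ?u))"] by simp
        also have "\<dots> = ennreal (?u\<^sup>2 * (s powr (1/2) * (norm (f' (\<tau> + s *\<^sub>R ?u)))\<^sup>2))" by (simp only: 3)
        also have "\<dots> = ennreal (?u\<^sup>2) * (ennreal (s powr (1/2)) * nsq (f' (\<tau> + s *\<^sub>R ?u)))"
          by (simp add: ennreal_mult)
        finally show ?thesis using s 2 by simp
      qed simp
    qed
    also have "\<dots> = ennreal (?u\<^sup>2) * (LI s. ennreal (s powr (1/2)) * indicator {0<..<1} s * ?F (\<tau> + s *\<^sub>R ?u))"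
    proof (rule nn_integral_cmult)
      have "(\<lambda>s. ?F (\<tau> + s *\<^sub>R ?u)) \<in> borel_measurable borel" by (rule measurable_compose[OF _ Fm]) measurable
      then show "(\<lambda>s. ennreal (s powr (1/2)) * indicator {0<..<1} s * ?F (\<tau> + s *\<^sub>R ?u)) \<in> borel_measurable lborel" by measurable
    qed
    finally have 1: "nsq (f t - f \<tau>) \<le> ennreal 2 * (ennreal (?u\<^sup>2) * (LI s. ennreal (s powr (1/2)) * indicator {0<..<1} s * ?F (\<tau> + s *\<^sub>R ?u)))"
      by (simp add: ennreal_sq mult_right_mono)
    \<comment> \<open>For \<open>t < \<tau>\<close> this rests on \<open>1 \<le> h\<close>, since
      then \<open>\<tau> - t < 1 < t\<close>.\<close>
    have "?u\<^sup>2 \<le> t\<^sup>2" using True \<tau> h by (intro power2_le_iff_abs_le[THEN iffD2]) auto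
    then have tu: "inverse (t\<^sup>2) * ?u\<^sup>2 \<le> 1" using tpos by (simp add: field_simps)
    let ?I = "\<integral>\<^sup>+s. ennreal (s powr (1/2)) * indicator {0<..<1} s * ?F (\<tau> + s *\<^sub>R ?u) \<partial>lborel"
    have "ennreal (inverse (t\<^sup>2)) * nsq (f t - f \<tau>) \<le> ennreal (inverse (t\<^sup>2)) * (ennreal 2 * (ennreal (?u\<^sup>2) * ?I))"
      by (intro mult_left_mono 1) auto
    also have "\<dots> = ennreal (inverse (t\<^sup>2) * ?u\<^sup>2) * (2 * ?I)"
      by (simp add: ennreal_mult mult_ac)
    also have "\<dots> \<le> 1 * (2 * ?I)" using ennreal_leI[OF tu] by (intro mult_right_mono) auto
    finally show ?thesis using True by simp
  qed simp
  have [measurable]: "(\<lambda>(t, s). ?F (\<tau> + s *\<^sub>R (t - \<tau>))) \<in> borel_measurable (lborel \<Otimes>\<^sub>M lborel)"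
    unfolding case_prod_unfold by (rule measurable_compose[OF _ Fm]) measurable
  have [measurable]: "(\<lambda>(s, t). ?F (\<tau> + s *\<^sub>R (t - \<tau>))) \<in> borel_measurable (lborel \<Otimes>\<^sub>M lborel)"
    unfolding case_prod_unfold by (rule measurable_compose[OF _ Fm]) measurable
  have Fs: "(\<lambda>t. ?F (\<tau> + s *\<^sub>R (t - \<tau>))) \<in> borel_measurable borel" for s
    by (rule measurable_compose[OF _ Fm]) measurable
  have "(LIS {h<..<T} (\<lambda>t. ennreal (inverse (t\<^sup>2)) * nsq (f t - f \<tau>))) \<le>
     (LI t. 2 * (LI s. ennreal (s powr (1/2)) * indicator {0<..<1} s * ?F (\<tau> + s *\<^sub>R (t - \<tau>))))"
    by (intro nn_integral_mono key)
  also have "\<dots> = 2 * (\<integral>\<^sup>+t. \<integral>\<^sup>+s. ennreal (s powr (1/2)) * indicator {0<..<1} s * ?F (\<tau> + s *\<^sub>R (t - \<tau>)) \<partial>lborel \<partial>lborel)"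
    by (rule nn_integral_cmult) measurable
  also have "(\<integral>\<^sup>+t. \<integral>\<^sup>+s. ennreal (s powr (1/2)) * indicator {0<..<1} s * ?F (\<tau> + s *\<^sub>R (t - \<tau>)) \<partial>lborel \<partial>lborel) =
     (\<integral>\<^sup>+s. \<integral>\<^sup>+t. ennreal (s powr (1/2)) * indicator {0<..<1} s * ?F (\<tau> + s *\<^sub>R (t - \<tau>)) \<partial>lborel \<partial>lborel)"
    by (rule lborel_pair.Fubini') measurable
  also have "\<dots> = (LI s. (ennreal (s powr (-1/2)) * indicator {0<..<1} s) * (LI t. ?F t))"
  proof (intro nn_integral_cong)
    fix s :: real
    show "(LI t. ennreal (s powr (1/2)) * indicator {0<..<1} s * ?F (\<tau> + s *\<^sub>R (t - \<tau>))) =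
      (ennreal (s powr (-1/2)) * indicator {0<..<1} s) * (LI t. ?F t)"
    proof (cases "s \<in> {0<..<1}")
      case True
      then have s: "0 < s" by simp
      have "(LI t. ennreal (s powr (1/2)) * indicator {0<..<1} s * ?F (\<tau> + s *\<^sub>R (t - \<tau>))) =
         ennreal (s powr (1/2)) * (LI t. ?F (\<tau> + s *\<^sub>R (t - \<tau>)))"
        using True Fs by (simp add: nn_integral_cmult)
      also have "(LI t. ?F (\<tau> + s *\<^sub>R (t - \<tau>))) = ennreal (s powr (- real DIM(real))) * (LI t. ?F t)"
        by (rule nn_integral_dilation[OF Fm s])
      also have "ennreal (s powr (1/2)) * (ennreal (s powr (- real DIM(real))) * (LI t. ?F t)) = ennreal (s powr (1/2) * s powr (- 1)) * (LI t. ?F t)"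
        by (simp add: mult.assoc[symmetric] ennreal_mult[symmetric])
      also have "s powr (1/2) * s powr (- 1) = s powr (-1/2)" unfolding powr_add[symmetric] by simp
      finally show ?thesis using True by simp
    qed simp
  qed
  also have "\<dots> = (LI s. ennreal (s powr (-1/2)) * indicator {0<..<1} s) * (LI t. ?F t)"
    by (rule nn_integral_multc) measurable
  also have "\<dots> \<le> ennreal 2 * (LI t. ?F t)"
    using powr_nn_integral[of "-1/2"] by (intro mult_right_mono) auto
  finally have "(LIS {h<..<T} (\<lambda>t. ennreal (inverse (t\<^sup>2)) * nsq (f t - f \<tau>))) \<le> 2 * (ennreal 2 * (LI t. ?F t))"
    by (meson mult_left_mono order_trans zero_le)
  also have "2 * (ennreal 2 * (LI t. ?F t)) = 4 * (LI t. ?F t)"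
    by (simp add: mult.assoc[symmetric])
  finally show ?thesis .
qed

text \<open>Applied with \<open>a\<close> equal to the \<open>m\<close>-th power of the distance
  \<open>R\<close> to the nearest centre: the vertical integral of the weight above the layer is
  then of the order of \<open>R powr (- m)\<close>, the weight inside the layer. This is what the
  exponent \<open>2 * m\<close> in the upper weight achieves.\<close>

lemma arctan_nn_integral:
  assumes a: "0 < a" and h: "0 \<le> h"
  shows "(LIS {h<..<T} (\<lambda>t. ennreal (inverse (t\<^sup>2 + a\<^sup>2)))) \<le> ennreal (pi / 2 / a)"
proof -
  have "(LIS {h<..<T} (\<lambda>t. ennreal (inverse (t\<^sup>2 + a\<^sup>2)))) \<le> (LI t. ennreal (inverse (t\<^sup>2 + a\<^sup>2)) * indicator {0..} t)"
    using h by (intro nn_integral_mono) (auto simp: indicator_def)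
  also have "\<dots> = ennreal (pi / 2 / a - arctan (0 / a) / a)"
  proof (rule nn_integral_FTC_atLeast)
    fix t :: real
    show "((\<lambda>t. arctan (t / a) / a) has_real_derivative inverse (t\<^sup>2 + a\<^sup>2)) (at t)"
    proof -
      have "((\<lambda>t. arctan (t / a) / a) has_real_derivative (inverse (1 + (t / a)\<^sup>2) * (1 / a)) / a) (at t)"
        using a by (auto intro!: derivative_eq_intros)
      moreover have "t\<^sup>2 + a\<^sup>2 = a * a * (1 + (t / a)\<^sup>2)" using a by (simp add: field_simps power2_eq_square)
      then have "(inverse (1 + (t / a)\<^sup>2) * (1 / a)) / a = inverse (t\<^sup>2 + a\<^sup>2)" by (simp add: divide_inverse mult_ac)
      ultimately show ?thesis by simp
    qed
    show "((\<lambda>t. arctan (t / a) / a) \<longlongrightarrow> pi / 2 / a) at_top"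
    proof -
      have "filterlim (\<lambda>t. (1 / a) * t) at_top at_top"
        using a by (intro filterlim_tendsto_pos_mult_at_top[OF tendsto_const] filterlim_ident) auto
      then have "((\<lambda>t. arctan (t / a)) \<longlongrightarrow> pi / 2) at_top"
        by (intro filterlim_compose[OF tendsto_arctan_at_top]) simp
      then show ?thesis using a by (intro tendsto_divide tendsto_const) auto
    qed
  qed auto
  finally show ?thesis by simp
qed

lemma nn_integral_pt:
  fixes f :: "'a::euclidean_space \<times> 'b::euclidean_space \<Rightarrow> ennreal"
  assumes "f \<in> borel_measurable borel"
  shows "(LI y. f y) = (\<integral>\<^sup>+x. \<integral>\<^sup>+t. f (x, t) \<partial>lborel \<partial>lborel)"
    and "(\<lambda>x. \<integral>\<^sup>+t. f (x, t) \<partial>lborel) \<in> borel_measurable borel"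
proof -
  have "f \<in> borel_measurable (lborel \<Otimes>\<^sub>M lborel)" using assms by (simp add: lborel_prod)
  from lborel.nn_integral_fst[OF this] lborel.borel_measurable_nn_integral_fst[OF this]
  show "(LI y. f y) = (\<integral>\<^sup>+x. \<integral>\<^sup>+t. f (x, t) \<partial>lborel \<partial>lborel)"
    and "(\<lambda>x. \<integral>\<^sup>+t. f (x, t) \<partial>lborel) \<in> borel_measurable borel" by (simp_all add: lborel_prod)
qed

text \<open>On a vertical line the value at \<open>t\<close> is split into the difference to the
  value at a height \<open>\<tau>\<close> in \<open>(h, h + 1)\<close> and that value itself. The
  difference is handled by \<open>weighted_line_hardy\<close> with the weight enlarged to
  \<open>1/t^2\<close>. For the value at \<open>\<tau>\<close> the weight is integrated by
  \<open>arctan_nn_integral\<close>, and the distance to the nearest centre at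
  \<open>(x, \<tau>)\<close> is at most twice that at \<open>(x, h)\<close>, whence
  \<open>2 powr m\<close>.\<close>

lemma upper_hardy_smooth:
  fixes \<phi> :: "'n::finite pt \<Rightarrow> complex" and w :: "real ^ 'n \<Rightarrow> ennreal"
  assumes \<omega>: "\<omega> \<in> configs h \<delta>" and \<delta>: "0 < \<delta>" and m: "0 \<le> m"
    and sm: "smooth \<phi>" and T: "h + 1 \<le> T" and B[measurable]: "B \<in> sets borel" and w[measurable]: "w \<in> borel_measurable borel"
  shows "(LIS (B \<times> {h<..<T}) (\<lambda>y. w (fst y) * ennreal (weight h m \<omega> y) * nsq (\<phi> y))) \<le>
    8 * (LIS (B \<times> {h<..<T}) (\<lambda>y. w (fst y) * nsq (classical_gradient \<phi> y))) +
    ennreal (pi * 2 powr m) * (LIS (B \<times> {h<..<T}) (\<lambda>y. w (fst y) * ennreal (infdist y \<omega> powr (- m)) * indicator (UNIV \<times> {h<..<h + 1}) y * nsq (\<phi> y)))"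
proof -
  note [measurable] = smooth_measurable[OF sm] classical_gradient_measurable[OF sm]
  have h1: "1 \<le> h" using height_pos[OF \<omega> \<delta>] \<delta> by simp
  have inm[measurable]: "(\<lambda>y. infdist y \<omega>) \<in> borel_measurable borel"
    by (intro borel_measurable_continuous_onI continuous_intros)
  have pairm[measurable]: "(\<lambda>t. (x, t)) \<in> borel_measurable borel" for x :: "real ^ 'n"
    by (intro borel_measurable_continuous_onI continuous_intros)
  have BTm[measurable]: "B \<times> {h<..<T} \<in> sets borel" "(UNIV :: (real ^ 'n) set) \<times> {h<..<h + 1} \<in> sets borel"
    by (auto intro: borel_Times)
  have wfm[measurable]: "(\<lambda>y :: 'n pt. w (fst y)) \<in> borel_measurable borel"
    by (rule measurable_compose[OF pt_measurable(1) w])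
  have inhm[measurable]: "(\<lambda>y :: 'n pt. infdist (fst y, h) \<omega>) \<in> borel_measurable borel"
    by (intro borel_measurable_continuous_onI continuous_intros)
  have wm[measurable]: "(\<lambda>y. weight h m \<omega> y) \<in> borel_measurable borel"
    unfolding weight_def nearest_dist_def by measurable
  have phix[measurable]: "(\<lambda>t. \<phi> (x, t)) \<in> borel_measurable borel" for x by (rule measurable_compose[OF pairm smooth_measurable[OF sm]])
  have cgx[measurable]: "(\<lambda>t. classical_gradient \<phi> (x, t)) \<in> borel_measurable borel" for x by (rule measurable_compose[OF pairm classical_gradient_measurable[OF sm]])
  have infx[measurable]: "(\<lambda>t. infdist (x, t) \<omega>) \<in> borel_measurable borel" for x by (rule measurable_compose[OF pairm inm])
  have wx[measurable]: "(\<lambda>t. weight h m \<omega> (x, t)) \<in> borel_measurable borel" for x by (rule measurable_compose[OF pairm wm])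
  have line: "(LIS {h<..<T} (\<lambda>t. ennreal (weight h m \<omega> (x, t)) * nsq (\<phi> (x, t)))) \<le>
     8 * (LIS {h<..<T} (\<lambda>t. nsq (classical_gradient \<phi> (x, t)))) +
     ennreal (pi * 2 powr m) * (\<integral>\<^sup>+\<tau>\<in>{h<..<h + 1}. ennreal (infdist (x, \<tau>) \<omega> powr (- m)) * nsq (\<phi> (x, \<tau>)) \<partial>lborel)" for x
  proof -
    let ?f = "\<lambda>t. \<phi> (x, t)" let ?f' = "\<lambda>t. frechet_derivative \<phi> (at (x, t)) (0, 1)"
    have fd: "(?f has_vector_derivative ?f' t) (at t)" "continuous_on UNIV ?f'" for t
      using smooth_line[OF sm, of "(x, 0)" "(0, 1)"] by simp_all
    let ?R = "infdist (x, h) \<omega>"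
    have R1: "1 \<le> ?R" using infdist_ge1[OF \<omega> \<delta>, of "(x, h)"] by simp
    let ?a = "?R powr m"
    have a: "0 < ?a" using R1 by simp
    have wt: "weight h m \<omega> (x, t) = inverse (t\<^sup>2 + ?a\<^sup>2)" if "h < t" for t
      using that by (simp add: weight_def nearest_dist_def power2_eq_square powr_add[symmetric])
    let ?L = "\<integral>\<^sup>+t\<in>{h<..<T}. ennreal (weight h m \<omega> (x, t)) * nsq (?f t) \<partial>lborel"
    let ?Gr = "\<integral>\<^sup>+t\<in>{h<..<T}. nsq (classical_gradient \<phi> (x, t)) \<partial>lborel"
    let ?r = "\<lambda>\<tau>. ennreal (infdist (x, \<tau>) \<omega> powr (- m)) * nsq (?f \<tau>)"
    have tau: "?L \<le> 8 * ?Gr + ennreal (pi * 2 powr m) * ?r \<tau>" if \<tau>: "h < \<tau>" "\<tau> < h + 1" for \<tau>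
    proof -
      have "?L \<le> (LI t. 2 * (ennreal (inverse (t\<^sup>2)) * nsq (?f t - ?f \<tau>) * indicator {h<..<T} t) +
          2 * nsq (?f \<tau>) * (ennreal (inverse (t\<^sup>2 + ?a\<^sup>2)) * indicator {h<..<T} t))"
      proof (intro nn_integral_mono)
        fix t
        show "ennreal (weight h m \<omega> (x, t)) * nsq (?f t) * indicator {h<..<T} t \<le> 2 * (ennreal (inverse (t\<^sup>2)) * nsq (?f t - ?f \<tau>) * indicator {h<..<T} t) +
          2 * nsq (?f \<tau>) * (ennreal (inverse (t\<^sup>2 + ?a\<^sup>2)) * indicator {h<..<T} t)"
        proof (cases "t \<in> {h<..<T}")
          case True
          then have t: "h < t" "0 < t" using h1 by auto
          have "ennreal (inverse (t\<^sup>2 + ?a\<^sup>2)) * nsq (?f t) \<le> ennreal (inverse (t\<^sup>2 + ?a\<^sup>2)) * (2 * nsq (?f t - ?f \<tau>) + 2 * nsq (?f \<tau>))"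
            using ennreal_norm_add_sq_le[of "?f t - ?f \<tau>" "?f \<tau>"] by (intro mult_left_mono) auto
          also have "\<dots> = ennreal (inverse (t\<^sup>2 + ?a\<^sup>2)) * (2 * nsq (?f t - ?f \<tau>)) + 2 * nsq (?f \<tau>) * ennreal (inverse (t\<^sup>2 + ?a\<^sup>2))"
            by (simp add: algebra_simps)
          also have "\<dots> \<le> ennreal (inverse (t\<^sup>2)) * (2 * nsq (?f t - ?f \<tau>)) + 2 * nsq (?f \<tau>) * ennreal (inverse (t\<^sup>2 + ?a\<^sup>2))"
            using t by (intro add_right_mono mult_right_mono ennreal_leI le_imp_inverse_le) auto
          finally show ?thesis using True wt[OF t(1)] by (simp add: mult.left_commute)
        qed simp
      qed
      also have "\<dots> = 2 * (LIS {h<..<T} (\<lambda>t. ennreal (inverse (t\<^sup>2)) * nsq (?f t - ?f \<tau>))) +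
          2 * nsq (?f \<tau>) * (LIS {h<..<T} (\<lambda>t. ennreal (inverse (t\<^sup>2 + ?a\<^sup>2))))"
        by (subst nn_integral_add) (measurable, simp add: nn_integral_cmult)
      also have "\<dots> \<le> 2 * (4 * ?Gr) + 2 * nsq (?f \<tau>) * ennreal (pi / 2 / ?a)"
      proof (intro add_mono mult_left_mono)
        have "(LIS {h<..<T} (\<lambda>t. ennreal (inverse (t\<^sup>2)) * nsq (?f t - ?f \<tau>))) \<le> 4 * (LIS {h<..<T} (\<lambda>t. nsq (?f' t)))"
          by (rule weighted_line_hardy[OF fd h1 \<tau> T])
        also have "(LIS {h<..<T} (\<lambda>t. nsq (?f' t))) \<le> ?Gr"
        proof (intro nn_integral_mono mult_right_mono ennreal_leI power_mono)
          fix t show "norm (?f' t) \<le> norm (classical_gradient \<phi> (x, t))"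
            using norm_derivative_le[OF sm, of "(x, t)" "(0, 1)"] by (simp add: norm_Pair)
        qed auto
        finally show "(LIS {h<..<T} (\<lambda>t. ennreal (inverse (t\<^sup>2)) * nsq (?f t - ?f \<tau>))) \<le> 4 * ?Gr"
          by (simp add: mult_left_mono)
        show "(LIS {h<..<T} (\<lambda>t. ennreal (inverse (t\<^sup>2 + ?a\<^sup>2)))) \<le> ennreal (pi / 2 / ?a)"
          using h1 by (intro arctan_nn_integral a) simp
      qed auto
      also have "2 * nsq (?f \<tau>) * ennreal (pi / 2 / ?a) = ennreal (pi / ?a) * nsq (?f \<tau>)"
      proof -
        have "2 * ennreal (pi / 2 / ?a) = ennreal (pi / ?a)" using a ennreal_mult[of 2 "pi / 2 / ?a"] by simp
        moreover have "2 * nsq (?f \<tau>) * X = (2 * X) * nsq (?f \<tau>)" for X by (simp only: mult_ac)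
        ultimately show ?thesis by (simp only:)
      qed
      also have "\<dots> \<le> ennreal (pi * 2 powr m) * ?r \<tau>"
      proof -
        have "infdist (x, \<tau>) \<omega> \<le> ?R + dist (x, \<tau>) (x, h)" by (rule infdist_lip[OF \<omega> \<delta>])
        also have "dist (x, \<tau>) (x, h) \<le> ?R" using \<tau> R1 by (simp add: dist_Pair_Pair dist_real_def)
        finally have le: "infdist (x, \<tau>) \<omega> \<le> 2 * ?R" by simp
        have pos: "0 < infdist (x, \<tau>) \<omega>" using infdist_ge1[OF \<omega> \<delta>, of "(x, \<tau>)"] \<tau> by simp
        have "infdist (x, \<tau>) \<omega> powr m \<le> (2 * ?R) powr m" using le pos m by (intro powr_mono2) auto
        also have "\<dots> = 2 powr m * ?a" using R1 by (simp add: powr_mult)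
        finally have "inverse ?a \<le> 2 powr m * infdist (x, \<tau>) \<omega> powr (- m)"
          using a pos by (simp add: powr_minus field_simps)
        then have "pi / ?a \<le> pi * 2 powr m * infdist (x, \<tau>) \<omega> powr (- m)"
          by (simp add: divide_inverse mult.assoc)
        then have "ennreal (pi / ?a) \<le> ennreal (pi * 2 powr m) * ennreal (infdist (x, \<tau>) \<omega> powr (- m))"
          by (simp add: ennreal_mult[symmetric] ennreal_leI)
        then have "ennreal (pi / ?a) * nsq (?f \<tau>) \<le> ennreal (pi * 2 powr m) * ennreal (infdist (x, \<tau>) \<omega> powr (- m)) * nsq (?f \<tau>)"
          by (rule mult_right_mono) simp
        then show ?thesis by (simp add: mult.assoc)
      qed
      finally show ?thesis by (simp add: mult.assoc[symmetric] add_left_mono)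
    qed
    \<comment> \<open>The left-hand side does not depend on \<open>\<tau>\<close>, and the interval
      of averaging has length \<open>1\<close>.\<close>
    have "?L = (\<integral>\<^sup>+\<tau>. ?L * indicator {h<..<h + 1} \<tau> \<partial>lborel)"
      by (simp add: nn_integral_cmult)
    also have "\<dots> \<le> (\<integral>\<^sup>+\<tau>. (8 * ?Gr) * indicator {h<..<h + 1} \<tau> + ennreal (pi * 2 powr m) * (?r \<tau> * indicator {h<..<h + 1} \<tau>) \<partial>lborel)"
      using tau by (intro nn_integral_mono) (auto simp: indicator_def)
    also have "\<dots> = 8 * ?Gr + ennreal (pi * 2 powr m) * (\<integral>\<^sup>+\<tau>\<in>{h<..<h + 1}. ?r \<tau> \<partial>lborel)"
      by (subst nn_integral_add) (measurable, simp add: nn_integral_cmult)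
    finally show ?thesis .
  qed
  let ?A1 = "\<lambda>y. w (fst y) * ennreal (weight h m \<omega> y) * nsq (\<phi> y) * indicator (B \<times> {h<..<T}) y"
  let ?A2 = "\<lambda>y. w (fst y) * nsq (classical_gradient \<phi> y) * indicator (B \<times> {h<..<T}) y"
  let ?A3 = "\<lambda>y. w (fst y) * ennreal (infdist y \<omega> powr (- m)) * indicator (UNIV \<times> {h<..<h + 1}) y * nsq (\<phi> y) * indicator (B \<times> {h<..<T}) y"
  have A[measurable]: "?A1 \<in> borel_measurable borel" "?A2 \<in> borel_measurable borel" "?A3 \<in> borel_measurable borel"
    by measurable
  have "(LI y. ?A1 y) = (\<integral>\<^sup>+x. \<integral>\<^sup>+t. ?A1 (x, t) \<partial>lborel \<partial>lborel)" by (rule nn_integral_pt(1)[OF A(1)])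
  also have "\<dots> \<le> (LI x. 8 * (LI t. ?A2 (x, t)) + ennreal (pi * 2 powr m) * (LI t. ?A3 (x, t)))"
  proof (intro nn_integral_mono)
    fix x
    have e: "(LI t. ?A1 (x, t)) = (w x * indicator B x) * (LIS {h<..<T} (\<lambda>t. ennreal (weight h m \<omega> (x, t)) * nsq (\<phi> (x, t))))"
      "(LI t. ?A2 (x, t)) = (w x * indicator B x) * (LIS {h<..<T} (\<lambda>t. nsq (classical_gradient \<phi> (x, t))))"
      "(LI t. ?A3 (x, t)) = (w x * indicator B x) * (\<integral>\<^sup>+\<tau>\<in>{h<..<h + 1}. ennreal (infdist (x, \<tau>) \<omega> powr (- m)) * nsq (\<phi> (x, \<tau>)) \<partial>lborel)"
    proof -
      have 1: "?A1 (x, t) = (w x * indicator B x) * (ennreal (weight h m \<omega> (x, t)) * nsq (\<phi> (x, t)) * indicator {h<..<T} t)" for t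
        by (simp add: indicator_times mult_ac)
      have 2: "?A2 (x, t) = (w x * indicator B x) * (nsq (classical_gradient \<phi> (x, t)) * indicator {h<..<T} t)" for t
        by (simp add: indicator_times mult_ac)
      have 3: "?A3 (x, t) = (w x * indicator B x) * (ennreal (infdist (x, t) \<omega> powr (- m)) * nsq (\<phi> (x, t)) * indicator {h<..<h + 1} t)" for t
        using T by (cases "t \<in> {h<..<h + 1}") (simp_all add: indicator_times mult_ac)
      show "(LI t. ?A1 (x, t)) = (w x * indicator B x) * (LIS {h<..<T} (\<lambda>t. ennreal (weight h m \<omega> (x, t)) * nsq (\<phi> (x, t))))"
        unfolding 1 by (rule nn_integral_cmult) measurable
      show "(LI t. ?A2 (x, t)) = (w x * indicator B x) * (LIS {h<..<T} (\<lambda>t. nsq (classical_gradient \<phi> (x, t))))"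
        unfolding 2 by (rule nn_integral_cmult) measurable
      show "(LI t. ?A3 (x, t)) = (w x * indicator B x) * (\<integral>\<^sup>+\<tau>\<in>{h<..<h + 1}. ennreal (infdist (x, \<tau>) \<omega> powr (- m)) * nsq (\<phi> (x, \<tau>)) \<partial>lborel)"
        unfolding 3 by (rule nn_integral_cmult) measurable
    qed
    show "(LI t. ?A1 (x, t)) \<le> 8 * (LI t. ?A2 (x, t)) + ennreal (pi * 2 powr m) * (LI t. ?A3 (x, t))"
      unfolding e using mult_left_mono[OF line[of x], of "w x * indicator B x"] by (simp add: distrib_left mult_ac)
  qed
  also have "\<dots> = 8 * (\<integral>\<^sup>+x. \<integral>\<^sup>+t. ?A2 (x, t) \<partial>lborel \<partial>lborel) + ennreal (pi * 2 powr m) * (\<integral>\<^sup>+x. \<integral>\<^sup>+t. ?A3 (x, t) \<partial>lborel \<partial>lborel)"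
    using nn_integral_pt(2)[OF A(2)] nn_integral_pt(2)[OF A(3)]
    by (subst nn_integral_add) (auto simp: nn_integral_cmult)
  also have "\<dots> = 8 * (LI y. ?A2 y) + ennreal (pi * 2 powr m) * (LI y. ?A3 y)"
    by (simp only: nn_integral_pt(1)[OF A(2), symmetric] nn_integral_pt(1)[OF A(3), symmetric])
  finally show ?thesis .
qed

context
  fixes \<omega> :: "'n::finite pt set" and h \<delta> :: real
  assumes \<omega>: "\<omega> \<in> configs h \<delta>" and \<delta>: "0 < \<delta>"
begin

lemma weight_measurable_config: "weight h m \<omega> \<in> borel_measurable borel"
proof -
  have [measurable]: "(\<lambda>y. infdist y \<omega>) \<in> borel_measurable borel" "(\<lambda>y :: 'n pt. infdist (fst y, h) \<omega>) \<in> borel_measurable borel"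
    by (intro borel_measurable_continuous_onI continuous_intros)+
  show ?thesis unfolding weight_def[abs_def] nearest_dist_def by measurable
qed

lemma h_ge_1: "1 \<le> h"
  using height_pos[OF \<omega> \<delta>] \<delta> by simp

lemma inv_powr_le_1: "0 \<le> m \<Longrightarrow> 1 \<le> r \<Longrightarrow> r powr (- m) \<le> (1::real)"
proof -
  assume "0 \<le> m" "1 \<le> r"
  then have "1 \<le> r powr m" by (intro ge_one_powr_ge_zero)
  then show ?thesis by (simp add: powr_minus inverse_le_1_iff)
qed

lemma weight_upper: "h < snd y \<Longrightarrow> 0 < weight h m \<omega> y" "h < snd y \<Longrightarrow> weight h m \<omega> y \<le> 1"
proof -
  assume y: "h < snd y"
  have 1: "1 \<le> (snd y)\<^sup>2" using y h_ge_1 by (simp add: one_le_power)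
  have 2: "0 \<le> nearest_dist \<omega> (fst y, h) powr (2 * m)" by simp
  have "1 \<le> (snd y)\<^sup>2 + nearest_dist \<omega> (fst y, h) powr (2 * m)" using 1 2 by linarith
  then show "0 < weight h m \<omega> y" "weight h m \<omega> y \<le> 1"
    using y unfolding weight_def by (simp_all add: inverse_le_1_iff)
qed

lemma weight_fluid: 
  assumes "y \<in> fluid_dom \<omega>" "0 \<le> m"
  shows "0 < weight h m \<omega> y" "weight h m \<omega> y \<le> 1"
proof -
  have i: "1 < infdist y \<omega>" using assms(1) fluid_dom_eq[OF \<omega> \<delta>] by auto
  show "0 < weight h m \<omega> y" "weight h m \<omega> y \<le> 1"
    using weight_upper[of y] i inv_powr_le_1[OF assms(2), of "infdist y \<omega>"]
    by (cases "snd y \<le> h"; force simp: weight_def nearest_dist_def)+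
qed

text \<open>The trace supplies smooth approximants, and the constants are those of
  \<open>upper_hardy_smooth\<close> times the \<open>4\<close> of \<open>sq_limit_le\<close>. The
  term left over lives in the strip up to \<open>h + 1\<close> and carries the layer weight, so
  \<open>slab_hardy\<close> bounds it.\<close>

lemma upper_hardy:
  fixes v :: "'n pt \<Rightarrow> complex"
  defines "D \<equiv> fluid_dom \<omega>"
  assumes m: "0 \<le> m" and q: "0 \<le> q"
    and v[measurable]: "v \<in> borel_measurable borel" "G \<in> borel_measurable borel"
    and t: "has_trace D S v g" and H: "H1loc D v G"
  shows "(LIS (UNIV \<times> {h<..}) (\<lambda>y. ennreal (pw q (fst y)) * ennreal (weight h m \<omega> y) * nsq (v y))) \<le>
    32 * (LIS D (\<lambda>y. ennreal (pw q (fst y)) * nsq (G y))) +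
    4 * ennreal (pi * 2 powr m) * (LIS (D \<inter> UNIV \<times> {..<h + 1}) (\<lambda>y. ennreal (pw q (fst y) * infdist y \<omega> powr (- m)) * nsq (v y)))"
proof (rule nn_integral_exhaust_ball[where c = 0])
  have Do: "open D" unfolding D_def by (rule fluid_dom_open[OF \<omega> \<delta>])
  have inm[measurable]: "(\<lambda>y. infdist y \<omega>) \<in> borel_measurable borel"
    by (intro borel_measurable_continuous_onI continuous_intros)
  note [measurable] = weight_measurable_config
  show "(\<lambda>y. ennreal (pw q (fst y)) * ennreal (weight h m \<omega> y) * nsq (v y)) \<in> borel_measurable borel" by measurable
  show "(UNIV :: (real ^ 'n) set) \<times> {h<..} \<in> sets borel" by (auto intro: borel_Times)
  obtain p where p: "\<And>k::nat. smooth (p k)"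
    "\<And>r. l2conv D r p v"
    "\<And>r. l2conv D r (\<lambda>k. classical_gradient (p k)) G"
    by (rule has_trace_approx[OF Do t H], rule that)
  fix N :: nat
  let ?T = "h + 1 + real N" let ?A = "ball (0 :: real ^ 'n) (real N) \<times> {h<..<?T}" let ?R = "real N + ?T + 1"
  have Am[measurable]: "?A \<in> sets borel" "(UNIV :: (real ^ 'n) set) \<times> {h<..<h + 1} \<in> sets borel" by (auto intro: borel_Times)
  have AD: "?A \<subseteq> D" unfolding D_def using h_ge_1 by (auto intro!: strip_in_fluid_dom[OF \<omega> \<delta>])
  have sub: "?A \<subseteq> D \<inter> ball 0 ?R"
  proof
    fix y assume y: "y \<in> ?A"
    have "norm y \<le> norm (fst y) + norm (snd y)" using norm_Pair_le[of "fst y" "snd y"] by simp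
    also have "\<dots> < ?R" using y h_ge_1 by (auto simp: mem_Times_iff)
    finally show "y \<in> D \<inter> ball 0 ?R" using y AD by auto
  qed
  have pw1: "ennreal (pw q x) \<le> 1" for x :: "real ^ 'n" using pw_le_1[OF q, of x] ennreal_leI by fastforce
  have w1: "ennreal (weight h m \<omega> y) \<le> 1" if "y \<in> ?A" for y
    using weight_upper(2)[of y m] that ennreal_leI by fastforce
  have i1: "ennreal (infdist y \<omega> powr (- m)) \<le> 1" if "y \<in> ?A" for y
    using inv_powr_le_1[OF m infdist_ge1[OF \<omega> \<delta>, of y]] that ennreal_leI by fastforce
  let ?b' = "\<lambda>y. ennreal (pw q (fst y)) * ennreal (infdist y \<omega> powr (- m)) * indicator (UNIV \<times> {h<..<h + 1}) y"
  have "(LIS (UNIV \<times> {h<..} \<inter> ball 0 (real N)) (\<lambda>y. ennreal (pw q (fst y)) * ennreal (weight h m \<omega> y) * nsq (v y))) \<le>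
    (LIS ?A (\<lambda>y. ennreal (pw q (fst y)) * ennreal (weight h m \<omega> y) * nsq (v y)))"
  proof (intro nn_integral_mono)
    fix y
    have "y \<in> ?A" if "y \<in> UNIV \<times> {h<..} \<inter> ball 0 (real N)"
    proof -
      have "norm (fst y) \<le> norm y" "norm (snd y) \<le> norm y" by (metis norm_fst_le prod.collapse, metis norm_snd_le prod.collapse)
      then show ?thesis using that h_ge_1 by (auto simp: mem_Times_iff)
    qed
    then show "ennreal (pw q (fst y)) * ennreal (weight h m \<omega> y) * nsq (v y) * indicator (UNIV \<times> {h<..} \<inter> ball 0 (real N)) y \<le>
      ennreal (pw q (fst y)) * ennreal (weight h m \<omega> y) * nsq (v y) * indicator ?A y"
      by (intro mult_left_mono) (auto simp: indicator_def)
  qed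
  also have "\<dots> \<le> 4 * 8 * (LIS ?A (\<lambda>y. ennreal (pw q (fst y)) * nsq (G y))) +
      4 * ennreal (pi * 2 powr m) * (LIS ?A (\<lambda>y. ?b' y * nsq (v y)))"
  proof (rule sq_limit_le[where p = p and r = "\<lambda>k. classical_gradient (p k)" and e = "\<lambda>k. 0"])
    show "p k \<in> borel_measurable lborel" "classical_gradient (p k) \<in> borel_measurable lborel" for k
      using smooth_measurable[OF p(1)] classical_gradient_measurable[OF p(1)] by auto
    show "(\<lambda>k. \<integral>\<^sup>+y\<in>?A. nsq (p k y - v y) \<partial>lborel) \<longlonglongrightarrow> 0" by (rule sq_tendsto_subset[OF p(2) sub])
    show "(\<lambda>k. \<integral>\<^sup>+y\<in>?A. nsq (classical_gradient (p k) y - G y) \<partial>lborel) \<longlonglongrightarrow> 0" by (rule sq_tendsto_subset[OF p(3) sub])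
    show "(LIS ?A (\<lambda>y. ennreal (pw q (fst y)) * ennreal (weight h m \<omega> y) * nsq (p k y))) \<le>
      0 + 8 * (LIS ?A (\<lambda>y. ennreal (pw q (fst y)) * nsq (classical_gradient (p k) y))) +
      ennreal (pi * 2 powr m) * (LIS ?A (\<lambda>y. ?b' y * nsq (p k y)))" for k
    proof -
      have [measurable]: "(\<lambda>x :: real ^ 'n. ennreal (pw q x)) \<in> borel_measurable borel" by measurable
      show ?thesis
        using upper_hardy_smooth[OF \<omega> \<delta> m p(1)[of k], of ?T "ball 0 (real N)" "\<lambda>x. ennreal (pw q x)"] by simp
    qed
    fix y assume y: "y \<in> ?A"
    show "ennreal (pw q (fst y)) * ennreal (weight h m \<omega> y) \<le> 1"
      using mult_mono[OF pw1 w1[OF y]] by simp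
    show "ennreal (pw q (fst y)) \<le> 1" by (rule pw1)
    show "?b' y \<le> 1"
      using mult_mono[OF pw1[of "fst y"] i1[OF y]] by (auto simp: indicator_def)
  qed (auto simp: ennreal_mult_less_top)
  also have "\<dots> \<le> 32 * (LIS D (\<lambda>y. ennreal (pw q (fst y)) * nsq (G y))) +
    4 * ennreal (pi * 2 powr m) * (LIS (D \<inter> UNIV \<times> {..<h + 1}) (\<lambda>y. ennreal (pw q (fst y) * infdist y \<omega> powr (- m)) * nsq (v y)))"
  proof (rule add_mono)
    show "4 * 8 * (LIS ?A (\<lambda>y. ennreal (pw q (fst y)) * nsq (G y))) \<le> 32 * (LIS D (\<lambda>y. ennreal (pw q (fst y)) * nsq (G y)))"
      using AD by (simp, intro mult_left_mono nn_integral_mono) (auto simp: indicator_def)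
    have "(LIS ?A (\<lambda>y. ?b' y * nsq (v y))) \<le> (LIS (D \<inter> UNIV \<times> {..<h + 1}) (\<lambda>y. ennreal (pw q (fst y) * infdist y \<omega> powr (- m)) * nsq (v y)))"
    proof (rule nn_integral_mono)
    fix y
    have "y \<in> ?A \<Longrightarrow> y \<in> D" using AD by blast
    then show "?b' y * nsq (v y) * indicator ?A y \<le>
      ennreal (pw q (fst y) * infdist y \<omega> powr (- m)) * nsq (v y) * indicator (D \<inter> UNIV \<times> {..<h + 1}) y"
      using pw_pos[of q "fst y"]
      by (cases "y \<in> ?A"; cases "y \<in> UNIV \<times> {h<..<h + 1}") (auto simp: ennreal_mult mem_Times_iff indicator_def)
    qed
    then show "4 * ennreal (pi * 2 powr m) * (LIS ?A (\<lambda>y. ?b' y * nsq (v y))) \<le>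
      4 * ennreal (pi * 2 powr m) * (LIS (D \<inter> UNIV \<times> {..<h + 1}) (\<lambda>y. ennreal (pw q (fst y) * infdist y \<omega> powr (- m)) * nsq (v y)))"
      by (rule mult_left_mono) simp
  qed
  finally show "(LIS (UNIV \<times> {h<..} \<inter> ball 0 (real N)) (\<lambda>y. ennreal (pw q (fst y)) * ennreal (weight h m \<omega> y) * nsq (v y))) \<le>
    32 * (LIS D (\<lambda>y. ennreal (pw q (fst y)) * nsq (G y))) +
    4 * ennreal (pi * 2 powr m) * (LIS (D \<inter> UNIV \<times> {..<h + 1}) (\<lambda>y. ennreal (pw q (fst y) * infdist y \<omega> powr (- m)) * nsq (v y)))" .
qed

text \<open>The slab inequality is used twice, for the layer itself and for the strip term of the
  upper inequality. The constant depends on \<open>m\<close>, \<open>q\<close> and the dimension but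
  not on the configuration, so that the expectation can be taken afterwards.\<close>

lemma path_hardy:
  fixes v :: "'n pt \<Rightarrow> complex" and m q :: real
  defines "d \<equiv> real CARD('n) + 1" and "D \<equiv> fluid_dom \<omega>"
  defines "K \<equiv> 4 * ennreal (2 / (m - 2 - q * real CARD('n) - d + 1))"
  assumes q: "0 \<le> q" and m: "0 \<le> m" and \<kappa>: "0 < m - 2 - q * real CARD('n)" "-1 < m - 2 - q * real CARD('n) - d"
    and v[measurable]: "v \<in> borel_measurable borel" "G \<in> borel_measurable borel"
    and t: "\<And>c. c \<in> \<omega> \<Longrightarrow> has_trace D (sphere_measure c) v (\<lambda>y. 0)" and H: "H1loc D v G"
  shows "(LIS D (\<lambda>y. ennreal (pw q (fst y)) * ennreal (weight h m \<omega> y) * nsq (v y))) \<le>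
    (K + (32 + 4 * ennreal (pi * 2 powr m) * K)) * (LIS D (\<lambda>y. ennreal (pw q (fst y)) * nsq (G y)))"
proof -
  have inm[measurable]: "(\<lambda>y. infdist y \<omega>) \<in> borel_measurable borel"
    by (intro borel_measurable_continuous_onI continuous_intros)
  note [measurable] = weight_measurable_config
  have Dm[measurable]: "D \<in> sets borel" unfolding D_def by (rule fluid_dom_borel[OF \<omega> \<delta>])
  have [measurable]: "(UNIV :: (real ^ 'n) set) \<times> {..<h + 1} \<in> sets borel" "(UNIV :: (real ^ 'n) set) \<times> {h<..} \<in> sets borel" by (auto intro: borel_Times)
  let ?G = "\<integral>\<^sup>+y\<in>D. ennreal (pw q (fst y)) * nsq (G y) \<partial>lborel"
  let ?S = "\<integral>\<^sup>+y\<in>D \<inter> UNIV \<times> {..<h + 1}. ennreal (pw q (fst y) * infdist y \<omega> powr (- m)) * nsq (v y) \<partial>lborel"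
  obtain c where c: "c \<in> \<omega>" using config_nonempty[OF \<omega> \<delta>] by blast
  have S: "?S \<le> K * ?G"
    unfolding K_def d_def D_def using \<kappa> v t H unfolding d_def D_def by (intro slab_hardy[OF \<omega> \<delta> q refl]) auto
  have "(LIS D (\<lambda>y. ennreal (pw q (fst y)) * ennreal (weight h m \<omega> y) * nsq (v y))) \<le>
     (LI y. ennreal (pw q (fst y) * infdist y \<omega> powr (- m)) * nsq (v y) * indicator (D \<inter> UNIV \<times> {..<h + 1}) y +
       ennreal (pw q (fst y)) * ennreal (weight h m \<omega> y) * nsq (v y) * indicator (UNIV \<times> {h<..}) y)"
  proof (intro nn_integral_mono)
    fix y
    show "ennreal (pw q (fst y)) * ennreal (weight h m \<omega> y) * nsq (v y) * indicator D y \<le>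
      ennreal (pw q (fst y) * infdist y \<omega> powr (- m)) * nsq (v y) * indicator (D \<inter> UNIV \<times> {..<h + 1}) y +
       ennreal (pw q (fst y)) * ennreal (weight h m \<omega> y) * nsq (v y) * indicator (UNIV \<times> {h<..}) y"
    proof (cases "snd y \<le> h")
      case True
      then have "weight h m \<omega> y = infdist y \<omega> powr (- m)" by (simp add: weight_def nearest_dist_def)
      then show ?thesis using True pw_pos[of q "fst y"] by (cases "y \<in> D") (auto simp: ennreal_mult mem_Times_iff)
    next
      case False
      then show ?thesis by (cases "y \<in> D") (auto simp: mem_Times_iff)
    qed
  qed
  also have "\<dots> = ?S + (LIS (UNIV \<times> {h<..}) (\<lambda>y. ennreal (pw q (fst y)) * ennreal (weight h m \<omega> y) * nsq (v y)))"
    by (rule nn_integral_add) measurable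
  also have "\<dots> \<le> K * ?G + (32 * ?G + 4 * ennreal (pi * 2 powr m) * ?S)"
    using upper_hardy[OF m q v t[OF c, unfolded D_def] H[unfolded D_def]] unfolding D_def[symmetric]
    by (intro add_mono S)
  also have "\<dots> \<le> K * ?G + (32 * ?G + 4 * ennreal (pi * 2 powr m) * (K * ?G))"
    by (intro add_left_mono mult_left_mono S) auto
  also have "\<dots> = (K + (32 + 4 * ennreal (pi * 2 powr m) * K)) * ?G"
    by (simp add: distrib_right mult.assoc)
  finally show ?thesis .
qed

end

subsection \<open>Traces on horizontal planes\<close>

text \<open>Cauchy-Schwarz with the weights \<open>2^j\<close> and \<open>2^(-j)\<close>; the tail
  of the second from \<open>k\<close> on sums to \<open>2 * (1/2) ^ k\<close>. A weighted sum of
  squared increments thus gives a pointwise limit together with a rate, for traces and for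
  completeness alike.\<close>

lemma fast_sequence_bound:
  fixes a :: "nat \<Rightarrow> 'a::banach"
  assumes s: "\<And>n. (\<Sum>j<n. 2 ^ j * (norm (a (Suc j) - a j))\<^sup>2) \<le> s"
  shows "convergent a" and "(norm (lim a - a k))\<^sup>2 \<le> 2 * (1/2) ^ k * s"
proof -
  have le: "(norm (a n - a k))\<^sup>2 \<le> 2 * (1/2) ^ k * s" if "k \<le> n" for k n
  proof -
    have "norm (a n - a k) \<le> (\<Sum>j=k..<n. norm (a (Suc j) - a j))"
      using sum_norm_le[of "{k..<n}" "\<lambda>j. a (Suc j) - a j"] sum_Suc_diff'[OF that, of a] by simp
    also have "\<dots> = (\<Sum>j=k..<n. sqrt ((1/2) ^ j) * (sqrt (2 ^ j) * norm (a (Suc j) - a j)))"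
    proof (rule sum.cong)
      fix j
      have "sqrt ((1/2) ^ j) * sqrt (2 ^ j) = 1" by (simp add: real_sqrt_mult[symmetric] power_mult_distrib[symmetric])
      then show "norm (a (Suc j) - a j) = sqrt ((1/2) ^ j) * (sqrt (2 ^ j) * norm (a (Suc j) - a j))"
        by (metis mult.assoc mult_1)
    qed simp
    finally have "(norm (a n - a k))\<^sup>2 \<le> (\<Sum>j=k..<n. sqrt ((1/2) ^ j) * (sqrt (2 ^ j) * norm (a (Suc j) - a j)))\<^sup>2"
      by (rule power_mono) simp
    also have "\<dots> \<le> (\<Sum>j=k..<n. (sqrt ((1/2) ^ j))\<^sup>2) * (\<Sum>j=k..<n. (sqrt (2 ^ j) * norm (a (Suc j) - a j))\<^sup>2)"
      by (rule Cauchy_Schwarz_ineq_sum)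
    also have "\<dots> = (\<Sum>j=k..<n. (1/2) ^ j) * (\<Sum>j=k..<n. 2 ^ j * (norm (a (Suc j) - a j))\<^sup>2)"
      by (simp add: power_mult_distrib)
    also have "\<dots> \<le> (2 * (1/2) ^ k) * s"
    proof (rule mult_mono)
      have "(\<Sum>j=k..<n. (1/2) ^ j) = 2 * (1/2) ^ k - 2 * (1/2::real) ^ n"
        using that by (induction rule: dec_induct) (simp_all add: sum.atLeastLessThan_Suc)
      then show "(\<Sum>j=k..<n. (1/2) ^ j) \<le> 2 * (1/2::real) ^ k" by simp
      have "(\<Sum>j=k..<n. 2 ^ j * (norm (a (Suc j) - a j))\<^sup>2) \<le> (\<Sum>j<n. 2 ^ j * (norm (a (Suc j) - a j))\<^sup>2)"
        by (rule sum_mono2) auto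
      then show "(\<Sum>j=k..<n. 2 ^ j * (norm (a (Suc j) - a j))\<^sup>2) \<le> s" using s order_trans by blast
    qed (auto intro: sum_nonneg)
    finally show ?thesis .
  qed
  have "s \<ge> 0" using s[of 0] by simp
  have "Cauchy a"
  proof (rule metric_CauchyI)
    fix e :: real assume e: "0 < e"
    have "(\<lambda>k. 2 * (1/2) ^ k * s) \<longlonglongrightarrow> 2 * 0 * s"
      by (intro tendsto_mult tendsto_const LIMSEQ_power_zero) simp
    moreover have "0 < (e/2)\<^sup>2" using e by simp
    ultimately obtain k where k: "2 * (1/2) ^ k * s < (e/2)\<^sup>2"
      using order_tendstoD(2)[of "\<lambda>k. 2 * (1/2) ^ k * s" "2 * 0 * s" sequentially "(e/2)\<^sup>2"] eventually_happens'[OF sequentially_bot] by auto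
    have "dist (a n) (a k) < e/2" if "k \<le> n" for n
    proof (rule power2_less_imp_less)
      show "(dist (a n) (a k))\<^sup>2 < (e/2)\<^sup>2" using le[OF that] k by (simp add: dist_norm)
    qed (use e in simp)
    then have "dist (a i) (a j) < e" if "k \<le> i" "k \<le> j" for i j
      using dist_triangle_half_l[of "a i" "a k" e "a j"] that by (simp add: dist_commute)
    then show "\<exists>M. \<forall>i\<ge>M. \<forall>j\<ge>M. dist (a i) (a j) < e" by blast
  qed
  then show c: "convergent a" by (rule Cauchy_convergent)
  then have "a \<longlonglongrightarrow> lim a" by (rule convergent_LIMSEQ_iff[THEN iffD1])
  then have "(\<lambda>n. (norm (a n - a k))\<^sup>2) \<longlonglongrightarrow> (norm (lim a - a k))\<^sup>2" by (intro tendsto_intros)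
  then show "(norm (lim a - a k))\<^sup>2 \<le> 2 * (1/2) ^ k * s"
    by (rule LIMSEQ_le_const2) (use le in auto)
qed

text \<open>Where the sum is infinite the second bound is trivially true, whatever value
  \<open>lim\<close> takes there. It therefore holds at every point and can be integrated without an
  exceptional set.\<close>

lemma fast_sequence_bound_nsq:
  fixes a :: "nat \<Rightarrow> 'a::banach"
  defines "S \<equiv> (\<Sum>j. 2 ^ j * nsq (a (Suc j) - a j))"
  shows "S < \<infinity> \<Longrightarrow> convergent a" and "nsq (lim a - a k) \<le> ennreal (2 * (1/2) ^ k) * S"
proof -
  have *: "convergent a \<and> nsq (lim a - a k) \<le> ennreal (2 * (1/2) ^ k) * S" if "S < \<infinity>"
  proof -
    obtain s where s: "S = ennreal s" "0 \<le> s" using \<open>S < \<infinity>\<close> by (cases S) auto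
    have "(\<Sum>j<n. 2 ^ j * (norm (a (Suc j) - a j))\<^sup>2) \<le> s" for n
    proof -
      have "ennreal (\<Sum>j<n. 2 ^ j * (norm (a (Suc j) - a j))\<^sup>2) = (\<Sum>j<n. 2 ^ j * nsq (a (Suc j) - a j))"
        by (subst sum_ennreal[symmetric]) (auto intro!: sum.cong simp: ennreal_mult ennreal_power[symmetric])
      also have "\<dots> \<le> S" unfolding S_def by (rule sum_le_suminf) auto
      finally show ?thesis using s by simp
    qed
    from fast_sequence_bound[OF this] have "convergent a" "(norm (lim a - a k))\<^sup>2 \<le> 2 * (1/2) ^ k * s" by auto
    then show ?thesis using s by (simp add: ennreal_mult[symmetric] ennreal_leI)
  qed
  then show "S < \<infinity> \<Longrightarrow> convergent a" by blast
  show "nsq (lim a - a k) \<le> ennreal (2 * (1/2) ^ k) * S"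
  proof (cases "S < \<infinity>")
    case True then show ?thesis using * by blast
  next
    case False
    then have "S = \<top>" by (simp add: less_top[symmetric])
    then show ?thesis by (simp add: ennreal_mult_top)
  qed
qed

definition avg :: "real \<Rightarrow> real \<Rightarrow> ('n::finite pt \<Rightarrow> complex) \<Rightarrow> real ^ 'n \<Rightarrow> complex" where
  "avg t0 e u x = (1 / e) *\<^sub>R (LINT t|lborel. indicator {t0<..<t0 + e} t *\<^sub>R u (x, t))"

lemma avg_bound:
  fixes w :: "real \<Rightarrow> complex"
  assumes e: "0 < e" and [measurable]: "w \<in> borel_measurable borel"
  shows "nsq ((1 / e) *\<^sub>R (LINT t|lborel. indicator {t0<..<t0 + e} t *\<^sub>R w t)) \<le> ennreal (1 / e) * (LIS {t0<..<t0 + e} (\<lambda>t. nsq (w t)))"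
proof (cases "integrable lborel (\<lambda>t. indicator {t0<..<t0 + e} t *\<^sub>R w t)")
  case True
  let ?I = "indicator {t0<..<t0 + e} :: real \<Rightarrow> ennreal"
  let ?L = "LINT t|lborel. indicator {t0<..<t0 + e} t *\<^sub>R w t"
  have "ennreal (norm ?L) \<le> (LI t. ennreal (norm (indicator {t0<..<t0 + e} t *\<^sub>R w t)))"
    by (rule integral_norm_bound_ennreal[OF True])
  also have "\<dots> = (LI t. ?I t * (ennreal (norm (w t)) * ?I t))"
    by (intro nn_integral_cong) (auto simp: indicator_def)
  finally have "(ennreal (norm ?L))\<^sup>2 \<le> (LI t. ?I t * (ennreal (norm (w t)) * ?I t))\<^sup>2"
    by (intro power_mono) auto
  also have "\<dots> \<le> (LI t. (?I t)\<^sup>2) * (LI t. (ennreal (norm (w t)) * ?I t)\<^sup>2)"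
    by (rule Cauchy_Schwarz_nn_integral[where f = ?I and g = "\<lambda>t. ennreal (norm (w t)) * ?I t"]) measurable
  also have "(LI t. (?I t)\<^sup>2) = (LI t. ?I t)"
    by (intro nn_integral_cong) (auto simp: indicator_def)
  also have "\<dots> = ennreal e" using e by (subst nn_integral_indicator) auto
  also have "(LI t. (ennreal (norm (w t)) * ?I t)\<^sup>2) = (LIS {t0<..<t0 + e} (\<lambda>t. nsq (w t)))"
    by (intro nn_integral_cong) (auto simp: indicator_def ennreal_sq)
  finally have "nsq ?L \<le> ennreal e * (LIS {t0<..<t0 + e} (\<lambda>t. nsq (w t)))" by (simp add: ennreal_sq)
  then have "ennreal ((1/e)\<^sup>2) * nsq ?L \<le> ennreal ((1/e)\<^sup>2) * (ennreal e * (LIS {t0<..<t0 + e} (\<lambda>t. nsq (w t))))"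
    by (rule mult_left_mono) simp
  also have "\<dots> = ennreal ((1/e)\<^sup>2 * e) * (LIS {t0<..<t0 + e} (\<lambda>t. nsq (w t)))"
    using e by (simp add: ennreal_mult mult.assoc)
  also have "(1/e)\<^sup>2 * e = 1 / e" using e by (simp add: power2_eq_square)
  also have "ennreal ((1/e)\<^sup>2) * nsq ?L = nsq ((1 / e) *\<^sub>R ?L)"
    using e by (simp add: power_mult_distrib ennreal_mult[symmetric] power_divide)
  finally show ?thesis .
next
  \<comment> \<open>The Bochner integral is \<open>0\<close> by convention here, so the left-hand
    side vanishes.\<close>
  case False
  then show ?thesis by (simp add: not_integrable_integral_eq)
qed

lemma integrable_of_sq:
  fixes w :: "real \<Rightarrow> complex"
  assumes [measurable]: "w \<in> borel_measurable borel" and fin: "(LIS {a<..<b} (\<lambda>t. nsq (w t))) < \<infinity>"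
  shows "integrable lborel (\<lambda>t. indicator {a<..<b} t *\<^sub>R w t)"
proof (rule integrableI_bounded)
  have "(LI t. ennreal (norm (indicator {a<..<b} t *\<^sub>R w t))) \<le> (LI t. indicator {a<..<b} t + nsq (w t) * indicator {a<..<b} t)"
  proof (intro nn_integral_mono)
    fix t
    have "norm (w t) \<le> 1 + (norm (w t))\<^sup>2"
      using zero_le_power2[of "norm (w t) - 1/2"] by (simp add: power2_eq_square algebra_simps)
    then have "ennreal (norm (w t)) \<le> 1 + nsq (w t)" using ennreal_leI by fastforce
    then show "ennreal (norm (indicator {a<..<b} t *\<^sub>R w t)) \<le> indicator {a<..<b} t + nsq (w t) * indicator {a<..<b} t"
      by (auto simp: indicator_def)
  qed
  also have "\<dots> = emeasure lborel {a<..<b} + (LIS {a<..<b} (\<lambda>t. nsq (w t)))"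
    by (subst nn_integral_add) auto
  also have "\<dots> < \<infinity>" using fin by (cases "a \<le> b") auto
  finally show "(LI t. ennreal (norm (indicator {a<..<b} t *\<^sub>R w t))) < \<infinity>" .
qed measurable

lemma avg_diff_bound:
  fixes u u' :: "'n::finite pt \<Rightarrow> complex"
  assumes e: "0 < e" and m: "(\<lambda>t. u (x, t)) \<in> borel_measurable borel" "(\<lambda>t. u' (x, t)) \<in> borel_measurable borel"
    and fin: "(LIS {t0<..<t0 + e} (\<lambda>t. nsq (u (x, t)))) < \<infinity>" "(LIS {t0<..<t0 + e} (\<lambda>t. nsq (u' (x, t)))) < \<infinity>"
  shows "nsq (avg t0 e u x - avg t0 e u' x) \<le> ennreal (1 / e) * (LIS {t0<..<t0 + e} (\<lambda>t. nsq (u (x, t) - u' (x, t))))"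
proof -
  have "avg t0 e u x - avg t0 e u' x = (1 / e) *\<^sub>R (LINT t|lborel. indicator {t0<..<t0 + e} t *\<^sub>R (u (x, t) - u' (x, t)))"
    unfolding avg_def using integrable_of_sq[OF m(1) fin(1)] integrable_of_sq[OF m(2) fin(2)]
    by (simp add: scaleR_diff_right)
  then show ?thesis using avg_bound[OF e, of "\<lambda>t. u (x, t) - u' (x, t)"] m by simp
qed

text \<open>Along a vertical segment of length at most \<open>e\<close> the squared variation is at
  most \<open>e\<close> times the integral of the squared gradient, by Cauchy-Schwarz; averaging
  over the segment keeps this bound.\<close>

lemma avg_smooth_bound:
  fixes \<phi> :: "'n::finite pt \<Rightarrow> complex"
  assumes e: "0 < e" and sm: "smooth \<phi>"
  shows "nsq (\<phi> (x, t0) - avg t0 e \<phi> x) \<le> ennreal e * (LIS {t0<..<t0 + e} (\<lambda>t. nsq (classical_gradient \<phi> (x, t))))"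
proof -
  have pairm: "(\<lambda>t. (x, t)) \<in> borel_measurable borel" 
    by (intro borel_measurable_continuous_onI continuous_intros)
  have [measurable]: "(\<lambda>t. \<phi> (x, t)) \<in> borel_measurable borel" by (rule measurable_compose[OF pairm smooth_measurable[OF sm]])
  have cg[measurable]: "(\<lambda>t. classical_gradient \<phi> (x, t)) \<in> borel_measurable borel" by (rule measurable_compose[OF pairm classical_gradient_measurable[OF sm]])
  let ?J = "\<integral>\<^sup>+t\<in>{t0<..<t0 + e}. nsq (classical_gradient \<phi> (x, t)) \<partial>lborel"
  have fd: "((\<lambda>t. \<phi> (x, t)) has_vector_derivative frechet_derivative \<phi> (at (x, t)) (0, 1)) (at t)"
     "continuous_on UNIV (\<lambda>t. frechet_derivative \<phi> (at (x, t)) (0, 1))" for t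
    using smooth_line[OF sm, of "(x, 0)" "(0, 1)"] by simp_all
  have pt: "nsq (\<phi> (x, t0) - \<phi> (x, t)) \<le> ennreal e * ?J" if t: "t \<in> {t0<..<t0 + e}" for t
  proof -
    let ?I = "indicator {t0<..<t} :: real \<Rightarrow> ennreal" and ?d = "\<lambda>s. norm (frechet_derivative \<phi> (at (x, s)) (0, 1))"
    have [measurable]: "?d \<in> borel_measurable borel" using borel_measurable_continuous_onI[OF fd(2)] by measurable
    have "ennreal (norm (\<phi> (x, t) - \<phi> (x, t0))) \<le> (LI s. ennreal (?d s) * ?I s)"
      using t by (intro norm_diff_le_line_integral fd) auto
    also have "\<dots> = (LI s. ?I s * (ennreal (?d s) * ?I s))" by (intro nn_integral_cong) (auto simp: indicator_def)
    finally have "(ennreal (norm (\<phi> (x, t) - \<phi> (x, t0))))\<^sup>2 \<le> (LI s. ?I s * (ennreal (?d s) * ?I s))\<^sup>2"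
      by (intro power_mono) auto
    also have "\<dots> \<le> (LI s. (?I s)\<^sup>2) * (LI s. (ennreal (?d s) * ?I s)\<^sup>2)"
      by (rule Cauchy_Schwarz_nn_integral[where f = ?I and g = "\<lambda>s. ennreal (?d s) * ?I s"]) measurable
    also have "\<dots> \<le> ennreal e * ?J"
    proof (intro mult_mono)
      have "(LI s. (?I s)\<^sup>2) = (LI s. ?I s)" by (intro nn_integral_cong) (auto simp: indicator_def)
      also have "\<dots> = ennreal (t - t0)" using t by (subst nn_integral_indicator) auto
      finally show "(LI s. (?I s)\<^sup>2) \<le> ennreal e" using t by (simp add: ennreal_leI)
      show "(LI s. (ennreal (?d s) * ?I s)\<^sup>2) \<le> ?J"
      proof (intro nn_integral_mono)
        fix s
        have "?d s \<le> norm (classical_gradient \<phi> (x, s))"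
          using norm_derivative_le[OF sm, of "(x, s)" "(0, 1)"] by (simp add: norm_Pair)
        then show "(ennreal (?d s) * ?I s)\<^sup>2 \<le> nsq (classical_gradient \<phi> (x, s)) * indicator {t0<..<t0 + e} s"
          using t by (auto simp: indicator_def ennreal_sq intro!: ennreal_leI power_mono)
      qed
    qed auto
    finally show ?thesis by (simp add: ennreal_sq norm_minus_commute)
  qed
  have ci: "integrable lborel (\<lambda>t. indicator {t0<..<t0 + e} t *\<^sub>R \<phi> (x, t))"
  proof -
    have "continuous_on {t0..t0 + e} (\<lambda>t. \<phi> (x, t))"
      by (rule continuous_on_compose2[OF smooth_continuous[OF sm]]) (auto intro!: continuous_intros)
    then have "set_integrable lborel {t0..t0 + e} (\<lambda>t. \<phi> (x, t))" by (rule borel_integrable_atLeastAtMost')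
    moreover have "{t0<..<t0 + e} \<subseteq> {t0..t0 + e}" by (rule greaterThanLessThan_subseteq_atLeastAtMost_iff[THEN iffD2]) simp
    ultimately show ?thesis using set_integrable_subset[OF \<open>set_integrable lborel {t0..t0 + e} (\<lambda>t. \<phi> (x, t))\<close>, of "{t0<..<t0 + e}"]
      by (auto simp: set_integrable_def)
  qed
  have c0: "(LINT t|lborel. indicator {t0<..<t0 + e} t *\<^sub>R \<phi> (x, t0)) = e *\<^sub>R \<phi> (x, t0)"
    using e by simp
  have "\<phi> (x, t0) - avg t0 e \<phi> x = (1 / e) *\<^sub>R (LINT t|lborel. indicator {t0<..<t0 + e} t *\<^sub>R (\<phi> (x, t0) - \<phi> (x, t)))"
    using e ci c0 unfolding avg_def scaleR_diff_right
    by (subst Bochner_Integration.integral_diff) (auto simp: scaleR_diff_right)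
  then have "nsq (\<phi> (x, t0) - avg t0 e \<phi> x) \<le> ennreal (1 / e) * (LIS {t0<..<t0 + e} (\<lambda>t. nsq (\<phi> (x, t0) - \<phi> (x, t))))"
    using avg_bound[OF e, of "\<lambda>t. \<phi> (x, t0) - \<phi> (x, t)" t0] by simp
  also have "\<dots> \<le> ennreal (1 / e) * (LI t. ennreal e * ?J * indicator {t0<..<t0 + e} t)"
    using pt by (intro mult_left_mono nn_integral_mono) (auto simp: indicator_def)
  also have "\<dots> = ennreal (1 / e) * (ennreal e * ?J * ennreal e)"
    using e by (simp add: nn_integral_cmult)
  also have "\<dots> = (ennreal (1 / e) * ennreal e) * (ennreal e * ?J)" by (simp only: mult_ac)
  also have "\<dots> = ennreal e * ?J" using e by (simp add: ennreal_mult[symmetric])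
  finally show ?thesis .
qed

lemma avg_measurable:
  assumes [measurable]: "u \<in> borel_measurable borel"
  shows "avg t0 e u \<in> borel_measurable borel"
proof -
  have u[measurable]: "u \<in> borel_measurable (lborel \<Otimes>\<^sub>M lborel)" using assms by (simp add: lborel_prod)
  have "(\<lambda>x. LINT t|lborel. indicator {t0<..<t0 + e} t *\<^sub>R u (x, t)) \<in> borel_measurable lborel"
    by (rule lborel.borel_measurable_lebesgue_integral) measurable
  then show ?thesis unfolding avg_def[abs_def] by simp
qed

lemma strip_integral:
  fixes f :: "'n::finite pt \<Rightarrow> ennreal" and \<rho> :: "real ^ 'n \<Rightarrow> ennreal"
  assumes f[measurable]: "f \<in> borel_measurable borel" and r[measurable]: "\<rho> \<in> borel_measurable borel"
  shows "(LIS (UNIV \<times> {a<..<b}) (\<lambda>y. \<rho> (fst y) * f y)) = (LI x. \<rho> x * (LIS {a<..<b} (\<lambda>t. f (x, t))))"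
    and "(\<lambda>x. \<integral>\<^sup>+t\<in>{a<..<b}. f (x, t) \<partial>lborel) \<in> borel_measurable borel"
proof -
  have [measurable]: "(UNIV :: (real ^ 'n) set) \<times> {a<..<b} \<in> sets borel" by (auto intro: borel_Times)
  have pairm[measurable]: "(\<lambda>t. (x, t)) \<in> borel_measurable borel" for x :: "real ^ 'n"
    by (intro borel_measurable_continuous_onI continuous_intros)
  have fx[measurable]: "(\<lambda>t. f (x, t)) \<in> borel_measurable borel" for x by (rule measurable_compose[OF pairm f])
  have 1: "(\<lambda>y. \<rho> (fst y) * f y * indicator (UNIV \<times> {a<..<b}) y) \<in> borel_measurable borel" by measurable
  have 2: "(\<lambda>y. f y * indicator (UNIV \<times> {a<..<b}) y) \<in> borel_measurable borel" by measurable
  show "(LIS (UNIV \<times> {a<..<b}) (\<lambda>y. \<rho> (fst y) * f y)) = (LI x. \<rho> x * (LIS {a<..<b} (\<lambda>t. f (x, t))))"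
    by (subst nn_integral_pt(1)[OF 1], intro nn_integral_cong, subst nn_integral_cmult[symmetric])
      (auto simp: indicator_times mult.assoc)
  show "(\<lambda>x. \<integral>\<^sup>+t\<in>{a<..<b}. f (x, t) \<partial>lborel) \<in> borel_measurable borel"
    using nn_integral_pt(2)[OF 2] by (simp add: indicator_times)
qed

lemma nn_integral_lin:
  assumes "f \<in> borel_measurable M" "g \<in> borel_measurable M"
  shows "(\<integral>\<^sup>+x. a * f x + b * g x \<partial>M) = a * (\<integral>\<^sup>+x. f x \<partial>M) + b * (\<integral>\<^sup>+x. g x \<partial>M :: ennreal)"
  using assms by (subst nn_integral_add) (auto simp: nn_integral_cmult)

text \<open>The strips shrink by the factor \<open>1/4\<close>: the squared increments of the
  averages are then of order \<open>4^(-n)\<close> and remain summable against the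
  \<open>2^n\<close> of \<open>fast_sequence_bound_nsq\<close>. Being a limit of explicit integrals,
  the result is jointly measurable when the field depends on a configuration.\<close>

definition trace_lim :: "real \<Rightarrow> real \<Rightarrow> ('n::finite pt \<Rightarrow> complex) \<Rightarrow> real ^ 'n \<Rightarrow> complex" where
  "trace_lim t0 e v x = lim (\<lambda>n. avg t0 (e * (1/4) ^ n) v x)"

lemma trace_lim_measurable:
  assumes "u \<in> borel_measurable borel"
  shows "trace_lim t0 e u \<in> borel_measurable borel"
  unfolding trace_lim_def[abs_def] by (intro borel_measurable_lim_metric avg_measurable assms)

text \<open>The smooth functions \<open>p k\<close> serve as intermediaries: on the plane they are
  compared with the averages of \<open>v\<close>, and letting \<open>k\<close> grow leaves a
  statement about \<open>v\<close> and \<open>G\<close> alone. The weight \<open>\<rho>\<close> is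
  kept general because two are used, the indicator of a ball and the weight of a configuration on
  the unit square of the plane.\<close>

lemma trace_lim_estimates:
  fixes v :: "'n::finite pt \<Rightarrow> complex" and G :: "'n pt \<Rightarrow> 'n cvec" and \<rho> :: "real ^ 'n \<Rightarrow> ennreal"
  defines "J \<equiv> \<lambda>(f :: 'n pt \<Rightarrow> ennreal) t0 e. \<integral>\<^sup>+y\<in>UNIV \<times> {t0<..<t0 + e}. \<rho> (fst y) * f y \<partial>lborel"
  assumes e: "0 < e" and v[measurable]: "v \<in> borel_measurable borel" and G[measurable]: "G \<in> borel_measurable borel"
    and r[measurable]: "\<rho> \<in> borel_measurable borel" and sm: "\<And>k. smooth (p k)"
    and c1: "(\<lambda>k. J (\<lambda>y. nsq (p k y - v y)) t0 e) \<longlonglongrightarrow> 0"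
    and c2: "(\<lambda>k. J (\<lambda>y. nsq (classical_gradient (p k) y - G y)) t0 e) \<longlonglongrightarrow> 0"
    and fin: "J (\<lambda>y. nsq (G y)) t0 e < \<infinity>" "J (\<lambda>y. nsq (v y)) t0 e < \<infinity>"
  shows "(LI x. \<rho> x * nsq (trace_lim t0 e v x)) \<le>
      ennreal (128 * e) * J (\<lambda>y. nsq (G y)) t0 e + ennreal (2 / e) * J (\<lambda>y. nsq (v y)) t0 e"
    and "(\<lambda>k. \<integral>\<^sup>+x. \<rho> x * nsq (p k (x, t0) - trace_lim t0 e v x) \<partial>lborel) \<longlonglongrightarrow> 0"
proof -
  let ?e = "\<lambda>n. e * (1/4) ^ n" let ?A = "\<lambda>n. avg t0 (?e n) v" let ?g = "trace_lim t0 e v"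
  let ?I = "J (\<lambda>y. nsq (G y)) t0 e"
  have en: "0 < ?e n" "?e n \<le> e" for n using e by (auto simp: power_le_one)
  have pairm: "(\<lambda>t. (x, t)) \<in> borel_measurable borel" for x :: "real ^ 'n"
    by (intro borel_measurable_continuous_onI continuous_intros)
  have pairm2: "(\<lambda>x. (x, t0)) \<in> borel_measurable borel" 
    by (intro borel_measurable_continuous_onI continuous_intros)
  have [measurable]: "avg t0 c v \<in> borel_measurable borel" for c by (rule avg_measurable[OF v])
  have [measurable]: "?g \<in> borel_measurable borel" by (rule trace_lim_measurable[OF v])
  have [measurable]: "p k \<in> borel_measurable borel" "classical_gradient (p k) \<in> borel_measurable borel" for k
    using smooth_measurable[OF sm] classical_gradient_measurable[OF sm] by auto
  have [measurable]: "(\<lambda>x. p k (x, t0)) \<in> borel_measurable borel" for k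
    by (rule measurable_compose[OF pairm2 smooth_measurable[OF sm]])
  have vx: "(\<lambda>t. v (x, t)) \<in> borel_measurable borel" for x by (rule measurable_compose[OF pairm v])
  have px: "(\<lambda>t. p k (x, t)) \<in> borel_measurable borel" for x k by (rule measurable_compose[OF pairm smooth_measurable[OF sm]])
  let ?Jx = "\<lambda>f x. \<integral>\<^sup>+t\<in>{t0<..<t0 + e}. f (x, t) \<partial>lborel"
  have Jeq: "J f t0 e = (LI x. \<rho> x * ?Jx f x)" "?Jx f \<in> borel_measurable borel" if "f \<in> borel_measurable borel" for f
    unfolding J_def using strip_integral[OF that r] by auto
  let ?D1 = "\<lambda>k y. nsq (p k y - v y)" let ?D2 = "\<lambda>k y. nsq (classical_gradient (p k) y)"
  have m[measurable]: "?D1 k \<in> borel_measurable borel" "?D2 k \<in> borel_measurable borel" "(\<lambda>y. nsq (v y)) \<in> borel_measurable borel"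
    "(\<lambda>y. nsq (G y)) \<in> borel_measurable borel" "(\<lambda>y. nsq (classical_gradient (p k) y - G y)) \<in> borel_measurable borel" for k by measurable
  note [measurable] = Jeq(2)[OF m(1)] Jeq(2)[OF m(2)] Jeq(2)[OF m(3)]
  \<comment> \<open>Where the strip integral of \<open>v\<close> is infinite the average could be
    the default value of the integral. Up to a null set this happens only where
    \<open>\<rho>\<close> vanishes.\<close>
  have aefin: "AE x in lborel. \<rho> x = 0 \<or> ?Jx (\<lambda>y. nsq (v y)) x < \<infinity>"
  proof -
    have "AE x in lborel. \<rho> x * ?Jx (\<lambda>y. nsq (v y)) x \<noteq> \<infinity>"
      using fin(2) unfolding Jeq(1)[OF m(3)] by (intro nn_integral_PInf_AE) auto
    then show ?thesis by eventually_elim (auto simp: ennreal_mult_eq_top_iff less_top[symmetric])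
  qed
  have pfin: "(LIS {t0<..<t0 + c} (\<lambda>t. nsq (p k (x, t)))) < \<infinity>" for c k x
  proof -
    have "compact ((\<lambda>t. p k (x, t)) ` {t0..t0 + c})"
      by (intro compact_continuous_image continuous_on_compose2[OF smooth_continuous[OF sm]]) (auto intro!: continuous_intros)
    then obtain B where B: "\<And>t. t \<in> {t0..t0 + c} \<Longrightarrow> norm (p k (x, t)) \<le> B"
      using compact_imp_bounded bounded_iff by (metis imageI)
    have "(LIS {t0<..<t0 + c} (\<lambda>t. nsq (p k (x, t)))) \<le> (LI t. ennreal (B\<^sup>2) * indicator {t0<..<t0 + c} t)"
      using B by (intro nn_integral_mono) (auto simp: indicator_def intro!: ennreal_leI power_mono)
    also have "\<dots> = ennreal (B\<^sup>2) * emeasure lborel {t0<..<t0 + c}" by (rule nn_integral_cmult_indicator) simp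
    also have "\<dots> < \<infinity>" by (cases "0 \<le> c") (auto simp: ennreal_mult_less_top)
    finally show ?thesis .
  qed
  define X where "X n k = (LI x. \<rho> x * nsq (p k (x, t0) - ?A n x))" for n k
  \<comment> \<open>Twice the error of \<open>avg_smooth_bound\<close> plus twice the averaged error
    of \<open>p k\<close>. The coefficient \<open>2 / ?e n\<close> grows with \<open>n\<close>, so
    \<open>k\<close> has to tend to infinity at fixed \<open>n\<close>.\<close>
  define Y where "Y n k = ennreal (2 * ?e n) * (2 * J (\<lambda>y. nsq (classical_gradient (p k) y - G y)) t0 e + 2 * ?I) + ennreal (2 / ?e n) * J (?D1 k) t0 e" for n k
  have XY: "X n k \<le> Y n k" for n k
  proof -
    have "X n k \<le> (LI x. ennreal (2 * ?e n) * (\<rho> x * ?Jx (?D2 k) x) + ennreal (2 / ?e n) * (\<rho> x * ?Jx (?D1 k) x))"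
      unfolding X_def
    proof (rule nn_integral_mono_AE, use aefin in eventually_elim)
      fix x assume "\<rho> x = 0 \<or> ?Jx (\<lambda>y. nsq (v y)) x < \<infinity>"
      then show "\<rho> x * nsq (p k (x, t0) - ?A n x) \<le> ennreal (2 * ?e n) * (\<rho> x * ?Jx (?D2 k) x) + ennreal (2 / ?e n) * (\<rho> x * ?Jx (?D1 k) x)"
      proof
        assume "\<rho> x = 0" then show ?thesis by simp
      next
        assume fx: "?Jx (\<lambda>y. nsq (v y)) x < \<infinity>"
        have sub: "(LIS {t0<..<t0 + ?e n} (\<lambda>t. f (x, t))) \<le> ?Jx f x" for f :: "'n pt \<Rightarrow> ennreal"
          using en(2)[of n] by (intro nn_integral_mono) (auto simp: indicator_def)
        have vf: "(LIS {t0<..<t0 + ?e n} (\<lambda>t. nsq (v (x, t)))) < \<infinity>"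
          using sub[of "\<lambda>y. nsq (v y)"] fx by (rule le_less_trans)
        have "nsq (p k (x, t0) - ?A n x) \<le> 2 * nsq (p k (x, t0) - avg t0 (?e n) (p k) x) + 2 * nsq (avg t0 (?e n) (p k) x - ?A n x)"
          using ennreal_norm_add_sq_le[of "p k (x, t0) - avg t0 (?e n) (p k) x" "avg t0 (?e n) (p k) x - ?A n x"] by simp
        also have "\<dots> \<le> 2 * (ennreal (?e n) * ?Jx (?D2 k) x) + 2 * (ennreal (1 / ?e n) * ?Jx (?D1 k) x)"
        proof (intro add_mono mult_left_mono)
          show "nsq (p k (x, t0) - avg t0 (?e n) (p k) x) \<le> ennreal (?e n) * ?Jx (?D2 k) x"
            using avg_smooth_bound[OF en(1) sm, of k x t0 n] sub[of "?D2 k"] by (meson mult_left_mono order_trans zero_le)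
          show "nsq (avg t0 (?e n) (p k) x - ?A n x) \<le> ennreal (1 / ?e n) * ?Jx (?D1 k) x"
            using avg_diff_bound[OF en(1) px vx pfin vf] sub[of "?D1 k"] by (meson mult_left_mono order_trans zero_le)
        qed auto
        also have "\<dots> = ennreal (2 * ?e n) * ?Jx (?D2 k) x + ennreal (2 / ?e n) * ?Jx (?D1 k) x"
        proof -
          have "2 * ennreal c = ennreal (2 * c)" if "0 \<le> c" for c using that by (simp add: ennreal_mult)
          then have "2 * ennreal (?e n) = ennreal (2 * ?e n)" "2 * ennreal (1 / ?e n) = ennreal (2 / ?e n)"
            using en(1)[of n] by (force, metis less_imp_le mult.right_neutral times_divide_eq_right zero_le_divide_1_iff)
          then show ?thesis by (simp only: mult.assoc[symmetric])
        qed
        finally have "\<rho> x * nsq (p k (x, t0) - ?A n x) \<le> \<rho> x * (ennreal (2 * ?e n) * ?Jx (?D2 k) x + ennreal (2 / ?e n) * ?Jx (?D1 k) x)"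
          by (rule mult_left_mono) simp
        then show ?thesis by (simp only: distrib_left mult.left_commute)
      qed
    qed
    also have "\<dots> = ennreal (2 * ?e n) * J (?D2 k) t0 e + ennreal (2 / ?e n) * J (?D1 k) t0 e"
      unfolding Jeq(1)[OF m(1)] Jeq(1)[OF m(2)] by (subst nn_integral_add) (measurable, simp add: nn_integral_cmult)
    also have "J (?D2 k) t0 e \<le> 2 * J (\<lambda>y. nsq (classical_gradient (p k) y - G y)) t0 e + 2 * ?I"
    proof -
      have [measurable]: "(UNIV :: (real ^ 'n) set) \<times> {t0<..<t0 + e} \<in> sets borel" by (auto intro: borel_Times)
      have "J (?D2 k) t0 e \<le> (LI y. 2 * (\<rho> (fst y) * nsq (classical_gradient (p k) y - G y) * indicator (UNIV \<times> {t0<..<t0 + e}) y) +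
          2 * (\<rho> (fst y) * nsq (G y) * indicator (UNIV \<times> {t0<..<t0 + e}) y))"
        unfolding J_def
      proof (intro nn_integral_mono)
        fix y
        have "?D2 k y \<le> 2 * nsq (classical_gradient (p k) y - G y) + 2 * nsq (G y)"
          using ennreal_norm_add_sq_le[of "classical_gradient (p k) y - G y" "G y"] by simp
        then have "\<rho> (fst y) * ?D2 k y \<le> \<rho> (fst y) * (2 * nsq (classical_gradient (p k) y - G y) + 2 * nsq (G y))" by (rule mult_left_mono) simp
        then show "\<rho> (fst y) * ?D2 k y * indicator (UNIV \<times> {t0<..<t0 + e}) y \<le> 2 * (\<rho> (fst y) * nsq (classical_gradient (p k) y - G y) * indicator (UNIV \<times> {t0<..<t0 + e}) y) +
          2 * (\<rho> (fst y) * nsq (G y) * indicator (UNIV \<times> {t0<..<t0 + e}) y)"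
          by (cases "y \<in> UNIV \<times> {t0<..<t0 + e}") (simp_all add: distrib_left mult.left_commute)
      qed
      then show ?thesis unfolding J_def by (simp add: nn_integral_add nn_integral_cmult)
    qed
    finally show ?thesis unfolding Y_def by (simp add: mult_left_mono add_right_mono)
  qed
  have Ylim: "Y n \<longlonglongrightarrow> ennreal (4 * ?e n) * ?I" for n
  proof -
    have "Y n \<longlonglongrightarrow> ennreal (2 * ?e n) * (2 * 0 + 2 * ?I) + ennreal (2 / ?e n) * 0"
      unfolding Y_def by (intro tendsto_add ennreal_tendsto_cmult c1 c2 tendsto_const) auto
    also have "ennreal (2 * ?e n) * (2 * 0 + 2 * ?I) + ennreal (2 / ?e n) * 0 = ennreal (4 * ?e n) * ?I"
    proof -
      have "ennreal (2 * ?e n) * 2 = ennreal (4 * ?e n)" using en(1)[of n] ennreal_mult[of "2 * ?e n" 2] by simp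
      then show ?thesis by (simp add: mult.assoc[symmetric])
    qed
    finally show ?thesis .
  qed
  let ?\<Delta> = "\<lambda>n x. nsq (?A (Suc n) x - ?A n x)"
  have Dn: "(LI x. \<rho> x * ?\<Delta> n x) \<le> ennreal (16 * ?e n) * ?I" for n
  proof -
    have 1: "(LI x. \<rho> x * ?\<Delta> n x) \<le> 2 * Y (Suc n) k + 2 * Y n k" for k
    proof -
      have "(LI x. \<rho> x * ?\<Delta> n x) \<le> (LI x. 2 * (\<rho> x * nsq (p k (x, t0) - ?A (Suc n) x)) + 2 * (\<rho> x * nsq (p k (x, t0) - ?A n x)))"
      proof (intro nn_integral_mono)
        fix x
        have "?\<Delta> n x \<le> 2 * nsq (p k (x, t0) - ?A (Suc n) x) + 2 * nsq (p k (x, t0) - ?A n x)"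
          using ennreal_norm_add_sq_le[of "?A (Suc n) x - p k (x, t0)" "p k (x, t0) - ?A n x"] by (simp add: norm_minus_commute)
        then have "\<rho> x * ?\<Delta> n x \<le> \<rho> x * (2 * nsq (p k (x, t0) - ?A (Suc n) x) + 2 * nsq (p k (x, t0) - ?A n x))" by (rule mult_left_mono) simp
        then show "\<rho> x * ?\<Delta> n x \<le> 2 * (\<rho> x * nsq (p k (x, t0) - ?A (Suc n) x)) + 2 * (\<rho> x * nsq (p k (x, t0) - ?A n x))"
          by (simp only: distrib_left mult.left_commute)
      qed
      also have "\<dots> = 2 * X (Suc n) k + 2 * X n k" unfolding X_def by (rule nn_integral_lin) measurable
      also have "\<dots> \<le> 2 * Y (Suc n) k + 2 * Y n k" by (intro add_mono mult_left_mono XY) auto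
      finally show ?thesis .
    qed
    \<comment> \<open>The quantity to be bounded does not involve \<open>p k\<close>; in the limit
      only the gradient terms \<open>8 * ?e (Suc n)\<close> and \<open>8 * ?e n\<close> remain,
      together at most \<open>16 * ?e n\<close>.\<close>
    have "(\<lambda>k. 2 * Y (Suc n) k + 2 * Y n k) \<longlonglongrightarrow> 2 * (ennreal (4 * ?e (Suc n)) * ?I) + 2 * (ennreal (4 * ?e n) * ?I)"
      by (intro tendsto_add ennreal_tendsto_cmult Ylim) auto
    then have "(LI x. \<rho> x * ?\<Delta> n x) \<le> 2 * (ennreal (4 * ?e (Suc n)) * ?I) + 2 * (ennreal (4 * ?e n) * ?I)"
      by (rule LIMSEQ_le_const) (use 1 in auto)
    also have "\<dots> \<le> 2 * (ennreal (4 * ?e n) * ?I) + 2 * (ennreal (4 * ?e n) * ?I)"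
      using e by (intro add_right_mono mult_left_mono mult_right_mono ennreal_leI) auto
    also have "\<dots> = ennreal (16 * ?e n) * ?I"
    proof -
      have "4 * ennreal (4 * ?e n) = ennreal (16 * ?e n)" using en(1)[of n] ennreal_mult[of 4 "4 * ?e n"] by simp
      then have "ennreal (16 * ?e n) * ?I = (4 * ennreal (4 * ?e n)) * ?I" by (rule arg_cong[where f = "\<lambda>z. z * ?I", OF sym])
      also have "\<dots> = 4 * (ennreal (4 * ?e n) * ?I)" by (rule mult.assoc)
      finally have "ennreal (16 * ?e n) * ?I = 4 * (ennreal (4 * ?e n) * ?I)" .
      moreover have "2 * z + 2 * z = 4 * z" for z :: ennreal by (simp add: distrib_right[symmetric])
      ultimately show ?thesis by simp
    qed
    finally show ?thesis .
  qed
  let ?S = "\<lambda>x. \<Sum>n. 2 ^ n * ?\<Delta> n x"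
  \<comment> \<open>Increments of order \<open>16 * e * (1/4)^n\<close> against \<open>2^n\<close>
    form a geometric series with sum \<open>32 * e\<close>.\<close>
  have SI: "(LI x. \<rho> x * ?S x) \<le> ennreal (32 * e) * ?I"
  proof -
    have "(LI x. \<rho> x * ?S x) = (LI x. (\<Sum>n. \<rho> x * (2 ^ n * ?\<Delta> n x)))"
      by (simp only: ennreal_suminf_cmult)
    also have "\<dots> = (\<Sum>n. \<integral>\<^sup>+x. \<rho> x * (2 ^ n * ?\<Delta> n x) \<partial>lborel)" by (rule nn_integral_suminf) measurable
    also have "\<dots> \<le> (\<Sum>n. ennreal (16 * e * (1/2) ^ n) * ?I)"
    proof (intro suminf_le)
      fix n
      have "(LI x. \<rho> x * (2 ^ n * ?\<Delta> n x)) = 2 ^ n * (LI x. \<rho> x * ?\<Delta> n x)"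
        by (subst nn_integral_cmult[symmetric]) (auto simp: mult_ac)
      also have "\<dots> \<le> 2 ^ n * (ennreal (16 * ?e n) * ?I)" by (intro mult_left_mono Dn) auto
      also have "\<dots> = ennreal (2 ^ n * (16 * ?e n)) * ?I"
        using en(1)[of n] by (simp add: ennreal_mult ennreal_power[symmetric] mult.assoc)
      also have "2 ^ n * (16 * ?e n) = 16 * e * (1/2) ^ n"
      proof -
        have "(2::real) ^ n * (1/4) ^ n = (1/2) ^ n" by (simp add: power_mult_distrib[symmetric])
        then show ?thesis by (simp add: mult_ac)
      qed
      finally show "(LI x. \<rho> x * (2 ^ n * ?\<Delta> n x)) \<le> ennreal (16 * e * (1/2) ^ n) * ?I" .
    qed auto
    also have "\<dots> = (\<Sum>n. ennreal (16 * e * (1/2) ^ n)) * ?I" by (rule ennreal_suminf_multc)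
    also have "(\<Sum>n. ennreal (16 * e * (1/2) ^ n)) = ennreal (32 * e)"
    proof (rule suminf_ennreal_eq)
      show "(\<lambda>n. 16 * e * (1/2) ^ n) sums (32 * e)"
        using sums_mult[OF geometric_sums[of "1/2::real"], of "16 * e"] by simp
    qed (use e in simp)
    finally show ?thesis .
  qed
  have gA: "(LI x. \<rho> x * nsq (?g x - ?A n x)) \<le> ennreal (64 * e * (1/2) ^ n) * ?I" for n
  proof -
    have "(LI x. \<rho> x * nsq (?g x - ?A n x)) \<le> (LI x. ennreal (2 * (1/2) ^ n) * (\<rho> x * ?S x))"
    proof (intro nn_integral_mono)
      fix x
      have "\<rho> x * nsq (?g x - ?A n x) \<le> \<rho> x * (ennreal (2 * (1/2) ^ n) * ?S x)"
        unfolding trace_lim_def by (intro mult_left_mono fast_sequence_bound_nsq(2)) simp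
      then show "\<rho> x * nsq (?g x - ?A n x) \<le> ennreal (2 * (1/2) ^ n) * (\<rho> x * ?S x)" by (simp only: mult.left_commute)
    qed
    also have "\<dots> = ennreal (2 * (1/2) ^ n) * (LI x. \<rho> x * ?S x)" by (rule nn_integral_cmult) measurable
    also have "\<dots> \<le> ennreal (2 * (1/2) ^ n) * (ennreal (32 * e) * ?I)" by (intro mult_left_mono SI) simp
    also have "\<dots> = ennreal (64 * e * (1/2) ^ n) * ?I"
    proof -
      have "ennreal (2 * (1/2) ^ n) * ennreal (32 * e) = ennreal (64 * e * (1/2) ^ n)"
        using e by (subst ennreal_mult[symmetric]) (auto simp: mult_ac)
      then show ?thesis by (simp only: mult.assoc[symmetric])
    qed
    finally show ?thesis .
  qed
  have split: "(LI x. \<rho> x * nsq (f x)) \<le> 2 * (LI x. \<rho> x * nsq (f x - f' x)) + 2 * (LI x. \<rho> x * nsq (f' x))"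
    if [measurable]: "f \<in> borel_measurable borel" "f' \<in> borel_measurable borel" for f f' :: "real ^ 'n \<Rightarrow> complex"
  proof -
    have "(LI x. \<rho> x * nsq (f x)) \<le> (LI x. 2 * (\<rho> x * nsq (f x - f' x)) + 2 * (\<rho> x * nsq (f' x)))"
    proof (intro nn_integral_mono)
      fix x
      have "\<rho> x * nsq (f x) \<le> \<rho> x * (2 * nsq (f x - f' x) + 2 * nsq (f' x))"
        using ennreal_norm_add_sq_le[of "f x - f' x" "f' x"] by (intro mult_left_mono) auto
      then show "\<rho> x * nsq (f x) \<le> 2 * (\<rho> x * nsq (f x - f' x)) + 2 * (\<rho> x * nsq (f' x))"
        by (simp only: distrib_left mult.left_commute)
    qed
    also have "\<dots> = 2 * (LI x. \<rho> x * nsq (f x - f' x)) + 2 * (LI x. \<rho> x * nsq (f' x))"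
      by (subst nn_integral_add) (measurable, simp add: nn_integral_cmult)
    finally show ?thesis .
  qed
  have tw: "2 * (ennreal c * z) = ennreal (2 * c) * z" if "0 \<le> c" for c z
    using that by (simp add: ennreal_mult mult.assoc)
  have A0: "(LI x. \<rho> x * nsq (?A 0 x)) \<le> ennreal (1 / e) * J (\<lambda>y. nsq (v y)) t0 e"
  proof -
    have "(LI x. \<rho> x * nsq (?A 0 x)) \<le> (LI x. ennreal (1 / e) * (\<rho> x * ?Jx (\<lambda>y. nsq (v y)) x))"
    proof (intro nn_integral_mono)
      fix x
      have "\<rho> x * nsq (?A 0 x) \<le> \<rho> x * (ennreal (1 / e) * ?Jx (\<lambda>y. nsq (v y)) x)"
        using avg_bound[OF e vx, of t0 x] by (intro mult_left_mono) (auto simp: avg_def)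
      then show "\<rho> x * nsq (?A 0 x) \<le> ennreal (1 / e) * (\<rho> x * ?Jx (\<lambda>y. nsq (v y)) x)" by (simp only: mult.left_commute)
    qed
    also have "\<dots> = ennreal (1 / e) * J (\<lambda>y. nsq (v y)) t0 e"
      unfolding Jeq(1)[OF m(3)] by (rule nn_integral_cmult) measurable
    finally show ?thesis .
  qed
  have "(LI x. \<rho> x * nsq (?g x)) \<le> 2 * (LI x. \<rho> x * nsq (?g x - ?A 0 x)) + 2 * (LI x. \<rho> x * nsq (?A 0 x))"
    by (rule split) measurable
  also have "\<dots> \<le> 2 * (ennreal (64 * e * (1/2) ^ 0) * ?I) + 2 * (ennreal (1 / e) * J (\<lambda>y. nsq (v y)) t0 e)"
    by (intro add_mono mult_left_mono gA A0) auto
  also have "\<dots> = ennreal (128 * e) * ?I + ennreal (2 / e) * J (\<lambda>y. nsq (v y)) t0 e"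
    using e by (subst (1 2) tw) auto
  finally show "(LI x. \<rho> x * nsq (?g x)) \<le> ennreal (128 * e) * ?I + ennreal (2 / e) * J (\<lambda>y. nsq (v y)) t0 e" .
  have Z: "(LI x. \<rho> x * nsq (p k (x, t0) - ?g x)) \<le> 2 * Y n k + ennreal (128 * e * (1/2) ^ n) * ?I" for n k
  proof -
    have "(LI x. \<rho> x * nsq (p k (x, t0) - ?g x)) \<le> 2 * (LI x. \<rho> x * nsq (p k (x, t0) - ?g x - (?A n x - ?g x))) + 2 * (LI x. \<rho> x * nsq (?A n x - ?g x))"
      by (rule split) measurable
    also have "\<dots> = 2 * X n k + 2 * (LI x. \<rho> x * nsq (?g x - ?A n x))"
      by (simp add: X_def norm_minus_commute)
    also have "\<dots> \<le> 2 * Y n k + 2 * (ennreal (64 * e * (1/2) ^ n) * ?I)" by (intro add_mono mult_left_mono XY gA) auto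
    also have "2 * (ennreal (64 * e * (1/2) ^ n) * ?I) = ennreal (128 * e * (1/2) ^ n) * ?I" using e by (subst tw) (auto simp: mult.assoc)
    finally show ?thesis .
  qed
  show "(\<lambda>k. \<integral>\<^sup>+x. \<rho> x * nsq (p k (x, t0) - ?g x) \<partial>lborel) \<longlonglongrightarrow> 0"
  proof (rule order_tendstoI)
    fix a :: ennreal assume a: "0 < a"
    \<comment> \<open>The limit in \<open>k\<close> of the bound \<open>Z\<close>. Its index
      \<open>n\<close> is fixed first so that it falls below \<open>a\<close>; only then is
      \<open>k\<close> taken large.\<close>
    let ?B = "\<lambda>n. 2 * (ennreal (4 * ?e n) * ?I) + ennreal (128 * e * (1/2) ^ n) * ?I"
    have "(\<lambda>n. 2 * (?I * ennreal (4 * ?e n)) + ?I * ennreal (128 * e * (1/2) ^ n)) \<longlonglongrightarrow> 2 * (?I * ennreal (4 * (e * 0))) + ?I * ennreal (128 * e * 0)"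
      using fin(1) by (intro tendsto_add ennreal_tendsto_cmult tendsto_ennrealI tendsto_mult tendsto_const LIMSEQ_power_zero) auto
    then have "?B \<longlonglongrightarrow> 0" unfolding mult.commute[of ?I] by simp
    then have "\<forall>\<^sub>F n in sequentially. ?B n < a" using a by (intro order_tendstoD(2)) auto
    then obtain n where n: "?B n < a" using eventually_happens'[OF sequentially_bot] by blast
    have "(\<lambda>k. 2 * Y n k + ennreal (128 * e * (1/2) ^ n) * ?I) \<longlonglongrightarrow> ?B n"
      by (intro tendsto_add ennreal_tendsto_cmult Ylim tendsto_const) auto
    then have "\<forall>\<^sub>F k in sequentially. 2 * Y n k + ennreal (128 * e * (1/2) ^ n) * ?I < a" using n by (rule order_tendstoD(2))
    then show "\<forall>\<^sub>F k in sequentially. (LI x. \<rho> x * nsq (p k (x, t0) - ?g x)) < a"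
      by eventually_elim (use Z le_less_trans in blast)
  qed simp
qed

lemma has_trace_cong:
  assumes "\<And>y. y \<in> D \<Longrightarrow> v y = v' y"
  shows "has_trace D S v g \<longleftrightarrow> has_trace D S v' g"
proof -
  have "H1loc D v G \<longleftrightarrow> H1loc D v' G" for G using assms by (intro H1loc_cong) auto
  moreover have "lsq D r (\<lambda>y. \<phi> y - v y) = lsq D r (\<lambda>y. \<phi> y - v' y)" for \<phi> r
    using assms by (intro nn_integral_cong) (auto simp: indicator_def)
  ultimately show ?thesis unfolding has_trace_def by simp
qed

lemma plane_nn_integral:
  fixes f :: "'n::finite pt \<Rightarrow> ennreal"
  assumes "f \<in> borel_measurable borel"
  shows "(\<integral>\<^sup>+y. f y \<partial>plane_measure t0) = (LI x. f (x, t0))"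
  unfolding plane_measure_def using assms
  by (subst nn_integral_distr) (auto intro!: borel_measurable_continuous_onI continuous_intros)

lemma sets_plane_measure[measurable_cong]: "sets (plane_measure t0) = sets borel"
  by (simp add: plane_measure_def)

lemma sets_sphere_measure: "sets (sphere_measure c) = sets borel"
  by (simp add: sphere_measure_def)

context
  fixes D :: "'n::finite pt set" and t0 e r :: real and v :: "'n pt \<Rightarrow> complex" and G :: "'n pt \<Rightarrow> 'n cvec"
    and \<rho> :: "real ^ 'n \<Rightarrow> ennreal"
  assumes D: "open D" and e: "0 < e" and strip: "UNIV \<times> {t0<..<t0 + e} \<subseteq> D"
    and v[measurable]: "v \<in> borel_measurable borel" and G[measurable]: "G \<in> borel_measurable borel"
    and r[measurable]: "\<rho> \<in> borel_measurable borel" and \<rho>1: "\<And>x. \<rho> x \<le> indicator (ball 0 r) x"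
    and H: "H1loc D v G"
begin

text \<open>The weight vanishes off a ball, so integrals over the unbounded strip reduce to a
  bounded part of \<open>D\<close>, where the approximants converge and the field is square
  integrable.\<close>

lemma strip_weight_le:
  "(LIS (UNIV \<times> {t0<..<t0 + e}) (\<lambda>y. \<rho> (fst y) * f y)) \<le> (LIS (D \<inter> ball 0 (r + \<bar>t0\<bar> + e)) f)"
proof (intro nn_integral_mono)
  fix y :: "'n pt"
  show "\<rho> (fst y) * f y * indicator (UNIV \<times> {t0<..<t0 + e}) y \<le> f y * indicator (D \<inter> ball 0 (r + \<bar>t0\<bar> + e)) y"
  proof (cases "fst y \<in> ball 0 r \<and> y \<in> UNIV \<times> {t0<..<t0 + e}")
    case True
    have "norm y \<le> norm (fst y) + norm (snd y)" using norm_Pair_le[of "fst y" "snd y"] by simp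
    also have "\<dots> < r + \<bar>t0\<bar> + e" using True e by (auto simp: mem_Times_iff)
    finally have "y \<in> D \<inter> ball 0 (r + \<bar>t0\<bar> + e)" using True strip by auto
    moreover have "\<rho> (fst y) * f y \<le> 1 * f y" using \<rho>1[of "fst y"] True by (intro mult_right_mono) auto
    ultimately show ?thesis using True by simp
  next
    case False
    then have "\<rho> (fst y) = 0 \<or> y \<notin> UNIV \<times> {t0<..<t0 + e}" using \<rho>1[of "fst y"] by (auto simp: indicator_def split: if_splits)
    then show ?thesis by auto
  qed
qed

lemma plane_trace_bound:
  assumes t: "has_trace D S v g0"
  shows "(LI x. \<rho> x * nsq (trace_lim t0 e v x)) \<le>
      ennreal (128 * e) * (LIS (UNIV \<times> {t0<..<t0 + e}) (\<lambda>y. \<rho> (fst y) * nsq (G y)))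
      + ennreal (2 / e) * (LIS (UNIV \<times> {t0<..<t0 + e}) (\<lambda>y. \<rho> (fst y) * nsq (v y)))"
    and "(\<And>k. smooth (p k)) \<Longrightarrow> (\<And>r. l2conv D r p v) \<Longrightarrow>
      (\<And>r. l2conv D r (\<lambda>k. classical_gradient (p k)) G) \<Longrightarrow>
      (\<lambda>k. \<integral>\<^sup>+x. \<rho> x * nsq (p k (x, t0) - trace_lim t0 e v x) \<partial>lborel) \<longlonglongrightarrow> 0"
proof -
  have sq0: "(\<lambda>k. \<integral>\<^sup>+y\<in>UNIV \<times> {t0<..<t0 + e}. \<rho> (fst y) * f k y \<partial>lborel) \<longlonglongrightarrow> 0"
    if "\<And>r. (\<lambda>k. \<integral>\<^sup>+y\<in>D \<inter> ball 0 r. f k y \<partial>lborel) \<longlonglongrightarrow> 0" for f :: "nat \<Rightarrow> 'n pt \<Rightarrow> ennreal"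
    by (rule tendsto_sandwich[OF always_eventually always_eventually tendsto_const that[of "r + \<bar>t0\<bar> + e"]])
      (auto intro: strip_weight_le)
  have fin: "(LIS (UNIV \<times> {t0<..<t0 + e}) (\<lambda>y. \<rho> (fst y) * nsq (v y))) < \<infinity>"
     "(LIS (UNIV \<times> {t0<..<t0 + e}) (\<lambda>y. \<rho> (fst y) * nsq (G y))) < \<infinity>"
    by (rule le_less_trans[OF strip_weight_le], use H in \<open>simp add: H1loc_def L2loc_def\<close>)+
  show "(\<lambda>k. \<integral>\<^sup>+x. \<rho> x * nsq (p k (x, t0) - trace_lim t0 e v x) \<partial>lborel) \<longlonglongrightarrow> 0"
    if "\<And>k. smooth (p k)" "\<And>r. l2conv D r p v"
      "\<And>r. l2conv D r (\<lambda>k. classical_gradient (p k)) G"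
    by (rule trace_lim_estimates(2)[OF e v G r that(1) sq0[OF that(2)] sq0[OF that(3)] fin(2,1)])
  obtain p where p: "\<And>k::nat. smooth (p k)"
    "\<And>r. l2conv D r p v"
    "\<And>r. l2conv D r (\<lambda>k. classical_gradient (p k)) G"
    by (rule has_trace_approx[OF D t H], rule that)
  show "(LI x. \<rho> x * nsq (trace_lim t0 e v x)) \<le>
      ennreal (128 * e) * (LIS (UNIV \<times> {t0<..<t0 + e}) (\<lambda>y. \<rho> (fst y) * nsq (G y)))
      + ennreal (2 / e) * (LIS (UNIV \<times> {t0<..<t0 + e}) (\<lambda>y. \<rho> (fst y) * nsq (v y)))"
    by (rule trace_lim_estimates(1)[OF e v G r p(1) sq0[OF p(2)] sq0[OF p(3)] fin(2,1)])
qed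

end

text \<open>Along every approximating sequence the restrictions to the plane converge to
  \<open>trace_lim t0 e v\<close>, which depends on \<open>v\<close> alone. Existence of the trace
  and its uniqueness are two readings of this.\<close>

lemma plane_trace:
  fixes D :: "'n::finite pt set"
  assumes D: "open D" and e: "0 < e" and strip: "UNIV \<times> {t0<..<t0 + e} \<subseteq> D"
    and v[measurable]: "v \<in> borel_measurable borel" and G: "G \<in> borel_measurable borel" and H: "H1loc D v G"
    and t: "has_trace D S v g0"
  shows "has_trace D (plane_measure t0) v (\<lambda>y. trace_lim t0 e v (fst y))"
    and "has_trace D (plane_measure t0) v (\<lambda>y. g (fst y)) \<Longrightarrow> AE x in lborel. g x = trace_lim t0 e v x"
proof -
  let ?g = "trace_lim t0 e v"
  have [measurable]: "?g \<in> borel_measurable borel" by (rule trace_lim_measurable[OF v])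
  have pairm2: "(\<lambda>x :: real ^ 'n. (x, t0)) \<in> borel_measurable borel" 
    by (intro borel_measurable_continuous_onI continuous_intros)
  have bm[measurable]: "ball 0 r \<in> sets borel" for r :: real and z :: "'n pt" by simp
  have bm2[measurable]: "indicator (ball (0 :: real ^ 'n) r) \<in> borel_measurable borel" for r
    by (rule borel_measurable_indicator) simp
  have conv: "(\<lambda>k. \<integral>\<^sup>+x. indicator (ball (0 :: real ^ 'n) r) x * nsq (p k (x, t0) - ?g x) \<partial>lborel) \<longlonglongrightarrow> 0"
    if "\<And>k. smooth (p k)" "\<And>r. l2conv D r p v"
      "\<And>r. l2conv D r (\<lambda>k. classical_gradient (p k)) G" for p :: "nat \<Rightarrow> 'n pt \<Rightarrow> complex" and r
    by (rule plane_trace_bound(2)[OF D e strip v G bm2 order_refl H t that])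
  have gm: "(\<lambda>y :: 'n pt. ?g (fst y)) \<in> borel_measurable borel" by measurable
  show "has_trace D (plane_measure t0) v (\<lambda>y. ?g (fst y))"
  proof -
    obtain p where p: "\<And>k::nat. smooth (p k)"
      "\<And>r. l2conv D r p v"
      "\<And>r. l2conv D r (\<lambda>k. classical_gradient (p k)) G"
      by (rule has_trace_approx[OF D t H], rule that)
    note [measurable] = smooth_measurable[OF p(1)]
    show ?thesis unfolding has_trace_def
    proof (intro conjI exI allI)
      show "(\<lambda>y. ?g (fst y)) \<in> borel_measurable (plane_measure t0)" using gm by (simp add: measurable_cong_sets[OF sets_plane_measure refl])
      show "H1loc D v G" by fact
      show "smooth (p k)" for k by (rule p)
      fix r
      show "l2conv D r p v" by (rule p)
      show "l2conv D r (\<lambda>k. classical_gradient (p k)) G" by (rule p)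
      show "(\<lambda>k. \<integral>\<^sup>+y\<in>ball (0 :: 'n pt) r. nsq (p k y - ?g (fst y)) \<partial>plane_measure t0) \<longlonglongrightarrow> 0"
      proof (rule tendsto_sandwich[OF always_eventually always_eventually tendsto_const conv[OF p, of r]])
        let ?PI = "\<lambda>k. \<integral>\<^sup>+y\<in>ball (0 :: 'n pt) r. nsq (p k y - ?g (fst y)) \<partial>plane_measure t0"
        let ?XI = "\<lambda>k. \<integral>\<^sup>+x. indicator (ball (0 :: real ^ 'n) r) x * nsq (p k (x, t0) - ?g x) \<partial>lborel"
        show "\<forall>k. ?PI k \<le> ?XI k"
        proof
          fix k
          have [measurable]: "indicator (ball (0 :: 'n pt) r) \<in> borel_measurable borel" by (rule borel_measurable_indicator) simp
          have m: "(\<lambda>y. nsq (p k y - ?g (fst y)) * indicator (ball 0 r) y) \<in> borel_measurable borel" by measurable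
          have "(\<integral>\<^sup>+y\<in>ball (0 :: 'n pt) r. nsq (p k y - ?g (fst y)) \<partial>plane_measure t0) = (LI x. nsq (p k (x, t0) - ?g x) * indicator (ball 0 r) (x, t0))"
            using plane_nn_integral[OF m] by simp
          also have "\<dots> \<le> (LI x. indicator (ball (0 :: real ^ 'n) r) x * nsq (p k (x, t0) - ?g x))"
          proof (intro nn_integral_mono)
            fix x :: "real ^ 'n"
            have "norm x \<le> norm (x, t0)" by (metis norm_fst_le)
            then have "indicator (ball 0 r) (x, t0) \<le> (indicator (ball 0 r) x :: ennreal)" by (auto simp: indicator_def)
            then show "nsq (p k (x, t0) - ?g x) * indicator (ball 0 r) (x, t0) \<le> indicator (ball (0 :: real ^ 'n) r) x * nsq (p k (x, t0) - ?g x)"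
              by (subst mult.commute) (rule mult_right_mono, auto)
          qed
          finally show "(\<integral>\<^sup>+y\<in>ball (0 :: 'n pt) r. nsq (p k y - ?g (fst y)) \<partial>plane_measure t0) \<le> (LI x. indicator (ball (0 :: real ^ 'n) r) x * nsq (p k (x, t0) - ?g x))" .
        qed
      qed simp
    qed
  qed
  show "AE x in lborel. g x = ?g x" if t': "has_trace D (plane_measure t0) v (\<lambda>y. g (fst y))"
  proof -
    have "(\<lambda>y :: 'n pt. g (fst y)) \<in> borel_measurable borel"
      using conjunct1[OF t'[unfolded has_trace_def]] by (simp add: measurable_cong_sets[OF sets_plane_measure refl])
    from measurable_compose[OF pairm2 this] have [measurable]: "g \<in> borel_measurable borel" by simp
    obtain p where p: "\<And>k::nat. smooth (p k)"
      "\<And>r. l2conv D r p v"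
      "\<And>r. l2conv D r (\<lambda>k. classical_gradient (p k)) G"
      "\<And>r. (\<lambda>k. \<integral>\<^sup>+y\<in>ball (0 :: 'n pt) r. nsq (p k y - g (fst y)) \<partial>plane_measure t0) \<longlonglongrightarrow> 0"
      by (rule has_trace_approx[OF D t' H], rule that)
    have [measurable]: "p k \<in> borel_measurable borel" for k by (rule smooth_measurable[OF p(1)])
    have pm[measurable]: "(\<lambda>x. p k (x, t0)) \<in> borel_measurable borel" for k
      by (rule measurable_compose[OF pairm2 smooth_measurable[OF p(1)]])
    \<comment> \<open>Convergence on the plane is local, so the two limits are compared ball by
      ball; a ball of the plane lies in a larger ball of the space.\<close>
    have "AE x in lborel. x \<in> ball 0 (real N) \<longrightarrow> g x = ?g x" for N :: nat
    proof -
      let ?R = "real N + \<bar>t0\<bar> + 1"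
      have [measurable]: "indicator (ball (0 :: 'n pt) ?R) \<in> borel_measurable borel" by (rule borel_measurable_indicator) simp
      have m: "(\<lambda>y. nsq (p k y - g (fst y)) * indicator (ball 0 ?R) y) \<in> borel_measurable borel" for k by measurable
      let ?B = "indicator (ball 0 (real N)) :: real ^ 'n \<Rightarrow> ennreal"
      have c1: "(\<lambda>k. \<integral>\<^sup>+x. ?B x * nsq (p k (x, t0) - g x) \<partial>lborel) \<longlonglongrightarrow> 0"
      proof (rule tendsto_sandwich[OF always_eventually always_eventually tendsto_const p(4)[of ?R]])
        show "\<forall>k. (LI x. ?B x * nsq (p k (x, t0) - g x)) \<le> (\<integral>\<^sup>+y\<in>ball 0 ?R. nsq (p k y - g (fst y)) \<partial>plane_measure t0)"
        proof
          fix k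
          have "(LI x. ?B x * nsq (p k (x, t0) - g x)) \<le> (LI x. nsq (p k (x, t0) - g x) * indicator (ball 0 ?R) (x, t0))"
          proof (intro nn_integral_mono)
            fix x :: "real ^ 'n"
            have "norm (x, t0) \<le> norm x + norm t0" by (rule norm_Pair_le)
            then have "?B x \<le> indicator (ball 0 ?R) (x, t0)" by (auto simp: indicator_def)
            then show "?B x * nsq (p k (x, t0) - g x) \<le> nsq (p k (x, t0) - g x) * indicator (ball 0 ?R) (x, t0)"
              by (subst (2) mult.commute) (rule mult_right_mono, auto)
          qed
          also have "\<dots> = (\<integral>\<^sup>+y\<in>ball 0 ?R. nsq (p k y - g (fst y)) \<partial>plane_measure t0)" using plane_nn_integral[OF m] by simp
          finally show "(LI x. ?B x * nsq (p k (x, t0) - g x)) \<le> (\<integral>\<^sup>+y\<in>ball 0 ?R. nsq (p k y - g (fst y)) \<partial>plane_measure t0)" .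
        qed
      qed simp
      have "(LI x. ?B x * nsq (g x - ?g x)) \<le> 2 * (LI x. ?B x * nsq (p k (x, t0) - g x)) + 2 * (LI x. ?B x * nsq (p k (x, t0) - ?g x))" for k
      proof -
        have "(LI x. ?B x * nsq (g x - ?g x)) \<le> (LI x. 2 * (?B x * nsq (p k (x, t0) - g x)) + 2 * (?B x * nsq (p k (x, t0) - ?g x)))"
        proof (intro nn_integral_mono)
          fix x
          have "nsq (g x - ?g x) \<le> 2 * nsq (p k (x, t0) - g x) + 2 * nsq (p k (x, t0) - ?g x)"
            using ennreal_norm_add_sq_le[of "g x - p k (x, t0)" "p k (x, t0) - ?g x"] by (simp add: norm_minus_commute)
          then show "?B x * nsq (g x - ?g x) \<le> 2 * (?B x * nsq (p k (x, t0) - g x)) + 2 * (?B x * nsq (p k (x, t0) - ?g x))"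
            by (auto simp: indicator_def)
        qed
        also have "\<dots> = 2 * (LI x. ?B x * nsq (p k (x, t0) - g x)) + 2 * (LI x. ?B x * nsq (p k (x, t0) - ?g x))"
          by (rule nn_integral_lin) measurable
        finally show ?thesis .
      qed
      moreover have "(\<lambda>k. 2 * (LI x. ?B x * nsq (p k (x, t0) - g x)) + 2 * (LI x. ?B x * nsq (p k (x, t0) - ?g x))) \<longlonglongrightarrow> 2 * 0 + 2 * 0"
        by (intro tendsto_add ennreal_tendsto_cmult c1 conv[OF p(1,2,3)]) auto
      ultimately have "(LI x. ?B x * nsq (g x - ?g x)) \<le> 2 * 0 + 2 * 0"
        by (intro LIMSEQ_le_const[where X = "\<lambda>k. 2 * (LI x. ?B x * nsq (p k (x, t0) - g x)) + 2 * (LI x. ?B x * nsq (p k (x, t0) - ?g x))"]) auto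
      then have "(LI x. ?B x * nsq (g x - ?g x)) = 0" by simp
      then have "AE x in lborel. ?B x * nsq (g x - ?g x) = 0" by (subst (asm) nn_integral_0_iff_AE) auto
      then show ?thesis by eventually_elim (auto simp: indicator_def split: if_splits)
    qed
    then have "AE x in lborel. \<forall>N::nat. x \<in> ball 0 (real N) \<longrightarrow> g x = ?g x" unfolding AE_all_countable by blast
    then show ?thesis
    proof eventually_elim
      fix x assume *: "\<forall>N::nat. x \<in> ball 0 (real N) \<longrightarrow> g x = ?g x"
      obtain N :: nat where "norm x < real N" using reals_Archimedean2 by blast
      then show "g x = ?g x" using *[rule_format, of N] by simp
    qed
  qed
qed

section \<open>The polynomial weight against the unit square\<close>

lemma pw_integrable:
  assumes "1 < q"
  shows "(LI x. ennreal (pw q (x :: real ^ 'n::finite))) < \<infinity>"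
proof -
  let ?f = "\<lambda>t::real. ennreal ((1 + \<bar>t\<bar>) powr (- q))"
  have half: "(LI t. ?f t * indicator {0..} t) < \<infinity>"
  proof -
    have "(LI t. ?f t * indicator {0..} t) = (LI t. ennreal ((1 + t) powr (- q)) * indicator {0..} t)"
      by (intro nn_integral_cong) (auto simp: indicator_def)
    also have "\<dots> = ennreal (0 - (1 + 0) powr (1 - q) / (1 - q))"
    proof (rule nn_integral_FTC_atLeast)
      fix t :: real assume t: "0 \<le> t"
      show "((\<lambda>t. (1 + t) powr (1 - q) / (1 - q)) has_real_derivative (1 + t) powr (- q)) (at t)"
      proof -
        have "((\<lambda>t. 1 + t) has_real_derivative 1) (at t)" by (auto intro!: derivative_eq_intros)
        from DERIV_cdivide[OF DERIV_fun_powr[OF this, of "1 - q"], of "1 - q"] show ?thesis using t assms by simp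
      qed
    next
      have "((\<lambda>t. (1 + t) powr (1 - q)) \<longlongrightarrow> 0) at_top"
        using assms by (intro tendsto_neg_powr filterlim_tendsto_add_at_top[OF tendsto_const filterlim_ident]) auto
      then show "((\<lambda>t. (1 + t) powr (1 - q) / (1 - q)) \<longlongrightarrow> 0) at_top"
        using tendsto_divide[OF _ tendsto_const, of "\<lambda>t. (1 + t) powr (1 - q)" 0 at_top "1 - q"] assms by simp
    qed auto
    finally show ?thesis by simp
  qed
  have "(LI t. ?f t) \<le> (LI t. ?f t * indicator {0..} t + ?f (- t) * indicator {0..} (- t))"
    by (intro nn_integral_mono) (auto simp: indicator_def)
  also have "\<dots> = (LI t. ?f t * indicator {0..} t) + (LI t. ?f (- t) * indicator {0..} (- t))"
    by (rule nn_integral_add) measurable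
  also have "(LI t. ?f (- t) * indicator {0..} (- t)) = (LI t. ?f t * indicator {0..} t)"
    using nn_integral_real_affine[of "\<lambda>t. ?f t * indicator {0..} t" "-1" 0] by simp
  finally have "(LI t. ?f t) \<le> 2 * (LI t. ?f t * indicator {0..} t)" by (simp add: mult_2)
  moreover have "2 * (LI t. ?f t * indicator {0..} t) < \<infinity>" using half by (auto simp: ennreal_mult_less_top)
  ultimately have one: "(LI t. ?f t) < \<infinity>" by (rule le_less_trans)
  have "(LI x. ennreal (pw q (x :: real ^ 'n))) = (\<integral>\<^sup>+x. (\<Prod>b\<in>Basis. ?f (x \<bullet> b)) \<partial>(lborel :: (real ^ 'n) measure))"
  proof (intro nn_integral_cong)
    fix x :: "real ^ 'n"
    have "(\<Prod>b\<in>(Basis :: (real ^ 'n) set). ?f (x \<bullet> b)) = (\<Prod>i\<in>UNIV. ?f (x $ i))"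
    proof -
      have B: "(Basis :: (real ^ 'n) set) = (\<lambda>i. axis i 1) ` UNIV" by (auto simp: Basis_vec_def)
      have "inj (\<lambda>i::'n. axis i (1::real))" by (auto simp: inj_on_def axis_eq_axis)
      then show ?thesis unfolding B by (subst prod.reindex) (auto simp: inner_axis)
    qed
    then show "ennreal (pw q x) = (\<Prod>b\<in>Basis. ?f (x \<bullet> b))" by (simp add: pw_def prod_ennreal)
  qed
  also have "\<dots> = (\<Prod>b\<in>(Basis :: (real ^ 'n) set). (LI t. ?f t))"
    by (rule nn_integral_lborel_prod) auto
  also have "\<dots> < \<infinity>" using one by (simp add: less_top[symmetric] power_eq_top_ennreal)
  finally show ?thesis .
qed

lemma square_bound: "x \<in> square 1 \<Longrightarrow> \<bar>x $ i\<bar> < 1 / 2"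
  unfolding square_def by (auto simp: mem_box_cart abs_if) (smt (verit) field_sum_of_halves)+

lemma square_bound': "x \<in> square 1 \<Longrightarrow> \<bar>x $ i\<bar> \<le> 2 - 1"
  using square_bound[of x i] by linarith

lemma emeasure_square: "emeasure lborel (square 1 :: (real ^ 'n::finite) set) = 1"
proof -
  have "emeasure lborel (square 1 :: (real ^ 'n) set) = ennreal (\<Prod>b\<in>Basis. ((\<chi> i. 1 / 2) - (\<chi> i. - 1 / 2)) \<bullet> (b :: real ^ 'n))"
    unfolding square_def by (subst emeasure_lborel_box_eq) (auto simp: Basis_vec_def inner_axis)
  also have "(\<Prod>b\<in>Basis. ((\<chi> i. 1 / 2) - (\<chi> i. - 1 / 2)) \<bullet> (b :: real ^ 'n)) = 1"
    by (intro prod.neutral) (auto simp: Basis_vec_def inner_axis)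
  finally show ?thesis by simp
qed

lemma square_borel[measurable]: "square r \<in> sets borel"
  by (simp add: square_def)

text \<open>The translates of the unit square form a continuous partition of unity, so
  \<open>pw q x\<close> is at most a constant times the integral of \<open>pw q z\<close> over those
  \<open>z\<close> whose translated square contains \<open>x\<close>. After exchanging the integrals
  each square contributes at most \<open>A\<close>, and the total mass of \<open>pw q\<close>
  remains as a factor.\<close>

lemma weighted_integral_le_square:
  fixes F :: "'n::finite pt \<Rightarrow> ennreal"
  assumes F[measurable]: "F \<in> borel_measurable borel" and q: "0 \<le> q"
    and le: "\<And>z. (LIS (square 1 \<times> UNIV) (\<lambda>y. F (y + (z, 0)))) \<le> A"
  shows "(LI y. ennreal (pw q (fst y)) * F y) \<le> ennreal (2 powr (q * real CARD('n))) * (LI x. ennreal (pw q (x :: real ^ 'n))) * A"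
proof -
  let ?C = "2 powr (q * real CARD('n))"
  have sqm[measurable]: "(indicator (square 1) :: real ^ 'n \<Rightarrow> ennreal) \<in> borel_measurable borel" by measurable
  have vol: "(LI z. indicator (square 1) (x - z)) = (1 :: ennreal)" for x :: "real ^ 'n"
  proof -
    have "(LI z. indicator (square 1) (x - z)) = (\<integral>\<^sup>+z. indicator (square 1) z \<partial>(lborel :: (real ^ 'n) measure) :: ennreal)"
      by (subst lborel_affine[of "-1" x], simp, subst nn_integral_density, simp, simp, subst nn_integral_distr) (auto simp: algebra_simps)
    then show ?thesis by (simp add: emeasure_square)
  qed
  \<comment> \<open>The coordinates of \<open>x\<close> and \<open>z\<close> differ by less than
    \<open>1/2\<close>, so \<open>pw_compare\<close> applies with \<open>r = 2\<close>, for which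
    \<open>r - 1 = 1\<close>.\<close>
  have key: "ennreal (pw q x) \<le> (LI z. ennreal ?C * (ennreal (pw q z) * indicator (square 1) (x - z)))" for x :: "real ^ 'n"
  proof -
    have "ennreal (pw q x) = (LI z. ennreal (pw q x) * indicator (square 1) (x - z))"
      by (subst nn_integral_cmult) (auto simp: vol)
    also have "\<dots> \<le> (LI z. ennreal ?C * (ennreal (pw q z) * indicator (square 1) (x - z)))"
    proof (intro nn_integral_mono)
      fix z
      have "pw q x \<le> ?C * pw q z" if "x - z \<in> square 1"
        using square_bound'[OF that] by (intro pw_compare q) simp_all
      then show "ennreal (pw q x) * indicator (square 1) (x - z) \<le> ennreal ?C * (ennreal (pw q z) * indicator (square 1) (x - z))"
        using pw_pos[of q z] by (auto simp: indicator_def ennreal_mult[symmetric] intro!: ennreal_leI)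
    qed
    finally show ?thesis .
  qed
  have [measurable]: "(\<lambda>p. fst (fst p)) \<in> borel_measurable ((lborel :: 'n pt measure) \<Otimes>\<^sub>M (lborel :: (real ^ 'n) measure))"
    by (rule measurable_compose[OF measurable_fst]) (use pt_measurable(1) in simp)
  have [measurable]: "(\<lambda>p. fst (snd p)) \<in> borel_measurable ((lborel :: (real ^ 'n) measure) \<Otimes>\<^sub>M (lborel :: 'n pt measure))"
    by (rule measurable_compose[OF measurable_snd]) (use pt_measurable(1) in simp)
  have mz[measurable]: "(\<lambda>(y :: 'n pt, z). indicator (square 1) (fst y - z) :: ennreal) \<in> borel_measurable (lborel \<Otimes>\<^sub>M (lborel :: (real ^ 'n) measure))"
    unfolding case_prod_unfold by (rule measurable_compose[OF _ sqm]) measurable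
  have mz2[measurable]: "(\<lambda>(z, y :: 'n pt). indicator (square 1) (fst y - z) :: ennreal) \<in> borel_measurable ((lborel :: (real ^ 'n) measure) \<Otimes>\<^sub>M lborel)"
    unfolding case_prod_unfold by (rule measurable_compose[OF _ sqm]) measurable
  have "(LI y. ennreal (pw q (fst y)) * F y) \<le> (LI y. (LI z. ennreal ?C * (ennreal (pw q z) * indicator (square 1) (fst y - z))) * F y)"
    by (intro nn_integral_mono mult_right_mono key) auto
  also have "\<dots> = (\<integral>\<^sup>+y. \<integral>\<^sup>+z. ennreal ?C * (ennreal (pw q z) * indicator (square 1) (fst y - z)) * F y \<partial>lborel \<partial>lborel)"
    by (intro nn_integral_cong nn_integral_multc[symmetric]) measurable
  also have "\<dots> = (\<integral>\<^sup>+z. \<integral>\<^sup>+y. ennreal ?C * (ennreal (pw q z) * indicator (square 1) (fst y - z)) * F y \<partial>lborel \<partial>lborel)"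
    by (rule lborel_pair.Fubini') measurable
  also have "\<dots> \<le> (\<integral>\<^sup>+z. ennreal ?C * ennreal (pw q z) * A \<partial>(lborel :: (real ^ 'n) measure))"
  proof (intro nn_integral_mono)
    fix z :: "real ^ 'n"
    have ym[measurable]: "(\<lambda>y :: 'n pt. indicator (square 1) (fst y - z) :: ennreal) \<in> borel_measurable borel"
      by (rule measurable_compose[OF _ sqm]) measurable
    have "(LI y. ennreal ?C * (ennreal (pw q z) * indicator (square 1) (fst y - z)) * F y) =
      (LI y. (ennreal ?C * ennreal (pw q z)) * (indicator (square 1) (fst y - z) * F y))"
      by (intro nn_integral_cong) (simp only: mult_ac)
    also have "\<dots> = (ennreal ?C * ennreal (pw q z)) * (LI y. indicator (square 1) (fst y - z) * F y)"
      by (rule nn_integral_cmult) measurable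
    also have "(LI y. indicator (square 1) (fst y - z) * F y) = (LI y. indicator (square 1) (fst (y + (z, 0)) - z) * F (y + (z, 0)))"
      by (rule nn_integral_lborel_shift[symmetric]) measurable
    also have "\<dots> = (LIS (square 1 \<times> UNIV) (\<lambda>y. F (y + (z, 0))))"
      by (intro nn_integral_cong) (auto simp: indicator_def)
    also have "(ennreal ?C * ennreal (pw q z)) * \<dots> \<le> (ennreal ?C * ennreal (pw q z)) * A"
      by (intro mult_left_mono le) auto
    finally show "(LI y. ennreal ?C * (ennreal (pw q z) * indicator (square 1) (fst y - z)) * F y) \<le> ennreal ?C * ennreal (pw q z) * A" .
  qed
  also have "\<dots> = ennreal ?C * (LI x. ennreal (pw q (x :: real ^ 'n))) * A"
    by (subst nn_integral_multc) (measurable, simp add: nn_integral_cmult)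
  finally show ?thesis .
qed

text \<open>The weight equals \<open>1\<close> at the origin, and \<open>pw_compare\<close> with
  \<open>r = 2\<close> bounds it from below on the unit square.\<close>

lemma square_integral_le_weighted:
  fixes F :: "'n::finite pt \<Rightarrow> ennreal"
  assumes F[measurable]: "F \<in> borel_measurable borel" and q: "0 \<le> q"
  shows "(LIS (square 1 \<times> UNIV) F) \<le> ennreal (2 powr (q * real CARD('n))) * (LI y. ennreal (pw q (fst y)) * F y)"
proof -
  let ?C = "2 powr (q * real CARD('n))"
  have "(LIS (square 1 \<times> UNIV) F) \<le> (LI y. ennreal ?C * (ennreal (pw q (fst y)) * F y))"
  proof (intro nn_integral_mono)
    fix y :: "'n pt"
    show "F y * indicator (square 1 \<times> UNIV) y \<le> ennreal ?C * (ennreal (pw q (fst y)) * F y)"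
    proof (cases "fst y \<in> square 1")
      case True
      have "pw q (0 :: real ^ 'n) \<le> ?C * pw q (fst y)"
        using square_bound'[OF True] by (intro pw_compare q) simp_all
      then have "1 \<le> ?C * pw q (fst y)" by (simp add: pw_def)
      then have "1 \<le> ennreal ?C * ennreal (pw q (fst y))"
        using pw_pos[of q "fst y"] by (subst ennreal_mult[symmetric]) auto
      then have "1 * F y \<le> (ennreal ?C * ennreal (pw q (fst y))) * F y" by (rule mult_right_mono) simp
      then show ?thesis by (auto simp: indicator_def mult.assoc)
    qed (auto simp: indicator_def mem_Times_iff)
  qed
  also have "\<dots> = ennreal ?C * (LI y. ennreal (pw q (fst y)) * F y)" by (rule nn_integral_cmult) measurable
  finally show ?thesis .
qed

subsection \<open>Stationary fields\<close>

lemma on_dom_in: "y \<in> fluid_dom \<omega> \<Longrightarrow> on_dom v \<omega> y = v \<omega> y"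
  and on_dom_out: "y \<notin> fluid_dom \<omega> \<Longrightarrow> on_dom v \<omega> y = 0"
  by (simp_all add: on_dom_def)

locale particle_law =
  fixes P :: "'n::finite pt set measure" and h \<delta> m :: real
  assumes \<delta>: "0 < \<delta>" and prob: "prob_space P" and sets_P: "sets P = sets (config_space h \<delta>)"
    and inv: "shift_invariant P" and m: "2 * real (CARD('n) + 1) < m"
begin

sublocale P: prob_space P by (rule prob)

sublocale PL: pair_sigma_finite P "lborel :: 'n pt measure" ..

sublocale PX: pair_sigma_finite P "lborel :: (real ^ 'n) measure" ..

abbreviation PB :: "('n pt set \<times> 'b::euclidean_space) measure" where
  "PB \<equiv> P \<Otimes>\<^sub>M lborel"

abbreviation jmeas :: "('n pt set \<Rightarrow> 'b::euclidean_space \<Rightarrow> 'c::topological_space) \<Rightarrow> bool" where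
  "jmeas f \<equiv> (\<lambda>(\<omega>, y). f \<omega> y) \<in> borel_measurable PB"

abbreviation "D \<equiv> fluid_dom"
abbreviation "W \<equiv> W0 P h m"
abbreviation "\<mu> \<equiv> weight h m"

lemma space_P': "space P = configs h \<delta>"
  by (rule space_P[OF sets_P \<delta>])

lemma m_pos: "0 \<le> m" using m by (smt (verit) of_nat_0_le_iff)

lemma config: "\<omega> \<in> space P \<Longrightarrow> \<omega> \<in> configs h \<delta>" by (simp add: space_P')

lemma D_open: "\<omega> \<in> space P \<Longrightarrow> open (D \<omega>)" and D_borel: "\<omega> \<in> space P \<Longrightarrow> D \<omega> \<in> sets borel"
  using fluid_dom_open[OF _ \<delta>] fluid_dom_borel[OF _ \<delta>] config by blast+

text \<open>Any \<open>q > 1\<close> with \<open>m > 2d + (q - 1)(d - 1)\<close> would do; this one is halfway.\<close>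

definition q where "q = 1 + (m - 2 * real (CARD('n) + 1)) / (2 * real CARD('n))"

text \<open>Half of the excess \<open>m - 2 d\<close> is spent on \<open>q\<close>. The other half
  remains in \<open>\<kappa> - d + 1 = (m - 2 d) / 2\<close>, so that the ray constant
  \<open>2 / (\<kappa> - d + 1)\<close> equals \<open>4 / (m - 2 d)\<close>.\<close>

lemma q: "1 < q" and \<kappa>: "0 < m - 2 - q * real CARD('n)" "-1 < m - 2 - q * real CARD('n) - (real CARD('n) + 1)"
proof -
  have n: "0 < real CARD('n)" by simp
  show "1 < q" using m n by (simp add: q_def)
  have "q * real CARD('n) = real CARD('n) + (m - 2 * real (CARD('n) + 1)) / 2"
    using n by (simp add: q_def field_simps)
  then show "0 < m - 2 - q * real CARD('n)" "-1 < m - 2 - q * real CARD('n) - (real CARD('n) + 1)"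
    using m by (simp_all add: field_simps)
qed

lemma q0: "0 \<le> q" using q by simp

lemma shift_measurable[measurable]: "shift z \<in> measurable P P"
  by (rule measurable_shift[OF sets_P \<delta>])

lemma distr_shift: "distr P P (shift z) = P" using inv by (simp add: shift_invariant_def)

lemma nn_integral_shift: "f \<in> borel_measurable P \<Longrightarrow> (\<integral>\<^sup>+\<omega>. f (shift z \<omega>) \<partial>P) = (\<integral>\<^sup>+\<omega>. f \<omega> \<partial>P)"
  using nn_integral_distr[OF shift_measurable, of f z] by (simp add: distr_shift)

lemma AE_shift: "AE \<omega> in P. Q \<omega> \<Longrightarrow> AE \<omega> in P. Q (shift z \<omega>)"
proof -
  assume "AE \<omega> in P. Q \<omega>"
  then have "AE \<omega> in distr P P (shift z). Q \<omega>" by (simp only: distr_shift)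
  then show ?thesis by (rule AE_distrD[OF shift_measurable])
qed

lemma D_meas[measurable]: "{p \<in> space PB. snd p \<in> D (fst p)} \<in> sets PB"
proof -
  have eq: "sets PB = sets (P \<Otimes>\<^sub>M (borel :: 'n pt measure))" by (intro sets_pair_measure_cong) simp_all
  show ?thesis unfolding eq sets_eq_imp_space_eq[OF eq] by (rule measurable_fluid_dom[OF sets_P \<delta>])
qed

lemma indicator_D_meas[measurable]: "jmeas (\<lambda>\<omega> y. indicator (D \<omega>) y :: 'b::{zero_neq_one, topological_space})"
proof -
  have "(\<lambda>p. if snd p \<in> D (fst p) then 1 else 0 :: 'b) \<in> borel_measurable PB"
    by (rule measurable_If[OF measurable_const measurable_const D_meas]) simp_all
  then show ?thesis by (simp add: case_prod_unfold indicator_def of_bool_def)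
qed

lemma weight_meas[measurable]: "jmeas \<mu>"
proof -
  have "measurable PB borel = measurable (P \<Otimes>\<^sub>M (borel :: 'n pt measure)) (borel :: real measure)"
    by (intro measurable_cong_sets sets_pair_measure_cong) simp_all
  then show ?thesis using measurable_weight[OF sets_P \<delta>] by blast
qed

text \<open>Weaker than the stationarity asked of fields: for each shift separately, up to null sets
  that may depend on it. A weak gradient, being determined only almost everywhere, satisfies it in
  this form.\<close>

definition shift_stat :: "('n pt set \<Rightarrow> 'n pt \<Rightarrow> ennreal) \<Rightarrow> bool" where
  "shift_stat f \<longleftrightarrow> jmeas f \<and>
    (\<forall>z. AE \<omega> in P. AE y in lborel. f \<omega> (y + (z, 0)) = f (shift z \<omega>) y)"

text \<open>The vertical coordinate is unrestricted; the integrands to which this is applied carry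
  \<open>on_dom\<close> and so vanish outside the upper half-space.\<close>

definition Esq :: "('n pt set \<Rightarrow> 'n pt \<Rightarrow> ennreal) \<Rightarrow> ennreal" where
  "Esq f = (\<integral>\<^sup>+\<omega>. (LIS (square 1 \<times> UNIV) (\<lambda>y. f \<omega> y)) \<partial>P)"

definition Ew :: "('n pt set \<Rightarrow> 'n pt \<Rightarrow> ennreal) \<Rightarrow> ennreal" where
  "Ew f = (\<integral>\<^sup>+\<omega>. (LI y. ennreal (pw q (fst y)) * f \<omega> y) \<partial>P)"

definition Cw :: ennreal where
  "Cw = ennreal (2 powr (q * real CARD('n))) * (LI x. ennreal (pw q (x :: real ^ 'n)))"

lemma Cw_finite: "Cw < \<infinity>"
  unfolding Cw_def using pw_integrable[OF q] by (auto simp: ennreal_mult_less_top)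

lemma square_UNIV[measurable]: "square 1 \<times> UNIV \<in> sets (borel :: 'n pt measure)"
  by (auto intro: borel_Times square_borel)

lemma section_meas:
  assumes "jmeas f" "\<omega> \<in> space P"
  shows "f \<omega> \<in> borel_measurable (borel :: 'n pt measure)"
  using measurable_Pair2[OF assms] by simp

lemma section_meas1:
  assumes "jmeas f"
  shows "(\<lambda>\<omega>. f \<omega> y) \<in> borel_measurable P"
  using measurable_Pair1[OF assms, of y] by simp

lemma Efun_meas:
  assumes f: "jmeas f"
  shows "(\<lambda>y. \<integral>\<^sup>+\<omega>. f \<omega> y \<partial>P) \<in> borel_measurable (borel :: 'n pt measure)"
proof -
  have "(\<lambda>y. \<integral>\<^sup>+\<omega>. f \<omega> y \<partial>P) \<in> borel_measurable (lborel :: 'n pt measure)"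
    by (rule P.borel_measurable_nn_integral) (use measurable_pair_swap[OF f] in simp)
  then show ?thesis by simp
qed

lemma shift_pair_meas:
  assumes f: "jmeas f"
  shows "(\<lambda>(\<omega>, y). f \<omega> (y + (z, 0))) \<in> borel_measurable (P \<Otimes>\<^sub>M (lborel :: 'n pt measure))"
proof -
  have "(\<lambda>p. (fst p, snd p + (z, 0))) \<in> P \<Otimes>\<^sub>M lborel \<rightarrow>\<^sub>M P \<Otimes>\<^sub>M (lborel :: 'n pt measure)"
    by (intro measurable_Pair) measurable
  from measurable_compose[OF this f] show ?thesis by (simp add: case_prod_unfold)
qed

lemma Fubini_E:
  assumes [measurable]: "jmeas f" and [measurable]: "w \<in> borel_measurable (borel :: 'n pt measure)"
  shows "(\<integral>\<^sup>+\<omega>. (LI y. w y * f \<omega> y) \<partial>P) = (LI y. w y * (\<integral>\<^sup>+\<omega>. f \<omega> y \<partial>P))"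
proof -
  have "(\<integral>\<^sup>+\<omega>. (LI y. w y * f \<omega> y) \<partial>P) = (LI y. (\<integral>\<^sup>+\<omega>. w y * f \<omega> y \<partial>P))"
    by (rule PL.Fubini'[symmetric]) measurable
  also have "\<dots> = (LI y. w y * (\<integral>\<^sup>+\<omega>. f \<omega> y \<partial>P))"
    by (intro nn_integral_cong nn_integral_cmult section_meas1[OF assms(1)])
  finally show ?thesis .
qed

text \<open>By stationarity and the invariance of the law, the expected integral over a translated
  square does not depend on the translation. After exchanging expectation and integral this is the
  hypothesis of \<open>weighted_integral_le_square\<close>.\<close>

lemma Ew_le:
  assumes "shift_stat f"
  shows "Ew f \<le> Cw * Esq f"
proof -
  have f[measurable]: "jmeas f" and
    st: "\<And>z. AE \<omega> in P. AE y in lborel. f \<omega> (y + (z, 0)) = f (shift z \<omega>) y" using assms by (auto simp: shift_stat_def)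
  let ?F = "\<lambda>y. \<integral>\<^sup>+\<omega>. f \<omega> y \<partial>P"
  have im: "(indicator (square 1 \<times> UNIV) :: 'n pt \<Rightarrow> ennreal) \<in> borel_measurable borel" by measurable
  have "(LIS (square 1 \<times> UNIV) (\<lambda>y. ?F (y + (z, 0)))) \<le> Esq f" for z
  proof -
    have "(LIS (square 1 \<times> UNIV) (\<lambda>y. ?F (y + (z, 0)))) = (\<integral>\<^sup>+\<omega>. (LI y. indicator (square 1 \<times> UNIV) y * f \<omega> (y + (z, 0))) \<partial>P)"
      using Fubini_E[OF shift_pair_meas[OF f] im, of z] by (simp add: mult.commute)
    also have "\<dots> = (\<integral>\<^sup>+\<omega>. (LI y. indicator (square 1 \<times> UNIV) y * f (shift z \<omega>) y) \<partial>P)"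
    proof (rule nn_integral_cong_AE, use st[of z] in eventually_elim)
      fix \<omega> assume "AE y in lborel. f \<omega> (y + (z, 0)) = f (shift z \<omega>) y"
      then show "(LI y. indicator (square 1 \<times> UNIV) y * f \<omega> (y + (z, 0))) = (LI y. indicator (square 1 \<times> UNIV) y * f (shift z \<omega>) y)"
        by (intro nn_integral_cong_AE, elim eventually_mono) simp
    qed
    also have "\<dots> = (\<integral>\<^sup>+\<omega>. (LI y. indicator (square 1 \<times> UNIV) y * f \<omega> y) \<partial>P)"
    proof (rule nn_integral_shift)
      have [measurable]: "jmeas (\<lambda>\<omega> y. indicator (square 1 \<times> UNIV) y * f \<omega> y)" by measurable
      show "(\<lambda>\<omega>. \<integral>\<^sup>+y. indicator (square 1 \<times> UNIV) y * f \<omega> y \<partial>lborel) \<in> borel_measurable P"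
        by (rule lborel.borel_measurable_nn_integral) measurable
    qed
    also have "\<dots> = Esq f" by (simp add: Esq_def mult.commute)
    finally show ?thesis by simp
  qed
  then have "(LI y. ennreal (pw q (fst y)) * ?F y) \<le> Cw * Esq f"
    unfolding Cw_def by (intro weighted_integral_le_square Efun_meas f q0)
  moreover have "Ew f = (LI y. ennreal (pw q (fst y)) * ?F y)"
    unfolding Ew_def by (intro Fubini_E f) measurable
  ultimately show ?thesis by simp
qed

lemma Esq_le:
  assumes f[measurable]: "jmeas f"
  shows "Esq f \<le> ennreal (2 powr (q * real CARD('n))) * Ew f"
proof -
  let ?F = "\<lambda>y. \<integral>\<^sup>+\<omega>. f \<omega> y \<partial>P"
  have im: "(indicator (square 1 \<times> UNIV) :: 'n pt \<Rightarrow> ennreal) \<in> borel_measurable borel" by measurable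
  have pm: "(\<lambda>y :: 'n pt. ennreal (pw q (fst y))) \<in> borel_measurable borel" by measurable
  have "Esq f = (LIS (square 1 \<times> UNIV) ?F)"
    using Fubini_E[OF f im] by (simp add: Esq_def mult.commute)
  also have "\<dots> \<le> ennreal (2 powr (q * real CARD('n))) * (LI y. ennreal (pw q (fst y)) * ?F y)"
    by (intro square_integral_le_weighted Efun_meas f q0)
  also have "(LI y. ennreal (pw q (fst y)) * ?F y) = Ew f" unfolding Ew_def by (rule Fubini_E[OF f pm, symmetric])
  finally show ?thesis .
qed

lemma AE_of_Ew:
  assumes f[measurable]: "jmeas f"
  shows "Ew f < \<infinity> \<Longrightarrow> AE \<omega> in P. (LI y. ennreal (pw q (fst y)) * f \<omega> y) < \<infinity>"
    and "Ew f = 0 \<Longrightarrow> AE \<omega> in P. AE y in lborel. f \<omega> y = 0"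
proof -
  have [measurable]: "jmeas (\<lambda>\<omega> y. ennreal (pw q (fst y)) * f \<omega> y)" by measurable
  have M: "(\<lambda>\<omega>. \<integral>\<^sup>+y. ennreal (pw q (fst y)) * f \<omega> y \<partial>lborel) \<in> borel_measurable P"
    by (rule lborel.borel_measurable_nn_integral) measurable
  show "AE \<omega> in P. (LI y. ennreal (pw q (fst y)) * f \<omega> y) < \<infinity>" if "Ew f < \<infinity>"
    using nn_integral_PInf_AE[OF M] that unfolding Ew_def by (auto simp: less_top[symmetric])
  show "AE \<omega> in P. AE y in lborel. f \<omega> y = 0" if "Ew f = 0"
  proof -
    have "AE \<omega> in P. (LI y. ennreal (pw q (fst y)) * f \<omega> y) = 0"
      using that M unfolding Ew_def by (subst (asm) nn_integral_0_iff_AE) auto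
    with AE_space show ?thesis
    proof eventually_elim
      fix \<omega> assume \<omega>: "\<omega> \<in> space P" and 0: "(LI y. ennreal (pw q (fst y)) * f \<omega> y) = 0"
      have [measurable]: "f \<omega> \<in> borel_measurable borel" by (rule section_meas[OF f \<omega>])
      have "AE y in lborel. ennreal (pw q (fst y)) * f \<omega> y = 0"
        using 0 by (subst (asm) nn_integral_0_iff_AE) auto
      then show "AE y in lborel. f \<omega> y = 0"
        by eventually_elim (use pw_pos[of q] in \<open>auto simp: ennreal_zero_less_mult_iff ennreal_eq_0_iff less_le_not_le\<close>)
    qed
  qed
qed

end

subsection \<open>The space \<open>\<W>\<^sub>0\<close>\<close>

text \<open>
  Members of \<open>\<W>\<^sub>0\<close> are functions, not classes, so they form no instance of an inner product space; the
  theorem is stated for a positive semidefinite form on a set closed under two given operations.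
\<close>

lemma riesz_abstract:
  fixes W :: "'a set" and add :: "'a \<Rightarrow> 'a \<Rightarrow> 'a" and scl :: "real \<Rightarrow> 'a \<Rightarrow> 'a" and B :: "'a \<Rightarrow> 'a \<Rightarrow> real" and l :: "'a \<Rightarrow> real"
  defines "sub \<equiv> \<lambda>u v. add u (scl (-1) v)"
  assumes ne: "z \<in> W" and add: "\<And>u v. u \<in> W \<Longrightarrow> v \<in> W \<Longrightarrow> add u v \<in> W" and scl: "\<And>c u. u \<in> W \<Longrightarrow> scl c u \<in> W"
    and B_add: "\<And>u v w. u \<in> W \<Longrightarrow> v \<in> W \<Longrightarrow> w \<in> W \<Longrightarrow> B (add u v) w = B u w + B v w"
    and B_scl: "\<And>c u w. u \<in> W \<Longrightarrow> w \<in> W \<Longrightarrow> B (scl c u) w = c * B u w"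
    and sym: "\<And>u v. u \<in> W \<Longrightarrow> v \<in> W \<Longrightarrow> B u v = B v u" and pos: "\<And>u. u \<in> W \<Longrightarrow> 0 \<le> B u u"
    and l_add: "\<And>u v. u \<in> W \<Longrightarrow> v \<in> W \<Longrightarrow> l (add u v) = l u + l v"
    and l_scl: "\<And>c u. u \<in> W \<Longrightarrow> l (scl c u) = c * l u"
    and bound: "\<And>u. u \<in> W \<Longrightarrow> \<bar>l u\<bar> \<le> K * sqrt (B u u)"
    and complete: "\<And>s. (\<And>k. s k \<in> W) \<Longrightarrow> (\<And>k. B (sub (s (Suc k)) (s k)) (sub (s (Suc k)) (s k)) \<le> (1/4) ^ k) \<Longrightarrow>
      \<exists>u\<in>W. (\<lambda>k::nat. B (sub (s k) u) (sub (s k) u)) \<longlonglongrightarrow> 0"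
  shows "\<exists>u\<in>W. \<forall>v\<in>W. B u v = l v"
proof -
  have B_add2: "B w (add u v) = B w u + B w v" if "u \<in> W" "v \<in> W" "w \<in> W" for u v w
    using B_add[OF that] sym that add by metis
  have B_scl2: "B w (scl c u) = c * B w u" if "u \<in> W" "w \<in> W" for u w c
    using B_scl[OF that] sym that scl by metis
  have exp: "B (add u (scl t v)) (add u (scl t v)) = B u u + 2 * t * B u v + t\<^sup>2 * B v v" if "u \<in> W" "v \<in> W" for u v t
    using that scl[OF that(2), of t] add[OF that(1) scl[OF that(2), of t]] sym[OF that]
    by (simp add: B_add B_add2 B_scl B_scl2 power2_eq_square algebra_simps)
  have CS: "(B u v)\<^sup>2 \<le> B u u * B v v" if "u \<in> W" "v \<in> W" for u v
  proof (cases "B v v = 0")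
    case True
    have "0 \<le> B u u + 2 * t * B u v" for t
      using pos[OF add[OF that(1) scl[OF that(2), of t]]] exp[OF that, of t] True by simp
    \<comment> \<open>If \<open>B u v\<close> were nonzero, this \<open>t\<close> would make the
      right-hand side equal to \<open>-1\<close>.\<close>
    from this[of "- (B u u + 1) / (2 * B u v)"] have "B u v = 0" by (cases "B u v = 0") (auto simp: field_simps)
    then show ?thesis using True by simp
  next
    case False
    then have v: "0 < B v v" using pos[OF that(2)] by simp
    have "0 \<le> B u u + 2 * (- B u v / B v v) * B u v + (- B u v / B v v)\<^sup>2 * B v v"
      using pos[OF add[OF that(1) scl[OF that(2), of "- B u v / B v v"]]] exp[OF that, of "- B u v / B v v"] by simp
    also have "\<dots> = B u u - (B u v)\<^sup>2 / B v v" using v by (simp add: power2_eq_square field_simps)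
    finally show ?thesis using v by (simp add: field_simps)
  qed
  \<comment> \<open>If \<open>u\<close> represents \<open>l\<close>, then \<open>J v\<close> is the
    squared distance of \<open>v\<close> to \<open>u\<close> minus \<open>B u u\<close>; the
    representing element is therefore sought as a minimiser.\<close>
  define J where "J v = B v v - 2 * l v" for v
  have Jlow: "- (K\<^sup>2) \<le> J v" if "v \<in> W" for v
  proof -
    have "2 * l v \<le> 2 * (K * sqrt (B v v))" using bound[OF that] by auto
    moreover have "0 \<le> (sqrt (B v v) - K)\<^sup>2" by simp
    moreover have "(sqrt (B v v) - K)\<^sup>2 = B v v - 2 * (K * sqrt (B v v)) + K\<^sup>2"
      using pos[OF that] by (simp add: power2_diff)
    ultimately show ?thesis by (simp add: J_def)
  qed
  have bdd: "bdd_below (J ` W)" using Jlow by (intro bdd_belowI2[of _ "- (K\<^sup>2)"]) auto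
  define d where "d = Inf (J ` W)"
  have dle: "d \<le> J v" if "v \<in> W" for v unfolding d_def using that bdd by (intro cINF_lower)
  \<comment> \<open>With this tolerance the parallelogram identity bounds the squared increments by
    \<open>2 * (1/16 + 1/4)\<close> times \<open>(1/4) ^ k\<close>, below the rate that
    \<open>complete\<close> asks for.\<close>
  have "\<exists>v\<in>W. J v < d + (1/4) ^ k / 4" for k :: nat
  proof -
    have "Inf (J ` W) < d + (1/4) ^ k / 4" unfolding d_def by simp
    then show ?thesis using cInf_lessD[of "J ` W"] ne by (metis (no_types, lifting) imageE image_is_empty empty_iff)
  qed
  then have "\<exists>s. \<forall>k. s k \<in> W \<and> J (s k) < d + (1/4) ^ k / 4" by (intro choice) blast
  then obtain s where s: "\<And>k::nat. s k \<in> W" "\<And>k. J (s k) < d + (1/4) ^ k / 4" by blast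
  \<comment> \<open>Parallelogram identity: the functional at the midpoint is at least the infimum
    \<open>d\<close>.\<close>
  have par: "B (sub a b) (sub a b) \<le> 2 * (J a - d + (J b - d))" if a: "a \<in> W" and b: "b \<in> W" for a b
  proof -
    let ?m = "add (scl (1/2) a) (scl (1/2) b)"
    have ab: "scl (1/2) a \<in> W" "scl (1/2) b \<in> W" "scl (-1) b \<in> W" using scl a b by auto
    have m: "?m \<in> W" by (intro add ab)
    have "B ?m ?m = (B a a + 2 * B a b + B b b) / 4"
      using exp[OF ab(1) b, of "1/2"] B_scl[OF a ab(1), of "1/2"] B_scl2[OF a a, of "1/2"] B_scl[OF a b, of "1/2"]
      by (simp add: power2_eq_square field_simps)
    moreover have "l ?m = (l a + l b) / 2" using l_add[OF ab(1,2)] l_scl[OF a] l_scl[OF b] by simp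
    moreover have "B (sub a b) (sub a b) = B a a - 2 * B a b + B b b" unfolding sub_def using exp[OF a b, of "-1"] by simp
    ultimately show ?thesis using dle[OF m] unfolding J_def by (simp add: field_simps)
  qed
  have "B (sub (s (Suc k)) (s k)) (sub (s (Suc k)) (s k)) \<le> (1/4) ^ k" for k
  proof -
    have gen: "x \<le> p" if "0 \<le> p" "a < d + p / 16" "b < d + p / 4" "x \<le> 2 * (a - d + (b - d))" for x p a b :: real
      using that by argo
    show ?thesis
      by (rule gen[OF _ _ s(2)[of k] par[OF s(1)[of "Suc k"] s(1)[of k]]]) (use s(2)[of "Suc k"] in simp_all)
  qed
  then obtain u where u: "u \<in> W" "(\<lambda>k. B (sub (s k) u) (sub (s k) u)) \<longlonglongrightarrow> 0" using complete[of s] s(1) by blast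
  have "B u v = l v" if v: "v \<in> W" for v
  proof -
    have "(\<lambda>k. B (s k) v) \<longlonglongrightarrow> B u v"
    proof -
      have w: "sub (s k) u \<in> W" for k unfolding sub_def by (intro add scl s(1) u(1))
      have "(\<lambda>k. B (sub (s k) u) (sub (s k) u) * B v v) \<longlonglongrightarrow> 0" using tendsto_mult[OF u(2) tendsto_const] by simp
      then have "(\<lambda>k. (B (sub (s k) u) v)\<^sup>2) \<longlonglongrightarrow> 0"
        by (rule tendsto_sandwich[OF _ _ tendsto_const, rotated 2]) (auto intro!: always_eventually CS w v)
      then have "(\<lambda>k. B (sub (s k) u) v) \<longlonglongrightarrow> 0" by simp
      moreover have "B (sub (s k) u) v = B (s k) v - B u v" for k
        unfolding sub_def using B_add[OF s(1) scl[OF u(1), of "-1"] v] B_scl[OF u(1) v, of "-1"] by simp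
      ultimately show ?thesis by (simp add: LIM_zero_iff)
    qed
    moreover have "(\<lambda>k. B (s k) v) \<longlonglongrightarrow> l v"
    proof -
      have key: "\<bar>B (s k) v - l v\<bar> \<le> (1/2) ^ k * (1 + B v v)" for k
      proof -
        have J': "J (s k) - (1/4) ^ k \<le> J (s k) + 2 * t * (B (s k) v - l v) + t\<^sup>2 * B v v" for t
        proof -
          have "J (s k) - (1/4) ^ k / 4 \<le> J (add (s k) (scl t v))"
            using dle[OF add[OF s(1) scl[OF v]]] s(2)[of k] by (meson diff_le_eq less_imp_le order_trans)
          also have "\<dots> = J (s k) + 2 * t * (B (s k) v - l v) + t\<^sup>2 * B v v"
            unfolding J_def exp[OF s(1) v] using l_add[OF s(1) scl[OF v]] l_scl[OF v] by (simp add: algebra_simps)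
          moreover have "(1/4::real) ^ k / 4 \<le> (1/4) ^ k" by simp
          ultimately show ?thesis by linarith
        qed
        \<comment> \<open>\<open>s k\<close> minimises up to \<open>(1/4) ^ k\<close>. Variations
          with \<open>t\<close> equal to plus and minus \<open>(1/2) ^ k\<close> make this error and
          the quadratic term of the same order, and leave a linear term of order
          \<open>(1/2) ^ k\<close>.\<close>
        let ?e = "(1/2::real) ^ k"
        have e: "0 < ?e" "(1/4) ^ k = ?e * ?e" by (auto simp: power_mult_distrib[symmetric])
        have "- (?e * ?e) \<le> 2 * ?e * (B (s k) v - l v) + ?e * ?e * B v v" "- (?e * ?e) \<le> - (2 * ?e * (B (s k) v - l v)) + ?e * ?e * B v v"
          using J'[of ?e] J'[of "- ?e"] e(2) by (simp_all add: power2_eq_square)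
        then have "?e * (2 * \<bar>B (s k) v - l v\<bar>) \<le> ?e * (?e * (1 + B v v))"
          by (auto simp: abs_if algebra_simps)
        then have "2 * \<bar>B (s k) v - l v\<bar> \<le> ?e * (1 + B v v)" using e(1) by (subst (asm) mult_le_cancel_left_pos)
        moreover have "x \<le> y" if "0 \<le> x" "2 * x \<le> y" for x y :: real using that by linarith
        ultimately show ?thesis by (meson abs_ge_zero)
      qed
      have "(\<lambda>k. (1/2) ^ k * (1 + B v v)) \<longlonglongrightarrow> 0 * (1 + B v v)" by (intro tendsto_mult tendsto_const LIMSEQ_power_zero) simp
      then have lim0: "(\<lambda>k. (1/2) ^ k * (1 + B v v)) \<longlonglongrightarrow> 0" by simp
      have "(\<lambda>k. \<bar>B (s k) v - l v\<bar>) \<longlonglongrightarrow> 0"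
        by (rule tendsto_sandwich[OF always_eventually always_eventually tendsto_const lim0]) (auto intro: key)
      then show ?thesis by (simp add: tendsto_rabs_zero_iff LIM_zero_iff)
    qed
    ultimately show ?thesis by (rule LIMSEQ_unique)
  qed
  then show ?thesis using u(1) by blast
qed

context particle_law
begin

text \<open>One measure on configurations times space, concentrated on the unit square:
  \<open>Esq\<close> becomes an integral against it and the energy form a pairing in its
  \<open>L^2\<close>.\<close>

definition MS :: "('n pt set \<times> 'n pt) measure" where
  "MS = density PB (\<lambda>p. indicator (square 1 \<times> UNIV) (snd p))"

lemma sets_MS[measurable_cong, simp]: "sets MS = sets PB" by (simp add: MS_def)

lemma ind_meas[measurable]: "(\<lambda>p. indicator (square 1 \<times> UNIV) (snd p) :: ennreal) \<in> borel_measurable (P \<Otimes>\<^sub>M (lborel :: 'n pt measure))"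
  by (rule measurable_compose[OF measurable_snd]) measurable

lemma Esq_MS:
  assumes f: "jmeas f"
  shows "Esq f = (\<integral>\<^sup>+p. f (fst p) (snd p) \<partial>MS)"
proof -
  have [measurable]: "(\<lambda>p. f (fst p) (snd p)) \<in> borel_measurable PB" using f by (simp add: case_prod_unfold)
  have "(\<integral>\<^sup>+p. f (fst p) (snd p) \<partial>MS) = (\<integral>\<^sup>+p. indicator (square 1 \<times> UNIV) (snd p) * f (fst p) (snd p) \<partial>PB)"
    unfolding MS_def by (rule nn_integral_density) measurable
  also have "\<dots> = (\<integral>\<^sup>+\<omega>. (LI y. indicator (square 1 \<times> UNIV) y * f \<omega> y) \<partial>P)"
    using lborel.nn_integral_fst[of "\<lambda>p. indicator (square 1 \<times> UNIV) (snd p) * f (fst p) (snd p)" P] by simp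
  finally show ?thesis by (simp add: Esq_def mult.commute)
qed

lemma AE_MS:
  assumes "AE \<omega> in P. AE y in lborel. Q \<omega> y" and m: "{p \<in> space PB. Q (fst p) (snd p)} \<in> sets PB"
  shows "AE p in MS. Q (fst p) (snd p)"
proof -
  have "AE p in P \<Otimes>\<^sub>M lborel. Q (fst p) (snd p)"
    by (rule PL.AE_pair_measure[OF m]) (use assms(1) in simp)
  then show ?thesis unfolding MS_def by (subst AE_density) auto
qed

lemma random_field_meas: "random_field P v \<Longrightarrow> jmeas (\<lambda>\<omega> y. on_dom v \<omega> y)"
  by (simp add: random_field_def)

text \<open>Together with \<open>e2\<close> the density of the squared norm of \<open>W0\<close>:
  \<open>e1\<close> is applied to fields, \<open>e2\<close> to gradients and to data.\<close>

abbreviation e1 where "e1 v \<equiv> (\<lambda>\<omega> y. ennreal (\<mu> \<omega> y) * nsq (on_dom v \<omega> y))"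
abbreviation e2 where "e2 v \<equiv> (\<lambda>\<omega> y. nsq (on_dom v \<omega> y))"

lemma e_meas:
  assumes "random_field P v"
  shows "jmeas (e1 v)" "jmeas (e2 v)"
  using random_field_meas[OF assms] by measurable

lemma weight_nonneg: "0 \<le> \<mu> \<omega> y"
  by (simp add: weight_def)

lemma D_pos: "\<omega> \<in> space P \<Longrightarrow> y \<in> D \<omega> \<Longrightarrow> 0 < snd y"
  using fluid_dom_eq[OF _ \<delta>, of \<omega> h] config by auto

lemma W0_sqnorm_eq:
  assumes v: "random_field P v" and g: "random_field P (grad P v)"
  shows "W0_sqnorm P h m v = Esq (e1 v) + Esq (e2 (grad P v))"
proof -
  have "W0_sqnorm P h m v = Esq (\<lambda>\<omega> y. e1 v \<omega> y + e2 (grad P v) \<omega> y)"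
    unfolding W0_sqnorm_def Esq_def
  proof (intro nn_integral_cong)
    fix \<omega> and y :: "'n pt" assume \<omega>: "\<omega> \<in> space P"
    show "indicator (D \<omega>) y * ennreal (\<mu> \<omega> y * (norm (v \<omega> y))\<^sup>2 + (norm (grad P v \<omega> y))\<^sup>2) * indicator (square 1 \<times> {0<..}) y =
      (e1 v \<omega> y + e2 (grad P v) \<omega> y) * indicator (square 1 \<times> UNIV) y"
      using D_pos[OF \<omega>, of y] weight_nonneg[of \<omega> y]
      by (cases "y \<in> D \<omega>") (auto simp: on_dom_def ennreal_plus ennreal_mult indicator_def mem_Times_iff)
  qed
  also have "\<dots> = Esq (e1 v) + Esq (e2 (grad P v))"
  proof -
    note [measurable] = e_meas(1)[OF v] e_meas(2)[OF g]
    have m: "jmeas (\<lambda>\<omega> y. e1 v \<omega> y + e2 (grad P v) \<omega> y)" by measurable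
    show ?thesis unfolding Esq_MS[OF m] Esq_MS[OF e_meas(1)[OF v]] Esq_MS[OF e_meas(2)[OF g]]
      using e_meas(1)[OF v] e_meas(2)[OF g] by (intro nn_integral_add) (simp_all add: case_prod_unfold)
  qed
  finally show ?thesis .
qed

lemma L2D_sqnorm_eq: "L2D_sqnorm P u = Esq (e2 u)"
  unfolding L2D_sqnorm_def Esq_def
proof (intro nn_integral_cong)
  fix \<omega> and y :: "'n pt" assume \<omega>: "\<omega> \<in> space P"
  show "indicator (D \<omega>) y * nsq (u \<omega> y) * indicator (square 1 \<times> {0<..}) y = e2 u \<omega> y * indicator (square 1 \<times> UNIV) y"
    using D_pos[OF \<omega>, of y] by (cases "y \<in> D \<omega>") (auto simp: on_dom_def indicator_def mem_Times_iff)
qed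

definition stat_field :: "('n pt set \<Rightarrow> 'n pt \<Rightarrow> 'b::real_vector) \<Rightarrow> bool" where
  "stat_field v \<longleftrightarrow> (\<forall>\<omega>\<in>space P. \<forall>y z. on_dom v \<omega> (y + (z, 0)) = on_dom v (shift z \<omega>) y)"

lemma D_shift: "\<omega> \<in> space P \<Longrightarrow> D (shift z \<omega>) = {y. y + (z, 0) \<in> D \<omega>}"
  by (rule shift_fluid_dom[OF config \<delta>])

lemma shift_space: "\<omega> \<in> space P \<Longrightarrow> shift z \<omega> \<in> space P"
  using shift_configs by (simp add: space_P')

text \<open>At heights \<open>t \<le> 0\<close> both sides of the stationarity identity vanish, so
  the condition for all positive heights becomes one statement about all points of the
  space.\<close>

lemma stat_field_iff: "(\<forall>t>0. stationary P (\<lambda>\<omega> x. on_dom v \<omega> (x, t))) \<longleftrightarrow> stat_field v"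
proof
  assume s: "\<forall>t>0. stationary P (\<lambda>\<omega> x. on_dom v \<omega> (x, t))"
  show "stat_field v" unfolding stat_field_def
  proof (intro ballI allI)
    fix \<omega> and y :: "'n pt" and z assume \<omega>: "\<omega> \<in> space P"
    show "on_dom v \<omega> (y + (z, 0)) = on_dom v (shift z \<omega>) y"
    proof (cases "0 < snd y")
      case True
      then have "on_dom v \<omega> (fst y + z, snd y) = on_dom v (shift z \<omega>) (fst y, snd y)"
        using s \<omega> unfolding stationary_def by blast
      moreover have "y + (z, 0) = (fst y + z, snd y)" by (simp add: prod_eq_iff)
      ultimately show ?thesis by simp
    next
      case False
      then have "y + (z, 0) \<notin> D \<omega>" "y \<notin> D (shift z \<omega>)"
        using D_pos[OF \<omega>, of "y + (z, 0)"] D_pos[OF shift_space[OF \<omega>], of y z] by auto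
      then show ?thesis by (simp add: on_dom_out)
    qed
  qed
next
  assume s: "stat_field v"
  show "\<forall>t>0. stationary P (\<lambda>\<omega> x. on_dom v \<omega> (x, t))"
    unfolding stationary_def
  proof (intro allI impI ballI)
    fix t :: real and \<omega> x z assume \<omega>: "\<omega> \<in> space P"
    show "on_dom v \<omega> (x + z, t) = on_dom v (shift z \<omega>) (x, t)"
      using s \<omega> unfolding stat_field_def by (metis add.right_neutral add_Pair)
  qed
qed

lemma e1_stat: "random_field P v \<Longrightarrow> stat_field v \<Longrightarrow> shift_stat (e1 v)"
  unfolding shift_stat_def using e_meas(1)
  by (auto simp: stat_field_def weight_shift intro!: AE_I2)

lemma random_gradient_unique:
  assumes "random_gradient P v G" "random_gradient P v G'"
  shows "AE \<omega> in P. AE y in lborel. on_dom G \<omega> y = on_dom G' \<omega> y"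
proof -
  have "AE \<omega> in P. H1loc (D \<omega>) (v \<omega>) (G \<omega>)" "AE \<omega> in P. H1loc (D \<omega>) (v \<omega>) (G' \<omega>)"
    using assms by (auto simp: random_gradient_def)
  with AE_space show ?thesis
  proof eventually_elim
    fix \<omega> assume "\<omega> \<in> space P" "H1loc (D \<omega>) (v \<omega>) (G \<omega>)" "H1loc (D \<omega>) (v \<omega>) (G' \<omega>)"
    then have "AE y in lborel. y \<in> D \<omega> \<longrightarrow> G \<omega> y = G' \<omega> y" by (intro weak_gradient_unique[OF D_open])
    then show "AE y in lborel. on_dom G \<omega> y = on_dom G' \<omega> y" by eventually_elim (auto simp: on_dom_def indicator_def)
  qed
qed

text \<open>On the domain of the shifted configuration the translated field is the field of that
  configuration. Hence the translated gradient and the gradient of the shifted configuration are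
  weak gradients of the same function, and uniqueness identifies them almost everywhere.\<close>

lemma e2_stat:
  assumes g: "random_gradient P v G" and s: "stat_field v"
  shows "shift_stat (e2 G)"
  unfolding shift_stat_def
proof (intro conjI allI)
  show "jmeas (e2 G)"
    using g by (intro e_meas) (simp add: random_gradient_def)
  fix z
  have H: "AE \<omega> in P. H1loc (D \<omega>) (v \<omega>) (G \<omega>)" using g by (simp add: random_gradient_def)
  from AE_space H AE_shift[OF H, of z] show "AE \<omega> in P. AE y in lborel. e2 G \<omega> (y + (z, 0)) = e2 G (shift z \<omega>) y"
  proof eventually_elim
    fix \<omega> assume \<omega>: "\<omega> \<in> space P" and H: "H1loc (D \<omega>) (v \<omega>) (G \<omega>)"
      and H': "H1loc (D (shift z \<omega>)) (v (shift z \<omega>)) (G (shift z \<omega>))"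
    have "H1loc (D (shift z \<omega>)) (\<lambda>y. v \<omega> (y + (z, 0))) (\<lambda>y. G \<omega> (y + (z, 0)))"
      unfolding D_shift[OF \<omega>] by (rule H1loc_translate[OF D_borel[OF \<omega>] H])
    moreover have "v \<omega> (y + (z, 0)) = v (shift z \<omega>) y" if "y \<in> D (shift z \<omega>)" for y
    proof -
      have "on_dom v \<omega> (y + (z, 0)) = on_dom v (shift z \<omega>) y" using s \<omega> unfolding stat_field_def by blast
      then show ?thesis using that by (simp add: on_dom_def D_shift[OF \<omega>])
    qed
    ultimately have "H1loc (D (shift z \<omega>)) (v (shift z \<omega>)) (\<lambda>y. G \<omega> (y + (z, 0)))"
      using H1loc_cong[of "D (shift z \<omega>)" "\<lambda>y. v \<omega> (y + (z, 0))" "v (shift z \<omega>)"] by blast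
    from weak_gradient_unique[OF D_open[OF shift_space[OF \<omega>]] this H']
    show "AE y in lborel. e2 G \<omega> (y + (z, 0)) = e2 G (shift z \<omega>) y"
      by eventually_elim (simp add: on_dom_def D_shift[OF \<omega>] indicator_def)
  qed
qed

lemma W_iff: "v \<in> W \<longleftrightarrow> random_field P v \<and> (\<exists>G. random_gradient P v G) \<and>
   (AE \<omega> in P. \<forall>c\<in>\<omega>. has_trace (D \<omega>) (sphere_measure c) (v \<omega>) (\<lambda>y. 0)) \<and> stat_field v \<and>
   Esq (e1 v) < \<infinity> \<and> Esq (e2 (grad P v)) < \<infinity>"
proof -
  have g: "random_field P (grad P v)" if "\<exists>G. random_gradient P v G"
    using someI_ex[OF that] by (simp add: grad_def random_gradient_def)
  show ?thesis
  proof (cases "random_field P v \<and> (\<exists>G. random_gradient P v G)")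
    case True
    then show ?thesis unfolding W0_def mem_Collect_eq stat_field_iff using W0_sqnorm_eq[of v] g by simp
  next
    case False then show ?thesis unfolding W0_def by blast
  qed
qed

lemma grad_random_gradient: "\<exists>G. random_gradient P v G \<Longrightarrow> random_gradient P v (grad P v)"
  using someI_ex[of "random_gradient P v"] by (simp add: grad_def)

lemma W_facts:
  assumes "v \<in> W"
  shows "random_field P v" "random_gradient P v (grad P v)" "random_field P (grad P v)" "stat_field v"
    "AE \<omega> in P. H1loc (D \<omega>) (v \<omega>) (grad P v \<omega>)"
    "AE \<omega> in P. \<forall>c\<in>\<omega>. has_trace (D \<omega>) (sphere_measure c) (v \<omega>) (\<lambda>y. 0)"
    "Esq (e1 v) < \<infinity>" "Esq (e2 (grad P v)) < \<infinity>"
  using assms grad_random_gradient[of v] by (auto simp: W_iff random_gradient_def)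

definition Kp :: ennreal where
  "Kp = (let K = 4 * ennreal (2 / (m - 2 - q * real CARD('n) - (real CARD('n) + 1) + 1)) in K + (32 + 4 * ennreal (pi * 2 powr m) * K))"

definition KH :: ennreal where
  "KH = ennreal (2 powr (q * real CARD('n))) * (Kp * Cw)"

lemma KH_finite: "KH < \<infinity>"
  unfolding KH_def Kp_def Let_def using Cw_finite by (auto simp: ennreal_mult_less_top)

text \<open>The unit square is exchanged for the polynomial weight by \<open>Esq_le\<close>,
  \<open>path_hardy\<close> is applied to almost every configuration, and stationarity of the
  gradient leads back to the square by \<open>Ew_le\<close>. The three factors of \<open>KH\<close>
  are the constants of these steps.\<close>

lemma hardy_W:
  assumes v: "v \<in> W" shows "Esq (e1 v) \<le> KH * Esq (e2 (grad P v))"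
proof -
  note vf = W_facts[OF v]
  have "Ew (e1 v) \<le> (\<integral>\<^sup>+\<omega>. Kp * (LI y. ennreal (pw q (fst y)) * e2 (grad P v) \<omega> y) \<partial>P)"
    unfolding Ew_def
  proof (rule nn_integral_mono_AE, use AE_space vf(5,6) in eventually_elim)
    fix \<omega> assume \<omega>: "\<omega> \<in> space P" and H: "H1loc (D \<omega>) (v \<omega>) (grad P v \<omega>)"
      and t: "\<forall>c\<in>\<omega>. has_trace (D \<omega>) (sphere_measure c) (v \<omega>) (\<lambda>y. 0)"
    have [measurable]: "on_dom v \<omega> \<in> borel_measurable borel" "on_dom (grad P v) \<omega> \<in> borel_measurable borel"
      using section_meas[OF random_field_meas[OF vf(1)] \<omega>] section_meas[OF random_field_meas[OF vf(3)] \<omega>] by auto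
    have H': "H1loc (D \<omega>) (on_dom v \<omega>) (on_dom (grad P v) \<omega>)"
      using H H1loc_cong[of "D \<omega>" "v \<omega>" "on_dom v \<omega>" "grad P v \<omega>" "on_dom (grad P v) \<omega>"] by (simp add: on_dom_in)
    have t': "has_trace (D \<omega>) (sphere_measure c) (on_dom v \<omega>) (\<lambda>y. 0)" if "c \<in> \<omega>" for c
      using t that has_trace_cong[of "D \<omega>" "v \<omega>" "on_dom v \<omega>"] by (simp add: on_dom_in)
    have "(LI y. ennreal (pw q (fst y)) * e1 v \<omega> y) =
      (LIS (D \<omega>) (\<lambda>y. ennreal (pw q (fst y)) * ennreal (\<mu> \<omega> y) * nsq (on_dom v \<omega> y)))"
      by (intro nn_integral_cong) (auto simp: indicator_def on_dom_out mult.assoc)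
    also have "\<dots> \<le> Kp * (LIS (D \<omega>) (\<lambda>y. ennreal (pw q (fst y)) * nsq (on_dom (grad P v) \<omega> y)))"
      unfolding Kp_def Let_def by (rule path_hardy[OF config[OF \<omega>] \<delta> q0 m_pos \<kappa>]) (use H' t' in auto)
    also have "(LIS (D \<omega>) (\<lambda>y. ennreal (pw q (fst y)) * nsq (on_dom (grad P v) \<omega> y))) =
      (LI y. ennreal (pw q (fst y)) * e2 (grad P v) \<omega> y)"
      by (intro nn_integral_cong) (auto simp: indicator_def on_dom_out)
    finally show "(LI y. ennreal (pw q (fst y)) * e1 v \<omega> y) \<le> Kp * (LI y. ennreal (pw q (fst y)) * e2 (grad P v) \<omega> y)" .
  qed
  also have "\<dots> = Kp * Ew (e2 (grad P v))"
    unfolding Ew_def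
  proof (rule nn_integral_cmult)
    note [measurable] = e_meas(2)[OF vf(3)]
    show "(\<lambda>\<omega>. \<integral>\<^sup>+y. ennreal (pw q (fst y)) * e2 (grad P v) \<omega> y \<partial>lborel) \<in> borel_measurable P"
      by (rule lborel.borel_measurable_nn_integral) measurable
  qed
  also have "\<dots> \<le> Kp * (Cw * Esq (e2 (grad P v)))"
    by (intro mult_left_mono Ew_le e2_stat[OF vf(2,4)]) simp
  finally have "Ew (e1 v) \<le> Kp * (Cw * Esq (e2 (grad P v)))" .
  then have "Esq (e1 v) \<le> ennreal (2 powr (q * real CARD('n))) * (Kp * (Cw * Esq (e2 (grad P v))))"
    using Esq_le[OF e_meas(1)[OF vf(1)]] by (meson mult_left_mono order_trans zero_le)
  then show ?thesis by (simp add: KH_def mult.assoc)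
qed


section \<open>Complex linear combinations of fields\<close>

definition comb :: "complex \<Rightarrow> ('n pt set \<Rightarrow> 'n pt \<Rightarrow> complex) \<Rightarrow> complex \<Rightarrow> ('n pt set \<Rightarrow> 'n pt \<Rightarrow> complex) \<Rightarrow> 'n pt set \<Rightarrow> 'n pt \<Rightarrow> complex" where
  "comb c u d v = (\<lambda>\<omega> y. c * u \<omega> y + d * v \<omega> y)"

lemma on_dom_comb: "on_dom (comb c u d v) \<omega> y = c * on_dom u \<omega> y + d * on_dom v \<omega> y"
  by (simp add: on_dom_def comb_def indicator_def)

lemma on_dom_cscale:
  "on_dom (\<lambda>\<omega> y. cscale c (F \<omega> y) + cscale d (G \<omega> y)) \<omega> y = cscale c (on_dom F \<omega> y) + cscale d (on_dom G \<omega> y)"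
  by (auto simp: on_dom_def indicator_def linear_0[OF bounded_linear.linear[OF bounded_linear_cscale]])

lemma cscale_measurable[measurable (raw)]:
  assumes "f \<in> borel_measurable M" shows "(\<lambda>x. cscale c (f x)) \<in> borel_measurable M"
  by (rule measurable_compose[OF assms]) (intro borel_measurable_continuous_onI linear_continuous_on bounded_linear_cscale)

lemma Esq_cong_AE:
  assumes "AE \<omega> in P. AE y in lborel. f \<omega> y = g \<omega> y"
  shows "Esq f = Esq g"
  unfolding Esq_def
proof (rule nn_integral_cong_AE, use assms in eventually_elim)
  fix \<omega> assume "AE y in lborel. f \<omega> y = g \<omega> y"
  then show "(LIS (square 1 \<times> UNIV) (\<lambda>y. f \<omega> y)) = (LIS (square 1 \<times> UNIV) (\<lambda>y. g \<omega> y))"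
    by (intro nn_integral_cong_AE, elim eventually_mono) simp
qed

lemma Ew_cong_AE:
  assumes "AE \<omega> in P. AE y in lborel. f \<omega> y = g \<omega> y"
  shows "Ew f = Ew g"
  unfolding Ew_def
proof (rule nn_integral_cong_AE, use assms in eventually_elim)
  fix \<omega> assume "AE y in lborel. f \<omega> y = g \<omega> y"
  then show "(LI y. ennreal (pw q (fst y)) * f \<omega> y) = (LI y. ennreal (pw q (fst y)) * g \<omega> y)"
    by (intro nn_integral_cong_AE, elim eventually_mono) simp
qed

lemma Esq_lin_le:
  assumes g: "jmeas g" and k: "jmeas k"
    and le: "\<And>\<omega> y. \<omega> \<in> space P \<Longrightarrow> f \<omega> y \<le> a * g \<omega> y + b * k \<omega> y"
  shows "Esq f \<le> a * Esq g + b * Esq k"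
proof -
  have [measurable]: "(\<lambda>p. g (fst p) (snd p)) \<in> borel_measurable MS" "(\<lambda>p. k (fst p) (snd p)) \<in> borel_measurable MS"
    using g k by (simp_all add: case_prod_unfold measurable_cong_sets[OF sets_MS refl])
  have m: "jmeas (\<lambda>\<omega> y. a * g \<omega> y + b * k \<omega> y)" using g k by measurable
  have "Esq f \<le> Esq (\<lambda>\<omega> y. a * g \<omega> y + b * k \<omega> y)"
    unfolding Esq_def by (intro nn_integral_mono mult_right_mono le) auto
  also have "\<dots> = a * Esq g + b * Esq k"
    unfolding Esq_MS[OF m] Esq_MS[OF g] Esq_MS[OF k] by (rule nn_integral_lin) measurable
  finally show ?thesis .
qed

lemma nsq_lin_le:
  fixes a b :: "'b::real_normed_vector"
  assumes "norm x \<le> C * norm a + E * norm b"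
  shows "nsq x \<le> ennreal (2 * C\<^sup>2) * nsq a + ennreal (2 * E\<^sup>2) * nsq b"
proof -
  have "(norm x)\<^sup>2 \<le> (C * norm a + E * norm b)\<^sup>2" using assms by (intro power_mono) auto
  also have "\<dots> \<le> 2 * (C * norm a)\<^sup>2 + 2 * (E * norm b)\<^sup>2" using norm_add_sq_le[of "C * norm a" "E * norm b"] by simp
  finally have "nsq x \<le> ennreal (2 * C\<^sup>2 * (norm a)\<^sup>2 + 2 * E\<^sup>2 * (norm b)\<^sup>2)"
    by (intro ennreal_leI) (simp add: power_mult_distrib)
  then show ?thesis by (simp add: ennreal_plus ennreal_mult'')
qed

lemma comb_gradient:
  assumes u: "u \<in> W" and v: "v \<in> W"
  shows "random_gradient P (comb c u d v) (\<lambda>\<omega> y. cscale c (grad P u \<omega> y) + cscale d (grad P v \<omega> y))"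
proof -
  note uf = W_facts[OF u] and vf = W_facts[OF v]
  have "jmeas (\<lambda>\<omega> y. cscale c (on_dom (grad P u) \<omega> y) + cscale d (on_dom (grad P v) \<omega> y))"
    using random_field_meas[OF uf(3)] random_field_meas[OF vf(3)] by measurable
  moreover have "AE \<omega> in P. H1loc (D \<omega>) (comb c u d v \<omega>) (\<lambda>y. cscale c (grad P u \<omega> y) + cscale d (grad P v \<omega> y))"
    using AE_space uf(5) vf(5) unfolding comb_def by eventually_elim (intro H1loc_lin D_borel)
  ultimately show ?thesis unfolding random_gradient_def random_field_def on_dom_cscale by simp
qed

text \<open>\<open>grad\<close> of a combination is a fresh choice, so it is the combination of the
  gradients only almost everywhere; later computations with gradients use this form.\<close>

lemma W_comb:
  assumes u: "u \<in> W" and v: "v \<in> W"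
  shows "comb c u d v \<in> W"
    and "AE \<omega> in P. AE y in lborel. on_dom (grad P (comb c u d v)) \<omega> y = cscale c (on_dom (grad P u) \<omega> y) + cscale d (on_dom (grad P v) \<omega> y)"
proof -
  note uf = W_facts[OF u] and vf = W_facts[OF v]
  have ex: "\<exists>G. random_gradient P (comb c u d v) G" using comb_gradient[OF u v] by blast
  show ae: "AE \<omega> in P. AE y in lborel. on_dom (grad P (comb c u d v)) \<omega> y = cscale c (on_dom (grad P u) \<omega> y) + cscale d (on_dom (grad P v) \<omega> y)"
    using random_gradient_unique[OF grad_random_gradient[OF ex] comb_gradient[OF u v]] by (simp only: on_dom_cscale)
  show "comb c u d v \<in> W" unfolding W_iff
  proof (intro conjI ex)
    have "jmeas (\<lambda>\<omega> y. c * on_dom u \<omega> y + d * on_dom v \<omega> y)"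
      using random_field_meas[OF uf(1)] random_field_meas[OF vf(1)] by measurable
    then show rf: "random_field P (comb c u d v)" unfolding random_field_def on_dom_comb .
    from AE_space uf(6) vf(6) show "AE \<omega> in P. \<forall>b\<in>\<omega>. has_trace (D \<omega>) (sphere_measure b) (comb c u d v \<omega>) (\<lambda>y. 0)"
    proof eventually_elim
      fix \<omega> assume \<omega>: "\<omega> \<in> space P" and t: "\<forall>b\<in>\<omega>. has_trace (D \<omega>) (sphere_measure b) (u \<omega>) (\<lambda>y. 0)"
        "\<forall>b\<in>\<omega>. has_trace (D \<omega>) (sphere_measure b) (v \<omega>) (\<lambda>y. 0)"
      then have "has_trace (D \<omega>) (sphere_measure b) (\<lambda>y. c * u \<omega> y + d * v \<omega> y) (\<lambda>y. c * 0 + d * 0)" if "b \<in> \<omega>" for b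
        using that by (intro has_trace_lin D_borel sets_sphere_measure) auto
      then show "\<forall>b\<in>\<omega>. has_trace (D \<omega>) (sphere_measure b) (comb c u d v \<omega>) (\<lambda>y. 0)" by (simp add: comb_def)
    qed
    show "stat_field (comb c u d v)" using uf(4) vf(4) unfolding stat_field_def on_dom_comb by simp
    have "Esq (e1 (comb c u d v)) \<le> ennreal (2 * (norm c)\<^sup>2) * Esq (e1 u) + ennreal (2 * (norm d)\<^sup>2) * Esq (e1 v)"
    proof (rule Esq_lin_le[OF e_meas(1)[OF uf(1)] e_meas(1)[OF vf(1)]])
      fix \<omega> y
      have "nsq (on_dom (comb c u d v) \<omega> y) \<le> ennreal (2 * (norm c)\<^sup>2) * nsq (on_dom u \<omega> y) + ennreal (2 * (norm d)\<^sup>2) * nsq (on_dom v \<omega> y)"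
        unfolding on_dom_comb by (intro nsq_lin_le) (simp add: norm_mult[symmetric] norm_triangle_ineq)
      then have "e1 (comb c u d v) \<omega> y \<le> ennreal (\<mu> \<omega> y) * (ennreal (2 * (norm c)\<^sup>2) * nsq (on_dom u \<omega> y) + ennreal (2 * (norm d)\<^sup>2) * nsq (on_dom v \<omega> y))"
        by (rule mult_left_mono) simp
      then show "e1 (comb c u d v) \<omega> y \<le> ennreal (2 * (norm c)\<^sup>2) * e1 u \<omega> y + ennreal (2 * (norm d)\<^sup>2) * e1 v \<omega> y"
        by (simp only: distrib_left mult.left_commute)
    qed
    also have "\<dots> < \<infinity>" using uf(7) vf(7) by (auto simp: ennreal_mult_less_top)
    finally show "Esq (e1 (comb c u d v)) < \<infinity>" .
    have "Esq (e2 (grad P (comb c u d v))) = Esq (\<lambda>\<omega> y. nsq (cscale c (on_dom (grad P u) \<omega> y) + cscale d (on_dom (grad P v) \<omega> y)))"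
      using ae by (intro Esq_cong_AE, elim eventually_mono) (auto elim: eventually_mono)
    also have "\<dots> \<le> ennreal (2 * (norm c)\<^sup>2) * Esq (e2 (grad P u)) + ennreal (2 * (norm d)\<^sup>2) * Esq (e2 (grad P v))"
      by (rule Esq_lin_le[OF e_meas(2)[OF uf(3)] e_meas(2)[OF vf(3)]], rule nsq_lin_le)
        (simp add: norm_cscale[symmetric] norm_triangle_ineq)
    also have "\<dots> < \<infinity>" using uf(8) vf(8) by (auto simp: ennreal_mult_less_top)
    finally show "Esq (e2 (grad P (comb c u d v))) < \<infinity>" .
  qed
qed

lemma zero_in_W: "(\<lambda>\<omega> y. 0) \<in> W"
proof -
  have od: "on_dom (\<lambda>\<omega> y. 0 :: 'b::real_vector) \<omega> y = 0" for \<omega> y by (simp add: on_dom_def)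
  have H: "H1loc D' (\<lambda>y :: 'n pt. 0) (\<lambda>y. 0)" for D'
    by (auto simp: H1loc_def L2loc_def set_borel_measurable_def weak_gradient_def weak_deriv_def set_lebesgue_integral_def)
  have rg: "random_gradient P (\<lambda>\<omega> y. 0) (\<lambda>\<omega> y. 0)"
    unfolding random_gradient_def random_field_def od by (simp add: H)
  have ex: "\<exists>G. random_gradient P (\<lambda>\<omega> y. 0) G" using rg by blast
  have cg: "classical_gradient (\<lambda>y :: 'n pt. 0) y = 0" for y
    by (simp add: classical_gradient_def prod_eq_iff vec_eq_iff frechet_derivative_const)
  have tr: "has_trace D' S (\<lambda>y :: 'n pt. 0) (\<lambda>y. 0)" for D' S
    unfolding has_trace_def by (intro conjI exI[of _ "\<lambda>y. 0"] exI[of _ "\<lambda>k y. 0"] H allI smooth_const) (simp_all add: cg)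
  have "AE \<omega> in P. AE y in lborel. on_dom (grad P (\<lambda>\<omega> y. 0)) \<omega> y = 0"
    using random_gradient_unique[OF grad_random_gradient[OF ex] rg] by (simp only: od)
  then have "Esq (e2 (grad P (\<lambda>\<omega> y. 0))) = Esq (\<lambda>\<omega> y. 0)"
    by (intro Esq_cong_AE, elim eventually_mono) (auto elim: eventually_mono)
  then show ?thesis unfolding W_iff using ex
    by (auto simp: random_field_def od tr stat_field_def Esq_def)
qed

text \<open>For one configuration the weights are bounded below on bounded parts of the fluid
  domain, with a constant that depends on the configuration. Finiteness of weighted integrals
  thereby gives control in \<open>L2loc\<close>, where weak gradients and traces are stable.\<close>

lemma weight_lower_bound:
  assumes \<omega>: "\<omega> \<in> space P"
  obtains c where "0 < c" "\<And>y. y \<in> D \<omega> \<inter> ball 0 r \<Longrightarrow> c \<le> pw q (fst y) * \<mu> \<omega> y" "\<And>y. y \<in> D \<omega> \<inter> ball 0 r \<Longrightarrow> c \<le> pw q (fst y)"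
proof -
  \<comment> \<open>Bounds the distance to the nearest centre at points of the ball and at their
    projections to height \<open>h\<close>. The summand \<open>1\<close> gives
    \<open>M \<ge> 1\<close>, so that the exponent \<open>m\<close> may be raised to
    \<open>2 * m\<close>.\<close>
  define M where "M = infdist 0 \<omega> + \<bar>r\<bar> + \<bar>h\<bar> + 1"
  have M: "1 \<le> M" unfolding M_def using infdist_nonneg[of 0 \<omega>] by simp
  let ?c1 = "(1 + \<bar>r\<bar>) powr (- (q * real CARD('n)))" and ?c2 = "inverse (r\<^sup>2 + M powr (2 * m))"
  have Mp: "0 < M powr (2 * m)" using M by simp
  have c1: "?c1 \<le> pw q (fst y)" if "y \<in> ball 0 r" for y :: "'n pt"
  proof -
    have "\<bar>(0 :: real ^ 'n) $ i - fst y $ i\<bar> \<le> (1 + \<bar>r\<bar>) - 1" for i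
    proof -
      have "\<bar>fst y $ i\<bar> \<le> norm (fst y)" by (rule component_le_norm_cart)
      also have "\<dots> \<le> norm y" by (metis norm_fst_le prod.collapse)
      finally show ?thesis using that by simp
    qed
    then have "pw q (0 :: real ^ 'n) \<le> (1 + \<bar>r\<bar>) powr (q * real CARD('n)) * pw q (fst y)"
      by (intro pw_compare q0) auto
    then have "1 \<le> (1 + \<bar>r\<bar>) powr (q * real CARD('n)) * pw q (fst y)" by (simp add: pw_def)
    then show ?thesis by (simp add: powr_minus field_simps)
  qed
  have c2: "?c2 \<le> \<mu> \<omega> y" if y: "y \<in> D \<omega> \<inter> ball 0 r" for y
  proof -
    have D: "0 < snd y" "1 < infdist y \<omega>" using y fluid_dom_eq[OF config[OF \<omega>] \<delta>] by auto
    have ny: "norm y < r" using y by simp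
    have sy: "\<bar>snd y\<bar> \<le> norm y" by (metis norm_snd_le prod.collapse real_norm_def)
    have fy: "norm (fst y) \<le> norm y" by (metis norm_fst_le prod.collapse)
    show ?thesis
    proof (cases "snd y \<le> h")
      case True
      have "infdist y \<omega> \<le> infdist 0 \<omega> + dist y 0" by (rule infdist_lip[OF config[OF \<omega>] \<delta>])
      then have "infdist y \<omega> \<le> M" using ny unfolding M_def by simp
      then have "infdist y \<omega> powr m \<le> M powr m" using D m_pos by (intro powr_mono2) auto
      also have "\<dots> \<le> M powr (2 * m)" using M m_pos by (intro powr_mono) auto
      also have "\<dots> \<le> r\<^sup>2 + M powr (2 * m)" by simp
      finally have "inverse (r\<^sup>2 + M powr (2 * m)) \<le> inverse (infdist y \<omega> powr m)"
        using D by (intro le_imp_inverse_le) auto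
      then show ?thesis using True by (simp add: weight_def nearest_dist_def powr_minus)
    next
      case False
      have "infdist (fst y, h) \<omega> \<le> infdist 0 \<omega> + dist (fst y, h) 0" by (rule infdist_lip[OF config[OF \<omega>] \<delta>])
      moreover have "norm (fst y, h) \<le> norm (fst y) + norm h" by (rule norm_Pair_le)
      ultimately have "infdist (fst y, h) \<omega> \<le> M" using ny fy unfolding M_def by simp
      then have "infdist (fst y, h) \<omega> powr (2 * m) \<le> M powr (2 * m)" using m_pos by (intro powr_mono2 infdist_nonneg) auto
      moreover have "(snd y)\<^sup>2 \<le> r\<^sup>2" using sy ny by (intro power2_le_iff_abs_le[THEN iffD2]) auto
      ultimately have "(snd y)\<^sup>2 + infdist (fst y, h) \<omega> powr (2 * m) \<le> r\<^sup>2 + M powr (2 * m)" by simp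
      moreover have "0 < (snd y)\<^sup>2 + infdist (fst y, h) \<omega> powr (2 * m)" using D by (intro add_pos_nonneg) auto
      ultimately show ?thesis using False by (simp add: weight_def nearest_dist_def le_imp_inverse_le)
    qed
  qed
  have p1: "0 < ?c1" by simp
  have p2: "0 < ?c2" using Mp by (simp add: add_nonneg_pos)
  show ?thesis
  proof (rule that[of "min (?c1 * ?c2) ?c1"])
    show "0 < min (?c1 * ?c2) ?c1" using p1 p2 by (simp only: min_less_iff_conj mult_pos_pos simp_thms)
    fix y assume y: "y \<in> D \<omega> \<inter> ball 0 r"
    have "?c1 * ?c2 \<le> pw q (fst y) * \<mu> \<omega> y" using c1[of y] c2[OF y] p1 p2 y pw_pos[of q "fst y"] by (intro mult_mono) auto
    then show "min (?c1 * ?c2) ?c1 \<le> pw q (fst y) * \<mu> \<omega> y" by linarith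
    show "min (?c1 * ?c2) ?c1 \<le> pw q (fst y)" using c1[of y] y by auto
  qed
qed

lemma local_bound:
  assumes c: "0 < c" "\<And>y. y \<in> A \<Longrightarrow> c \<le> w y" and f[measurable]: "f \<in> borel_measurable borel" and w[measurable]: "w \<in> borel_measurable (borel :: 'n pt measure)"
  shows "(LIS A f) \<le> ennreal (1 / c) * (LI y. ennreal (w y) * f y)"
proof -
  have "(LIS A f) \<le> (LI y. ennreal (1 / c) * (ennreal (w y) * f y))"
  proof (intro nn_integral_mono)
    fix y
    have "1 * f y \<le> (ennreal (1 / c) * ennreal (w y)) * f y" if "y \<in> A"
    proof (rule mult_right_mono)
      have "1 \<le> (1 / c) * w y" using c(1) c(2)[OF that] by (simp add: field_simps)
      then show "1 \<le> ennreal (1 / c) * ennreal (w y)" using c(1) c(2)[OF that] by (subst ennreal_mult[symmetric]) auto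
    qed simp
    then show "f y * indicator A y \<le> ennreal (1 / c) * (ennreal (w y) * f y)" by (auto simp: indicator_def mult.assoc)
  qed
  also have "\<dots> = ennreal (1 / c) * (LI y. ennreal (w y) * f y)" by (rule nn_integral_cmult) measurable
  finally show ?thesis .
qed

lemma Ew_suminf:
  assumes F: "\<And>k. jmeas (F k)"
  shows "Ew (\<lambda>\<omega> y. \<Sum>k. a k * F k \<omega> y) = (\<Sum>k. a k * Ew (F k))"
proof -
  note [measurable] = F
  have M: "(\<lambda>\<omega>. \<integral>\<^sup>+y. ennreal (pw q (fst y)) * F k \<omega> y \<partial>lborel) \<in> borel_measurable P" for k
    by (rule lborel.borel_measurable_nn_integral) measurable
  have "Ew (\<lambda>\<omega> y. \<Sum>k. a k * F k \<omega> y) = (\<integral>\<^sup>+\<omega>. (\<Sum>k. a k * (LI y. ennreal (pw q (fst y)) * F k \<omega> y)) \<partial>P)"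
    unfolding Ew_def
  proof (intro nn_integral_cong)
    fix \<omega> assume \<omega>: "\<omega> \<in> space P"
    have [measurable]: "F k \<omega> \<in> borel_measurable borel" for k by (rule section_meas[OF F \<omega>])
    have "(LI y. ennreal (pw q (fst y)) * (\<Sum>k. a k * F k \<omega> y)) = (LI y. (\<Sum>k. a k * (ennreal (pw q (fst y)) * F k \<omega> y)))"
      by (intro nn_integral_cong) (simp add: ennreal_suminf_cmult[symmetric] mult.left_commute)
    also have "\<dots> = (\<Sum>k. \<integral>\<^sup>+y. a k * (ennreal (pw q (fst y)) * F k \<omega> y) \<partial>lborel)" by (rule nn_integral_suminf) measurable
    also have "\<dots> = (\<Sum>k. a k * (LI y. ennreal (pw q (fst y)) * F k \<omega> y))"
      by (intro arg_cong[where f = suminf] ext nn_integral_cmult) measurable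
    finally show "(LI y. ennreal (pw q (fst y)) * (\<Sum>k. a k * F k \<omega> y)) = (\<Sum>k. a k * (LI y. ennreal (pw q (fst y)) * F k \<omega> y))" .
  qed
  also have "\<dots> = (\<Sum>k. \<integral>\<^sup>+\<omega>. a k * (LI y. ennreal (pw q (fst y)) * F k \<omega> y) \<partial>P)"
    using M by (intro nn_integral_suminf) measurable
  also have "\<dots> = (\<Sum>k. a k * Ew (F k))"
    unfolding Ew_def using M by (intro arg_cong[where f = suminf] ext nn_integral_cmult)
  finally show ?thesis .
qed

lemma suminf_fast: "(\<Sum>k. 2 ^ k * (C * ennreal ((1/4) ^ k))) = 2 * C"
proof -
  have "(\<Sum>k. 2 ^ k * (C * ennreal ((1/4) ^ k))) = (\<Sum>k. C * ennreal ((1/2) ^ k))"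
  proof (intro arg_cong[where f = suminf] ext)
    fix k :: nat
    have "2 ^ k * ennreal ((1/4) ^ k) = ennreal (2 ^ k * (1/4) ^ k)" by (simp add: ennreal_mult ennreal_power[symmetric])
    also have "(2::real) ^ k * (1/4) ^ k = (1/2) ^ k" by (simp add: power_mult_distrib[symmetric])
    finally show "2 ^ k * (C * ennreal ((1/4) ^ k)) = C * ennreal ((1/2) ^ k)" by (simp only: mult.left_commute)
  qed
  also have "\<dots> = C * (\<Sum>k. ennreal ((1/2) ^ k))" by (rule ennreal_suminf_cmult)
  also have "(\<Sum>k. ennreal ((1/2) ^ k)) = ennreal 2"
    by (rule suminf_ennreal_eq) (use geometric_sums[of "1/2::real"] in auto)
  finally show ?thesis by (simp add: mult.commute)
qed


lemma lim_meas:
  fixes a :: "nat \<Rightarrow> 'n pt set \<Rightarrow> 'n pt \<Rightarrow> 'b::{euclidean_space}"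
  assumes "\<And>k. jmeas (a k)"
  shows "jmeas (\<lambda>\<omega> y. lim (\<lambda>k. a k \<omega> y))"
  unfolding case_prod_unfold
  by (rule borel_measurable_lim_metric) (use assms in \<open>simp add: case_prod_unfold\<close>)

text \<open>The pointwise rate of \<open>fast_sequence_bound_nsq\<close> is integrated over bounded
  sets, where the lower bound of the weight makes the sum of squared increments integrable.\<close>

lemma fast_local_limit:
  fixes a :: "nat \<Rightarrow> 'n pt \<Rightarrow> 'b::euclidean_space"
  defines "S \<equiv> \<lambda>y. \<Sum>k. 2 ^ k * nsq (a (Suc k) y - a k y)"
  assumes a[measurable]: "\<And>k. a k \<in> borel_measurable borel" and w[measurable]: "w \<in> borel_measurable (borel :: 'n pt measure)"
    and fin: "(LI y. ennreal (w y) * S y) < \<infinity>"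
    and low: "\<And>r. \<exists>c>0. \<forall>y\<in>D' \<inter> ball 0 r. c \<le> w y" and D': "D' \<in> sets borel" and L: "L2loc D' (a 0)"
  shows "l2conv D' r a (\<lambda>y. lim (\<lambda>k. a k y))"
    and "L2loc D' (\<lambda>y. lim (\<lambda>k. a k y))"
proof -
  let ?U = "\<lambda>y. lim (\<lambda>k. a k y)"
  have [measurable]: "?U \<in> borel_measurable borel" by (intro borel_measurable_lim_metric a)
  have Sm[measurable]: "S \<in> borel_measurable borel" unfolding S_def by measurable
  have pt: "nsq (?U y - a k y) \<le> ennreal (2 * (1/2) ^ k) * S y" for y k
    unfolding S_def by (rule fast_sequence_bound_nsq(2))
  have Sr: "(LIS (D' \<inter> ball 0 r) S) < \<infinity>" for r
  proof -
    obtain c where c: "0 < c" "\<And>y. y \<in> D' \<inter> ball 0 r \<Longrightarrow> c \<le> w y" using low[of r] by blast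
    have "(LIS (D' \<inter> ball 0 r) S) \<le> ennreal (1 / c) * (LI y. ennreal (w y) * S y)"
      by (rule local_bound[OF c Sm w])
    also have "\<dots> < \<infinity>" using fin by (auto simp: ennreal_mult_less_top)
    finally show ?thesis .
  qed
  have [measurable]: "D' \<inter> ball 0 r \<in> sets borel" for r using D' by simp
  have bd: "lsq D' r (\<lambda>y. a k y - ?U y) \<le> (LIS (D' \<inter> ball 0 r) S) * ennreal (2 * (1/2) ^ k)" for k r
  proof -
    have "lsq D' r (\<lambda>y. a k y - ?U y) \<le> (LI y. S y * indicator (D' \<inter> ball 0 r) y * ennreal (2 * (1/2) ^ k))"
    proof (intro nn_integral_mono)
      fix y
      show "nsq (a k y - ?U y) * indicator (D' \<inter> ball 0 r) y \<le> S y * indicator (D' \<inter> ball 0 r) y * ennreal (2 * (1/2) ^ k)"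
        using pt[of y k] by (auto simp: indicator_def norm_minus_commute mult.commute)
    qed
    also have "\<dots> = (LIS (D' \<inter> ball 0 r) S) * ennreal (2 * (1/2) ^ k)" by (rule nn_integral_multc) measurable
    finally show ?thesis .
  qed
  show "l2conv D' r a ?U" for r
  proof (rule tendsto_sandwich[OF always_eventually always_eventually tendsto_const])
    have "(\<lambda>k. (LIS (D' \<inter> ball 0 r) S) * ennreal (2 * (1/2) ^ k)) \<longlonglongrightarrow> (LIS (D' \<inter> ball 0 r) S) * ennreal (2 * 0)"
      using Sr[of r] by (intro ennreal_tendsto_cmult tendsto_ennrealI tendsto_mult tendsto_const LIMSEQ_power_zero) auto
    then show "(\<lambda>k. (LIS (D' \<inter> ball 0 r) S) * ennreal (2 * (1/2) ^ k)) \<longlonglongrightarrow> 0" by simp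
  qed (auto intro: bd)
  have "L2loc D' (\<lambda>y. a 0 y - ?U y)"
    unfolding L2loc_def set_borel_measurable_def
  proof (intro conjI allI)
    have "indicator D' \<in> borel_measurable (borel :: 'n pt measure)" using D' by simp
    then show "(\<lambda>y. indicator D' y *\<^sub>R (a 0 y - ?U y)) \<in> borel_measurable lborel" by measurable
    fix r
    have "(LIS (D' \<inter> ball 0 r) S) * ennreal (2 * (1/2) ^ 0) < \<infinity>" using Sr[of r] by (auto simp: ennreal_mult_less_top)
    then show "lsq D' r (\<lambda>y. a 0 y - ?U y) < \<infinity>" by (rule le_less_trans[OF bd])
  qed
  from L2loc_diff[OF D' L this] show "L2loc D' ?U" by simp
qed

text \<open>Stationarity is demanded for every configuration, so the limit is taken with
  \<open>lim\<close> at every point: the sequences at \<open>y + (z, 0)\<close> for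
  \<open>\<omega>\<close> and at \<open>y\<close> for \<open>shift z \<omega>\<close> coincide,
  hence so do their values under \<open>lim\<close>, convergent or not. The same choice makes the
  limit jointly measurable.\<close>

lemma W_complete:
  assumes s: "\<And>k. s k \<in> W" and fast: "\<And>k. Esq (e2 (grad P (comb 1 (s (Suc k)) (-1) (s k)))) \<le> ennreal ((1/4) ^ k)"
  shows "\<exists>U\<in>W. (\<lambda>k. Esq (e2 (grad P (comb 1 (s k) (-1) U)))) \<longlonglongrightarrow> 0"
proof -
  note sf = W_facts[OF s]
  define a where "a k \<omega> y = on_dom (s k) \<omega> y" for k \<omega> y
  define g where "g k \<omega> y = on_dom (grad P (s k)) \<omega> y" for k \<omega> y
  define U where "U \<omega> y = lim (\<lambda>k. a k \<omega> y)" for \<omega> y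
  define GU where "GU \<omega> y = lim (\<lambda>k. g k \<omega> y)" for \<omega> y
  let ?\<Delta> = "\<lambda>k. comb 1 (s (Suc k)) (-1) (s k)"
  have \<Delta>W: "?\<Delta> k \<in> W" for k by (rule W_comb(1)[OF s s])
  note \<Delta>f = W_facts[OF \<Delta>W]
  have am[measurable]: "jmeas (a k)" for k
    unfolding a_def using random_field_meas[OF sf(1)] by simp
  have gm[measurable]: "jmeas (g k)" for k
    unfolding g_def using random_field_meas[OF sf(3)] by simp
  have Um[measurable]: "jmeas U" unfolding U_def by (rule lim_meas[OF am])
  have GUm[measurable]: "jmeas GU" unfolding GU_def by (rule lim_meas[OF gm])
  \<comment> \<open>Off the fluid domain both sequences are constantly \<open>0\<close>, so their
    limits are \<open>0\<close> as well.\<close>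
  have odU: "on_dom U \<omega> y = U \<omega> y" and odG: "on_dom GU \<omega> y = GU \<omega> y" for \<omega> y
    by (auto simp: on_dom_def U_def a_def GU_def g_def indicator_def lim_const)
  define S1 where "S1 \<omega> y = (\<Sum>k. 2 ^ k * nsq (a (Suc k) \<omega> y - a k \<omega> y))" for \<omega> y
  define S2 where "S2 \<omega> y = (\<Sum>k. 2 ^ k * nsq (g (Suc k) \<omega> y - g k \<omega> y))" for \<omega> y
  have S1m[measurable]: "jmeas S1" unfolding S1_def by measurable
  have S2m[measurable]: "jmeas S2" unfolding S2_def by measurable
  have pt1: "nsq (U \<omega> y - a k \<omega> y) \<le> ennreal (2 * (1/2) ^ k) * S1 \<omega> y" for \<omega> y k
    unfolding U_def S1_def by (rule fast_sequence_bound_nsq(2))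
  have pt2: "nsq (GU \<omega> y - g k \<omega> y) \<le> ennreal (2 * (1/2) ^ k) * S2 \<omega> y" for \<omega> y k
    unfolding GU_def S2_def by (rule fast_sequence_bound_nsq(2))
  let ?M1 = "\<lambda>\<omega> y. ennreal (\<mu> \<omega> y) * S1 \<omega> y"
  have M1m[measurable]: "jmeas (\<lambda>\<omega> y. ?M1 \<omega> y)" by measurable
  have da: "on_dom (?\<Delta> k) \<omega> y = a (Suc k) \<omega> y - a k \<omega> y" for k \<omega> y by (simp add: on_dom_comb a_def)
  have dg: "AE \<omega> in P. AE y in lborel. on_dom (grad P (?\<Delta> k)) \<omega> y = g (Suc k) \<omega> y - g k \<omega> y" for k
    using W_comb(2)[OF s s, of 1 "Suc k" "-1" k] by (simp only: cscale_1 cscale_minus1 g_def add_uminus_conv_diff)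
  \<comment> \<open>Only the increments of the gradients are assumed small; \<open>hardy_W\<close>
    transfers their rate \<open>(1/4) ^ k\<close> to the weighted values, and against the factor
    \<open>2 ^ k\<close> the sum is finite.\<close>
  have E1: "Ew ?M1 < \<infinity>"
  proof -
    have "Ew ?M1 = Ew (\<lambda>\<omega> y. \<Sum>k. 2 ^ k * e1 (?\<Delta> k) \<omega> y)"
      unfolding S1_def da by (simp only: ennreal_suminf_cmult[symmetric] mult.left_commute)
    also have "\<dots> = (\<Sum>k. 2 ^ k * Ew (e1 (?\<Delta> k)))" by (rule Ew_suminf[OF e_meas(1)[OF \<Delta>f(1)]])
    also have "\<dots> \<le> (\<Sum>k. 2 ^ k * ((Cw * KH) * ennreal ((1/4) ^ k)))"
    proof (intro suminf_le mult_left_mono)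
      fix k
      have "Ew (e1 (?\<Delta> k)) \<le> Cw * Esq (e1 (?\<Delta> k))" by (rule Ew_le[OF e1_stat[OF \<Delta>f(1,4)]])
      also have "\<dots> \<le> Cw * (KH * ennreal ((1/4) ^ k))"
        by (intro mult_left_mono order_trans[OF hardy_W[OF \<Delta>W] mult_left_mono[OF fast]]) auto
      finally show "Ew (e1 (?\<Delta> k)) \<le> (Cw * KH) * ennreal ((1/4) ^ k)" by (simp add: mult.assoc)
    qed auto
    also have "\<dots> = 2 * (Cw * KH)" by (rule suminf_fast)
    also have "\<dots> < \<infinity>" using Cw_finite KH_finite by (auto simp: ennreal_mult_less_top)
    finally show ?thesis .
  qed
  have E2: "Ew S2 < \<infinity>"
  proof -
    have "Ew S2 = (\<Sum>k. 2 ^ k * Ew (\<lambda>\<omega> y. nsq (g (Suc k) \<omega> y - g k \<omega> y)))"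
      unfolding S2_def by (rule Ew_suminf) measurable
    also have "\<dots> = (\<Sum>k. 2 ^ k * Ew (e2 (grad P (?\<Delta> k))))"
    proof (intro arg_cong[where f = suminf] ext arg_cong2[where f = "(*)"] refl Ew_cong_AE)
      fix k show "AE \<omega> in P. AE y in lborel. nsq (g (Suc k) \<omega> y - g k \<omega> y) = e2 (grad P (?\<Delta> k)) \<omega> y"
        using dg[of k] by (elim eventually_mono) (auto elim: eventually_mono)
    qed
    also have "\<dots> \<le> (\<Sum>k. 2 ^ k * (Cw * ennreal ((1/4) ^ k)))"
    proof (intro suminf_le mult_left_mono)
      fix k
      have "Ew (e2 (grad P (?\<Delta> k))) \<le> Cw * Esq (e2 (grad P (?\<Delta> k)))" by (rule Ew_le[OF e2_stat[OF \<Delta>f(2,4)]])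
      also have "\<dots> \<le> Cw * ennreal ((1/4) ^ k)" by (intro mult_left_mono fast) auto
      finally show "Ew (e2 (grad P (?\<Delta> k))) \<le> Cw * ennreal ((1/4) ^ k)" .
    qed auto
    also have "\<dots> = 2 * Cw" by (rule suminf_fast)
    also have "\<dots> < \<infinity>" using Cw_finite by (auto simp: ennreal_mult_less_top)
    finally show ?thesis .
  qed
  have allH: "AE \<omega> in P. \<forall>k. H1loc (D \<omega>) (s k \<omega>) (grad P (s k) \<omega>)" using sf(5) by (simp add: AE_all_countable)
  have allT: "AE \<omega> in P. \<forall>k. \<forall>c\<in>\<omega>. has_trace (D \<omega>) (sphere_measure c) (s k \<omega>) (\<lambda>y. 0)" using sf(6) by (simp add: AE_all_countable)
  have path: "AE \<omega> in P. H1loc (D \<omega>) (U \<omega>) (GU \<omega>) \<and> (\<forall>c\<in>\<omega>. has_trace (D \<omega>) (sphere_measure c) (U \<omega>) (\<lambda>y. 0))"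
    using AE_space allH allT AE_of_Ew(1)[OF M1m E1] AE_of_Ew(1)[OF S2m E2]
  proof eventually_elim
    fix \<omega> assume \<omega>: "\<omega> \<in> space P" and H: "\<forall>k. H1loc (D \<omega>) (s k \<omega>) (grad P (s k) \<omega>)"
      and T: "\<forall>k. \<forall>c\<in>\<omega>. has_trace (D \<omega>) (sphere_measure c) (s k \<omega>) (\<lambda>y. 0)"
      and F1: "(LI y. ennreal (pw q (fst y)) * ?M1 \<omega> y) < \<infinity>"
      and F2: "(LI y. ennreal (pw q (fst y)) * S2 \<omega> y) < \<infinity>"
    have ab: "a k \<omega> \<in> borel_measurable borel" "g k \<omega> \<in> borel_measurable borel" for k
      by (rule section_meas[OF am \<omega>], rule section_meas[OF gm \<omega>])
    have wb[measurable]: "\<mu> \<omega> \<in> borel_measurable borel" by (rule section_meas[OF weight_meas \<omega>])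
    have Hk: "H1loc (D \<omega>) (a k \<omega>) (g k \<omega>)" for k
      using H H1loc_cong[of "D \<omega>" "s k \<omega>" "a k \<omega>" "grad P (s k) \<omega>" "g k \<omega>"] by (simp add: a_def g_def on_dom_in)
    have hc: "has_trace (D \<omega>) S (s k \<omega>) g' \<longleftrightarrow> has_trace (D \<omega>) S (a k \<omega>) g'" for S g' k
      by (rule has_trace_cong) (simp add: a_def on_dom_in)
    have Tk: "has_trace (D \<omega>) (sphere_measure c) (a k \<omega>) (\<lambda>y. 0)" if "c \<in> \<omega>" for c k
      using T that hc by blast
    have low1: "\<exists>c>0. \<forall>y\<in>D \<omega> \<inter> ball 0 r. c \<le> pw q (fst y) * \<mu> \<omega> y" for r
      using weight_lower_bound[OF \<omega>, of r] by metis
    have low2: "\<exists>c>0. \<forall>y\<in>D \<omega> \<inter> ball 0 r. c \<le> pw q (fst y)" for r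
      using weight_lower_bound[OF \<omega>, of r] by metis
    have F1': "(LI y. ennreal (pw q (fst y) * \<mu> \<omega> y) * (\<Sum>k. 2 ^ k * nsq (a (Suc k) \<omega> y - a k \<omega> y))) < \<infinity>"
    proof -
      have e: "ennreal (pw q (fst y) * \<mu> \<omega> y) = ennreal (pw q (fst y)) * ennreal (\<mu> \<omega> y)" for y :: "'n pt"
        by (rule ennreal_mult[OF less_imp_le[OF pw_pos] weight_nonneg])
      show ?thesis using F1 unfolding e by (simp add: S1_def mult.assoc)
    qed
    have w1: "(\<lambda>y. pw q (fst y) * \<mu> \<omega> y) \<in> borel_measurable borel" by measurable
    note l1 = fast_local_limit[where a = "\<lambda>k. a k \<omega>", OF ab(1) w1 F1' low1 D_borel[OF \<omega>]]
    note l2 = fast_local_limit[where a = "\<lambda>k. g k \<omega>", OF ab(2) pw_meas F2[unfolded S2_def] low2 D_borel[OF \<omega>]]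
    have La: "L2loc (D \<omega>) (a 0 \<omega>)" "L2loc (D \<omega>) (g 0 \<omega>)" using Hk[of 0] by (auto simp: H1loc_def)
    have c1: "l2conv (D \<omega>) r (\<lambda>k. a k \<omega>) (U \<omega>)" and c2: "l2conv (D \<omega>) r (\<lambda>k. g k \<omega>) (GU \<omega>)" for r
      unfolding U_def GU_def using l1(1)[OF La(1)] l2(1)[OF La(2)] by auto
    have LU: "L2loc (D \<omega>) (U \<omega>)" "L2loc (D \<omega>) (GU \<omega>)"
      using l1(2)[OF La(1)] l2(2)[OF La(2)] unfolding U_def[abs_def] GU_def[abs_def] by auto
    have HU: "H1loc (D \<omega>) (U \<omega>) (GU \<omega>)" by (rule H1loc_limit[OF D_borel[OF \<omega>] LU Hk c1 c2])
    moreover have "has_trace (D \<omega>) (sphere_measure c) (U \<omega>) (\<lambda>y. 0)" if "c \<in> \<omega>" for c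
      by (rule has_trace_limit[OF D_open[OF \<omega>] sets_sphere_measure Tk[OF that] Hk HU c1 c2])
    ultimately show "H1loc (D \<omega>) (U \<omega>) (GU \<omega>) \<and> (\<forall>c\<in>\<omega>. has_trace (D \<omega>) (sphere_measure c) (U \<omega>) (\<lambda>y. 0))" by blast
  qed
  have rfU: "random_field P U" and rfG: "random_field P GU" unfolding random_field_def odU odG by (rule Um, rule GUm)
  have rg: "random_gradient P U GU" unfolding random_gradient_def using rfG path by (auto elim: eventually_mono)
  have ex: "\<exists>G. random_gradient P U G" using rg by blast
  have gU: "AE \<omega> in P. AE y in lborel. on_dom (grad P U) \<omega> y = GU \<omega> y"
    using random_gradient_unique[OF grad_random_gradient[OF ex] rg] by (simp only: odG)
  have ES: "Esq ?M1 < \<infinity>" "Esq S2 < \<infinity>"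
  proof -
    have *: "ennreal (2 powr (q * real CARD('n))) * x < \<infinity>" if "x < \<infinity>" for x using that by (auto simp: ennreal_mult_less_top)
    show "Esq ?M1 < \<infinity>" "Esq S2 < \<infinity>"
      using le_less_trans[OF Esq_le[OF M1m] *[OF E1]] le_less_trans[OF Esq_le[OF S2m] *[OF E2]] by auto
  qed
  have sq2: "nsq x \<le> 2 * nsq (x - z) + 2 * nsq z" for x z :: "'b::real_normed_vector"
    using ennreal_norm_add_sq_le[of "x - z" z] by simp
  have UW: "U \<in> W" unfolding W_iff
  proof (intro conjI ex rfU)
    show "AE \<omega> in P. \<forall>c\<in>\<omega>. has_trace (D \<omega>) (sphere_measure c) (U \<omega>) (\<lambda>y. 0)" using path by (auto elim: eventually_mono)
    show "stat_field U" unfolding stat_field_def odU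
    proof (intro ballI allI)
      fix \<omega> and y :: "'n pt" and z assume \<omega>: "\<omega> \<in> space P"
      have "a k \<omega> (y + (z, 0)) = a k (shift z \<omega>) y" for k using sf(4)[of k] \<omega> unfolding stat_field_def a_def by blast
      then show "U \<omega> (y + (z, 0)) = U (shift z \<omega>) y" unfolding U_def by simp
    qed
    have "Esq (e1 U) \<le> 4 * Esq ?M1 + 2 * Esq (e1 (s 0))"
    proof (rule Esq_lin_le[OF M1m e_meas(1)[OF sf(1)]])
      fix \<omega> y
      have "nsq (U \<omega> y) \<le> 2 * nsq (U \<omega> y - a 0 \<omega> y) + 2 * nsq (a 0 \<omega> y)" by (rule sq2)
      also have "\<dots> \<le> 2 * (2 * S1 \<omega> y) + 2 * nsq (a 0 \<omega> y)" using pt1[of \<omega> y 0] by (intro add_right_mono mult_left_mono) auto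
      also have "2 * (2 * S1 \<omega> y) = 4 * S1 \<omega> y" by (simp add: mult.assoc[symmetric])
      finally have "ennreal (\<mu> \<omega> y) * nsq (U \<omega> y) \<le> ennreal (\<mu> \<omega> y) * (4 * S1 \<omega> y + 2 * nsq (a 0 \<omega> y))" by (rule mult_left_mono) simp
      then show "e1 U \<omega> y \<le> 4 * ?M1 \<omega> y + 2 * e1 (s 0) \<omega> y" unfolding odU a_def by (simp only: distrib_left mult.left_commute)
    qed
    also have "\<dots> < \<infinity>" using ES sf(7)[of 0] by (auto simp: ennreal_mult_less_top)
    finally show "Esq (e1 U) < \<infinity>" .
    have "Esq (e2 (grad P U)) = Esq (\<lambda>\<omega> y. nsq (GU \<omega> y))"
      using gU by (intro Esq_cong_AE, elim eventually_mono) (auto elim: eventually_mono)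
    also have "\<dots> \<le> 4 * Esq S2 + 2 * Esq (e2 (grad P (s 0)))"
    proof (rule Esq_lin_le[OF S2m e_meas(2)[OF sf(3)]])
      fix \<omega> y
      have "nsq (GU \<omega> y) \<le> 2 * nsq (GU \<omega> y - g 0 \<omega> y) + 2 * nsq (g 0 \<omega> y)" by (rule sq2)
      also have "\<dots> \<le> 2 * (2 * S2 \<omega> y) + 2 * nsq (g 0 \<omega> y)" using pt2[of \<omega> y 0] by (intro add_right_mono mult_left_mono) auto
      also have "2 * (2 * S2 \<omega> y) = 4 * S2 \<omega> y" by (simp add: mult.assoc[symmetric])
      finally show "nsq (GU \<omega> y) \<le> 4 * S2 \<omega> y + 2 * e2 (grad P (s 0)) \<omega> y" by (simp add: g_def)
    qed
    also have "\<dots> < \<infinity>" using ES sf(8)[of 0] by (auto simp: ennreal_mult_less_top)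
    finally show "Esq (e2 (grad P U)) < \<infinity>" .
  qed
  have "(\<lambda>k. Esq (e2 (grad P (comb 1 (s k) (-1) U)))) \<longlonglongrightarrow> 0"
  proof (rule tendsto_sandwich[OF always_eventually always_eventually tendsto_const])
    have "(\<lambda>k. Esq S2 * ennreal (2 * (1/2) ^ k)) \<longlonglongrightarrow> Esq S2 * ennreal (2 * 0)"
      using ES(2) by (intro ennreal_tendsto_cmult tendsto_ennrealI tendsto_mult tendsto_const LIMSEQ_power_zero) auto
    then show "(\<lambda>k. Esq S2 * ennreal (2 * (1/2) ^ k)) \<longlonglongrightarrow> 0" by simp
    show "\<forall>k. Esq (e2 (grad P (comb 1 (s k) (-1) U))) \<le> Esq S2 * ennreal (2 * (1/2) ^ k)"
    proof
      fix k
      have "Esq (e2 (grad P (comb 1 (s k) (-1) U))) = Esq (\<lambda>\<omega> y. nsq (g k \<omega> y - GU \<omega> y))"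
      proof (rule Esq_cong_AE)
        show "AE \<omega> in P. AE y in lborel. e2 (grad P (comb 1 (s k) (-1) U)) \<omega> y = nsq (g k \<omega> y - GU \<omega> y)"
          using W_comb(2)[OF s[of k] UW, of 1 "-1"] gU
        proof eventually_elim
          fix \<omega> assume "AE y in lborel. on_dom (grad P (comb 1 (s k) (-1) U)) \<omega> y = cscale 1 (on_dom (grad P (s k)) \<omega> y) + cscale (-1) (on_dom (grad P U) \<omega> y)"
            "AE y in lborel. on_dom (grad P U) \<omega> y = GU \<omega> y"
          then show "AE y in lborel. e2 (grad P (comb 1 (s k) (-1) U)) \<omega> y = nsq (g k \<omega> y - GU \<omega> y)"
            by eventually_elim (simp add: cscale_1 cscale_minus1 g_def)
        qed
      qed
      also have "\<dots> \<le> ennreal (2 * (1/2) ^ k) * Esq S2 + 0 * Esq S2"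
        by (rule Esq_lin_le[OF S2m S2m]) (use pt2[of _ _ k] in \<open>simp add: norm_minus_commute\<close>)
      finally show "Esq (e2 (grad P (comb 1 (s k) (-1) U))) \<le> Esq S2 * ennreal (2 * (1/2) ^ k)" by (simp add: mult.commute)
    qed
  qed simp
  then show ?thesis using UW by blast
qed

end

section \<open>The Hermitian pairing of gradients\<close>

lemma norm_hdot_le: "norm (hdot a b) \<le> norm a * norm b"
proof -
  have "norm (hdot a b) \<le> (\<Sum>i\<in>UNIV. norm (fst a $ i) * norm (fst b $ i)) + norm (snd a) * norm (snd b)"
    unfolding hdot_def by (rule norm_triangle_le, rule add_mono, rule sum_norm_le) (simp_all add: norm_mult)
  also have "\<dots> = (\<chi> i. norm (fst a $ i), norm (snd a)) \<bullet> (\<chi> i. norm (fst b $ i), norm (snd b))"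
    by (simp add: inner_prod_def inner_vec_def)
  also have "\<dots> \<le> norm (\<chi> i. norm (fst a $ i), norm (snd a)) * norm (\<chi> i. norm (fst b $ i), norm (snd b))"
    by (rule norm_cauchy_schwarz)
  also have "\<dots> = norm a * norm b" by (simp add: norm_prod_def norm_vec_def L2_set_def)
  finally show ?thesis .
qed

lemma Re_hdot: "Re (hdot a b) = a \<bullet> b"
  by (simp add: hdot_def inner_prod_def inner_vec_def inner_complex_def)

lemma hdot_lin_right: "hdot w (cscale c a + cscale d b) = cnj c * hdot w a + cnj d * hdot w b"
  by (simp add: hdot_def cscale_def algebra_simps sum.distrib sum_distrib_left)

lemma hdot_0: "hdot 0 b = 0" "hdot a 0 = 0"
  by (simp_all add: hdot_def)

lemma hdot_measurable[measurable (raw)]: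
  fixes f g :: "'x \<Rightarrow> 'n::finite cvec"
  assumes "f \<in> borel_measurable M" "g \<in> borel_measurable M"
  shows "(\<lambda>x. hdot (f x) (g x)) \<in> borel_measurable M"
proof -
  have *: "(\<lambda>x. fst (k x) $ i) \<in> borel_measurable M" "(\<lambda>x. snd (k x)) \<in> borel_measurable M" if "k \<in> borel_measurable M" for k :: "'x \<Rightarrow> 'n cvec" and i
    by (rule measurable_compose[OF that], intro borel_measurable_continuous_onI continuous_intros)+
  note [measurable] = *[OF assms(1)] *[OF assms(2)]
  have [measurable]: "cnj \<in> borel_measurable borel" by (intro borel_measurable_continuous_onI continuous_intros)
  show ?thesis unfolding hdot_def by measurable
qed

definition l2n :: "'x measure \<Rightarrow> ('x \<Rightarrow> 'b::real_normed_vector) \<Rightarrow> real" where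
  "l2n M f = sqrt (enn2real (\<integral>\<^sup>+x. nsq (f x) \<partial>M))"

lemma l2n_nonneg: "0 \<le> l2n M f" by (simp add: l2n_def)

lemma L2_product:
  fixes X :: "'x \<Rightarrow> complex" and f :: "'x \<Rightarrow> 'b::euclidean_space" and g :: "'x \<Rightarrow> 'c::euclidean_space"
  assumes [measurable]: "X \<in> borel_measurable M" "f \<in> borel_measurable M" "g \<in> borel_measurable M"
    and le: "\<And>x. x \<in> space M \<Longrightarrow> norm (X x) \<le> norm (f x) * norm (g x)"
    and fin: "(\<integral>\<^sup>+x. nsq (f x) \<partial>M) < \<infinity>" "(\<integral>\<^sup>+x. nsq (g x) \<partial>M) < \<infinity>"
  shows "integrable M X" and "norm (\<integral>x. X x \<partial>M) \<le> l2n M f * l2n M g"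
proof -
  let ?A = "\<integral>\<^sup>+x. nsq (f x) \<partial>M" and ?B = "\<integral>\<^sup>+x. nsq (g x) \<partial>M"
  have "(\<integral>\<^sup>+x. ennreal (norm (X x)) \<partial>M) \<le> (\<integral>\<^sup>+x. ennreal (norm (f x)) * ennreal (norm (g x)) \<partial>M)"
    using le by (intro nn_integral_mono) (simp add: ennreal_mult[symmetric] ennreal_leI)
  then have "(\<integral>\<^sup>+x. ennreal (norm (X x)) \<partial>M)\<^sup>2 \<le> (\<integral>\<^sup>+x. ennreal (norm (f x)) * ennreal (norm (g x)) \<partial>M)\<^sup>2"
    by (rule power_mono) simp
  also have "\<dots> \<le> (\<integral>\<^sup>+x. (ennreal (norm (f x)))\<^sup>2 \<partial>M) * (\<integral>\<^sup>+x. (ennreal (norm (g x)))\<^sup>2 \<partial>M)"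
    by (rule Cauchy_Schwarz_nn_integral) measurable
  also have "\<dots> = ?A * ?B" by (simp add: ennreal_sq)
  finally have CS: "(\<integral>\<^sup>+x. ennreal (norm (X x)) \<partial>M)\<^sup>2 \<le> ?A * ?B" .
  have AB: "?A * ?B < \<infinity>" using fin by (auto simp: ennreal_mult_less_top)
  have "(\<integral>\<^sup>+x. ennreal (norm (X x)) \<partial>M)\<^sup>2 < \<infinity>" using CS AB by (rule le_less_trans)
  then have "(\<integral>\<^sup>+x. ennreal (norm (X x)) \<partial>M) < \<infinity>"
    by (auto simp: power2_eq_square ennreal_mult_eq_top_iff less_top[symmetric])
  then show int: "integrable M X" by (intro integrableI_bounded) auto
  have "ennreal (norm (\<integral>x. X x \<partial>M)) \<le> (\<integral>\<^sup>+x. ennreal (norm (X x)) \<partial>M)" by (rule integral_norm_bound_ennreal[OF int])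
  then have "(ennreal (norm (\<integral>x. X x \<partial>M)))\<^sup>2 \<le> ?A * ?B" using CS by (meson order_trans power_mono zero_le)
  then have "nsq (\<integral>x. X x \<partial>M) \<le> ennreal (enn2real ?A * enn2real ?B)"
    using fin by (simp add: ennreal_sq ennreal_mult less_top)
  then have "(norm (\<integral>x. X x \<partial>M))\<^sup>2 \<le> enn2real ?A * enn2real ?B" by (subst (asm) ennreal_le_iff) auto
  also have "\<dots> = (l2n M f * l2n M g)\<^sup>2" by (simp add: l2n_def power_mult_distrib)
  finally show "norm (\<integral>x. X x \<partial>M) \<le> l2n M f * l2n M g" by (rule power2_le_imp_le) (simp add: l2n_nonneg)
qed

section \<open>Traces of members of \<open>W0\<close> on the two planes\<close>

context particle_law
begin

text \<open>What is needed of a plane \<open>\<Sigma>\<^sub>t\<close> for its traces to be controlled by the fluid strip above it.\<close>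

definition trace_plane :: "real \<Rightarrow> real \<Rightarrow> bool" where
  "trace_plane t0 Kt \<longleftrightarrow> 0 \<le> Kt \<and> (\<forall>\<omega>\<in>space P. UNIV \<times> {t0<..<t0 + \<delta>} \<subseteq> D \<omega> \<and>
     (\<forall>x. 0 < \<mu> \<omega> (x, t0) \<and> \<mu> \<omega> (x, t0) \<le> 1 \<and> (\<forall>t\<in>{t0<..<t0 + \<delta>}. \<mu> \<omega> (x, t0) \<le> Kt * \<mu> \<omega> (x, t))))"

text \<open>Below height \<open>\<delta>\<close> the distance to the nearest centre exceeds
  \<open>1\<close>; moving up from the plane changes it by less than \<open>\<delta>\<close>, hence
  by a factor of at most \<open>1 + \<delta>\<close>.\<close>

lemma trace_plane_0: "trace_plane 0 ((1 + \<delta>) powr m)"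
  unfolding trace_plane_def
proof (intro conjI ballI allI)
  fix \<omega> assume \<omega>: "\<omega> \<in> space P"
  note c = config[OF \<omega>]
  show "UNIV \<times> {0<..<0 + \<delta>} \<subseteq> D \<omega>" using strip_in_fluid_dom[OF c \<delta>] by auto
  have h: "\<delta> < h" "0 \<le> h" using height_pos[OF c \<delta>] \<delta> by auto
  fix x
  let ?R = "infdist (x, 0) \<omega>"
  have R: "1 < ?R" using infdist_gt[OF c \<delta>, of "(x, 0)"] \<delta> by simp
  have w0: "\<mu> \<omega> (x, 0) = ?R powr (- m)" using h by (simp add: weight_def nearest_dist_def)
  show "0 < \<mu> \<omega> (x, 0)" using R by (simp add: w0)
  show "\<mu> \<omega> (x, 0) \<le> 1" unfolding w0 using R m_pos by (intro inv_powr_le_1[OF c \<delta>]) auto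
  fix t assume t: "t \<in> {0<..<0 + \<delta>}"
  have wt: "\<mu> \<omega> (x, t) = infdist (x, t) \<omega> powr (- m)" using h t by (simp add: weight_def nearest_dist_def)
  have Rt: "1 < infdist (x, t) \<omega>" using infdist_gt[OF c \<delta>, of "(x, t)"] t by simp
  have "infdist (x, t) \<omega> \<le> ?R + dist (x, t) (x, 0)" by (rule infdist_lip[OF c \<delta>])
  also have "dist (x, t) (x, 0) \<le> \<delta> * ?R"
  proof -
    have "dist (x, t) (x, 0) = t" using t by (simp add: dist_Pair_Pair dist_real_def)
    also have "\<dots> \<le> \<delta> * 1" using t by simp
    also have "\<dots> \<le> \<delta> * ?R" using R \<delta> by (intro mult_left_mono) auto
    finally show ?thesis .
  qed
  finally have "infdist (x, t) \<omega> \<le> (1 + \<delta>) * ?R" by (simp add: algebra_simps)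
  then have "infdist (x, t) \<omega> powr m \<le> ((1 + \<delta>) * ?R) powr m" using Rt m_pos by (intro powr_mono2) auto
  also have "\<dots> = (1 + \<delta>) powr m * ?R powr m" using \<delta> R by (simp add: powr_mult)
  finally have le: "infdist (x, t) \<omega> powr m \<le> (1 + \<delta>) powr m * ?R powr m" .
  have "0 < infdist (x, t) \<omega> powr m" "0 < ?R powr m" using Rt R by auto
  then show "\<mu> \<omega> (x, 0) \<le> (1 + \<delta>) powr m * \<mu> \<omega> (x, t)" unfolding w0 wt powr_minus
    using le by (simp add: field_simps)
qed simp

text \<open>Above the layer the part of the weight that involves the nearest centre is evaluated at
  height \<open>h\<close> and does not change along a vertical line; only the square of the height
  grows, up to the square of \<open>H + \<delta>\<close>.\<close>

lemma trace_plane_H: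
  assumes H: "h < H"
  shows "trace_plane H (((H + \<delta>) / H)\<^sup>2)"
  unfolding trace_plane_def
proof (intro conjI ballI allI)
  fix \<omega> assume \<omega>: "\<omega> \<in> space P"
  note c = config[OF \<omega>]
  have h: "1 \<le> h" using height_pos[OF c \<delta>] \<delta> by auto
  show "UNIV \<times> {H<..<H + \<delta>} \<subseteq> D \<omega>" using strip_in_fluid_dom[OF c \<delta>] h H by auto
  fix x
  show "0 < \<mu> \<omega> (x, H)" "\<mu> \<omega> (x, H) \<le> 1" using weight_upper[OF c \<delta>, of "(x, H)" m] H by simp_all
  fix t assume t: "t \<in> {H<..<H + \<delta>}"
  let ?a = "infdist (x, h) \<omega> powr (2 * m)" and ?k = "((H + \<delta>) / H)\<^sup>2"
  have a: "0 \<le> ?a" by simp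
  have Hp: "0 < H" using H h by simp
  have k: "1 \<le> ?k" using Hp \<delta> by (intro one_le_power) simp
  have "t\<^sup>2 \<le> (H + \<delta>)\<^sup>2" using t Hp by (intro power_mono) auto
  also have "\<dots> = ?k * H\<^sup>2" using Hp by (simp add: power_divide)
  finally have "t\<^sup>2 + ?a \<le> ?k * H\<^sup>2 + ?k * ?a" using mult_right_mono[OF k a] by simp
  then have le: "t\<^sup>2 + ?a \<le> ?k * (H\<^sup>2 + ?a)" by (simp add: algebra_simps)
  have "0 < t\<^sup>2 + ?a" "0 < H\<^sup>2 + ?a" using t Hp a by (auto intro: add_pos_nonneg)
  moreover have "inverse A \<le> k * inverse B" if "0 < B" "0 < A" "B \<le> k * A" for A B k :: real
    using that by (simp add: field_simps)
  ultimately have "inverse (H\<^sup>2 + ?a) \<le> ?k * inverse (t\<^sup>2 + ?a)" using le by blast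
  then show "\<mu> \<omega> (x, H) \<le> ?k * \<mu> \<omega> (x, t)" using H t by (simp add: weight_def nearest_dist_def)
qed simp

text \<open>An explicit trace from averages over strips of width at most \<open>\<delta>\<close>. It
  shows that the choice in \<open>trace_on\<close> has a candidate, and by uniqueness it equals the
  chosen one up to null sets.\<close>

definition tr :: "real \<Rightarrow> ('n pt set \<Rightarrow> 'n pt \<Rightarrow> complex) \<Rightarrow> 'n pt set \<Rightarrow> real ^ 'n \<Rightarrow> complex" where
  "tr t0 v \<omega> = trace_lim t0 \<delta> (on_dom v \<omega>)"

lemma tr_meas:
  assumes v: "random_field P v"
  shows "jmeas (tr t0 v)"
proof -
  have [measurable]: "(\<lambda>p. (snd (fst p), snd p)) \<in> ((P \<Otimes>\<^sub>M (lborel :: (real ^ 'n) measure)) \<Otimes>\<^sub>M (lborel :: real measure)) \<rightarrow>\<^sub>M (borel :: 'n pt measure)"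
    unfolding borel_prod[symmetric] by measurable
  have "(\<lambda>p. (fst (fst p), (snd (fst p), snd p))) \<in> ((P \<Otimes>\<^sub>M (lborel :: (real ^ 'n) measure)) \<Otimes>\<^sub>M (lborel :: real measure)) \<rightarrow>\<^sub>M P \<Otimes>\<^sub>M (lborel :: 'n pt measure)"
    by (intro measurable_Pair) measurable
  from measurable_compose[OF this random_field_meas[OF v]]
  have [measurable]: "(\<lambda>p. on_dom v (fst (fst p)) (snd (fst p), snd p)) \<in> borel_measurable ((P \<Otimes>\<^sub>M (lborel :: (real ^ 'n) measure)) \<Otimes>\<^sub>M (lborel :: real measure))"
    by simp
  have "(\<lambda>p. LINT t|lborel. indicator {t0<..<t0 + e} t *\<^sub>R on_dom v (fst p) (snd p, t)) \<in> borel_measurable (P \<Otimes>\<^sub>M (lborel :: (real ^ 'n) measure))" for e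
    by (rule lborel.borel_measurable_lebesgue_integral) (simp add: case_prod_unfold, measurable)
  then have "(\<lambda>p. avg t0 e (on_dom v (fst p)) (snd p)) \<in> borel_measurable (P \<Otimes>\<^sub>M (lborel :: (real ^ 'n) measure))" for e
    unfolding avg_def by measurable
  then show ?thesis unfolding tr_def trace_lim_def case_prod_unfold by (intro borel_measurable_lim_metric)
qed

text \<open>Configurations are nonempty, and the vanishing trace on one sphere provides the
  approximating sequence from which \<open>plane_trace\<close> derives existence and uniqueness on
  the plane.\<close>

lemma path_trace:
  assumes v: "v \<in> W" and T: "trace_plane t0 Kt"
  shows "AE \<omega> in P. has_trace (D \<omega>) (plane_measure t0) (v \<omega>) (\<lambda>y. tr t0 v \<omega> (fst y)) \<and>
    (\<forall>g. has_trace (D \<omega>) (plane_measure t0) (v \<omega>) (\<lambda>y. g (fst y)) \<longrightarrow> (AE x in lborel. g x = tr t0 v \<omega> x))"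
proof -
  note vf = W_facts[OF v]
  show ?thesis
  proof (use AE_space vf(5,6) in eventually_elim)
    fix \<omega> assume \<omega>: "\<omega> \<in> space P" and H: "H1loc (D \<omega>) (v \<omega>) (grad P v \<omega>)"
      and t: "\<forall>c\<in>\<omega>. has_trace (D \<omega>) (sphere_measure c) (v \<omega>) (\<lambda>y. 0)"
    obtain c where c: "c \<in> \<omega>" using config_nonempty[OF config[OF \<omega>] \<delta>] by blast
    have m: "on_dom v \<omega> \<in> borel_measurable borel" "on_dom (grad P v) \<omega> \<in> borel_measurable borel"
      using section_meas[OF random_field_meas[OF vf(1)] \<omega>] section_meas[OF random_field_meas[OF vf(3)] \<omega>] by auto
    have H': "H1loc (D \<omega>) (on_dom v \<omega>) (on_dom (grad P v) \<omega>)"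
      using H H1loc_cong[of "D \<omega>" "v \<omega>" "on_dom v \<omega>" "grad P v \<omega>" "on_dom (grad P v) \<omega>"] by (simp add: on_dom_in)
    have hc: "has_trace (D \<omega>) S (v \<omega>) g \<longleftrightarrow> has_trace (D \<omega>) S (on_dom v \<omega>) g" for S g
      by (rule has_trace_cong) (simp add: on_dom_in)
    have t': "has_trace (D \<omega>) (sphere_measure c) (on_dom v \<omega>) (\<lambda>y. 0)" using t c hc by blast
    have strip: "UNIV \<times> {t0<..<t0 + \<delta>} \<subseteq> D \<omega>" using T \<omega> unfolding trace_plane_def by blast
    show "has_trace (D \<omega>) (plane_measure t0) (v \<omega>) (\<lambda>y. tr t0 v \<omega> (fst y)) \<and>
      (\<forall>g. has_trace (D \<omega>) (plane_measure t0) (v \<omega>) (\<lambda>y. g (fst y)) \<longrightarrow> (AE x in lborel. g x = tr t0 v \<omega> x))"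
      unfolding hc tr_def using plane_trace[OF D_open[OF \<omega>] \<delta> strip m H' t'] by blast
  qed
qed

lemma trace_on_facts:
  assumes v: "v \<in> W" and T: "trace_plane t0 Kt"
  shows "jmeas (\<lambda>\<omega> x. trace_on P t0 v \<omega> x)"
    and "AE \<omega> in P. AE x in lborel. trace_on P t0 v \<omega> x = tr t0 v \<omega> x"
proof -
  let ?Q = "\<lambda>g. jmeas g \<and>
     (AE \<omega> in P. has_trace (D \<omega>) (plane_measure t0) (v \<omega>) (\<lambda>y. g \<omega> (fst y)))"
  have "?Q (tr t0 v)" using tr_meas[OF W_facts(1)[OF v]] path_trace[OF v T] by (auto elim: eventually_mono)
  then have Q: "?Q (trace_on P t0 v)" unfolding trace_on_def by (rule someI[of ?Q])
  then show "jmeas (\<lambda>\<omega> x. trace_on P t0 v \<omega> x)" by blast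
  show "AE \<omega> in P. AE x in lborel. trace_on P t0 v \<omega> x = tr t0 v \<omega> x"
    using conjunct2[OF Q] path_trace[OF v T] by eventually_elim blast
qed

lemma trace_on_comb:
  assumes u: "u \<in> W" and v: "v \<in> W" and T: "trace_plane t0 Kt"
  shows "AE \<omega> in P. AE x in lborel. trace_on P t0 (comb c u d v) \<omega> x = c * trace_on P t0 u \<omega> x + d * trace_on P t0 v \<omega> x"
  using AE_space path_trace[OF u T] path_trace[OF v T] path_trace[OF W_comb(1)[OF u v] T, of c d]
    trace_on_facts(2)[OF u T] trace_on_facts(2)[OF v T] trace_on_facts(2)[OF W_comb(1)[OF u v] T, of c d]
proof eventually_elim
  fix \<omega>
  assume \<omega>: "\<omega> \<in> space P"
    and 1: "has_trace (D \<omega>) (plane_measure t0) (u \<omega>) (\<lambda>y. tr t0 u \<omega> (fst y)) \<and> (\<forall>g. has_trace (D \<omega>) (plane_measure t0) (u \<omega>) (\<lambda>y. g (fst y)) \<longrightarrow> (AE x in lborel. g x = tr t0 u \<omega> x))"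
    and 2: "has_trace (D \<omega>) (plane_measure t0) (v \<omega>) (\<lambda>y. tr t0 v \<omega> (fst y)) \<and> (\<forall>g. has_trace (D \<omega>) (plane_measure t0) (v \<omega>) (\<lambda>y. g (fst y)) \<longrightarrow> (AE x in lborel. g x = tr t0 v \<omega> x))"
    and 3: "has_trace (D \<omega>) (plane_measure t0) (comb c u d v \<omega>) (\<lambda>y. tr t0 (comb c u d v) \<omega> (fst y)) \<and> (\<forall>g. has_trace (D \<omega>) (plane_measure t0) (comb c u d v \<omega>) (\<lambda>y. g (fst y)) \<longrightarrow> (AE x in lborel. g x = tr t0 (comb c u d v) \<omega> x))"
    and e: "AE x in lborel. trace_on P t0 u \<omega> x = tr t0 u \<omega> x" "AE x in lborel. trace_on P t0 v \<omega> x = tr t0 v \<omega> x"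
      "AE x in lborel. trace_on P t0 (comb c u d v) \<omega> x = tr t0 (comb c u d v) \<omega> x"
  have "has_trace (D \<omega>) (plane_measure t0) (\<lambda>y. c * u \<omega> y + d * v \<omega> y) (\<lambda>y. c * tr t0 u \<omega> (fst y) + d * tr t0 v \<omega> (fst y))"
    using 1 2 by (intro has_trace_lin D_borel \<omega> sets_plane_measure) auto
  then have "AE x in lborel. c * tr t0 u \<omega> x + d * tr t0 v \<omega> x = tr t0 (comb c u d v) \<omega> x"
    using conjunct2[OF 3, rule_format, of "\<lambda>x. c * tr t0 u \<omega> x + d * tr t0 v \<omega> x"] by (simp add: comb_def)
  with e show "AE x in lborel. trace_on P t0 (comb c u d v) \<omega> x = c * trace_on P t0 u \<omega> x + d * trace_on P t0 v \<omega> x"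
    by eventually_elim simp
qed

text \<open>\<open>plane_trace_bound\<close> is used with the weight of the plane, restricted to the
  unit square, as \<open>\<rho>\<close>. In the gradient term this weight is at most
  \<open>1\<close>; in the term with the values it is at most \<open>Kt\<close> times the weight in
  the strip, and \<open>hardy_W\<close> converts that term into gradients.\<close>

lemma trace_bound:
  assumes v: "v \<in> W" and T: "trace_plane t0 Kt"
  shows "(\<integral>\<^sup>+\<omega>. (LIS (square 1) (\<lambda>x. ennreal (\<mu> \<omega> (x, t0)) * nsq (trace_on P t0 v \<omega> x))) \<partial>P) \<le>
    (ennreal (128 * \<delta>) + ennreal (2 / \<delta>) * ennreal Kt * KH) * Esq (e2 (grad P v))"
proof -
  note vf = W_facts[OF v]
  have "(\<integral>\<^sup>+\<omega>. (LIS (square 1) (\<lambda>x. ennreal (\<mu> \<omega> (x, t0)) * nsq (trace_on P t0 v \<omega> x))) \<partial>P) \<le>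
    (\<integral>\<^sup>+\<omega>. ennreal (128 * \<delta>) * (LIS (square 1 \<times> UNIV) (\<lambda>y. e2 (grad P v) \<omega> y)) +
       (ennreal (2 / \<delta>) * ennreal Kt) * (LIS (square 1 \<times> UNIV) (\<lambda>y. e1 v \<omega> y)) \<partial>P)"
  proof (rule nn_integral_mono_AE, use AE_space vf(5,6) trace_on_facts(2)[OF v T] in eventually_elim)
    fix \<omega> assume \<omega>: "\<omega> \<in> space P" and H: "H1loc (D \<omega>) (v \<omega>) (grad P v \<omega>)"
      and t: "\<forall>c\<in>\<omega>. has_trace (D \<omega>) (sphere_measure c) (v \<omega>) (\<lambda>y. 0)"
      and ae: "AE x in lborel. trace_on P t0 v \<omega> x = tr t0 v \<omega> x"
    obtain c where c: "c \<in> \<omega>" using config_nonempty[OF config[OF \<omega>] \<delta>] by blast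
    have m[measurable]: "on_dom v \<omega> \<in> borel_measurable borel" "on_dom (grad P v) \<omega> \<in> borel_measurable borel" "\<mu> \<omega> \<in> borel_measurable borel"
      using section_meas[OF random_field_meas[OF vf(1)] \<omega>] section_meas[OF random_field_meas[OF vf(3)] \<omega>] section_meas[OF weight_meas \<omega>] by auto
    have H': "H1loc (D \<omega>) (on_dom v \<omega>) (on_dom (grad P v) \<omega>)"
      using H H1loc_cong[of "D \<omega>" "v \<omega>" "on_dom v \<omega>" "grad P v \<omega>" "on_dom (grad P v) \<omega>"] by (simp add: on_dom_in)
    have t': "has_trace (D \<omega>) (sphere_measure c) (on_dom v \<omega>) (\<lambda>y. 0)"
      using t c has_trace_cong[of "D \<omega>" "v \<omega>" "on_dom v \<omega>"] by (simp add: on_dom_in)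
    have strip: "UNIV \<times> {t0<..<t0 + \<delta>} \<subseteq> D \<omega>" and w: "\<And>x. \<mu> \<omega> (x, t0) \<le> 1"
      and wt: "\<And>x t. t \<in> {t0<..<t0 + \<delta>} \<Longrightarrow> \<mu> \<omega> (x, t0) \<le> Kt * \<mu> \<omega> (x, t)" and Kt: "0 \<le> Kt"
      using T \<omega> unfolding trace_plane_def by blast+
    let ?\<rho> = "\<lambda>x. ennreal (\<mu> \<omega> (x, t0)) * indicator (square 1) x"
    have pm: "(\<lambda>x :: real ^ 'n. (x, t0)) \<in> borel_measurable borel" by (intro borel_measurable_continuous_onI continuous_intros)
    have [measurable]: "(\<lambda>x. \<mu> \<omega> (x, t0)) \<in> borel_measurable borel" by (rule measurable_compose[OF pm m(3)])
    have rm: "?\<rho> \<in> borel_measurable borel" by measurable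
    \<comment> \<open>On the unit square each coordinate is below \<open>1\<close> in absolute
      value, so the sum norm gives the radius \<open>real CARD('n)\<close>.\<close>
    have rle: "?\<rho> x \<le> indicator (ball 0 (real CARD('n))) x" for x
    proof (cases "x \<in> square 1")
      case True
      have "norm x \<le> (\<Sum>i\<in>UNIV. \<bar>x $ i\<bar>)" by (rule norm_le_l1_cart)
      also have "\<dots> < (\<Sum>i\<in>(UNIV :: 'n set). 1)" proof (intro sum_strict_mono)
        show "\<bar>x $ i\<bar> < 1" for i using square_bound[OF True, of i] by linarith
      qed auto
      finally have "x \<in> ball 0 (real CARD('n))" by simp
      then show ?thesis using True ennreal_leI[OF w[of x]] by (simp only: indicator_simps mult_1_right ennreal_1 if_True)
    qed simp
    have "(LIS (square 1) (\<lambda>x. ennreal (\<mu> \<omega> (x, t0)) * nsq (trace_on P t0 v \<omega> x))) = (LI x. ?\<rho> x * nsq (trace_lim t0 \<delta> (on_dom v \<omega>) x))"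
      using ae by (intro nn_integral_cong_AE, elim eventually_mono) (simp add: tr_def mult_ac)
    also have "\<dots> \<le> ennreal (128 * \<delta>) * (LIS (UNIV \<times> {t0<..<t0 + \<delta>}) (\<lambda>y. ?\<rho> (fst y) * nsq (on_dom (grad P v) \<omega> y)))
      + ennreal (2 / \<delta>) * (LIS (UNIV \<times> {t0<..<t0 + \<delta>}) (\<lambda>y. ?\<rho> (fst y) * nsq (on_dom v \<omega> y)))"
      by (rule plane_trace_bound(1)[OF D_open[OF \<omega>] \<delta> strip m(1,2) rm rle H' t'])
    also have "\<dots> \<le> ennreal (128 * \<delta>) * (LIS (square 1 \<times> UNIV) (\<lambda>y. e2 (grad P v) \<omega> y)) +
       ennreal (2 / \<delta>) * (ennreal Kt * (LIS (square 1 \<times> UNIV) (\<lambda>y. e1 v \<omega> y)))"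
    proof (intro add_mono mult_left_mono)
      show "(LIS (UNIV \<times> {t0<..<t0 + \<delta>}) (\<lambda>y. ?\<rho> (fst y) * nsq (on_dom (grad P v) \<omega> y))) \<le> (LIS (square 1 \<times> UNIV) (\<lambda>y. e2 (grad P v) \<omega> y))"
      proof (rule nn_integral_mono)
        fix y :: "'n pt"
        have "ennreal (\<mu> \<omega> (fst y, t0)) * nsq (on_dom (grad P v) \<omega> y) \<le> 1 * nsq (on_dom (grad P v) \<omega> y)"
          using ennreal_leI[OF w[of "fst y"]] by (intro mult_right_mono) auto
        then show "?\<rho> (fst y) * nsq (on_dom (grad P v) \<omega> y) * indicator (UNIV \<times> {t0<..<t0 + \<delta>}) y \<le> e2 (grad P v) \<omega> y * indicator (square 1 \<times> UNIV) y"
          by (auto simp: indicator_def mem_Times_iff)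
      qed
      have "(LIS (UNIV \<times> {t0<..<t0 + \<delta>}) (\<lambda>y. ?\<rho> (fst y) * nsq (on_dom v \<omega> y))) \<le> (LI y. ennreal Kt * (e1 v \<omega> y * indicator (square 1 \<times> UNIV) y))"
      proof (rule nn_integral_mono)
        fix y :: "'n pt"
        have "ennreal (\<mu> \<omega> (fst y, t0)) * nsq (on_dom v \<omega> y) \<le> ennreal Kt * e1 v \<omega> y" if "snd y \<in> {t0<..<t0 + \<delta>}"
        proof -
          have "ennreal (\<mu> \<omega> (fst y, t0)) \<le> ennreal Kt * ennreal (\<mu> \<omega> y)"
            using ennreal_leI[OF wt[OF that, of "fst y"]] ennreal_mult[OF Kt weight_nonneg, of \<omega> y] by simp
          then show ?thesis by (simp add: mult.assoc[symmetric] mult_right_mono)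
        qed
        then show "?\<rho> (fst y) * nsq (on_dom v \<omega> y) * indicator (UNIV \<times> {t0<..<t0 + \<delta>}) y \<le> ennreal Kt * (e1 v \<omega> y * indicator (square 1 \<times> UNIV) y)"
          by (auto simp: indicator_def mem_Times_iff)
      qed
      also have "\<dots> = ennreal Kt * (LIS (square 1 \<times> UNIV) (\<lambda>y. e1 v \<omega> y))" by (rule nn_integral_cmult) measurable
      finally show "(LIS (UNIV \<times> {t0<..<t0 + \<delta>}) (\<lambda>y. ?\<rho> (fst y) * nsq (on_dom v \<omega> y))) \<le> ennreal Kt * (LIS (square 1 \<times> UNIV) (\<lambda>y. e1 v \<omega> y))" .
    qed auto
    finally show "(LIS (square 1) (\<lambda>x. ennreal (\<mu> \<omega> (x, t0)) * nsq (trace_on P t0 v \<omega> x))) \<le>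
      ennreal (128 * \<delta>) * (LIS (square 1 \<times> UNIV) (\<lambda>y. e2 (grad P v) \<omega> y)) +
       (ennreal (2 / \<delta>) * ennreal Kt) * (LIS (square 1 \<times> UNIV) (\<lambda>y. e1 v \<omega> y))" by (simp add: mult.assoc)
  qed
  also have "\<dots> = ennreal (128 * \<delta>) * Esq (e2 (grad P v)) + (ennreal (2 / \<delta>) * ennreal Kt) * Esq (e1 v)"
    unfolding Esq_def
  proof (rule nn_integral_lin)
    note [measurable] = e_meas(2)[OF vf(3)] e_meas(1)[OF vf(1)]
    show "(\<lambda>\<omega>. \<integral>\<^sup>+y\<in>square 1 \<times> UNIV. e2 (grad P v) \<omega> y \<partial>lborel) \<in> borel_measurable P"
      "(\<lambda>\<omega>. \<integral>\<^sup>+y\<in>square 1 \<times> UNIV. e1 v \<omega> y \<partial>lborel) \<in> borel_measurable P"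
      by (rule lborel.borel_measurable_nn_integral, measurable)+
  qed
  also have "\<dots> \<le> ennreal (128 * \<delta>) * Esq (e2 (grad P v)) + (ennreal (2 / \<delta>) * ennreal Kt) * (KH * Esq (e2 (grad P v)))"
    by (intro add_left_mono mult_left_mono hardy_W v) auto
  also have "\<dots> = (ennreal (128 * \<delta>) + ennreal (2 / \<delta>) * ennreal Kt * KH) * Esq (e2 (grad P v))"
    by (simp add: distrib_right mult.assoc)
  finally show ?thesis .
qed

end

subsection \<open>Weak solutions\<close>

lemma hdot_sym: "hdot a b = cnj (hdot b a)"
  by (simp add: hdot_def mult.commute)

lemma hdot_snd: "hdot (0, a) (0, b) = a * cnj b"
  by (simp add: hdot_def)

text \<open>The energy and the four terms of the right-hand side are all pairings of this kind,
  scalar fields being embedded as \<open>(0, z)\<close>; one lemma gives integrability, the bound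
  and antilinearity in the second argument. The combination is asked for almost everywhere, which is
  how gradients and traces provide it.\<close>

lemma hdot_pairing:
  fixes f u v w :: "'x \<Rightarrow> 'n::finite cvec"
  assumes f: "f \<in> borel_measurable M" "(\<integral>\<^sup>+x. nsq (f x) \<partial>M) < \<infinity>"
    and u: "u \<in> borel_measurable M" "(\<integral>\<^sup>+x. nsq (u x) \<partial>M) < \<infinity>"
  shows "integrable M (\<lambda>x. hdot (f x) (u x))"
    and "norm (\<integral>x. hdot (f x) (u x) \<partial>M) \<le> l2n M f * l2n M u"
    and "v \<in> borel_measurable M \<Longrightarrow> (\<integral>\<^sup>+x. nsq (v x) \<partial>M) < \<infinity> \<Longrightarrow> w \<in> borel_measurable M \<Longrightarrow>
      AE x in M. w x = cscale c (u x) + cscale d (v x) \<Longrightarrow>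
      (\<integral>x. hdot (f x) (w x) \<partial>M) = cnj c * (\<integral>x. hdot (f x) (u x) \<partial>M) + cnj d * (\<integral>x. hdot (f x) (v x) \<partial>M)"
proof -
  show I: "integrable M (\<lambda>x. hdot (f x) (u x))"
    by (rule L2_product(1)[OF hdot_measurable[OF f(1) u(1)] f(1) u(1) norm_hdot_le f(2) u(2)])
  show "norm (\<integral>x. hdot (f x) (u x) \<partial>M) \<le> l2n M f * l2n M u"
    by (rule L2_product(2)[OF hdot_measurable[OF f(1) u(1)] f(1) u(1) norm_hdot_le f(2) u(2)])
  assume v: "v \<in> borel_measurable M" "(\<integral>\<^sup>+x. nsq (v x) \<partial>M) < \<infinity>" and w: "w \<in> borel_measurable M"
    and ae: "AE x in M. w x = cscale c (u x) + cscale d (v x)"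
  have J: "integrable M (\<lambda>x. hdot (f x) (v x))"
    by (rule L2_product(1)[OF hdot_measurable[OF f(1) v(1)] f(1) v(1) norm_hdot_le f(2) v(2)])
  have "(\<integral>x. hdot (f x) (w x) \<partial>M) = (\<integral>x. cnj c * hdot (f x) (u x) + cnj d * hdot (f x) (v x) \<partial>M)"
  proof (rule integral_cong_AE)
    show "AE x in M. hdot (f x) (w x) = cnj c * hdot (f x) (u x) + cnj d * hdot (f x) (v x)"
      using ae by eventually_elim (simp add: hdot_lin_right)
  qed (use f u v w in measurable)
  also have "\<dots> = cnj c * (\<integral>x. hdot (f x) (u x) \<partial>M) + cnj d * (\<integral>x. hdot (f x) (v x) \<partial>M)"
    using I J by simp
  finally show "(\<integral>x. hdot (f x) (w x) \<partial>M) = cnj c * (\<integral>x. hdot (f x) (u x) \<partial>M) + cnj d * (\<integral>x. hdot (f x) (v x) \<partial>M)" .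
qed

text \<open>Turns an integral against \<open>MS\<close> or \<open>MX\<close> into the expectation of
  integrals over realisations, the shape of the weak formulation. Integrability of the inner
  integrals is included so that two such expectations can be added.\<close>

lemma integral_density_section:
  fixes X :: "'x \<times> 'y \<Rightarrow> 'b::{banach, second_countable_topology}"
  assumes "pair_sigma_finite P Q" and S: "S \<in> sets Q"
    and X: "integrable (density (P \<Otimes>\<^sub>M Q) (\<lambda>p. indicator S (snd p))) X"
  shows "integrable P (\<lambda>\<omega>. LINT y:S|Q. X (\<omega>, y))"
    and "(\<integral>p. X p \<partial>density (P \<Otimes>\<^sub>M Q) (\<lambda>p. indicator S (snd p))) = (\<integral>\<omega>. (LINT y:S|Q. X (\<omega>, y)) \<partial>P)"
proof -
  interpret pair_sigma_finite P Q by fact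
  have d: "density (P \<Otimes>\<^sub>M Q) (\<lambda>p. indicator S (snd p)) = density (P \<Otimes>\<^sub>M Q) (\<lambda>p. ennreal (indicator S (snd p)))"
    by (simp add: ennreal_indicator)
  have X': "X \<in> borel_measurable (P \<Otimes>\<^sub>M Q)" using borel_measurable_integrable[OF X] by simp
  have i: "(\<lambda>p. indicator S (snd p) :: real) \<in> borel_measurable (P \<Otimes>\<^sub>M Q)" using S by measurable
  have I: "integrable (P \<Otimes>\<^sub>M Q) (\<lambda>p. indicator S (snd p) *\<^sub>R X p)"
    using X integrable_density[OF X' i] unfolding d by simp
  show "integrable P (\<lambda>\<omega>. LINT y:S|Q. X (\<omega>, y))"
    using integrable_fst'[OF I] by (simp add: set_lebesgue_integral_def)
  have "(\<integral>p. X p \<partial>density (P \<Otimes>\<^sub>M Q) (\<lambda>p. ennreal (indicator S (snd p)))) = (\<integral>p. indicator S (snd p) *\<^sub>R X p \<partial>(P \<Otimes>\<^sub>M Q))"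
    by (rule integral_density[OF X' i]) simp
  then show "(\<integral>p. X p \<partial>density (P \<Otimes>\<^sub>M Q) (\<lambda>p. indicator S (snd p))) = (\<integral>\<omega>. (LINT y:S|Q. X (\<omega>, y)) \<partial>P)"
    using integral_fst'[OF I] unfolding d by (simp add: set_lebesgue_integral_def)
qed

section \<open>Energy form, representation and uniqueness\<close>

context particle_law
begin

definition \<Gamma> :: "('n pt set \<Rightarrow> 'n pt \<Rightarrow> complex) \<Rightarrow> 'n pt set \<times> 'n pt \<Rightarrow> 'n cvec" where
  "\<Gamma> v p = on_dom (grad P v) (fst p) (snd p)"

definition enorm :: "('n pt set \<Rightarrow> 'n pt \<Rightarrow> complex) \<Rightarrow> real" where
  "enorm v = l2n MS (\<Gamma> v)"

definition dform :: "('n pt set \<Rightarrow> 'n pt \<Rightarrow> complex) \<Rightarrow> ('n pt set \<Rightarrow> 'n pt \<Rightarrow> complex) \<Rightarrow> complex" where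
  "dform u v = (\<integral>p. hdot (\<Gamma> u p) (\<Gamma> v p) \<partial>MS)"

lemma \<Gamma>_facts:
  assumes v: "v \<in> W"
  shows "\<Gamma> v \<in> borel_measurable MS" "(\<integral>\<^sup>+p. nsq (\<Gamma> v p) \<partial>MS) < \<infinity>" "(\<integral>\<^sup>+p. nsq (\<Gamma> v p) \<partial>MS) = Esq (e2 (grad P v))"
    "ennreal ((enorm v)\<^sup>2) = Esq (e2 (grad P v))"
proof -
  note vf = W_facts[OF v]
  have "(\<lambda>p. on_dom (grad P v) (fst p) (snd p)) \<in> borel_measurable PB"
    using random_field_meas[OF vf(3)] by (simp add: case_prod_unfold)
  then show "\<Gamma> v \<in> borel_measurable MS" unfolding \<Gamma>_def[abs_def] by simp
  show e: "(\<integral>\<^sup>+p. nsq (\<Gamma> v p) \<partial>MS) = Esq (e2 (grad P v))"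
    using Esq_MS[OF e_meas(2)[OF vf(3)]] by (simp add: \<Gamma>_def)
  then show "(\<integral>\<^sup>+p. nsq (\<Gamma> v p) \<partial>MS) < \<infinity>" using vf(8) by simp
  show "ennreal ((enorm v)\<^sup>2) = Esq (e2 (grad P v))" using vf(8) by (simp add: enorm_def l2n_def e)
qed

lemma enorm_nonneg: "0 \<le> enorm v" by (simp add: enorm_def l2n_nonneg)

lemma \<Gamma>_comb:
  assumes u: "u \<in> W" and v: "v \<in> W"
  shows "AE p in MS. \<Gamma> (comb c u d v) p = cscale c (\<Gamma> u p) + cscale d (\<Gamma> v p)"
  unfolding \<Gamma>_def
proof (rule AE_MS[OF W_comb(2)[OF u v]])
  note m = random_field_meas[OF W_facts(3)[OF u]] random_field_meas[OF W_facts(3)[OF v]] random_field_meas[OF W_facts(3)[OF W_comb(1)[OF u v, of c d]]]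
  have [measurable]: "(\<lambda>p. on_dom (grad P u) (fst p) (snd p)) \<in> borel_measurable PB"
    "(\<lambda>p. on_dom (grad P v) (fst p) (snd p)) \<in> borel_measurable PB"
    "(\<lambda>p. on_dom (grad P (comb c u d v)) (fst p) (snd p)) \<in> borel_measurable PB"
    using m by (simp_all add: case_prod_unfold)
  show "{p \<in> space PB. on_dom (grad P (comb c u d v)) (fst p) (snd p) =
      cscale c (on_dom (grad P u) (fst p) (snd p)) + cscale d (on_dom (grad P v) (fst p) (snd p))} \<in> sets PB"
    by measurable
qed

lemma dform_comb:
  assumes w: "w \<in> W" and u: "u \<in> W" and v: "v \<in> W"
  shows "dform w (comb c u d v) = cnj c * dform w u + cnj d * dform w v"
  unfolding dform_def
  by (rule hdot_pairing(3)[OF \<Gamma>_facts(1,2)[OF w] \<Gamma>_facts(1,2)[OF u] \<Gamma>_facts(1,2)[OF v] \<Gamma>_facts(1)[OF W_comb(1)[OF u v]] \<Gamma>_comb[OF u v]])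

lemma dform_sym: "dform u v = cnj (dform v u)"
  unfolding dform_def by (subst hdot_sym) simp

lemma dform_self:
  assumes u: "u \<in> W" shows "dform u u = of_real ((enorm u)\<^sup>2)"
proof -
  have e: "hdot a a = of_real ((norm a)\<^sup>2)" for a :: "'n cvec"
  proof (rule complex_eqI)
    show "Re (hdot a a) = Re (of_real ((norm a)\<^sup>2))" by (simp only: Re_hdot power2_norm_eq_inner Re_complex_of_real)
    have "Im (hdot a a) = - Im (hdot a a)" by (subst hdot_sym) simp
    then show "Im (hdot a a) = Im (of_real ((norm a)\<^sup>2))" by simp
  qed
  have "dform u u = of_real (\<integral>p. (norm (\<Gamma> u p))\<^sup>2 \<partial>MS)" unfolding dform_def e by (rule integral_complex_of_real)
  also have "(\<integral>p. (norm (\<Gamma> u p))\<^sup>2 \<partial>MS) = enn2real (\<integral>\<^sup>+p. nsq (\<Gamma> u p) \<partial>MS)"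
    using \<Gamma>_facts(1)[OF u] by (intro integral_eq_nn_integral) simp_all
  finally show ?thesis by (simp add: enorm_def l2n_def)
qed

text \<open>\<open>riesz_abstract\<close> is a real statement and is applied to real parts, with the
  real multiple of \<open>u\<close> by \<open>c\<close> written as \<open>comb c u 0 u\<close>.
  Testing with \<open>\<i>\<close> times \<open>V\<close> recovers the imaginary parts, because both
  sides are antilinear in the test field.\<close>

lemma riesz_W:
  assumes lin: "\<And>c d u v. u \<in> W \<Longrightarrow> v \<in> W \<Longrightarrow> L (comb c u d v) = cnj c * L u + cnj d * L v"
    and bnd: "\<And>v. v \<in> W \<Longrightarrow> norm (L v) \<le> K * enorm v"
  shows "\<exists>U\<in>W. \<forall>V\<in>W. dform U V = L V"
proof -
  have ReA: "Re (dform u v) = Re (dform v u)" for u v by (subst dform_sym) simp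
  have "\<exists>U\<in>W. \<forall>V\<in>W. Re (dform U V) = Re (L V)"
  proof (rule riesz_abstract[where z = "\<lambda>\<omega> y. 0" and add = "\<lambda>u v. comb 1 u 1 v" and scl = "\<lambda>c u. comb (of_real c) u 0 u" and K = K])
    show "\<bar>Re (L u)\<bar> \<le> K * sqrt (Re (dform u u))" if u: "u \<in> W" for u
      using bnd[OF u] abs_Re_le_cmod[of "L u"] by (simp add: dform_self[OF u] enorm_nonneg)
    fix s assume s: "\<And>k. s k \<in> W"
      and fast: "\<And>k. Re (dform (comb 1 (s (Suc k)) 1 (comb (of_real (-1)) (s k) 0 (s k))) (comb 1 (s (Suc k)) 1 (comb (of_real (-1)) (s k) 0 (s k)))) \<le> (1/4) ^ k"
    have eq: "comb 1 u 1 (comb (of_real (-1)) v 0 v) = comb 1 u (-1) v" for u v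
      by (simp add: comb_def fun_eq_iff)
    have W': "comb 1 u (-1) v \<in> W" if "u \<in> W" "v \<in> W" for u v by (rule W_comb(1)[OF that])
    have "Esq (e2 (grad P (comb 1 (s (Suc k)) (-1) (s k)))) \<le> ennreal ((1/4) ^ k)" for k
      using fast[of k] unfolding eq dform_self[OF W'[OF s s]] \<Gamma>_facts(4)[OF W'[OF s s], symmetric]
      by (intro ennreal_leI) simp
    from W_complete[OF s this] obtain U where U: "U \<in> W"
      and lim: "(\<lambda>k. Esq (e2 (grad P (comb 1 (s k) (-1) U)))) \<longlonglongrightarrow> 0" by blast
    have "(\<lambda>k. (enorm (comb 1 (s k) (-1) U))\<^sup>2) \<longlonglongrightarrow> 0"
      using lim unfolding \<Gamma>_facts(4)[OF W'[OF s U], symmetric]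
      by (subst (asm) ennreal_0[symmetric], subst (asm) tendsto_ennreal_iff) auto
    then have "(\<lambda>k. Re (dform (comb 1 (s k) (-1) U) (comb 1 (s k) (-1) U))) \<longlonglongrightarrow> 0"
      unfolding dform_self[OF W'[OF s U]] by simp
    then show "\<exists>u\<in>W. (\<lambda>k. Re (dform (comb 1 (s k) 1 (comb (of_real (-1)) u 0 u)) (comb 1 (s k) 1 (comb (of_real (-1)) u 0 u)))) \<longlonglongrightarrow> 0"
      unfolding eq using U by blast
  next
    fix u v w assume "u \<in> W" "v \<in> W" "w \<in> W"
    then show "Re (dform (comb 1 u 1 v) w) = Re (dform u w) + Re (dform v w)"
      using ReA[of w] by (simp add: ReA[of _ w] dform_comb)
  next
    fix c :: real and u w assume "u \<in> W" "w \<in> W"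
    then show "Re (dform (comb (of_real c) u 0 u) w) = c * Re (dform u w)" by (simp add: ReA[of _ w] dform_comb)
  next
    show "(\<lambda>\<omega> y. 0) \<in> W" by (rule zero_in_W)
  qed (auto simp: lin W_comb(1) dform_self intro: ReA)
  then obtain U where U: "U \<in> W" and re: "\<And>V. V \<in> W \<Longrightarrow> Re (dform U V) = Re (L V)" by blast
  have "dform U V = L V" if V: "V \<in> W" for V
  proof (rule complex_eqI)
    show "Re (dform U V) = Re (L V)" by (rule re[OF V])
    show "Im (dform U V) = Im (L V)"
      using re[OF W_comb(1)[OF V V, of \<i> 0]] by (simp add: lin[OF V V] dform_comb[OF U V V])
  qed
  then show ?thesis using U by blast
qed

text \<open>The solution is its own test field: the squared energy norm is at most \<open>K\<close>
  times the energy norm, which can be divided out unless it vanishes.\<close>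

lemma energy_bound:
  assumes U: "U \<in> W" and "dform U U = z" "norm z \<le> K * enorm U" "0 \<le> K"
  shows "enorm U \<le> K"
proof (cases "enorm U = 0")
  case False
  then have "0 < enorm U" using enorm_nonneg[of U] by simp
  moreover have "norm z = enorm U * enorm U" unfolding assms(2)[symmetric] dform_self[OF U] norm_of_real by (simp add: power2_eq_square)
  moreover note assms(3)
  ultimately show ?thesis by simp
qed (use assms in simp)

lemma W0_norm_le:
  assumes U: "U \<in> W" shows "W0_norm P h m U \<le> sqrt (enn2real (KH + 1)) * enorm U"
proof -
  note uf = W_facts[OF U]
  have "W0_sqnorm P h m U \<le> (KH + 1) * ennreal ((enorm U)\<^sup>2)"
    unfolding W0_sqnorm_eq[OF uf(1,3)] \<Gamma>_facts(4)[OF U] distrib_right using hardy_W[OF U] by (intro add_mono) auto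
  moreover have "(KH + 1) * ennreal ((enorm U)\<^sup>2) < \<top>" using KH_finite by (auto simp: ennreal_mult_less_top)
  ultimately have "enn2real (W0_sqnorm P h m U) \<le> enn2real ((KH + 1) * ennreal ((enorm U)\<^sup>2))" by (rule enn2real_mono)
  then have "W0_norm P h m U \<le> sqrt (enn2real (KH + 1) * (enorm U)\<^sup>2)"
    unfolding W0_norm_def by (simp add: enn2real_mult)
  then show ?thesis using enorm_nonneg[of U] by (simp add: real_sqrt_mult)
qed

text \<open>By the Hardy inequality the weighted \<open>L^2\<close> part vanishes as well, on the
  unit square and then by stationarity everywhere; the weight is positive in the fluid
  domain.\<close>

lemma energy_zero:
  assumes w: "w \<in> W" and 0: "enorm w = 0"
  shows "AE \<omega> in P. AE y in lborel. y \<in> D \<omega> \<longrightarrow> w \<omega> y = 0"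
proof -
  note wf = W_facts[OF w]
  have "Esq (e1 w) \<le> KH * 0" using hardy_W[OF w] \<Gamma>_facts(4)[OF w] 0 by simp
  then have "Ew (e1 w) = 0" using Ew_le[OF e1_stat[OF wf(1,4)]] by simp
  from AE_space AE_of_Ew(2)[OF e_meas(1)[OF wf(1)] this] show ?thesis
  proof eventually_elim
    fix \<omega> assume \<omega>: "\<omega> \<in> space P" and ae: "AE y in lborel. e1 w \<omega> y = 0"
    from ae show "AE y in lborel. y \<in> D \<omega> \<longrightarrow> w \<omega> y = 0"
    proof eventually_elim
      fix y assume "e1 w \<omega> y = 0"
      then show "y \<in> D \<omega> \<longrightarrow> w \<omega> y = 0"
        using weight_fluid(1)[OF config[OF \<omega>] \<delta>, of y m] m_pos by (auto simp: on_dom_in ennreal_eq_0_iff)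
    qed
  qed
qed

lemma energy_unique:
  assumes U: "U \<in> W" and U': "U' \<in> W" and eq: "\<And>V. V \<in> W \<Longrightarrow> dform U V = dform U' V"
  shows "field_eq P U' U"
proof -
  let ?w = "comb 1 U' (-1) U"
  have w: "?w \<in> W" by (rule W_comb(1)[OF U' U])
  have "dform ?w ?w = dform ?w U' - dform ?w U" using dform_comb[OF w U' U, of 1 "-1"] by simp
  also have "\<dots> = cnj (dform U' ?w) - cnj (dform U ?w)" using dform_sym[of ?w U'] dform_sym[of ?w U] by simp
  also have "\<dots> = 0" by (simp add: eq[OF w])
  finally have "enorm ?w = 0" by (simp add: dform_self[OF w])
  from energy_zero[OF w this] show ?thesis unfolding field_eq_def
    by (elim eventually_mono) (simp add: comb_def)
qed

section \<open>Square integrability on planes and the right-hand side\<close>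

definition MX :: "('n pt set \<times> (real ^ 'n)) measure" where
  "MX = density PB (\<lambda>p. indicator (square 1) (snd p))"

lemma sets_MX[measurable_cong, simp]: "sets MX = sets PB" by (simp add: MX_def)

lemma indX_meas[measurable]: "(\<lambda>p. indicator (square 1) (snd p) :: ennreal) \<in> borel_measurable (P \<Otimes>\<^sub>M (lborel :: (real ^ 'n) measure))"
  by (rule measurable_compose[OF measurable_snd]) measurable

lemma nn_integral_MX:
  assumes f[measurable]: "f \<in> borel_measurable PB"
  shows "(\<integral>\<^sup>+p. f p \<partial>MX) = (\<integral>\<^sup>+\<omega>. (LIS (square 1) (\<lambda>x. f (\<omega>, x))) \<partial>P)"
proof -
  have "(\<integral>\<^sup>+p. f p \<partial>MX) = (\<integral>\<^sup>+p. indicator (square 1) (snd p) * f p \<partial>PB)"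
    unfolding MX_def by (rule nn_integral_density) measurable
  also have "\<dots> = (\<integral>\<^sup>+\<omega>. (LI x. indicator (square 1) x * f (\<omega>, x)) \<partial>P)"
    using lborel.nn_integral_fst[of "\<lambda>p. indicator (square 1) (snd p) * f p" P] by simp
  finally show ?thesis by (simp add: mult.commute)
qed

lemma AE_MX:
  assumes "AE \<omega> in P. AE y in lborel. Q \<omega> y" and m: "{p \<in> space PB. Q (fst p) (snd p)} \<in> sets PB"
  shows "AE p in MX. Q (fst p) (snd p)"
proof -
  have "AE p in P \<Otimes>\<^sub>M lborel. Q (fst p) (snd p)"
    by (rule PX.AE_pair_measure[OF m]) (use assms(1) in simp)
  then show ?thesis unfolding MX_def by (subst AE_density) auto
qed

text \<open>The norm in \<open>L2S\<close> takes the second moment at the origin. By stationarity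
  the moment is the same at every point, and the unit square has measure \<open>1\<close>.\<close>

lemma L2S_MX:
  assumes \<phi>: "\<phi> \<in> L2S P"
  shows "(\<lambda>p. \<phi> (fst p) (snd p)) \<in> borel_measurable MX"
    and "(\<integral>\<^sup>+p. nsq (\<phi> (fst p) (snd p)) \<partial>MX) = L2S_sqnorm P \<phi>"
proof -
  have m: "jmeas (\<lambda>\<omega> x. \<phi> \<omega> x)" and st: "stationary P \<phi>" using \<phi> by (auto simp: L2S_def)
  then have m'[measurable]: "(\<lambda>p. \<phi> (fst p) (snd p)) \<in> borel_measurable PB" by (simp add: case_prod_unfold)
  then show "(\<lambda>p. \<phi> (fst p) (snd p)) \<in> borel_measurable MX" by simp
  have s0[measurable]: "(\<lambda>\<omega>. \<phi> \<omega> x) \<in> borel_measurable P" for x using measurable_Pair1[OF m, of x] by simp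
  have "(\<integral>\<^sup>+p. nsq (\<phi> (fst p) (snd p)) \<partial>MX) = (\<integral>\<^sup>+\<omega>. (LI x. nsq (\<phi> \<omega> x) * indicator (square 1) x) \<partial>P)"
    by (subst nn_integral_MX) simp_all
  also have "\<dots> = (LI x. (\<integral>\<^sup>+\<omega>. nsq (\<phi> \<omega> x) * indicator (square 1) x \<partial>P))"
    by (rule PX.Fubini'[symmetric]) (simp add: case_prod_unfold, measurable)
  also have "\<dots> = (LI (x :: real ^ 'n). L2S_sqnorm P \<phi> * indicator (square 1) x)"
  proof (intro nn_integral_cong)
    fix x :: "real ^ 'n"
    have "(\<integral>\<^sup>+\<omega>. nsq (\<phi> \<omega> x) \<partial>P) = (\<integral>\<^sup>+\<omega>. nsq (\<phi> (shift x \<omega>) 0) \<partial>P)"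
    proof (intro nn_integral_cong)
      fix \<omega> assume "\<omega> \<in> space P"
      then have "\<phi> \<omega> (0 + x) = \<phi> (shift x \<omega>) 0" using st unfolding stationary_def by blast
      then show "nsq (\<phi> \<omega> x) = nsq (\<phi> (shift x \<omega>) 0)" by simp
    qed
    also have "\<dots> = L2S_sqnorm P \<phi>" unfolding L2S_sqnorm_def by (rule nn_integral_shift) measurable
    finally show "(\<integral>\<^sup>+\<omega>. nsq (\<phi> \<omega> x) * indicator (square 1) x \<partial>P) = L2S_sqnorm P \<phi> * indicator (square 1) x"
      using s0[of x] by (subst nn_integral_multc) simp_all
  qed
  also have "\<dots> = L2S_sqnorm P \<phi>" by (subst nn_integral_cmult) (simp_all add: emeasure_square)
  finally show "(\<integral>\<^sup>+p. nsq (\<phi> (fst p) (snd p)) \<partial>MX) = L2S_sqnorm P \<phi>" .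
qed

lemma l2n_le:
  assumes v: "v \<in> W" and le: "(\<integral>\<^sup>+x. nsq (f x) \<partial>M) \<le> C * Esq (e2 (grad P v))" and C: "C < \<infinity>"
  shows "(\<integral>\<^sup>+x. nsq (f x) \<partial>M) < \<infinity>" and "l2n M f \<le> sqrt (enn2real C) * enorm v"
proof -
  have t: "C * ennreal ((enorm v)\<^sup>2) < \<top>" using C by (auto simp: ennreal_mult_less_top)
  have le': "(\<integral>\<^sup>+x. nsq (f x) \<partial>M) \<le> C * ennreal ((enorm v)\<^sup>2)" using le by (simp only: \<Gamma>_facts(4)[OF v])
  then show "(\<integral>\<^sup>+x. nsq (f x) \<partial>M) < \<infinity>" using t by (simp add: le_less_trans)
  have "enn2real (\<integral>\<^sup>+x. nsq (f x) \<partial>M) \<le> enn2real (C * ennreal ((enorm v)\<^sup>2))" using le' t by (rule enn2real_mono)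
  then have "l2n M f \<le> sqrt (enn2real C * (enorm v)\<^sup>2)" unfolding l2n_def by (simp add: enn2real_mult)
  then show "l2n M f \<le> sqrt (enn2real C) * enorm v" using enorm_nonneg[of v] by (simp add: real_sqrt_mult)
qed

text \<open>Test fields, and in \<open>wt\<close> their traces, carry the square root of the weight,
  while the data in \<open>sF\<close> and \<open>sS\<close> carry the inverse square root: the
  weights cancel in the pairing, and each factor is square integrable on its own.\<close>

definition wv :: "('n pt set \<Rightarrow> 'n pt \<Rightarrow> complex) \<Rightarrow> 'n pt set \<times> 'n pt \<Rightarrow> 'n cvec" where
  "wv v p = (0, sqrt (\<mu> (fst p) (snd p)) *\<^sub>R on_dom v (fst p) (snd p))"

definition wt :: "real \<Rightarrow> ('n pt set \<Rightarrow> 'n pt \<Rightarrow> complex) \<Rightarrow> 'n pt set \<times> (real ^ 'n) \<Rightarrow> 'n cvec" where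
  "wt t v p = (0, sqrt (\<mu> (fst p) (snd p, t)) *\<^sub>R trace_on P t v (fst p) (snd p))"

lemma snd_emb_meas: "f \<in> borel_measurable M \<Longrightarrow> (\<lambda>x. (0 :: complex ^ 'n, f x :: complex)) \<in> borel_measurable M"
  by (rule borel_measurable_Pair) simp_all

lemma nsq_wt: "0 \<le> a \<Longrightarrow> nsq (0, sqrt a *\<^sub>R z) = ennreal a * nsq z"
  by (simp add: norm_prod_def power_mult_distrib ennreal_mult)

lemma cscale_snd: "cscale c (0, z) = (0, c * z)"
  by (simp add: cscale_def vec_eq_iff)

lemma wv_facts:
  assumes v: "v \<in> W"
  shows "wv v \<in> borel_measurable MS" "(\<integral>\<^sup>+p. nsq (wv v p) \<partial>MS) < \<infinity>" "l2n MS (wv v) \<le> sqrt (enn2real KH) * enorm v"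
proof -
  note vf = W_facts[OF v]
  have [measurable]: "(\<lambda>p. on_dom v (fst p) (snd p)) \<in> borel_measurable PB" "(\<lambda>p. \<mu> (fst p) (snd p)) \<in> borel_measurable PB"
    using random_field_meas[OF vf(1)] weight_meas by (simp_all add: case_prod_unfold)
  have "wv v \<in> borel_measurable PB" unfolding wv_def[abs_def] by (rule snd_emb_meas) measurable
  then show "wv v \<in> borel_measurable MS" by simp
  have "(\<integral>\<^sup>+p. nsq (wv v p) \<partial>MS) = Esq (e1 v)"
    unfolding Esq_MS[OF e_meas(1)[OF vf(1)]] wv_def nsq_wt[OF weight_nonneg] ..
  then have le: "(\<integral>\<^sup>+p. nsq (wv v p) \<partial>MS) \<le> KH * Esq (e2 (grad P v))" using hardy_W[OF v] by simp
  show "(\<integral>\<^sup>+p. nsq (wv v p) \<partial>MS) < \<infinity>" "l2n MS (wv v) \<le> sqrt (enn2real KH) * enorm v"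
    by (rule l2n_le[OF v le KH_finite])+
qed

lemma wv_comb: "wv (comb c u d v) p = cscale c (wv u p) + cscale d (wv v p)"
  by (simp add: wv_def on_dom_comb cscale_snd scaleR_conv_of_real algebra_simps)

definition KT :: "real \<Rightarrow> ennreal" where
  "KT k = ennreal (128 * \<delta>) + ennreal (2 / \<delta>) * ennreal k * KH"

lemma KT_finite: "KT k < \<infinity>"
  using KH_finite by (auto simp: KT_def ennreal_mult_less_top)

lemma weight_plane_meas: "(\<lambda>p. \<mu> (fst p) (snd p, t)) \<in> borel_measurable (P \<Otimes>\<^sub>M (lborel :: (real ^ 'n) measure))"
proof -
  have "(\<lambda>x :: real ^ 'n. (x, t)) \<in> borel_measurable borel" by (intro borel_measurable_continuous_onI continuous_intros)
  then have "(\<lambda>p. (fst p, (snd p, t))) \<in> P \<Otimes>\<^sub>M (lborel :: (real ^ 'n) measure) \<rightarrow>\<^sub>M P \<Otimes>\<^sub>M (lborel :: 'n pt measure)"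
    by (intro measurable_Pair) (auto intro: measurable_compose[OF measurable_snd])
  from measurable_compose[OF this weight_meas] show ?thesis by simp
qed

lemma wt_facts:
  assumes v: "v \<in> W" and T: "trace_plane t k"
  shows "wt t v \<in> borel_measurable MX" "(\<integral>\<^sup>+p. nsq (wt t v p) \<partial>MX) < \<infinity>" "l2n MX (wt t v) \<le> sqrt (enn2real (KT k)) * enorm v"
proof -
  note [measurable] = weight_plane_meas
  have [measurable]: "(\<lambda>p. trace_on P t v (fst p) (snd p)) \<in> borel_measurable PB"
    using trace_on_facts(1)[OF v T] by (simp add: case_prod_unfold)
  have m[measurable]: "wt t v \<in> borel_measurable PB" unfolding wt_def[abs_def] by (rule snd_emb_meas) measurable
  then show "wt t v \<in> borel_measurable MX" by simp
  have "(\<integral>\<^sup>+p. nsq (wt t v p) \<partial>MX) = (\<integral>\<^sup>+\<omega>. (LIS (square 1) (\<lambda>x. nsq (wt t v (\<omega>, x)))) \<partial>P)"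
    by (rule nn_integral_MX) measurable
  also have "\<dots> \<le> KT k * Esq (e2 (grad P v))"
    using trace_bound[OF v T] unfolding wt_def nsq_wt[OF weight_nonneg] KT_def by simp
  finally have le: "(\<integral>\<^sup>+p. nsq (wt t v p) \<partial>MX) \<le> KT k * Esq (e2 (grad P v))" .
  show "(\<integral>\<^sup>+p. nsq (wt t v p) \<partial>MX) < \<infinity>" "l2n MX (wt t v) \<le> sqrt (enn2real (KT k)) * enorm v"
    by (rule l2n_le[OF v le KT_finite])+
qed

lemma wt_comb:
  assumes u: "u \<in> W" and v: "v \<in> W" and T: "trace_plane t k"
  shows "AE p in MX. wt t (comb c u d v) p = cscale c (wt t u p) + cscale d (wt t v p)"
proof -
  have [measurable]: "(\<lambda>p. trace_on P t v (fst p) (snd p)) \<in> borel_measurable PB"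
    "(\<lambda>p. trace_on P t u (fst p) (snd p)) \<in> borel_measurable PB"
    "(\<lambda>p. trace_on P t (comb c u d v) (fst p) (snd p)) \<in> borel_measurable PB"
    using trace_on_facts(1)[OF v T] trace_on_facts(1)[OF u T] trace_on_facts(1)[OF W_comb(1)[OF u v] T, of c d] by (simp_all add: case_prod_unfold)
  have "AE p in MX. trace_on P t (comb c u d v) (fst p) (snd p) = c * trace_on P t u (fst p) (snd p) + d * trace_on P t v (fst p) (snd p)"
    by (rule AE_MX[OF trace_on_comb[OF u v T]]) measurable
  then show ?thesis by eventually_elim (simp add: wt_def cscale_snd scaleR_conv_of_real algebra_simps)
qed

lemma dform_eq:
  assumes U: "U \<in> W" and V: "V \<in> W"
  shows "(\<integral>\<omega>. (LINT y:square 1 \<times> {0<..}|lborel. indicator (D \<omega>) y *\<^sub>R hdot (grad P U \<omega> y) (grad P V \<omega> y)) \<partial>P) = dform U V"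
proof -
  have I: "integrable MS (\<lambda>p. hdot (\<Gamma> U p) (\<Gamma> V p))"
    by (rule hdot_pairing(1)[OF \<Gamma>_facts(1,2)[OF U] \<Gamma>_facts(1,2)[OF V]])
  have "dform U V = (\<integral>\<omega>. (LINT y:square 1 \<times> UNIV|lborel. hdot (\<Gamma> U (\<omega>, y)) (\<Gamma> V (\<omega>, y))) \<partial>P)"
    unfolding dform_def MS_def
    by (rule integral_density_section(2)[OF PL.pair_sigma_finite_axioms _ I[unfolded MS_def]]) simp
  also have "\<dots> = (\<integral>\<omega>. (LINT y:square 1 \<times> {0<..}|lborel. indicator (D \<omega>) y *\<^sub>R hdot (grad P U \<omega> y) (grad P V \<omega> y)) \<partial>P)"
    unfolding set_lebesgue_integral_def
  proof (intro Bochner_Integration.integral_cong refl)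
    fix \<omega> and y :: "'n pt" assume \<omega>: "\<omega> \<in> space P"
    show "indicator (square 1 \<times> UNIV) y *\<^sub>R hdot (\<Gamma> U (\<omega>, y)) (\<Gamma> V (\<omega>, y)) =
      indicator (square 1 \<times> {0<..}) y *\<^sub>R indicator (D \<omega>) y *\<^sub>R hdot (grad P U \<omega> y) (grad P V \<omega> y)"
      using D_pos[OF \<omega>, of y] by (cases "y \<in> D \<omega>") (auto simp: \<Gamma>_def on_dom_def indicator_def mem_Times_iff hdot_0)
  qed
  finally show ?thesis ..
qed


abbreviation RF :: "('n pt set \<Rightarrow> 'n pt \<Rightarrow> complex) \<Rightarrow> 'n pt set \<Rightarrow> 'n pt \<Rightarrow> complex" where
  "RF F \<equiv> (\<lambda>\<omega> y. \<mu> \<omega> y powr (-1/2) *\<^sub>R F \<omega> y)"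

abbreviation RS :: "real \<Rightarrow> ('n pt set \<Rightarrow> real ^ 'n \<Rightarrow> complex) \<Rightarrow> 'n pt set \<Rightarrow> real ^ 'n \<Rightarrow> complex" where
  "RS t \<psi> \<equiv> (\<lambda>\<omega> x. \<mu> \<omega> (x, t) powr (-1/2) *\<^sub>R \<psi> \<omega> x)"

definition sF :: "('n pt set \<Rightarrow> 'n pt \<Rightarrow> complex) \<Rightarrow> 'n pt set \<times> 'n pt \<Rightarrow> 'n cvec" where
  "sF F p = (0, on_dom (RF F) (fst p) (snd p))"

definition sG :: "('n pt set \<Rightarrow> 'n pt \<Rightarrow> 'n cvec) \<Rightarrow> 'n pt set \<times> 'n pt \<Rightarrow> 'n cvec" where
  "sG G p = on_dom G (fst p) (snd p)"

definition sS :: "real \<Rightarrow> ('n pt set \<Rightarrow> real ^ 'n \<Rightarrow> complex) \<Rightarrow> 'n pt set \<times> (real ^ 'n) \<Rightarrow> 'n cvec" where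
  "sS t \<psi> p = (0, RS t \<psi> (fst p) (snd p))"

lemma L2D_MS:
  assumes u: "u \<in> L2D P"
  shows "(\<lambda>p. on_dom u (fst p) (snd p)) \<in> borel_measurable MS"
    "(\<integral>\<^sup>+p. nsq (on_dom u (fst p) (snd p)) \<partial>MS) = L2D_sqnorm P u" "L2D_sqnorm P u < \<infinity>"
proof -
  have rf: "random_field P u" and f: "L2D_sqnorm P u < \<infinity>" using u by (auto simp: L2D_def)
  show "(\<lambda>p. on_dom u (fst p) (snd p)) \<in> borel_measurable MS"
    using random_field_meas[OF rf] by (simp add: case_prod_unfold measurable_cong_sets[OF sets_MS refl])
  have "jmeas (e2 u)" using random_field_meas[OF rf] by measurable
  from Esq_MS[OF this] show "(\<integral>\<^sup>+p. nsq (on_dom u (fst p) (snd p)) \<partial>MS) = L2D_sqnorm P u" by (simp add: L2D_sqnorm_eq)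
  show "L2D_sqnorm P u < \<infinity>" by (rule f)
qed

lemma sF_facts:
  assumes "RF F \<in> L2D P"
  shows "sF F \<in> borel_measurable MS" "(\<integral>\<^sup>+p. nsq (sF F p) \<partial>MS) < \<infinity>" "l2n MS (sF F) = L2D_norm P (RF F)"
proof -
  note L = L2D_MS[OF assms]
  show "sF F \<in> borel_measurable MS" unfolding sF_def[abs_def] by (rule snd_emb_meas[OF L(1)])
  have e: "(\<integral>\<^sup>+p. nsq (sF F p) \<partial>MS) = L2D_sqnorm P (RF F)" unfolding L(2)[symmetric] by (simp add: sF_def norm_prod_def)
  show "(\<integral>\<^sup>+p. nsq (sF F p) \<partial>MS) < \<infinity>" "l2n MS (sF F) = L2D_norm P (RF F)" using L(3) by (simp_all add: e l2n_def L2D_norm_def)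
qed

lemma sG_facts:
  assumes "G \<in> L2D P"
  shows "sG G \<in> borel_measurable MS" "(\<integral>\<^sup>+p. nsq (sG G p) \<partial>MS) < \<infinity>" "l2n MS (sG G) = L2D_norm P G"
  unfolding sG_def[abs_def] l2n_def L2D_norm_def using L2D_MS[OF assms] by simp_all

lemma sS_facts:
  assumes "RS t \<psi> \<in> L2S P"
  shows "sS t \<psi> \<in> borel_measurable MX" "(\<integral>\<^sup>+p. nsq (sS t \<psi> p) \<partial>MX) < \<infinity>" "l2n MX (sS t \<psi>) = L2S_norm P (RS t \<psi>)"
proof -
  note L = L2S_MX[OF assms]
  have f: "L2S_sqnorm P (RS t \<psi>) < \<infinity>" using assms by (simp add: L2S_def)
  show "sS t \<psi> \<in> borel_measurable MX" unfolding sS_def[abs_def] by (rule snd_emb_meas[OF L(1)])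
  have e: "(\<integral>\<^sup>+p. nsq (sS t \<psi> p) \<partial>MX) = L2S_sqnorm P (RS t \<psi>)" unfolding L(2)[symmetric] by (simp add: sS_def norm_prod_def)
  show "(\<integral>\<^sup>+p. nsq (sS t \<psi> p) \<partial>MX) < \<infinity>" "l2n MX (sS t \<psi>) = L2S_norm P (RS t \<psi>)" using f by (simp_all add: e l2n_def L2S_norm_def)
qed

definition load where
  "load H F G \<Psi> \<alpha> V = (\<integral>p. hdot (sF F p) (wv V p) \<partial>MS) + (\<integral>p. hdot (sG G p) (\<Gamma> V p) \<partial>MS) +
     ((\<integral>p. hdot (sS 0 \<Psi> p) (wt 0 V p) \<partial>MX) + (\<integral>p. hdot (sS H \<alpha> p) (wt H V p) \<partial>MX))"

lemma weight_cancel: "0 < a \<Longrightarrow> (a powr (-1/2) *\<^sub>R z) * cnj (sqrt a *\<^sub>R w) = z * cnj w"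
  by (simp add: scaleR_conv_of_real powr_minus_divide powr_half_sqrt field_simps flip: of_real_mult)

text \<open>The weights cancel where they are positive, that is in the fluid domain and on both
  planes. Off the fluid domain the volume integrand vanishes, which reconciles
  \<open>square 1 \<times> UNIV\<close> with the half-space.\<close>

lemma load_eq:
  assumes V: "V \<in> W" and F: "RF F \<in> L2D P" and G: "G \<in> L2D P" and \<Psi>: "RS 0 \<Psi> \<in> L2S P" and \<alpha>: "RS H \<alpha> \<in> L2S P"
    and T0: "trace_plane 0 k0" and TH: "trace_plane H k1"
  shows "(\<integral>\<omega>. (LINT y:square 1 \<times> {0<..}|lborel. indicator (D \<omega>) y *\<^sub>R (F \<omega> y * cnj (V \<omega> y) + hdot (G \<omega> y) (grad P V \<omega> y))) +
      (LINT x:square 1|lborel. \<Psi> \<omega> x * cnj (trace_on P 0 V \<omega> x) + \<alpha> \<omega> x * cnj (trace_on P H V \<omega> x)) \<partial>P) = load H F G \<Psi> \<alpha> V"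
proof -
  let ?X = "\<lambda>p. hdot (sF F p) (wv V p) + hdot (sG G p) (\<Gamma> V p)"
  let ?Y = "\<lambda>p. hdot (sS 0 \<Psi> p) (wt 0 V p) + hdot (sS H \<alpha> p) (wt H V p)"
  have i: "integrable MS (\<lambda>p. hdot (sF F p) (wv V p))" "integrable MS (\<lambda>p. hdot (sG G p) (\<Gamma> V p))"
    "integrable MX (\<lambda>p. hdot (sS 0 \<Psi> p) (wt 0 V p))" "integrable MX (\<lambda>p. hdot (sS H \<alpha> p) (wt H V p))"
    by (rule hdot_pairing(1)[OF sF_facts(1,2)[OF F] wv_facts(1,2)[OF V]]
      hdot_pairing(1)[OF sG_facts(1,2)[OF G] \<Gamma>_facts(1,2)[OF V]]
      hdot_pairing(1)[OF sS_facts(1,2)[OF \<Psi>] wt_facts(1,2)[OF V T0]]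
      hdot_pairing(1)[OF sS_facts(1,2)[OF \<alpha>] wt_facts(1,2)[OF V TH]])+
  have X: "integrable MS ?X" and Y: "integrable MX ?Y" using i by simp_all
  have sq: "square 1 \<times> UNIV \<in> sets (lborel :: 'n pt measure)" "square 1 \<in> sets (lborel :: (real ^ 'n) measure)" by simp_all
  note SX = integral_density_section[OF PL.pair_sigma_finite_axioms sq(1) X[unfolded MS_def], folded MS_def]
  note SY = integral_density_section[OF PX.pair_sigma_finite_axioms sq(2) Y[unfolded MX_def], folded MX_def]
  have "load H F G \<Psi> \<alpha> V = (\<integral>p. ?X p \<partial>MS) + (\<integral>p. ?Y p \<partial>MX)" using i by (simp add: load_def)
  also have "\<dots> = (\<integral>\<omega>. (LINT y:square 1 \<times> UNIV|lborel. ?X (\<omega>, y)) + (LINT x:square 1|lborel. ?Y (\<omega>, x)) \<partial>P)"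
    unfolding SX(2) SY(2) by (rule Bochner_Integration.integral_add[OF SX(1) SY(1), symmetric])
  also have "\<dots> = (\<integral>\<omega>. (LINT y:square 1 \<times> {0<..}|lborel. indicator (D \<omega>) y *\<^sub>R (F \<omega> y * cnj (V \<omega> y) + hdot (G \<omega> y) (grad P V \<omega> y))) +
      (LINT x:square 1|lborel. \<Psi> \<omega> x * cnj (trace_on P 0 V \<omega> x) + \<alpha> \<omega> x * cnj (trace_on P H V \<omega> x)) \<partial>P)"
  proof (rule Bochner_Integration.integral_cong[OF refl])
    fix \<omega> assume \<omega>: "\<omega> \<in> space P"
    have wp: "0 < \<mu> \<omega> (x, 0)" "0 < \<mu> \<omega> (x, H)" for x using T0 TH \<omega> unfolding trace_plane_def by blast+
    have "(LINT x:square 1|lborel. ?Y (\<omega>, x)) =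
        (LINT x:square 1|lborel. \<Psi> \<omega> x * cnj (trace_on P 0 V \<omega> x) + \<alpha> \<omega> x * cnj (trace_on P H V \<omega> x))"
      by (simp only: sS_def wt_def hdot_snd fst_conv snd_conv weight_cancel[OF wp(1)] weight_cancel[OF wp(2)])
    moreover have "(LINT y:square 1 \<times> UNIV|lborel. ?X (\<omega>, y)) =
      (LINT y:square 1 \<times> {0<..}|lborel. indicator (D \<omega>) y *\<^sub>R (F \<omega> y * cnj (V \<omega> y) + hdot (G \<omega> y) (grad P V \<omega> y)))"
      unfolding set_lebesgue_integral_def
    proof (intro Bochner_Integration.integral_cong refl)
      fix y :: "'n pt"
      show "indicator (square 1 \<times> UNIV) y *\<^sub>R ?X (\<omega>, y) =
        indicator (square 1 \<times> {0<..}) y *\<^sub>R indicator (D \<omega>) y *\<^sub>R (F \<omega> y * cnj (V \<omega> y) + hdot (G \<omega> y) (grad P V \<omega> y))"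
      proof (cases "y \<in> D \<omega>")
        case True
        have "?X (\<omega>, y) = F \<omega> y * cnj (V \<omega> y) + hdot (G \<omega> y) (grad P V \<omega> y)"
          using weight_fluid(1)[OF config[OF \<omega>] \<delta> True m_pos]
          by (simp only: sF_def wv_def sG_def \<Gamma>_def hdot_snd fst_conv snd_conv on_dom_in[OF True] weight_cancel)
        then show ?thesis using True D_pos[OF \<omega> True] by (simp add: indicator_def mem_Times_iff)
      next
        case False
        have "?X (\<omega>, y) = 0" by (simp add: sF_def wv_def sG_def \<Gamma>_def hdot_snd on_dom_out[OF False] hdot_0)
        then show ?thesis using False by simp
      qed
    qed
    ultimately show "(LINT y:square 1 \<times> UNIV|lborel. ?X (\<omega>, y)) + (LINT x:square 1|lborel. ?Y (\<omega>, x)) =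
      (LINT y:square 1 \<times> {0<..}|lborel. indicator (D \<omega>) y *\<^sub>R (F \<omega> y * cnj (V \<omega> y) + hdot (G \<omega> y) (grad P V \<omega> y))) +
      (LINT x:square 1|lborel. \<Psi> \<omega> x * cnj (trace_on P 0 V \<omega> x) + \<alpha> \<omega> x * cnj (trace_on P H V \<omega> x))" by simp
  qed
  finally show ?thesis ..
qed

lemma load_comb:
  assumes u: "u \<in> W" and v: "v \<in> W" and F: "RF F \<in> L2D P" and G: "G \<in> L2D P" and \<Psi>: "RS 0 \<Psi> \<in> L2S P" and \<alpha>: "RS H \<alpha> \<in> L2S P"
    and T0: "trace_plane 0 k0" and TH: "trace_plane H k1"
  shows "load H F G \<Psi> \<alpha> (comb c u d v) = cnj c * load H F G \<Psi> \<alpha> u + cnj d * load H F G \<Psi> \<alpha> v"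
proof -
  note w = W_comb(1)[OF u v, of c d]
  have "(\<integral>p. hdot (sF F p) (wv (comb c u d v) p) \<partial>MS) = cnj c * (\<integral>p. hdot (sF F p) (wv u p) \<partial>MS) + cnj d * (\<integral>p. hdot (sF F p) (wv v p) \<partial>MS)"
    by (rule hdot_pairing(3)[OF sF_facts(1,2)[OF F] wv_facts(1,2)[OF u] wv_facts(1,2)[OF v] wv_facts(1)[OF w]]) (simp add: wv_comb)
  moreover have "(\<integral>p. hdot (sG G p) (\<Gamma> (comb c u d v) p) \<partial>MS) = cnj c * (\<integral>p. hdot (sG G p) (\<Gamma> u p) \<partial>MS) + cnj d * (\<integral>p. hdot (sG G p) (\<Gamma> v p) \<partial>MS)"
    by (rule hdot_pairing(3)[OF sG_facts(1,2)[OF G] \<Gamma>_facts(1,2)[OF u] \<Gamma>_facts(1,2)[OF v] \<Gamma>_facts(1)[OF w] \<Gamma>_comb[OF u v]])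
  moreover have "(\<integral>p. hdot (sS 0 \<Psi> p) (wt 0 (comb c u d v) p) \<partial>MX) = cnj c * (\<integral>p. hdot (sS 0 \<Psi> p) (wt 0 u p) \<partial>MX) + cnj d * (\<integral>p. hdot (sS 0 \<Psi> p) (wt 0 v p) \<partial>MX)"
    by (rule hdot_pairing(3)[OF sS_facts(1,2)[OF \<Psi>] wt_facts(1,2)[OF u T0] wt_facts(1,2)[OF v T0] wt_facts(1)[OF w T0] wt_comb[OF u v T0]])
  moreover have "(\<integral>p. hdot (sS H \<alpha> p) (wt H (comb c u d v) p) \<partial>MX) = cnj c * (\<integral>p. hdot (sS H \<alpha> p) (wt H u p) \<partial>MX) + cnj d * (\<integral>p. hdot (sS H \<alpha> p) (wt H v p) \<partial>MX)"
    by (rule hdot_pairing(3)[OF sS_facts(1,2)[OF \<alpha>] wt_facts(1,2)[OF u TH] wt_facts(1,2)[OF v TH] wt_facts(1)[OF w TH] wt_comb[OF u v TH]])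
  ultimately show ?thesis unfolding load_def by (simp only: distrib_left ac_simps)
qed

text \<open>Cauchy-Schwarz in each of the four pairings; the second factor is bounded by the energy
  norm through \<open>hardy_W\<close> for the field, trivially for its gradient and through
  \<open>trace_bound\<close> for the two traces.\<close>

lemma load_bound:
  assumes V: "V \<in> W" and F: "RF F \<in> L2D P" and G: "G \<in> L2D P" and \<Psi>: "RS 0 \<Psi> \<in> L2S P" and \<alpha>: "RS H \<alpha> \<in> L2S P"
    and T0: "trace_plane 0 k0" and TH: "trace_plane H k1"
    and C: "1 \<le> C" "sqrt (enn2real KH) \<le> C" "sqrt (enn2real (KT k0)) \<le> C" "sqrt (enn2real (KT k1)) \<le> C"
  shows "norm (load H F G \<Psi> \<alpha> V) \<le> C * (L2S_norm P (RS 0 \<Psi>) + L2S_norm P (RS H \<alpha>) + L2D_norm P (RF F) + L2D_norm P G) * enorm V"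
proof -
  have le: "a \<le> C * s * enorm V" if "a \<le> s * t" "t \<le> c * enorm V" "c \<le> C" "0 \<le> s" for a s t c
  proof -
    have "s * t \<le> s * (C * enorm V)" using that enorm_nonneg[of V] by (meson mult_left_mono mult_right_mono order_trans)
    then show ?thesis using that(1) by (simp add: mult_ac)
  qed
  have "norm (\<integral>p. hdot (sF F p) (wv V p) \<partial>MS) \<le> C * L2D_norm P (RF F) * enorm V"
    by (rule le[OF hdot_pairing(2)[OF sF_facts(1,2)[OF F] wv_facts(1,2)[OF V], unfolded sF_facts(3)[OF F]] wv_facts(3)[OF V] C(2)])
      (simp add: L2D_norm_def)
  moreover have "norm (\<integral>p. hdot (sG G p) (\<Gamma> V p) \<partial>MS) \<le> C * L2D_norm P G * enorm V"
    by (rule le[OF hdot_pairing(2)[OF sG_facts(1,2)[OF G] \<Gamma>_facts(1,2)[OF V], unfolded sG_facts(3)[OF G]] _ C(1)])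
      (simp_all add: L2D_norm_def enorm_def)
  moreover have "norm (\<integral>p. hdot (sS 0 \<Psi> p) (wt 0 V p) \<partial>MX) \<le> C * L2S_norm P (RS 0 \<Psi>) * enorm V"
    by (rule le[OF hdot_pairing(2)[OF sS_facts(1,2)[OF \<Psi>] wt_facts(1,2)[OF V T0], unfolded sS_facts(3)[OF \<Psi>]] wt_facts(3)[OF V T0] C(3)])
      (simp add: L2S_norm_def)
  moreover have "norm (\<integral>p. hdot (sS H \<alpha> p) (wt H V p) \<partial>MX) \<le> C * L2S_norm P (RS H \<alpha>) * enorm V"
    by (rule le[OF hdot_pairing(2)[OF sS_facts(1,2)[OF \<alpha>] wt_facts(1,2)[OF V TH], unfolded sS_facts(3)[OF \<alpha>]] wt_facts(3)[OF V TH] C(4)])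
      (simp add: L2S_norm_def)
  moreover have "norm (a + b + (c + d)) \<le> norm a + norm b + (norm c + norm d)" for a b c d :: complex
    by (intro norm_triangle_mono order_refl)
  ultimately show ?thesis unfolding load_def distrib_left distrib_right by (smt (verit))
qed

lemma weak_solution_iff:
  assumes "RF F \<in> L2D P" "G \<in> L2D P" "RS 0 \<Psi> \<in> L2S P" "RS H \<alpha> \<in> L2S P" "trace_plane 0 k0" "trace_plane H k1"
  shows "weak_solution P h H m F G \<Psi> \<alpha> U \<longleftrightarrow> U \<in> W \<and> (\<forall>V\<in>W. dform U V = load H F G \<Psi> \<alpha> V)"
  unfolding weak_solution_def using dform_eq load_eq[OF _ assms] by (intro conj_cong refl ball_cong) auto

lemma well_posed:
  assumes H: "h < H"
  shows "\<exists>C>0. \<forall>F G \<Psi> \<alpha>. RF F \<in> L2D P \<longrightarrow> G \<in> L2D P \<longrightarrow> RS 0 \<Psi> \<in> L2S P \<longrightarrow> RS H \<alpha> \<in> L2S P \<longrightarrow>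
    (\<exists>U. weak_solution P h H m F G \<Psi> \<alpha> U \<and> (\<forall>U'. weak_solution P h H m F G \<Psi> \<alpha> U' \<longrightarrow> field_eq P U' U) \<and>
      W0_norm P h m U \<le> C * (L2S_norm P (RS 0 \<Psi>) + L2S_norm P (RS H \<alpha>) + L2D_norm P (RF F) + L2D_norm P G))"
proof -
  note T = trace_plane_0 trace_plane_H[OF H]
  let ?a = "sqrt (enn2real KH)" and ?b = "sqrt (enn2real (KT ((1 + \<delta>) powr m)))" and ?c = "sqrt (enn2real (KT (((H + \<delta>) / H)\<^sup>2)))"
    and ?s = "sqrt (enn2real (KH + 1))"
  \<comment> \<open>A sum that dominates each of the constants; the summand \<open>1\<close> belongs
    to the term with \<open>G\<close>, which is paired with the gradient itself.\<close>
  define C where "C = 1 + ?a + ?b + ?c"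
  have C: "1 \<le> C" "?a \<le> C" "?b \<le> C" "?c \<le> C" by (auto simp: C_def)
  \<comment> \<open>The factor \<open>1 + ?s\<close> instead of \<open>?s\<close> makes positivity
    of the constant immediate.\<close>
  have "0 < (1 + ?s) * C" using C(1) by (intro mult_pos_pos add_pos_nonneg) auto
  moreover have "\<exists>U. weak_solution P h H m F G \<Psi> \<alpha> U \<and> (\<forall>U'. weak_solution P h H m F G \<Psi> \<alpha> U' \<longrightarrow> field_eq P U' U) \<and>
      W0_norm P h m U \<le> (1 + ?s) * C * (L2S_norm P (RS 0 \<Psi>) + L2S_norm P (RS H \<alpha>) + L2D_norm P (RF F) + L2D_norm P G)"
    if d: "RF F \<in> L2D P" "G \<in> L2D P" "RS 0 \<Psi> \<in> L2S P" "RS H \<alpha> \<in> L2S P" for F G \<Psi> \<alpha>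
  proof -
    let ?S = "L2S_norm P (RS 0 \<Psi>) + L2S_norm P (RS H \<alpha>) + L2D_norm P (RF F) + L2D_norm P G"
    have S: "0 \<le> C * ?S" using C(1) by (intro mult_nonneg_nonneg add_nonneg_nonneg) (auto simp: L2S_norm_def L2D_norm_def)
    note b = load_bound[OF _ d T C]
    obtain U where U: "U \<in> W" and sol: "\<forall>V\<in>W. dform U V = load H F G \<Psi> \<alpha> V"
      using riesz_W[OF load_comb[OF _ _ d T] b] by blast
    have "enorm U \<le> C * ?S" by (rule energy_bound[OF U bspec[OF sol U] b[OF U] S])
    then have "?s * enorm U \<le> (1 + ?s) * (C * ?S)" using enorm_nonneg[of U] S by (intro mult_mono) auto
    then have "W0_norm P h m U \<le> (1 + ?s) * C * ?S" using W0_norm_le[OF U] by (simp only: mult.assoc)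
    moreover have "field_eq P U' U" if "weak_solution P h H m F G \<Psi> \<alpha> U'" for U'
      using that sol energy_unique[OF U] by (simp add: weak_solution_iff[OF d T])
    ultimately show ?thesis using U sol weak_solution_iff[OF d T] by blast
  qed
  ultimately show ?thesis by blast
qed

end

theorem proposition5:
  fixes P :: "'n::finite pt set measure" and h \<delta> H m :: real
  assumes "CARD('n) + 1 \<in> {2, 3}"
    and "h > 0" and "\<delta> > 0" and "H > h"
    and "prob_space P" and "sets P = sets (config_space h \<delta>)"
    and "shift_invariant P" and "shift_ergodic P"
    and "m > 2 * real (CARD('n) + 1)" and "moment_condition P h m"
  shows "\<exists>C>0. \<forall>(F :: 'n pt set \<Rightarrow> 'n pt \<Rightarrow> complex) (G :: 'n pt set \<Rightarrow> 'n pt \<Rightarrow> 'n cvec)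
      (\<Psi> :: 'n pt set \<Rightarrow> real ^ 'n \<Rightarrow> complex) (\<alpha> :: 'n pt set \<Rightarrow> real ^ 'n \<Rightarrow> complex).
    (\<lambda>\<omega> y. weight h m \<omega> y powr (-1/2) *\<^sub>R F \<omega> y) \<in> L2D P \<longrightarrow>
    G \<in> L2D P \<longrightarrow>
    (\<lambda>\<omega> x. weight h m \<omega> (x, 0) powr (-1/2) *\<^sub>R \<Psi> \<omega> x) \<in> L2S P \<longrightarrow>
    (\<lambda>\<omega> x. weight h m \<omega> (x, H) powr (-1/2) *\<^sub>R \<alpha> \<omega> x) \<in> L2S P \<longrightarrow>
    (\<exists>U. weak_solution P h H m F G \<Psi> \<alpha> U \<and>
      (\<forall>U'. weak_solution P h H m F G \<Psi> \<alpha> U' \<longrightarrow> field_eq P U' U) \<and>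
      W0_norm P h m U \<le> C *
        (L2S_norm P (\<lambda>\<omega> x. weight h m \<omega> (x, 0) powr (-1/2) *\<^sub>R \<Psi> \<omega> x) +
         L2S_norm P (\<lambda>\<omega> x. weight h m \<omega> (x, H) powr (-1/2) *\<^sub>R \<alpha> \<omega> x) +
         L2D_norm P (\<lambda>\<omega> y. weight h m \<omega> y powr (-1/2) *\<^sub>R F \<omega> y) +
         L2D_norm P G))"
proof -
  interpret particle_law P h \<delta> m
    by (rule particle_law.intro) fact+
  show ?thesis by (rule well_posed) fact
qed

end
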